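(* Let $d\ge2$, let $P_1,\dots,P_{d+1}$ be finite sets, each in general position in $\mathbb{R}^d$, and let $r$ be a sufficiently large positive integer with $r\le\min\{|P_i|:1\le i\le d+1\}$. Write $\Pi_d(P_i,r)=\{(P_{i,j},\Delta_{i,j})\}_j$ and $\Sigma_d(P_i,r)=\{\Delta_{i,j}\}_j$. Then the partitions $\Pi_d(P_1,r),\dots,\Pi_d(P_{d+1},r)$ determine only $O\!\left(r^{d+1-\frac{1}{d^4+d}}\right)$ loose $(d+1)$-tuples $(\Delta_{1,j_1},\dots,\Delta_{d+1,j_{d+1}})\in\Sigma_d(P_1,r)\times\cdots\times\Sigma_d(P_{d+1},r)$; the implicit constant depends only on $d$.
   Context: General position: no $d+1$ points on a common hyperplane. A simplicial $r$-partition of an $n$-point set $P$ is a collection $\{(P_i,\Delta_i)\}_{i=1}^r$ with $P=\bigsqcup P_i$, each nonempty $P_i$ satisfying $\lceil n/r\rceil\le|P_i|<2\lceil n/r\rceil$, and each $\Delta_i$ a closed $d$-simplex containing $P_i$ in its interior. $\Pi_d(P,r)$ denotes a fixed such partition in which every hyperplane intersects at most $c(d)r^{1-1/d}$ of the $\Delta_i$ ($c(d)$ depending only on $d$; such partitions exist by Matoušek's theorem), with simplex vertices in general position; $\Sigma_d(P,r)$ is its set of simplices. A family is separated if for every $2\le k\le d+1$ no $k$ members can all be intersected by a single $(k-2)$-flat. With $C(\mathcal{F})=\operatorname{conv}(\bigcup\mathcal{F})$, a separated family $\mathcal{K}=\{K_1,\dots,K_{d+1}\}$ of nonempty compact convex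 sets is tight if $\bigcap_{i}C(\mathcal{K}\setminus\{K_i\})=\emptyset$ and loose otherwise. *)

theory Defs
  imports "HOL-Analysis.Analysis"
begin

text \<open>The ambient space is a Euclidean space \<open>'a\<close> with \<open>d = DIM('a)\<close>.\<close>

definition hyperplane :: "'a::euclidean_space set \<Rightarrow> bool" where
  "hyperplane H \<longleftrightarrow> (\<exists>a b. a \<noteq> 0 \<and> H = {x. a \<bullet> x = b})"

definition general_position :: "'a::euclidean_space set \<Rightarrow> bool" where
  "general_position X \<longleftrightarrow>
     (\<forall>S\<subseteq>X. card S = DIM('a) + 1 \<longrightarrow> \<not> (\<exists>H. hyperplane H \<and> S \<subseteq> H))"

definition vertices :: "'a::euclidean_space set \<Rightarrow> 'a set" where
  "vertices S = {v. v extreme_point_of S}"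

text \<open>A collection of \<open>r\<close> pairs \<open>(Q j, \<Delta> j)\<close>, \<open>j = 1, \<dots>, r\<close>. Some classes \<open>Q j\<close> may be empty;
  only the nonempty ones are subject to the size condition.\<close>

definition simplicial_partition ::
    "'a::euclidean_space set \<Rightarrow> nat \<Rightarrow> (nat \<Rightarrow> 'a set) \<Rightarrow> (nat \<Rightarrow> 'a set) \<Rightarrow> bool" where
  "simplicial_partition P r Q \<Delta> \<longleftrightarrow>
     (\<Union>j\<in>{1..r}. Q j) = P \<and>
     disjoint_family_on Q {1..r} \<and>
     (\<forall>j\<in>{1..r}. Q j \<noteq> {} \<longrightarrow>
        \<lceil>real (card P) / real r\<rceil> \<le> int (card (Q j)) \<and>
        int (card (Q j)) < 2 * \<lceil>real (card P) / real r\<rceil>) \<and>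
     (\<forall>j\<in>{1..r}. int DIM('a) simplex \<Delta> j \<and> Q j \<subseteq> interior (\<Delta> j))"

text \<open>The properties required of the fixed partition \<open>\<Pi>\<^sub>d(P, r)\<close>; the real number \<open>c\<close> plays the role of
  Matousek's constant \<open>c(d)\<close>. Crossings are counted by index.\<close>

definition matousek_partition ::
    "real \<Rightarrow> 'a::euclidean_space set \<Rightarrow> nat \<Rightarrow> (nat \<Rightarrow> 'a set) \<Rightarrow> (nat \<Rightarrow> 'a set) \<Rightarrow> bool" where
  "matousek_partition c P r Q \<Delta> \<longleftrightarrow>
     simplicial_partition P r Q \<Delta> \<and>
     (\<forall>H. hyperplane H \<longrightarrow>
        real (card {j\<in>{1..r}. H \<inter> \<Delta> j \<noteq> {}}) \<le> c * real r powr (1 - 1 / real DIM('a))) \<and>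
     general_position (\<Union>j\<in>{1..r}. vertices (\<Delta> j))"

text \<open>Families are indexed, so that members with different indices count as different members.\<close>

definition separated :: "'i set \<Rightarrow> ('i \<Rightarrow> 'a::euclidean_space set) \<Rightarrow> bool" where
  "separated I K \<longleftrightarrow>
     (\<forall>k\<in>{2..DIM('a) + 1}. \<forall>J\<subseteq>I. card J = k \<longrightarrow>
        \<not> (\<exists>F. affine F \<and> aff_dim F = int k - 2 \<and> (\<forall>j\<in>J. F \<inter> K j \<noteq> {})))"

definition separated_convex_family :: "'i set \<Rightarrow> ('i \<Rightarrow> 'a::euclidean_space set) \<Rightarrow> bool" where
  "separated_convex_family I K \<longleftrightarrow>
     card I = DIM('a) + 1 \<and>
     (\<forall>i\<in>I. K i \<noteq> {} \<and> compact (K i) \<and> convex (K i)) \<and>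
     separated I K"

definition tight :: "'i set \<Rightarrow> ('i \<Rightarrow> 'a::euclidean_space set) \<Rightarrow> bool" where
  "tight I K \<longleftrightarrow>
     separated_convex_family I K \<and>
     (\<Inter>i\<in>I. convex hull (\<Union>j\<in>I - {i}. K j)) = {}"

definition loose :: "'i set \<Rightarrow> ('i \<Rightarrow> 'a::euclidean_space set) \<Rightarrow> bool" where
  "loose I K \<longleftrightarrow> separated_convex_family I K \<and> \<not> tight I K"

end

theory Submission
  imports Defs "HOL-Computational_Algebra.Polynomial" "HOL-Library.Multiset" "HOL-Library.Z2"
begin

text \<open>Loose tuples have a point common to all the sets \<open>conv (\<Union>\<^bsub>j \<noteq> i\<^esub> K\<^sub>j)\<close>, a condition that is
  semialgebraic in the vertices of the simplices. By quantifier elimination and a Warren-type bound, few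
  patterns of this relation occur when one colour varies, so each family splits into few clusters on which
  the relation is nearly constant; if loose tuples were numerous, there would be a product of large
  subfamilies almost all of whose tuples have such a common point. By a coloured selection theorem
  (proved with Gromov's cofilling method) some point \<open>p\<close> lies in the hull of a positive fraction of the
  transversals of generic points chosen in these simplices. Since a hyperplane crosses few simplices, for
  most tuples no hyperplane through \<open>p\<close> meets \<open>d\<close> of the simplices, and if \<open>p\<close> lies in the hull of a
  transversal of such a tuple, the sets above have no common point: a contradiction.\<close>

section \<open>Signs of real univariate polynomials\<close>

text \<open>The exponent comes from a balance. A density \<epsilon> of loose tuples yields a box
  whose sides are at least a constant times \<epsilon>^(q+1) r, and the contradiction needs them to
  exceed a large multiple of r^(1-1/d), the order of the number of simplices that one hyperplane can
  cross. So the threshold for \<epsilon> is r^(-1/(d(q+1))), and q = d^3 gives d(q+1) = d^4+d. A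
  moving simplex has n = d(d+1) coordinates, so a packing at distance \<delta> has about
  \<delta>^(-n) members up to a power of log(1/\<delta>); the inequality 4n \<le> 3q, true from d =
  2 on, leaves room for this logarithm. The box need not be homogeneous: its exceptional tuples only
  have to be rarer than the fraction that selection guarantees, which is why a variance estimate is
  enough. No formulas are ever built. Elimination is semantic: a finite set of polynomials such that
  parameters with equal signs on it admit the same witnesses. Increasing bijections of the line
  carry the witnesses over.\<close>

lemma strict_mono_on_extends_to_bijection:
  fixes f :: "real \<Rightarrow> real"
  assumes "finite A" "strict_mono_on A f"
  shows "\<exists>\<psi>. strict_mono \<psi> \<and> surj \<psi> \<and> (\<forall>a\<in>A. \<psi> a = f a)"
  using assms
proof (induction A rule: finite_linorder_max_induct)
  case empty
  show ?case by (rule exI[of _ id]) (auto simp: strict_mono_def)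
next
  case (insert b A)
  have "strict_mono_on A f"
    using insert.prems by (rule monotone_on_subset) auto
  then obtain \<psi> where \<psi>: "strict_mono \<psi>" "surj \<psi>" "\<forall>a\<in>A. \<psi> a = f a"
    using insert.IH by blast
  show ?case
  proof (cases "A = {}")
    case True
    have "surj (\<lambda>x. x - b + f b)"
      by (rule surjI[of _ "\<lambda>y. y + b - f b"]) simp
    then show ?thesis using True
      by (intro exI[of _ "\<lambda>x. x - b + f b"]) (auto simp: strict_mono_def)
  next
    case False
    define m where "m = Max A"
    have mA: "m \<in> A" "\<And>a. a \<in> A \<Longrightarrow> a \<le> m" using False insert.hyps m_def by auto
    have mb: "m < b" using insert.hyps mA by auto
    have fm: "f m < f b" using strict_mono_onD[OF insert.prems] mA mb by auto
    define k where "k = (f b - f m) / (b - m)"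
    have k: "k > 0" using mb fm k_def by simp
    \<comment> \<open>Beyond the old maximum \<open>m\<close> the bijection is replaced by the ray
      through \<open>(m, f m)\<close> and \<open>(b, f b)\<close>; the values on \<open>A\<close>
      survive because \<open>A\<close> lies at or left of \<open>m\<close>.\<close>
    define g where "g = (\<lambda>x. if x \<le> m then \<psi> x else f m + (x - m) * k)"
    have \<psi>m: "\<psi> m = f m" using \<psi> mA by blast
    have "strict_mono g"
    proof (rule strict_monoI)
      fix x y :: real assume "x < y"
      consider "y \<le> m" | "x \<le> m" "m < y" | "m < x" by linarith
      then show "g x < g y"
      proof cases
        case 1 then show ?thesis using \<open>x < y\<close> \<psi> by (auto simp: g_def strict_mono_def)
      next
        case 2
        then have "\<psi> x \<le> f m" using \<psi> \<psi>m by (metis strict_mono_less_eq)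
        moreover have "(y - m) * k > 0" using 2 k by simp
        ultimately show ?thesis using 2 by (auto simp: g_def)
      next
        case 3 then show ?thesis using \<open>x < y\<close> k by (auto simp: g_def)
      qed
    qed
    moreover have "surj g"
    proof (rule surjI[of _ "\<lambda>y. if y \<le> f m then inv \<psi> y else m + (y - f m) / k"])
      fix y
      show "g (if y \<le> f m then inv \<psi> y else m + (y - f m) / k) = y"
      proof (cases "y \<le> f m")
        case True
        have e: "\<psi> (inv \<psi> y) = y" using \<psi> by (simp add: surj_f_inv_f)
        then have "inv \<psi> y \<le> m" using True \<psi>m \<psi>(1) by (metis strict_mono_less_eq)
        then show ?thesis using True e by (simp add: g_def)
      next
        case False
        then have "(y - f m) / k > 0" using k by simp
        moreover from this have "\<not> m + (y - f m) / k \<le> m" by linarith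
        ultimately show ?thesis using False k by (simp add: g_def)
      qed
    qed
    moreover have "\<forall>a\<in>insert b A. g a = f a"
      using mA mb \<psi> by (auto simp: g_def k_def)
    ultimately show ?thesis by blast
  qed
qed

lemma sgn_poly_eq_if_no_root:
  fixes p :: "real poly"
  assumes "\<And>z. min x y \<le> z \<Longrightarrow> z \<le> max x y \<Longrightarrow> poly p z \<noteq> 0"
  shows "sgn (poly p x) = sgn (poly p y)"
proof -
  have *: "sgn (poly p a) = sgn (poly p b)" if "a < b" and nr: "\<And>z. a \<le> z \<Longrightarrow> z \<le> b \<Longrightarrow> poly p z \<noteq> 0" for a b
  proof (rule ccontr)
    assume n: "sgn (poly p a) \<noteq> sgn (poly p b)"
    have "poly p a \<noteq> 0" "poly p b \<noteq> 0" using \<open>a < b\<close> nr by auto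
    then have "poly p a * poly p b < 0"
      using n by (metis linorder_neqE_linordered_idom mult_neg_pos mult_pos_neg sgn_neg sgn_pos)
    then obtain z where "a < z" "z < b" "poly p z = 0" using poly_IVT \<open>a < b\<close> by blast
    then show False using nr[of z] by simp
  qed
  consider "x < y" | "x = y" | "y < x" by linarith
  then show ?thesis
  proof cases
    case 1 then show ?thesis using *[of x y] assms by simp
  next
    case 2 then show ?thesis by simp
  next
    case 3 then show ?thesis using *[of y x] assms by simp
  qed
qed

text \<open>Replaces the missing endpoint of a gap that is unbounded to the right: \<open>p\<close>
  and \<open>pderiv p\<close> have leading coefficients of the same sign, which is the sign near
  infinity.\<close>

lemma poly_sgn_at_right_end:
  fixes p :: "real poly"
  assumes "\<And>y. y > c \<Longrightarrow> sgn (poly (pderiv p) y) = s" "s \<noteq> 0"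
  shows "\<exists>y>c. sgn (poly p y) = s"
proof -
  have *: "\<exists>y>c. poly p y > 0" if dp: "\<And>y. y > c \<Longrightarrow> poly (pderiv p) y > 0" for p :: "real poly"
  proof -
    have dnz: "pderiv p \<noteq> 0" using dp[of "c+1"] by auto
    then have deg: "degree p \<noteq> 0" by (simp add: pderiv_eq_0_iff)
    have lcd: "lead_coeff (pderiv p) = of_nat (degree p) * lead_coeff p"
      using deg by (simp add: degree_pderiv coeff_pderiv)
    have "lead_coeff p > 0"
    proof (rule ccontr)
      assume "\<not> lead_coeff p > 0"
      then have "lead_coeff p < 0" using deg by (metis leading_coeff_0_iff degree_0 linorder_neqE_linordered_idom)
      then have "lead_coeff (- pderiv p) > 0" using lcd deg
        by (simp add: mult_pos_neg)
      then obtain n where n: "\<forall>x\<ge>n. poly (- pderiv p) x \<ge> lead_coeff (- pderiv p)"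
        using poly_pinfty_gt_lc by blast
      have "poly (- pderiv p) (max n (c+1)) > 0" using n \<open>lead_coeff (- pderiv p) > 0\<close>
        by (metis max.cobounded1 order_less_le_trans)
      moreover have "max n (c+1) > c" by linarith
      ultimately show False using dp[of "max n (c+1)"] by simp
    qed
    then obtain n where "\<forall>x\<ge>n. poly p x \<ge> lead_coeff p" using poly_pinfty_gt_lc by blast
    then have "poly p (max n (c+1)) > 0" using \<open>lead_coeff p > 0\<close>
      by (metis max.cobounded1 order_less_le_trans)
    then show ?thesis by (intro exI[of _ "max n (c+1)"]) auto
  qed
  have "s = 1 \<or> s = -1" using assms(1)[of "c+1"] assms(2) by (auto simp: sgn_if split: if_splits)
  then show ?thesis
  proof
    assume s: "s = 1"
    have "\<exists>y>c. poly p y > 0" by (rule *) (use assms(1) s sgn_1_pos in metis)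
    then show ?thesis using s by auto
  next
    assume s: "s = -1"
    have "\<exists>y>c. poly (-p) y > 0"
    proof (rule *)
      fix y assume "y > c"
      then have "sgn (poly (pderiv p) y) = -1" using assms(1) s by simp
      then show "poly (pderiv (-p)) y > 0" by (simp add: pderiv_minus sgn_if split: if_splits)
    qed
    then show ?thesis using s by auto
  qed
qed

lemma poly_sgn_at_left_end:
  fixes p :: "real poly"
  assumes "\<And>y. y < c \<Longrightarrow> sgn (poly (pderiv p) y) = s" "s \<noteq> 0"
  shows "\<exists>y<c. sgn (poly p y) = - s"
proof -
  let ?r = "pcompose p [:0, -1:]"
  have "\<exists>y>-c. sgn (poly ?r y) = - s"
  proof (rule poly_sgn_at_right_end)
    fix y assume "y > -c"
    then have "-y < c" by simp
    then show "sgn (poly (pderiv ?r) y) = - s"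
      using assms(1)[of "-y"] by (simp add: pderiv_pcompose poly_pcompose pderiv_pCons sgn_mult)
  qed (use assms in auto)
  then obtain y where "y > -c" "sgn (poly ?r y) = -s" by blast
  then show ?thesis by (intro exI[of _ "-y"]) (auto simp: poly_pcompose)
qed

lemma poly_sgn_mvt:
  fixes p :: "real poly"
  assumes "a < b"
  obtains \<xi> where "a < \<xi>" "\<xi> < b" "sgn (poly p b - poly p a) = sgn (poly (pderiv p) \<xi>)"
proof -
  obtain \<xi> where "a < \<xi>" "\<xi> < b" "poly p b - poly p a = (b - a) * poly (pderiv p) \<xi>"
    using poly_MVT[OF assms] by blast
  then show ?thesis using that[of \<xi>] assms by (simp add: sgn_mult)
qed

lemma poly_rolle:
  fixes p :: "real poly"
  assumes "a < b" "poly p a = 0" "poly p b = 0"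
  obtains \<xi> where "a < \<xi>" "\<xi> < b" "poly (pderiv p) \<xi> = 0"
  by (rule poly_sgn_mvt[OF assms(1), of p]) (use assms in \<open>auto simp: sgn_if split: if_splits\<close>)

text \<open>A root of \<open>p\<close> in a gap of the roots \<open>Z\<close> of a family containing \<open>p'\<close> has a counterpart.\<close>

lemma root_in_corresponding_gap:
  fixes p p' :: "real poly"
  assumes \<phi>: "strict_mono \<phi>" "surj \<phi>"
    and Z: "finite Z"
    and d: "\<And>x. sgn (poly (pderiv p) x) = sgn (poly (pderiv p') (\<phi> x))"
    and dZ: "\<And>x. poly (pderiv p) x = 0 \<Longrightarrow> x \<in> Z"
    and match: "\<And>z. z \<in> Z \<Longrightarrow> sgn (poly p z) = sgn (poly p' (\<phi> z))"
    and x: "x \<notin> Z" "poly p x = 0"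
  shows "\<exists>y. poly p' y = 0 \<and> y \<notin> \<phi> ` Z \<and> (\<forall>z\<in>Z. z < x \<longleftrightarrow> \<phi> z < y)"
proof -
  define s where "s = sgn (poly (pderiv p) x)"
  have s0: "s \<noteq> 0" using x dZ s_def by (auto simp: sgn_if split: if_splits)
  have sgap: "sgn (poly (pderiv p) t) = s" if "\<And>z. z \<in> Z \<Longrightarrow> \<not> (min t x \<le> z \<and> z \<le> max t x)" for t
    unfolding s_def by (rule sgn_poly_eq_if_no_root) (use that dZ in blast)
  have sgap': "sgn (poly (pderiv p') t) = s" if t: "\<And>z. z \<in> Z \<Longrightarrow> \<not> (min t (\<phi> x) \<le> \<phi> z \<and> \<phi> z \<le> max t (\<phi> x))" for t
  proof -
    have "sgn (poly (pderiv p') t) = sgn (poly (pderiv p') (\<phi> x))"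
    proof (rule sgn_poly_eq_if_no_root)
      fix w assume w: "min t (\<phi> x) \<le> w" "w \<le> max t (\<phi> x)"
      obtain z where z: "w = \<phi> z" using \<phi> by (metis surjD)
      show "poly (pderiv p') w \<noteq> 0"
        using d[of z] dZ[of z] t[of z] w z by (auto simp: sgn_if split: if_splits)
    qed
    then show ?thesis using d[of x] s_def by simp
  qed
  \<comment> \<open>A sign change of \<open>p'\<close> is sought inside the gap. On the right it
    ends at the next point \<open>b\<close> of \<open>Z\<close>, where the mean value theorem gives
    \<open>p\<close> the sign \<open>s\<close> and \<open>match\<close> transfers it, or else at a
    point far out.\<close>
  have up: "\<exists>y2>\<phi> x. sgn (poly p' y2) = s \<and> (\<forall>z\<in>Z. z > x \<longrightarrow> \<phi> z \<ge> y2)"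
  proof (cases "{z\<in>Z. z > x} = {}")
    case True
    have "\<exists>y>\<phi> x. sgn (poly p' y) = s"
    proof (rule poly_sgn_at_right_end)
      fix y assume y: "y > \<phi> x"
      show "sgn (poly (pderiv p') y) = s"
      proof (rule sgap')
        fix z assume "z \<in> Z"
        then have "z < x" using True x by (metis (mono_tags, lifting) empty_Collect_eq linorder_neqE_linordered_idom)
        then show "\<not> (min y (\<phi> x) \<le> \<phi> z \<and> \<phi> z \<le> max y (\<phi> x))"
          using \<phi>(1) y by (auto simp: strict_mono_def not_le)
      qed
    qed (rule s0)
    then show ?thesis using True by blast
  next
    case False
    define b where "b = Min {z\<in>Z. z > x}"
    have b: "b \<in> Z" "b > x" "\<And>z. z \<in> Z \<Longrightarrow> z > x \<Longrightarrow> b \<le> z"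
      using Min_in[of "{z\<in>Z. z > x}"] Z False b_def by auto
    obtain \<xi> where \<xi>: "x < \<xi>" "\<xi> < b" "sgn (poly p b - poly p x) = sgn (poly (pderiv p) \<xi>)"
      using poly_sgn_mvt[OF b(2)] by blast
    have "sgn (poly (pderiv p) \<xi>) = s"
      by (rule sgap) (use \<xi> b x in force)
    then have "sgn (poly p' (\<phi> b)) = s" using \<xi> x match[OF b(1)] by simp
    then show ?thesis using b \<phi> by (intro exI[of _ "\<phi> b"]) (auto simp: strict_mono_def strict_mono_less_eq[OF \<phi>(1)])
  qed
  have dn: "\<exists>y1<\<phi> x. sgn (poly p' y1) = - s \<and> (\<forall>z\<in>Z. z < x \<longrightarrow> \<phi> z \<le> y1)"
  proof (cases "{z\<in>Z. z < x} = {}")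
    case True
    have "\<exists>y<\<phi> x. sgn (poly p' y) = - s"
    proof (rule poly_sgn_at_left_end)
      fix y assume y: "y < \<phi> x"
      show "sgn (poly (pderiv p') y) = s"
      proof (rule sgap')
        fix z assume "z \<in> Z"
        then have "z > x" using True x by (metis (mono_tags, lifting) empty_Collect_eq linorder_neqE_linordered_idom)
        then show "\<not> (min y (\<phi> x) \<le> \<phi> z \<and> \<phi> z \<le> max y (\<phi> x))"
          using \<phi>(1) y by (auto simp: strict_mono_def not_le)
      qed
    qed (rule s0)
    then show ?thesis using True by blast
  next
    case False
    define b where "b = Max {z\<in>Z. z < x}"
    have b: "b \<in> Z" "b < x" "\<And>z. z \<in> Z \<Longrightarrow> z < x \<Longrightarrow> z \<le> b"
      using Max_in[of "{z\<in>Z. z < x}"] Z False b_def by auto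
    obtain \<xi> where \<xi>: "b < \<xi>" "\<xi> < x" "sgn (poly p x - poly p b) = sgn (poly (pderiv p) \<xi>)"
      using poly_sgn_mvt[OF b(2)] by blast
    have "sgn (poly (pderiv p) \<xi>) = s"
      by (rule sgap) (use \<xi> b x in force)
    then have "sgn (poly p' (\<phi> b)) = - s" using \<xi> x match[OF b(1)] by (simp add: sgn_minus)
    then show ?thesis using b \<phi> by (intro exI[of _ "\<phi> b"]) (auto simp: strict_mono_def strict_mono_less_eq[OF \<phi>(1)])
  qed
  obtain y1 y2 where y: "y1 < \<phi> x" "\<phi> x < y2" "sgn (poly p' y1) = - s" "sgn (poly p' y2) = s"
      "\<forall>z\<in>Z. z < x \<longrightarrow> \<phi> z \<le> y1" "\<forall>z\<in>Z. z > x \<longrightarrow> \<phi> z \<ge> y2" using up dn by blast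
  have s1: "s = 1 \<or> s = -1" using s0 s_def by (auto simp: sgn_if)
  have "poly p' y1 * poly p' y2 < 0"
    using y(3,4) s1 by (auto simp: sgn_if mult_neg_pos mult_pos_neg split: if_splits)
  then obtain y where y': "y1 < y" "y < y2" "poly p' y = 0" using poly_IVT[of y1 y2 p'] y by auto
  have zx: "(z < x \<and> \<phi> z < y) \<or> (z > x \<and> \<phi> z > y)" if "z \<in> Z" for z
  proof -
    have "z \<noteq> x" using that x(1) by blast
    then consider "z < x" | "z > x" by linarith
    then show ?thesis
      by cases (use that y(5,6) y' in force)+
  qed
  have "\<forall>z\<in>Z. z < x \<longleftrightarrow> \<phi> z < y" using zx by force
  moreover have "y \<notin> \<phi> ` Z" using zx by force
  ultimately show ?thesis using y' by blast
qed

text \<open>The sign pattern of a family on the line is the order of its roots with the signs at and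
  between them. Between neighbours of \<open>Z\<close> the derivative keeps its sign, so
  \<open>p\<close> has at most one further root there, and whether it has one depends on data that
  agree for \<open>p\<close> and \<open>p'\<close>. Hence the roots of the enlarged families
  correspond in order, and an increasing bijection through them preserves all signs.\<close>

lemma extend_sign_isomorphism:
  fixes p p' :: "real poly" and R :: "(real poly \<times> real poly) set"
  assumes \<phi>: "strict_mono \<phi>" "surj \<phi>"
    and R: "finite R" "\<And>q q'. (q, q') \<in> R \<Longrightarrow> q \<noteq> 0 \<and> q' \<noteq> 0"
    and sg: "\<And>q q' x. (q, q') \<in> R \<Longrightarrow> sgn (poly q x) = sgn (poly q' (\<phi> x))"
    and d: "(pderiv p, pderiv p') \<in> R"
    and match: "\<And>q q' z. (q, q') \<in> R \<Longrightarrow> poly q z = 0 \<Longrightarrow> sgn (poly p z) = sgn (poly p' (\<phi> z))"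
  shows "\<exists>\<psi>. strict_mono \<psi> \<and> surj \<psi> \<and> (\<forall>(q, q')\<in>R. \<forall>x. sgn (poly q x) = sgn (poly q' (\<psi> x)))
      \<and> (\<forall>x. sgn (poly p x) = sgn (poly p' (\<psi> x)))"
proof -
  define Z where "Z = {z. \<exists>(q, q')\<in>R. poly q z = 0}"
  define Z' where "Z' = {z. \<exists>(q, q')\<in>R. poly q' z = 0}"
  define W where "W = {z. poly p z = 0}"
  define W' where "W' = {z. poly p' z = 0}"
  have dnz: "pderiv p \<noteq> 0" "pderiv p' \<noteq> 0" using R(2)[OF d] by auto
  have pnz: "p \<noteq> 0" "p' \<noteq> 0" using dnz by auto
  have "Z = (\<Union>(q, q')\<in>R. {z. poly q z = 0})" by (auto simp: Z_def)
  moreover have "finite (case qq of (q, q') \<Rightarrow> {z. poly q z = 0})" if "qq \<in> R" for qq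
    using that R(2) poly_roots_finite[of "fst qq"] by (cases qq) auto
  ultimately have fZ: "finite Z" using R(1) by simp
  have fW: "finite W" using poly_roots_finite pnz W_def by blast
  have zero_iff: "poly q x = 0 \<longleftrightarrow> poly q' (\<phi> x) = 0" if "(q, q') \<in> R" for q q' x
    using sg[OF that, of x] by (metis sgn_zero_iff)
  have Z'eq: "Z' = \<phi> ` Z"
  proof (intro set_eqI iffI)
    fix z assume "z \<in> Z'"
    then obtain q q' where q: "(q, q') \<in> R" "poly q' z = 0" unfolding Z'_def by blast
    obtain x where "z = \<phi> x" using \<phi> by (metis surjD)
    then show "z \<in> \<phi> ` Z" using q zero_iff unfolding Z_def by blast
  next
    fix z assume "z \<in> \<phi> ` Z"
    then show "z \<in> Z'" using zero_iff unfolding Z_def Z'_def by blast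
  qed
  have lt: "\<phi> x < \<phi> y \<longleftrightarrow> x < y" for x y using \<phi>(1) by (rule strict_mono_less)
  have fw: "\<exists>y. poly p' y = 0 \<and> y \<notin> Z' \<and> (\<forall>z\<in>Z. z < x \<longleftrightarrow> \<phi> z < y)" if "x \<in> W - Z" for x
    unfolding Z'eq
  proof (rule root_in_corresponding_gap[OF \<phi> fZ, of p])
    show "\<And>z. z \<in> Z \<Longrightarrow> sgn (poly p z) = sgn (poly p' (\<phi> z))" using match unfolding Z_def by blast
    show "\<And>x. poly (pderiv p) x = 0 \<Longrightarrow> x \<in> Z" using d unfolding Z_def by blast
  qed (use sg d that W_def in auto)
  \<comment> \<open>The situation is symmetric under inversion of \<phi>, so every new root of
    \<open>p'\<close> comes from a gap with a new root of \<open>p\<close>; this makes the matching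
    of roots onto.\<close>
  define \<phi>' where "\<phi>' = inv \<phi>"
  have \<phi>'1: "\<phi>' (\<phi> x) = x" and \<phi>'2: "\<phi> (\<phi>' y) = y" for x y
    using \<phi> by (auto simp: \<phi>'_def surj_f_inv_f strict_mono_imp_inj_on inv_f_f)
  have \<phi>'m: "strict_mono \<phi>'" by (rule strict_monoI) (metis \<phi>'2 lt)
  have \<phi>'s: "surj \<phi>'" by (metis \<phi>'1 surjI)
  have bw: "\<exists>x. poly p x = 0 \<and> x \<notin> Z \<and> (\<forall>z\<in>Z'. z < y \<longleftrightarrow> \<phi>' z < x)" if "y \<in> W' - Z'" for y
  proof -
    have ZZ: "\<phi>' ` Z' = Z" unfolding Z'eq by (auto simp: \<phi>'1 image_iff)
    have "\<exists>x. poly p x = 0 \<and> x \<notin> \<phi>' ` Z' \<and> (\<forall>z\<in>Z'. z < y \<longleftrightarrow> \<phi>' z < x)"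
    proof (rule root_in_corresponding_gap[OF \<phi>'m \<phi>'s, of Z' p'])
      show "finite Z'" using Z'eq fZ by simp
      show "sgn (poly p' z) = sgn (poly p (\<phi>' z))" if zZ: "z \<in> Z'" for z
      proof -
        obtain x where x: "x \<in> Z" "z = \<phi> x" using zZ Z'eq by blast
        then have "sgn (poly p x) = sgn (poly p' (\<phi> x))" using match unfolding Z_def by blast
        then show ?thesis using x \<phi>'1 by simp
      qed
      show "sgn (poly (pderiv p') x) = sgn (poly (pderiv p) (\<phi>' x))" for x
        using sg[OF d, of "\<phi>' x"] \<phi>'2 by simp
      show "\<And>x. poly (pderiv p') x = 0 \<Longrightarrow> x \<in> Z'" using d unfolding Z'_def by blast
    qed (use that W'_def in auto)
    then show ?thesis using ZZ by simp
  qed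
  define f where "f = (\<lambda>x. if x \<in> Z then \<phi> x else SOME y. poly p' y = 0 \<and> y \<notin> Z' \<and> (\<forall>z\<in>Z. z < x \<longleftrightarrow> \<phi> z < y))"
  have fZ': "f z = \<phi> z" if "z \<in> Z" for z using that f_def by simp
  have fWZ: "poly p' (f x) = 0 \<and> f x \<notin> Z' \<and> (\<forall>z\<in>Z. z < x \<longleftrightarrow> \<phi> z < f x)" if "x \<in> W - Z" for x
  proof -
    have "f x = (SOME y. poly p' y = 0 \<and> y \<notin> Z' \<and> (\<forall>z\<in>Z. z < x \<longleftrightarrow> \<phi> z < y))" using that by (simp add: f_def)
    then show ?thesis using someI_ex[OF fw[OF that]] by metis
  qed
  have fWZ2: "\<phi> z > f x" if "x \<in> W - Z" "z \<in> Z" "z > x" for x z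
  proof -
    have "\<not> \<phi> z < f x" using fWZ[OF that(1)] that(2,3) by (meson less_asym)
    moreover have "\<phi> z \<in> Z'" using that(2) Z'eq by simp
    then have "\<phi> z \<noteq> f x" using fWZ[OF that(1)] by metis
    ultimately show ?thesis by simp
  qed
  have fm: "strict_mono_on (Z \<union> W) f"
  proof (rule strict_mono_onI)
    fix a b assume a: "a \<in> Z \<union> W" and b: "b \<in> Z \<union> W" and ab: "a < b"
    consider "a \<in> Z" "b \<in> Z" | "a \<in> Z" "b \<in> W - Z" | "a \<in> W - Z" "b \<in> Z" | "a \<in> W - Z" "b \<in> W - Z" using a b by blast
    then show "f a < f b"
    proof cases
      case 1 then show ?thesis using ab lt fZ' by simp
    next
      case 2 then show ?thesis using ab fWZ fZ' by simp
    next
      case 3 then show ?thesis using ab fWZ2 fZ' by simp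
    next
      case 4
      obtain \<xi> where \<xi>: "a < \<xi>" "\<xi> < b" "poly (pderiv p) \<xi> = 0"
        using poly_rolle[OF ab, of p] 4 W_def by auto
      then have "\<xi> \<in> Z" using d Z_def by blast
      then show ?thesis using fWZ2[of a \<xi>] fWZ[of b] 4 \<xi> by force
    qed
  qed
  have fsurj: "\<exists>a\<in>Z \<union> W. f a = y" if y: "y \<in> Z' \<union> W'" for y
  proof (cases "y \<in> Z'")
    case True then show ?thesis using Z'eq fZ' by auto
  next
    case False
    then obtain x where x: "poly p x = 0" "x \<notin> Z" "\<forall>z\<in>Z'. z < y \<longleftrightarrow> \<phi>' z < x" using bw y by blast
    then have xW: "x \<in> W - Z" using W_def by simp
    have gap: "z < x \<longleftrightarrow> \<phi> z < y" if "z \<in> Z" for z using x(3) that Z'eq \<phi>'1 by auto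
    have "f x = y"
    proof (rule ccontr)
      assume ne: "f x \<noteq> y"
      have r: "poly p' (f x) = 0" "poly p' y = 0" using fWZ[OF xW] y False W'_def by auto
      have "\<exists>\<xi>. min (f x) y < \<xi> \<and> \<xi> < max (f x) y \<and> poly (pderiv p') \<xi> = 0"
      proof (cases "f x < y")
        case True
        then show ?thesis using poly_rolle[OF True r] by (metis max.absorb4 min.absorb3)
      next
        case False
        then have "y < f x" using ne by simp
        then show ?thesis using poly_rolle[OF _ r(2,1)] by (metis max.absorb3 min.absorb4)
      qed
      then obtain \<xi> where \<xi>: "min (f x) y < \<xi>" "\<xi> < max (f x) y" "\<xi> \<in> Z'" using d Z'_def by blast
      then obtain z where "z \<in> Z" "\<xi> = \<phi> z" using Z'eq by blast
      then show False using \<xi> gap[of z] fWZ[OF xW] fWZ2[OF xW, of z] by (auto simp: min_def max_def split: if_splits)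
    qed
    then show ?thesis using xW by blast
  qed
  obtain \<psi> where \<psi>: "strict_mono \<psi>" "surj \<psi>" and \<psi>f: "\<forall>a\<in>Z \<union> W. \<psi> a = f a"
    using strict_mono_on_extends_to_bijection[OF _ fm] fZ fW by auto
  have lt': "\<psi> x < \<psi> y \<longleftrightarrow> x < y" for x y using \<psi>(1) by (rule strict_mono_less)
  have le': "\<psi> x \<le> \<psi> y \<longleftrightarrow> x \<le> y" for x y using \<psi>(1) by (rule strict_mono_less_eq)
  have pull: "\<exists>a\<in>Z \<union> W. y = \<psi> a" if "y \<in> Z' \<union> W'" for y using fsurj[OF that] \<psi>f by auto
  have \<psi>Z: "\<psi> z = \<phi> z" if "z \<in> Z" for z using that \<psi>f fZ' by simp
  have sgR: "sgn (poly q x) = sgn (poly q' (\<psi> x))" if qR: "(q, q') \<in> R" for q q' x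
  proof (cases "x \<in> Z")
    case True then show ?thesis using sg[OF qR] \<psi>Z by simp
  next
    case False
    have "sgn (poly q' (\<phi> x)) = sgn (poly q' (\<psi> x))"
    proof (rule sgn_poly_eq_if_no_root)
      fix w assume w: "min (\<phi> x) (\<psi> x) \<le> w" "w \<le> max (\<phi> x) (\<psi> x)"
      show "poly q' w \<noteq> 0"
      proof
        assume "poly q' w = 0"
        then have "w \<in> Z'" using qR Z'_def by blast
        then obtain z where z: "z \<in> Z" "w = \<phi> z" using Z'eq by blast
        have "z \<noteq> x" using z False by blast
        then consider "z < x" | "x < z" by linarith
        then show False
        proof cases
          case 1
          then have "\<phi> z < \<phi> x" "\<phi> z < \<psi> x" using lt lt'[of z x] lt'[of x z] \<psi>Z[OF z(1)] by auto
          then show False using w z by simp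
        next
          case 2
          then have "\<phi> x < \<phi> z" "\<psi> x < \<phi> z" using lt lt'[of z x] lt'[of x z] \<psi>Z[OF z(1)] by auto
          then show False using w z by simp
        qed
      qed
    qed
    then show ?thesis using sg[OF qR] by simp
  qed
  have nroot: "poly p' (\<psi> x) \<noteq> 0" if "x \<notin> Z \<union> W" for x
  proof
    assume "poly p' (\<psi> x) = 0"
    then obtain a where "a \<in> Z \<union> W" "\<psi> x = \<psi> a" using pull W'_def by blast
    then show False using that \<psi>(1) by (metis strict_mono_eq)
  qed
  have nroot': "poly p' y \<noteq> 0" if "\<psi> a \<le> y" "y \<le> \<psi> b" "\<And>t. a \<le> t \<Longrightarrow> t \<le> b \<Longrightarrow> poly p' (\<psi> t) \<noteq> 0" for a b y
    by (metis \<psi>(2) le' surjD that)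
  have pW: "sgn (poly p a) = sgn (poly p' (\<psi> a))" if "a \<in> Z \<union> W" for a
  proof (cases "a \<in> Z")
    case True then show ?thesis using match \<psi>Z unfolding Z_def by fastforce
  next
    case False
    then have "poly p a = 0" "poly p' (f a) = 0" using fWZ[of a] that W_def by auto
    then show ?thesis using \<psi>f that by simp
  qed
  \<comment> \<open>Off the roots, the sign of \<open>p\<close> is read off from a neighbouring
    point \<open>a\<close> of \<open>Z \<union> W\<close>. If \<open>a\<close> is a root of
    \<open>p\<close>, it is the sign of the derivative in between, up to the side on which
    \<open>x\<close> lies.\<close>
  have near: "sgn (poly p x) = sgn (poly p' (\<psi> x))"
    if aA: "a \<in> Z \<union> W" and xA: "x \<notin> Z \<union> W" and between: "\<And>t. t \<in> Z \<union> W \<Longrightarrow> t \<noteq> a \<Longrightarrow> \<not> (min a x \<le> t \<and> t \<le> max a x)" for a x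
  proof (cases "poly p a = 0")
    case False
    have 1: "sgn (poly p a) = sgn (poly p x)"
      by (rule sgn_poly_eq_if_no_root) (use between False W_def in blast)
    have pa: "poly p' (\<psi> a) \<noteq> 0" using pW[OF aA] False by (metis sgn_zero_iff)
    have 2: "sgn (poly p' (\<psi> a)) = sgn (poly p' (\<psi> x))"
    proof (rule sgn_poly_eq_if_no_root)
      fix w assume w: "min (\<psi> a) (\<psi> x) \<le> w" "w \<le> max (\<psi> a) (\<psi> x)"
      obtain t where t: "w = \<psi> t" using \<psi> by (metis surjD)
      have "min a x \<le> t \<and> t \<le> max a x" using w t le' by (auto simp: min_def max_def split: if_splits)
      then show "poly p' w \<noteq> 0" using between[of t] pa nroot[of t] t by blast
    qed
    show ?thesis using 1 2 pW[OF aA] by simp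
  next
    case True
    then have True': "poly p' (\<psi> a) = 0" using pW[OF aA] by (metis sgn_zero_iff)
    have ax: "a \<noteq> x" using aA xA by blast
    have dconst: "sgn (poly (pderiv p') \<eta>) = sgn (poly (pderiv p) \<xi>)"
      if "min a x < \<xi>" "\<xi> < max a x" "min (\<psi> a) (\<psi> x) < \<eta>" "\<eta> < max (\<psi> a) (\<psi> x)" for \<xi> \<eta>
    proof -
      obtain t where t: "\<eta> = \<psi> t" using \<psi> by (metis surjD)
      have tt: "min a x < t" "t < max a x" using that t lt' by (auto simp: min_def max_def split: if_splits)
      have "sgn (poly (pderiv p) \<xi>) = sgn (poly (pderiv p) t)"
      proof (rule sgn_poly_eq_if_no_root)
        fix w assume w: "min \<xi> t \<le> w" "w \<le> max \<xi> t"
        show "poly (pderiv p) w \<noteq> 0"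
        proof
          assume "poly (pderiv p) w = 0"
          then have "w \<in> Z" using d Z_def by blast
          moreover have "w \<noteq> a" "min a x \<le> w" "w \<le> max a x" using w tt that by (auto simp: min_def max_def split: if_splits)
          ultimately show False using between by blast
        qed
      qed
      then show ?thesis using sgR[OF d] t by simp
    qed
    show ?thesis
    proof (cases "a < x")
      case True
      obtain \<xi> where \<xi>: "a < \<xi>" "\<xi> < x" "sgn (poly p x - poly p a) = sgn (poly (pderiv p) \<xi>)" using poly_sgn_mvt[OF True] by blast
      have "\<psi> a < \<psi> x" using True lt' by simp
      then obtain \<eta> where \<eta>: "\<psi> a < \<eta>" "\<eta> < \<psi> x" "sgn (poly p' (\<psi> x) - poly p' (\<psi> a)) = sgn (poly (pderiv p') \<eta>)" using poly_sgn_mvt by blast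
      show ?thesis using dconst[of \<xi> \<eta>] \<xi> \<eta> True \<open>poly p a = 0\<close> True' by simp
    next
      case False
      then have "x < a" using ax by simp
      then obtain \<xi> where \<xi>: "x < \<xi>" "\<xi> < a" "sgn (poly p a - poly p x) = sgn (poly (pderiv p) \<xi>)" using poly_sgn_mvt by blast
      have "\<psi> x < \<psi> a" using \<open>x < a\<close> lt' by simp
      then obtain \<eta> where \<eta>: "\<psi> x < \<eta>" "\<eta> < \<psi> a" "sgn (poly p' (\<psi> a) - poly p' (\<psi> x)) = sgn (poly (pderiv p') \<eta>)" using poly_sgn_mvt by blast
      show ?thesis using dconst[of \<xi> \<eta>] \<xi> \<eta> \<open>x < a\<close> \<open>\<psi> x < \<psi> a\<close> \<open>poly p a = 0\<close> True' by (simp add: sgn_minus)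
    qed
  qed
  \<comment> \<open>Without any root the derivative would have constant sign and \<open>p\<close>
    opposite signs at the two ends of the line, hence a root after all.\<close>
  have ne: "Z \<union> W \<noteq> {}"
  proof
    assume e: "Z \<union> W = {}"
    define s where "s = sgn (poly (pderiv p) 0)"
    have nd: "poly (pderiv p) t \<noteq> 0" for t using e d Z_def by blast
    have s: "s \<noteq> 0" using nd s_def by (metis sgn_zero_iff)
    have c: "sgn (poly (pderiv p) t) = s" for t
      unfolding s_def by (rule sgn_poly_eq_if_no_root) (use nd in blast)
    obtain y1 y2 where y: "y1 > 0" "sgn (poly p y1) = s" "y2 < 0" "sgn (poly p y2) = -s"
      using poly_sgn_at_right_end[of 0 p s] poly_sgn_at_left_end[of 0 p s] c s by blast
    have "sgn (poly p y1) = sgn (poly p y2)"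
      by (rule sgn_poly_eq_if_no_root) (use e W_def in blast)
    then show False using y s by simp
  qed
  have "sgn (poly p x) = sgn (poly p' (\<psi> x))" for x
  proof (cases "x \<in> Z \<union> W")
    case True then show ?thesis by (rule pW)
  next
    case False
    have fA: "finite (Z \<union> W)" using fZ fW by simp
    show ?thesis
    proof (cases "{a \<in> Z \<union> W. a < x} = {}")
      case True
      define a where "a = Min (Z \<union> W)"
      have a: "a \<in> Z \<union> W" "\<And>t. t \<in> Z \<union> W \<Longrightarrow> a \<le> t" using Min_in[OF fA ne] fA a_def by auto
      have "x < a" using True a False by (metis (mono_tags, lifting) empty_Collect_eq linorder_neqE_linordered_idom)
      show ?thesis by (rule near[OF a(1) False]) (use a \<open>x < a\<close> in force)
    next
      case F: False
      define a where "a = Max {a \<in> Z \<union> W. a < x}"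
      have a: "a \<in> Z \<union> W" "a < x" "\<And>t. t \<in> Z \<union> W \<Longrightarrow> t < x \<Longrightarrow> t \<le> a"
        using Max_in[OF _ F] fA a_def by auto
      show ?thesis by (rule near[OF a(1) False]) (use a False in force)
    qed
  qed
  then show ?thesis using \<psi> sgR by blast
qed

section \<open>Polynomials whose coefficients depend on parameters\<close>

definition function_algebra :: "('u \<Rightarrow> real) set \<Rightarrow> bool" where
  "function_algebra \<A> \<longleftrightarrow> (\<forall>c. (\<lambda>_. c) \<in> \<A>) \<and> (\<forall>f\<in>\<A>. \<forall>g\<in>\<A>. (\<lambda>u. f u + g u) \<in> \<A> \<and> (\<lambda>u. f u * g u) \<in> \<A>)"

text \<open>The length of the list is a formal degree plus one: at a given \<open>u\<close> the last
  coefficient may vanish, and then \<open>butlast cs\<close> represents the same polynomial. The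
  elimination splits off this case, so that its recursion can run on lengths.\<close>

definition poly_at :: "('u \<Rightarrow> real) list \<Rightarrow> 'u \<Rightarrow> real poly" where
  "poly_at cs u = Poly (map (\<lambda>c. c u) cs)"

lemma coeff_poly_at: "coeff (poly_at cs u) i = (if i < length cs then (cs ! i) u else 0)"
  by (simp add: poly_at_def coeff_Poly_eq nth_default_def)

lemma poly_at_Nil [simp]: "poly_at [] u = 0"
  by (simp add: poly_at_def)

lemma poly_at_last: "cs \<noteq> [] \<Longrightarrow> last cs u \<noteq> 0 \<Longrightarrow> poly_at cs u \<noteq> 0"
  by (metis coeff_poly_at coeff_0 diff_less last_conv_nth length_greater_0_conv less_numeral_extra(1))

lemma poly_at_butlast: "cs \<noteq> [] \<Longrightarrow> last cs u = 0 \<Longrightarrow> poly_at (butlast cs) u = poly_at cs u"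
proof (rule poly_eqI)
  fix i assume cs: "cs \<noteq> []" "last cs u = 0"
  show "coeff (poly_at (butlast cs) u) i = coeff (poly_at cs u) i"
  proof (cases "i = length cs - 1")
    case True then show ?thesis using cs by (auto simp: coeff_poly_at last_conv_nth)
  next
    case False then show ?thesis using cs by (auto simp: coeff_poly_at nth_butlast)
  qed
qed

lemma poly_at_singleton_no_root: "length cs = 1 \<Longrightarrow> last cs u \<noteq> 0 \<Longrightarrow> poly (poly_at cs u) z \<noteq> 0"
  by (cases cs) (auto simp: poly_at_def)

lemma poly_at_derivative:
  assumes "function_algebra \<A>" "set cs \<subseteq> \<A>" "length cs \<ge> 2"
  obtains ds where "set ds \<subseteq> \<A>" "length ds = length cs - 1" "\<And>u. poly_at ds u = pderiv (poly_at cs u)"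
    "\<And>u. last cs u \<noteq> 0 \<Longrightarrow> last ds u \<noteq> 0"
proof -
  define ds where "ds = map (\<lambda>i u. real (Suc i) * (cs ! Suc i) u) [0..<length cs - 1]"
  have "set ds \<subseteq> \<A>"
    using assms by (auto simp: ds_def function_algebra_def subset_iff)
  moreover have "poly_at ds u = pderiv (poly_at cs u)" for u
    by (rule poly_eqI) (auto simp: coeff_poly_at coeff_pderiv ds_def)
  moreover have "last ds u \<noteq> 0" if "last cs u \<noteq> 0" for u
  proof -
    have "ds \<noteq> []" using assms(3) by (auto simp: ds_def)
    then have "last ds u = real (Suc (length cs - 2)) * (cs ! Suc (length cs - 2)) u"
      using assms(3) by (auto simp: ds_def last_conv_nth numeral_2_eq_2)
    moreover have "cs ! Suc (length cs - 2) = last cs"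
    proof -
      have "Suc (length cs - 2) = length cs - 1" "cs \<noteq> []" using assms(3) by auto
      then show ?thesis by (metis last_conv_nth)
    qed
    ultimately show ?thesis using that by simp
  qed
  ultimately show ?thesis using that[of ds] by (simp add: ds_def)
qed

text \<open>Pseudo-division: multiplying by squares of the leading coefficient keeps signs at the roots of the divisor.\<close>

lemma poly_at_remainder:
  assumes A: "function_algebra \<A>" and q: "set q \<subseteq> \<A>" "length q \<ge> 2"
  shows "set p \<subseteq> \<A> \<Longrightarrow> \<exists>r. set r \<subseteq> \<A> \<and> length r < length q \<and>
    (\<forall>u z. last q u \<noteq> 0 \<longrightarrow> poly (poly_at q u) z = 0 \<longrightarrow> sgn (poly (poly_at r u) z) = sgn (poly (poly_at p u) z))"
proof (induction "length p" arbitrary: p rule: less_induct)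
  case less
  show ?case
  proof (cases "length p < length q")
    case True then show ?thesis using less.prems by blast
  next
    case False
    then have pq: "length q \<le> length p" "p \<noteq> []" "q \<noteq> []" using q by auto
    define k where "k = length p - length q"
    \<comment> \<open>One division step: \<open>(last q)^2 p - (last q)(last p) X^k q\<close> loses
      the term of degree \<open>length p - 1\<close>, and at a root of \<open>q\<close> it is a
      positive multiple of \<open>p\<close>.\<close>
    define r where "r = map (\<lambda>i u. last q u * last q u * (p ! i) u + (if k \<le> i then (- 1) * (last q u * last p u) * (q ! (i - k)) u else 0)) [0..<length p - 1]"
    have "last q \<in> \<A>" "last p \<in> \<A>" using q pq less.prems by auto
    have c0: "\<And>c. (\<lambda>u. c) \<in> \<A>" and pl: "\<And>f g. f \<in> \<A> \<Longrightarrow> g \<in> \<A> \<Longrightarrow> (\<lambda>u. f u + g u) \<in> \<A>"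
      and ti: "\<And>f g. f \<in> \<A> \<Longrightarrow> g \<in> \<A> \<Longrightarrow> (\<lambda>u. f u * g u) \<in> \<A>" using A by (auto simp: function_algebra_def)
    have "(\<lambda>u. last q u * last q u * (p ! i) u + (if k \<le> i then (- 1) * (last q u * last p u) * (q ! (i - k)) u else 0)) \<in> \<A>" if i: "i < length p - 1" for i
    proof -
      have 1: "p ! i \<in> \<A>" using i less.prems by auto
      have "(\<lambda>u. if k \<le> i then (- 1) * (last q u * last p u) * (q ! (i - k)) u else 0) \<in> \<A>"
      proof (cases "k \<le> i")
        case True
        have "q ! (i - k) \<in> \<A>" using i True q k_def pq by auto
        then show ?thesis using True ti[OF ti[OF c0[of "-1"] ti[OF \<open>last q \<in> \<A>\<close> \<open>last p \<in> \<A>\<close>]]] by simp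
      qed (use c0 in simp)
      then show ?thesis using pl[OF ti[OF ti[OF \<open>last q \<in> \<A>\<close> \<open>last q \<in> \<A>\<close>] 1]] by simp
    qed
    then have rA: "set r \<subseteq> \<A>" by (auto simp: r_def)
    have rl: "length r < length p" using pq by (simp add: r_def)
    have val: "poly_at r u = smult (last q u * last q u) (poly_at p u) - smult (last q u * last p u) (monom 1 k * poly_at q u)" for u
    proof (rule poly_eqI)
      fix i
      consider "i < length p - 1" | "i = length p - 1" | "i \<ge> length p" by linarith
      then show "coeff (poly_at r u) i = coeff (smult (last q u * last q u) (poly_at p u) - smult (last q u * last p u) (monom 1 k * poly_at q u)) i"
      proof cases
        case 1
        then have "i - k < length q" if "k \<le> i" using that k_def pq by auto
        then show ?thesis using 1 by (auto simp: coeff_poly_at r_def coeff_monom_mult)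
      next
        case 2
        then have ik: "i - k = length q - 1" "k \<le> i" "i < length p" using k_def pq q by auto
        then have "(p ! i) u = last p u" "(q ! (i - k)) u = last q u" "i - k < length q"
          using 2 pq by (auto simp: last_conv_nth)
        then show ?thesis using 2 ik by (auto simp: coeff_poly_at r_def coeff_monom_mult)
      next
        case 3
        then have "i - k \<ge> length q" using k_def pq by auto
        then show ?thesis using 3 by (auto simp: coeff_poly_at r_def coeff_monom_mult)
      qed
    qed
    have sr: "sgn (poly (poly_at r u) z) = sgn (poly (poly_at p u) z)" if "last q u \<noteq> 0" "poly (poly_at q u) z = 0" for u z
    proof -
      have "last q u * last q u > 0" using that(1) by (metis not_real_square_gt_zero)
      then show ?thesis using that by (simp add: val sgn_mult)
    qed
    obtain r' where "set r' \<subseteq> \<A>" "length r' < length q"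
      "\<forall>u z. last q u \<noteq> 0 \<longrightarrow> poly (poly_at q u) z = 0 \<longrightarrow> sgn (poly (poly_at r' u) z) = sgn (poly (poly_at r u) z)"
      using less.hyps[OF rl rA] by blast
    then show ?thesis using sr by metis
  qed
qed

text \<open>The Cohen--Hormander elimination: replace a polynomial of top degree by its derivative and by
  its remainders modulo the others, and split off the cases where a leading coefficient vanishes.\<close>

lemma sign_isomorphism_elimination:
  assumes A: "function_algebra \<A>"
  shows "(\<forall>cs\<in>set L. set cs \<subseteq> \<A>) \<Longrightarrow> \<exists>G. finite G \<and> G \<subseteq> \<A> \<and>
    (\<forall>u u'. (\<forall>g\<in>G. sgn (g u) = sgn (g u')) \<longrightarrow>
      (\<exists>\<phi>. strict_mono \<phi> \<and> surj \<phi> \<and>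
         (\<forall>cs\<in>set L. \<forall>x. sgn (poly (poly_at cs u) x) = sgn (poly (poly_at cs u') (\<phi> x)))))"
proof (induction "mset (map length L)" arbitrary: L rule: wf_induct_rule[OF wf_mult[OF wf_less_than]])
  \<comment> \<open>A step may increase the number of polynomials, so the measure is the multiset of
    lengths: an entry is replaced by any number of smaller ones.\<close>
  case (1 L)
  define good where "good = (\<lambda>L G. finite G \<and> G \<subseteq> \<A> \<and>
    (\<forall>u u'. (\<forall>g\<in>G. sgn (g u) = sgn (g u')) \<longrightarrow>
      (\<exists>\<phi>. strict_mono \<phi> \<and> surj (\<phi> :: real \<Rightarrow> real) \<and>
         (\<forall>cs\<in>set L. \<forall>x. sgn (poly (poly_at cs u) x) = sgn (poly (poly_at cs u') (\<phi> x))))))"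
  have IH: "\<exists>G. good L' G" if "(mset (map length L'), mset (map length L)) \<in> mult less_than" "\<forall>cs\<in>set L'. set cs \<subseteq> \<A>" for L'
    using 1(1)[OF that] unfolding good_def by blast
  show ?case
  proof (cases "\<forall>cs\<in>set L. length cs \<le> 1")
    case True
    define G where "G = (\<Union>cs\<in>set L. set cs)"
    have "sgn (poly (poly_at cs u) x) = sgn (poly (poly_at cs u') x)"
      if "\<forall>g\<in>G. sgn (g u) = sgn (g u')" "cs \<in> set L" for cs u u' x
    proof -
      have "cs = [] \<or> (\<exists>c. cs = [c])" using True that(2) by (cases cs) auto
      then show ?thesis using that by (auto simp: poly_at_def G_def)
    qed
    then have "\<forall>u u'. (\<forall>g\<in>G. sgn (g u) = sgn (g u')) \<longrightarrow>
      (\<exists>\<phi>. strict_mono \<phi> \<and> surj \<phi> \<and>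
         (\<forall>cs\<in>set L. \<forall>x. sgn (poly (poly_at cs u) x) = sgn (poly (poly_at cs u') (\<phi> x))))"
      by (intro allI impI exI[of _ id]) (auto simp: strict_mono_def)
    moreover have "finite G" "G \<subseteq> \<A>" using 1(2) by (auto simp: G_def)
    ultimately show ?thesis by blast
  next
    case False
    define m where "m = Max (length ` set L)"
    have "L \<noteq> []" using False by auto
    then obtain p where p: "p \<in> set L" "length p = m"
    proof -
      have "m \<in> length ` set L" unfolding m_def by (rule Max_in) (use \<open>L \<noteq> []\<close> in auto)
      then show ?thesis using that by blast
    qed
    have mx: "length cs \<le> m" if "cs \<in> set L" for cs using that by (simp add: m_def)
    have m2: "m \<ge> 2" using False mx by fastforce
    have pA: "set p \<subseteq> \<A>" using p 1(2) by blast
    obtain dp where dp: "set dp \<subseteq> \<A>" "length dp = length p - 1" "\<And>u. poly_at dp u = pderiv (poly_at p u)"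
      "\<And>u. last p u \<noteq> 0 \<Longrightarrow> last dp u \<noteq> 0"
      using poly_at_derivative[OF A pA] p m2 by blast
    define M where "M = removeAll p L"
    define N where "N = dp # M"
    have NA: "\<forall>cs\<in>set N. set cs \<subseteq> \<A>" using 1(2) dp by (auto simp: N_def M_def)
    have "\<exists>r. set r \<subseteq> \<A> \<and> length r < length q \<and>
       (\<forall>u z. last q u \<noteq> 0 \<longrightarrow> poly (poly_at q u) z = 0 \<longrightarrow> sgn (poly (poly_at r u) z) = sgn (poly (poly_at p u) z))"
      if "q \<in> set N" "length q \<ge> 2" for q
      using poly_at_remainder[OF A _ that(2) pA] NA that(1) by blast
    then obtain rem where rem: "\<And>q. q \<in> set N \<Longrightarrow> length q \<ge> 2 \<Longrightarrow> set (rem q) \<subseteq> \<A> \<and> length (rem q) < length q \<and>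
       (\<forall>u z. last q u \<noteq> 0 \<longrightarrow> poly (poly_at q u) z = 0 \<longrightarrow> sgn (poly (poly_at (rem q) u) z) = sgn (poly (poly_at p u) z))"
      by metis
    \<comment> \<open>The remainders of \<open>p\<close> modulo the remaining polynomials and modulo
      \<open>dp\<close> have, at the roots of these, the sign of \<open>p\<close>. This is the
      matching hypothesis for putting \<open>p\<close> back.\<close>
    define L2 where "L2 = M @ dp # map rem (filter (\<lambda>q. length q \<ge> 2) N)"
    have split: "mset L = mset (removeAll q L) + filter_mset (\<lambda>x. x = q) (mset L)" for q
    proof -
      have "mset (removeAll q L) = filter_mset (\<lambda>x. x \<noteq> q) (mset L)"
        by (simp add: removeAll_filter_not_eq mset_filter neq_commute)
      then show ?thesis using multiset_partition[of "mset L" "\<lambda>x. x \<noteq> q"] by simp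
    qed
    have step: "(mset (map length (removeAll q L @ K)), mset (map length L)) \<in> mult less_than"
      if "q \<in> set L" "\<And>k. k \<in> set K \<Longrightarrow> length k < length q" for q K
    proof -
      have "image_mset length (mset L) = image_mset length (mset (removeAll q L)) + image_mset length (filter_mset (\<lambda>x. x = q) (mset L))"
        by (subst split[of q]) simp
      moreover have "(image_mset length (mset (removeAll q L)) + image_mset length (mset K),
         image_mset length (mset (removeAll q L)) + image_mset length (filter_mset (\<lambda>x. x = q) (mset L))) \<in> mult less_than"
        by (rule one_step_implies_mult) (use that in auto)
      ultimately show ?thesis by simp
    qed
    have "\<exists>G. good L2 G"
    proof (rule IH)
      have lk: "length k < length p" if kK: "k \<in> set (dp # map rem (filter (\<lambda>q. length q \<ge> 2) N))" for k
      proof (cases "k = dp")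
        case True then show ?thesis using dp(2) p m2 by simp
      next
        case False
        then obtain q where q: "q \<in> set N" "length q \<ge> 2" "k = rem q" using kK by auto
        have "q = dp \<or> q \<in> set L" using q(1) by (auto simp: N_def M_def)
        then have "length q \<le> length p" using mx dp(2) p(2) by auto
        then show ?thesis using rem[OF q(1,2)] q(3) by simp
      qed
      show "(mset (map length L2), mset (map length L)) \<in> mult less_than"
        unfolding L2_def M_def by (rule step[OF p(1)]) (rule lk)
      show "\<forall>cs\<in>set L2. set cs \<subseteq> \<A>" using NA rem by (auto simp: L2_def N_def)
    qed
    then obtain G2 where G2: "good L2 G2" by blast
    have "\<exists>G. good (removeAll q L @ [butlast q]) G" if "q \<in> set L" "q \<noteq> []" for q
    proof (rule IH)
      show "(mset (map length (removeAll q L @ [butlast q])), mset (map length L)) \<in> mult less_than"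
        by (rule step) (use that in auto)
      show "\<forall>cs\<in>set (removeAll q L @ [butlast q]). set cs \<subseteq> \<A>"
        using 1(2) that by (auto dest: in_set_butlastD)
    qed
    then obtain Gt where Gt: "\<And>q. q \<in> set L \<Longrightarrow> q \<noteq> [] \<Longrightarrow> good (removeAll q L @ [butlast q]) (Gt q)" by metis
    define Q where "Q = {q \<in> set L. q \<noteq> []}"
    \<comment> \<open>The signs of the leading coefficients tell which case applies at
      \<open>u\<close>; in each case the set obtained by recursion settles the rest.\<close>
    define G where "G = last ` Q \<union> (\<Union>q\<in>Q. Gt q) \<union> G2"
    have "finite G" using G2 Gt by (auto simp: G_def Q_def good_def)
    moreover have "G \<subseteq> \<A>"
    proof -
      have "last q \<in> \<A>" "Gt q \<subseteq> \<A>" if "q \<in> Q" for q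
        using that 1(2) Gt[of q] last_in_set[of q] unfolding Q_def good_def by blast+
      moreover have "G2 \<subseteq> \<A>" using G2 by (simp add: good_def)
      ultimately show ?thesis by (auto simp: G_def)
    qed
    moreover have "\<exists>\<phi>. strict_mono \<phi> \<and> surj \<phi> \<and>
         (\<forall>cs\<in>set L. \<forall>x. sgn (poly (poly_at cs u) x) = sgn (poly (poly_at cs u') (\<phi> x)))"
      if ag: "\<forall>g\<in>G. sgn (g u) = sgn (g u')" for u u'
    proof (cases "\<exists>q\<in>Q. last q u = 0")
      case True
      then obtain q where q: "q \<in> Q" "last q u = 0" by blast
      have q': "last q u' = 0" 
      proof -
        have "last q \<in> G" using q by (simp add: G_def)
        then show ?thesis using ag q by (metis sgn_zero_iff)
      qed
      have "good (removeAll q L @ [butlast q]) (Gt q)" "\<forall>g\<in>Gt q. sgn (g u) = sgn (g u')"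
        using Gt q ag by (auto simp: Q_def G_def)
      then obtain \<phi> where \<phi>: "strict_mono \<phi>" "surj \<phi>"
         "\<forall>cs\<in>set (removeAll q L @ [butlast q]). \<forall>x. sgn (poly (poly_at cs u) x) = sgn (poly (poly_at cs u') (\<phi> x))"
        unfolding good_def by blast
      have "sgn (poly (poly_at cs u) x) = sgn (poly (poly_at cs u') (\<phi> x))" if "cs \<in> set L" for cs x
      proof (cases "cs = q")
        case True
        then show ?thesis using \<phi>(3) q q' poly_at_butlast[of q u] poly_at_butlast[of q u'] by (auto simp: Q_def)
      next
        case False then show ?thesis using \<phi>(3) that by auto
      qed
      then show ?thesis using \<phi> by blast
    next
      case False
      then have nz: "\<And>q. q \<in> Q \<Longrightarrow> last q u \<noteq> 0" by blast
      have nz': "last q u' \<noteq> 0" if "q \<in> Q" for q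
      proof -
        have "sgn (last q u) = sgn (last q u')" using ag that by (auto simp: G_def)
        then show ?thesis using nz[OF that] by (metis sgn_zero_iff)
      qed
      have pQ: "p \<in> Q" using p m2 by (auto simp: Q_def)
      have nzN: "last q u \<noteq> 0" "last q u' \<noteq> 0" if "q \<in> set N" "q \<noteq> []" for q
        using that nz nz' dp(4) pQ by (auto simp: N_def M_def Q_def)
      have "\<forall>g\<in>G2. sgn (g u) = sgn (g u')" using ag by (auto simp: G_def)
      then obtain \<phi> where \<phi>: "strict_mono \<phi>" "surj \<phi>"
         and \<phi>3: "\<forall>cs\<in>set L2. \<forall>x. sgn (poly (poly_at cs u) x) = sgn (poly (poly_at cs u') (\<phi> x))"
        using G2 unfolding good_def by blast
      define R where "R = (\<lambda>q. (poly_at q u, poly_at q u')) ` {q \<in> set N. q \<noteq> []}"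
      have dpne: "dp \<noteq> []" using dp(2) p m2 by auto
      have NL2: "set N \<subseteq> set L2" by (auto simp: N_def L2_def)
      have "\<exists>\<psi>. strict_mono \<psi> \<and> surj \<psi> \<and> (\<forall>(q, q')\<in>R. \<forall>x. sgn (poly q x) = sgn (poly q' (\<psi> x)))
          \<and> (\<forall>x. sgn (poly (poly_at p u) x) = sgn (poly (poly_at p u') (\<psi> x)))"
      proof (rule extend_sign_isomorphism[OF \<phi>])
        show "finite R" by (simp add: R_def)
        show "q \<noteq> 0 \<and> q' \<noteq> 0" if qR: "(q, q') \<in> R" for q q'
        proof -
          obtain c where c: "c \<in> set N" "c \<noteq> []" "q = poly_at c u" "q' = poly_at c u'" using qR by (auto simp: R_def)
          then show ?thesis using poly_at_last[OF c(2)] nzN[OF c(1,2)] by simp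
        qed
        show "sgn (poly q x) = sgn (poly q' (\<phi> x))" if "(q, q') \<in> R" for q q' x
          using that \<phi>3 NL2 by (auto simp: R_def)
        show "(pderiv (poly_at p u), pderiv (poly_at p u')) \<in> R"
          unfolding R_def dp(3)[symmetric] using dpne by (auto simp: N_def)
        show "sgn (poly (poly_at p u) z) = sgn (poly (poly_at p u') (\<phi> z))"
          if "(q, q') \<in> R" "poly q z = 0" for q q' z
        proof -
          obtain c where c: "c \<in> set N" "c \<noteq> []" "q = poly_at c u" "q' = poly_at c u'" using \<open>(q, q') \<in> R\<close> by (auto simp: R_def)
          have c2: "length c \<ge> 2"
          proof (rule ccontr)
            assume "\<not> length c \<ge> 2"
            moreover have "length c > 0" using c(2) by simp
            ultimately have "length c = 1" by linarith
            then show False using poly_at_singleton_no_root[of c u z] nzN c that by auto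
          qed
          have r0: "poly (poly_at c u') (\<phi> z) = 0"
            using \<phi>3 NL2 c \<open>poly q z = 0\<close> by (metis in_mono sgn_zero_iff)
          have "rem c \<in> set L2" using c c2 by (auto simp: L2_def)
          then have "sgn (poly (poly_at (rem c) u) z) = sgn (poly (poly_at (rem c) u') (\<phi> z))" using \<phi>3 by blast
          then show ?thesis using rem[OF c(1) c2] nzN[OF c(1,2)] c \<open>poly q z = 0\<close> r0 by metis
        qed
      qed
      then obtain \<psi> where \<psi>: "strict_mono \<psi>" "surj \<psi>" "\<forall>(q, q')\<in>R. \<forall>x. sgn (poly q x) = sgn (poly q' (\<psi> x))"
          "\<forall>x. sgn (poly (poly_at p u) x) = sgn (poly (poly_at p u') (\<psi> x))" by blast
      have "sgn (poly (poly_at cs u) x) = sgn (poly (poly_at cs u') (\<psi> x))" if "cs \<in> set L" for cs x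
      proof (cases "cs = p \<or> cs = []")
        case True then show ?thesis using \<psi>(4) by auto
      next
        case False
        then have "(poly_at cs u, poly_at cs u') \<in> R" using that by (auto simp: R_def N_def M_def)
        then show ?thesis using \<psi>(3) by blast
      qed
      then show ?thesis using \<psi> by blast
    qed
    ultimately show ?thesis by blast
  qed
qed

section \<open>Elimination of real quantifiers\<close>

text \<open>Thom's lemma: prescribed signs of all derivatives cut out an interval. By induction the
  derivative keeps its sign between \<open>a\<close> and \<open>b\<close>, so \<open>p\<close> is
  strictly monotone or constant there, and equal signs at the ends force the same sign between
  them.\<close>

lemma thom_constant_sign:
  fixes p :: "real poly"
  shows "a < b \<Longrightarrow> (\<And>k. sgn (poly ((pderiv ^^ k) p) a) = sgn (poly ((pderiv ^^ k) p) b)) \<Longrightarrow>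
    a \<le> z \<Longrightarrow> z \<le> b \<Longrightarrow> sgn (poly p z) = sgn (poly p a)"
proof (induction "degree p" arbitrary: p z rule: less_induct)
  case less
  show ?case
  proof (cases "degree p = 0")
    case True
    then show ?thesis by (metis (no_types) degree_eq_zeroE poly_pCons poly_0 mult_zero_right add.right_neutral)
  next
    case False
    define s where "s = sgn (poly (pderiv p) a)"
    have ds: "sgn (poly (pderiv p) t) = s" if "a \<le> t" "t \<le> b" for t
      unfolding s_def
    proof (rule less.hyps)
      show "degree (pderiv p) < degree p" using False by (simp add: degree_pderiv)
      show "sgn (poly ((pderiv ^^ k) (pderiv p)) a) = sgn (poly ((pderiv ^^ k) (pderiv p)) b)" for k
        using less.prems(2)[of "Suc k"] by (simp add: funpow_swap1)
    qed (use that less.prems in auto)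
    have e: "sgn (poly p a) = sgn (poly p b)" using less.prems(2)[of 0] by simp
    show ?thesis
    proof (cases "z = a \<or> z = b")
      case True then show ?thesis using e by auto
    next
      case F: False
      then have zz: "a < z" "z < b" using less.prems by auto
      obtain \<xi> where 1: "a < \<xi>" "\<xi> < z" "sgn (poly p z - poly p a) = sgn (poly (pderiv p) \<xi>)"
        using poly_sgn_mvt[OF zz(1)] by blast
      obtain \<eta> where 2: "z < \<eta>" "\<eta> < b" "sgn (poly p b - poly p z) = sgn (poly (pderiv p) \<eta>)"
        using poly_sgn_mvt[OF zz(2)] by blast
      have "sgn (poly p z - poly p a) = s" "sgn (poly p b - poly p z) = s"
        using 1 2 ds[of \<xi>] ds[of \<eta>] zz by auto
      then show ?thesis using e by (auto simp: sgn_if split: if_splits)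
    qed
  qed
qed

text \<open>Otherwise \<open>p\<close> would vanish on a whole segment. A root is thus named by
  finitely many signs, and can be recognised after the parameters have changed.\<close>

lemma thom_root_unique:
  fixes p :: "real poly"
  assumes "p \<noteq> 0" "poly p a = 0" "poly p b = 0"
    and "\<And>k. sgn (poly ((pderiv ^^ k) p) a) = sgn (poly ((pderiv ^^ k) p) b)"
  shows "a = b"
proof (rule ccontr)
  assume "a \<noteq> b"
  have *: False if cd: "c < d" and pc: "poly p c = 0"
    and sg: "\<And>k. sgn (poly ((pderiv ^^ k) p) c) = sgn (poly ((pderiv ^^ k) p) d)" for c d
  proof -
    have "sgn (poly p z) = 0" if "z \<in> {c..d}" for z
      using thom_constant_sign[OF cd sg, of z] that pc by simp
    then have "{c..d} \<subseteq> {z. poly p z = 0}" by (auto simp: sgn_zero_iff)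
    then have "finite {c..d}" using poly_roots_finite[OF assms(1)] finite_subset by blast
    then show False using \<open>c < d\<close> using infinite_Icc cd by blast
  qed
  show False using *[of a b] *[of b a] assms \<open>a \<noteq> b\<close> by (metis linorder_neqE_linordered_idom)
qed

text \<open>Polynomials are taken as functions, with variables indexed by any type. The expansion in
  a chosen variable is obtained by induction over these rules, without a normal form.\<close>

inductive_set polyfun :: "(('i \<Rightarrow> real) \<Rightarrow> real) set" where
  const: "(\<lambda>_. c) \<in> polyfun"
| var: "(\<lambda>u. u i) \<in> polyfun"
| add: "f \<in> polyfun \<Longrightarrow> g \<in> polyfun \<Longrightarrow> (\<lambda>u. f u + g u) \<in> polyfun"
| mult: "f \<in> polyfun \<Longrightarrow> g \<in> polyfun \<Longrightarrow> (\<lambda>u. f u * g u) \<in> polyfun"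

lemma function_algebra_polyfun: "function_algebra polyfun"
  by (auto simp: function_algebra_def intro: polyfun.intros)

lemma polyfun_sum: "(\<And>x. x \<in> A \<Longrightarrow> f x \<in> polyfun) \<Longrightarrow> (\<lambda>u. \<Sum>x\<in>A. f x u) \<in> polyfun"
  by (induction A rule: infinite_finite_induct) (auto intro: polyfun.intros)

lemma polyfun_diff: "f \<in> polyfun \<Longrightarrow> g \<in> polyfun \<Longrightarrow> (\<lambda>u. f u - g u) \<in> polyfun"
  using polyfun.add[OF _ polyfun.mult[OF polyfun.const[of "-1"]], of f g] by simp

lemma polyfun_expand:
  assumes "f \<in> polyfun"
  shows "\<exists>cs. set cs \<subseteq> polyfun \<and> (\<forall>u x. f (u(j := x)) = poly (poly_at cs u) x)"
  using assms
proof induction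
  case (const c)
  show ?case by (rule exI[of _ "[\<lambda>_. c]"]) (auto simp: poly_at_def intro: polyfun.const)
next
  case (var i)
  show ?case
  proof (cases "i = j")
    case True
    then show ?thesis by (intro exI[of _ "[\<lambda>_. 0, \<lambda>_. 1]"]) (auto simp: poly_at_def intro: polyfun.const)
  next
    case False
    then show ?thesis by (intro exI[of _ "[\<lambda>u. u i]"]) (auto simp: poly_at_def intro: polyfun.var)
  qed
next
  case (add f g)
  then obtain cs ds where cs: "set cs \<subseteq> polyfun" "\<forall>u x. f (u(j := x)) = poly (poly_at cs u) x"
    and ds: "set ds \<subseteq> polyfun" "\<forall>u x. g (u(j := x)) = poly (poly_at ds u) x" by blast
  define c where "c = (\<lambda>ls i. if i < length ls then ls ! i else (\<lambda>_::('a \<Rightarrow> real). 0::real))"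
  have cP: "c ls i \<in> polyfun" if "set ls \<subseteq> polyfun" for ls i using that by (auto simp: c_def intro: polyfun.const)
  have cc: "coeff (poly_at ls u) i = c ls i u" for ls i u by (simp add: coeff_poly_at c_def)
  define es where "es = map (\<lambda>i u. c cs i u + c ds i u) [0..<max (length cs) (length ds)]"
  have "poly_at es u = poly_at cs u + poly_at ds u" for u
    by (rule poly_eqI) (auto simp: coeff_poly_at es_def c_def)
  moreover have "set es \<subseteq> polyfun" using cP cs ds by (auto simp: es_def intro!: polyfun.add)
  ultimately show ?case using cs ds by (intro exI[of _ es]) (auto simp del: fun_upd_apply)
next
  case (mult f g)
  then obtain cs ds where cs: "set cs \<subseteq> polyfun" "\<forall>u x. f (u(j := x)) = poly (poly_at cs u) x"
    and ds: "set ds \<subseteq> polyfun" "\<forall>u x. g (u(j := x)) = poly (poly_at ds u) x" by blast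
  define c where "c = (\<lambda>ls i. if i < length ls then ls ! i else (\<lambda>_::('a \<Rightarrow> real). 0::real))"
  have cP: "c ls i \<in> polyfun" if "set ls \<subseteq> polyfun" for ls i using that by (auto simp: c_def intro: polyfun.const)
  have cc: "coeff (poly_at ls u) i = c ls i u" for ls i u by (simp add: coeff_poly_at c_def)
  define es where "es = map (\<lambda>i u. \<Sum>k\<le>i. c cs k u * c ds (i - k) u) [0..<length cs + length ds]"
  have "poly_at es u = poly_at cs u * poly_at ds u" for u
  proof (rule poly_eqI)
    fix i
    have "(\<Sum>k\<le>i. c cs k u * c ds (i - k) u) = 0" if "i \<ge> length cs + length ds"
      using that by (intro sum.neutral) (auto simp: c_def)
    moreover have "coeff (poly_at es u) i = (if i < length cs + length ds then \<Sum>k\<le>i. c cs k u * c ds (i - k) u else 0)"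
      by (simp add: coeff_poly_at es_def)
    moreover have "coeff (poly_at cs u * poly_at ds u) i = (\<Sum>k\<le>i. c cs k u * c ds (i - k) u)"
      by (simp add: coeff_mult cc)
    ultimately show "coeff (poly_at es u) i = coeff (poly_at cs u * poly_at ds u) i"
      by (cases "i < length cs + length ds") auto
  qed
  moreover have "set es \<subseteq> polyfun" using cP cs ds by (auto simp: es_def intro!: polyfun_sum polyfun.mult)
  ultimately show ?case using cs ds by (intro exI[of _ es]) (auto simp del: fun_upd_apply)
qed

text \<open>The semantic substitute for a quantifier-free formula: parameters with equal signs on
  \<open>G\<close> are interchangeable. The two-place form of \<open>P\<close> suits statements that
  carry a witness over \<open>u\<close> to one over \<open>u'\<close>.\<close>

definition sign_determines :: "('u \<Rightarrow> real) set \<Rightarrow> ('u \<Rightarrow> 'u \<Rightarrow> bool) \<Rightarrow> bool" where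
  "sign_determines G P \<longleftrightarrow> (\<forall>u u'. (\<forall>g\<in>G. sgn (g u) = sgn (g u')) \<longrightarrow> P u u')"

text \<open>The witness for \<open>x\<close> is \<open>\<phi> x\<close>, with \<phi> the sign
  isomorphism from the line over \<open>u\<close> to the line over \<open>u'\<close>.\<close>

lemma polyfun_eliminate_variable:
  assumes "finite F" "F \<subseteq> polyfun"
  shows "\<exists>G. finite G \<and> G \<subseteq> polyfun \<and>
    sign_determines G (\<lambda>u u'. \<forall>x. \<exists>x'. \<forall>f\<in>F. sgn (f (u(j := x))) = sgn (f (u'(j := x'))))"
proof -
  obtain fs where fs: "set fs = F" using assms finite_list by blast
  have "\<forall>f\<in>F. \<exists>cs. set cs \<subseteq> polyfun \<and> (\<forall>u x. f (u(j := x)) = poly (poly_at cs u) x)"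
  proof
    fix f assume "f \<in> F"
    then have "f \<in> polyfun" using assms(2) by (rule rev_subsetD)
    then show "\<exists>cs. set cs \<subseteq> polyfun \<and> (\<forall>u x. f (u(j := x)) = poly (poly_at cs u) x)" by (rule polyfun_expand)
  qed
  from bchoice[OF this] obtain cs where "\<forall>f\<in>F. set (cs f) \<subseteq> polyfun \<and> (\<forall>u x. f (u(j := x)) = poly (poly_at (cs f) u) x)"
    by (elim exE)
  then have cs: "\<And>f. f \<in> F \<Longrightarrow> set (cs f) \<subseteq> polyfun \<and> (\<forall>u x. f (u(j := x)) = poly (poly_at (cs f) u) x)"
    by (rule bspec)
  have "\<forall>c\<in>set (map cs fs). set c \<subseteq> polyfun" using cs fs by auto
  from sign_isomorphism_elimination[OF function_algebra_polyfun this]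
  obtain G where G: "finite G" "G \<subseteq> polyfun" and
    iso: "sign_determines G (\<lambda>u u'. \<exists>\<phi>. strict_mono \<phi> \<and> surj \<phi> \<and>
         (\<forall>c\<in>set (map cs fs). \<forall>x. sgn (poly (poly_at c u) x) = sgn (poly (poly_at c u') (\<phi> x))))"
    unfolding sign_determines_def[symmetric] by (elim exE conjE)
  have "\<exists>x'. \<forall>f\<in>F. sgn (f (u(j := x))) = sgn (f (u'(j := x')))" if ag: "\<forall>g\<in>G. sgn (g u) = sgn (g u')" for u u' x
  proof -
    obtain \<phi> where "\<forall>c\<in>set (map cs fs). \<forall>x. sgn (poly (poly_at c u) x) = sgn (poly (poly_at c u') (\<phi> x))"
      using iso ag unfolding sign_determines_def by blast
    then show ?thesis using cs fs by (intro exI[of _ "\<phi> x"]) (auto simp del: fun_upd_apply)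
  qed
  then have "sign_determines G (\<lambda>u u'. \<forall>x. \<exists>x'. \<forall>f\<in>F. sgn (f (u(j := x))) = sgn (f (u'(j := x'))))"
    by (simp add: sign_determines_def del: fun_upd_apply)
  then show ?thesis using G by blast
qed

text \<open>Here \<open>V\<close> holds the quantified variables. They are eliminated one at a time,
  \<open>j\<close> after those of the smaller set; a witness is built in the opposite order,
  starting with the value at \<open>j\<close>.\<close>

lemma polyfun_eliminate:
  assumes "finite V"
  shows "finite F \<Longrightarrow> F \<subseteq> polyfun \<Longrightarrow> \<exists>G. finite G \<and> G \<subseteq> polyfun \<and>
    sign_determines G (\<lambda>u u'. \<forall>w. (\<forall>i. i \<notin> V \<longrightarrow> w i = u i) \<longrightarrow>
      (\<exists>w'. (\<forall>i. i \<notin> V \<longrightarrow> w' i = u' i) \<and> (\<forall>f\<in>F. sgn (f w) = sgn (f w'))))"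
  using assms
proof (induction V arbitrary: F rule: finite_induct)
  case empty
  have "(\<forall>w. (\<forall>i. i \<notin> {} \<longrightarrow> w i = u i) \<longrightarrow> (\<exists>w'. (\<forall>i. i \<notin> {} \<longrightarrow> w' i = u' i) \<and> (\<forall>f\<in>F. sgn (f w) = sgn (f w'))))"
    if "\<forall>g\<in>F. sgn (g u) = sgn (g u')" for u u' :: "'a \<Rightarrow> real"
  proof (intro allI impI)
    fix w assume "\<forall>i. i \<notin> {} \<longrightarrow> w i = u i"
    then have "w = u" by auto
    then show "\<exists>w'. (\<forall>i. i \<notin> {} \<longrightarrow> w' i = u' i) \<and> (\<forall>f\<in>F. sgn (f w) = sgn (f w'))" using that by auto
  qed
  then have "sign_determines F (\<lambda>u u'. \<forall>w. (\<forall>i. i \<notin> {} \<longrightarrow> w i = u i) \<longrightarrow>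
      (\<exists>w'. (\<forall>i. i \<notin> {} \<longrightarrow> w' i = u' i) \<and> (\<forall>f\<in>F. sgn (f w) = sgn (f w'))))"
    unfolding sign_determines_def by blast
  then show ?case using empty.prems by blast
next
  case (insert j V)
  obtain G1 where G1: "finite G1" "G1 \<subseteq> polyfun" "sign_determines G1 (\<lambda>u u'. \<forall>w. (\<forall>i. i \<notin> V \<longrightarrow> w i = u i) \<longrightarrow>
      (\<exists>w'. (\<forall>i. i \<notin> V \<longrightarrow> w' i = u' i) \<and> (\<forall>f\<in>F. sgn (f w) = sgn (f w'))))"
    using insert.IH[OF insert.prems] by blast
  obtain G where G: "finite G" "G \<subseteq> polyfun" "sign_determines G (\<lambda>u u'. \<forall>x. \<exists>x'. \<forall>f\<in>G1. sgn (f (u(j := x))) = sgn (f (u'(j := x'))))"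
    using polyfun_eliminate_variable[OF G1(1,2)] by blast
  have "\<exists>w'. (\<forall>i. i \<notin> insert j V \<longrightarrow> w' i = u' i) \<and> (\<forall>f\<in>F. sgn (f w) = sgn (f w'))"
    if ag: "\<forall>g\<in>G. sgn (g u) = sgn (g u')" and w: "\<forall>i. i \<notin> insert j V \<longrightarrow> w i = u i" for u u' w
  proof -
    obtain x' where x': "\<forall>f\<in>G1. sgn (f (u(j := w j))) = sgn (f (u'(j := x')))" using G(3) ag unfolding sign_determines_def by blast
    have "\<forall>i. i \<notin> V \<longrightarrow> w i = (u(j := w j)) i" using w by auto
    then obtain w' where w': "\<forall>i. i \<notin> V \<longrightarrow> w' i = (u'(j := x')) i" "\<forall>f\<in>F. sgn (f w) = sgn (f w')"
      using G1(3) x' unfolding sign_determines_def by blast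
    then show ?thesis by (intro exI[of _ w']) auto
  qed
  then have "sign_determines G (\<lambda>u u'. \<forall>w. (\<forall>i. i \<notin> insert j V \<longrightarrow> w i = u i) \<longrightarrow>
      (\<exists>w'. (\<forall>i. i \<notin> insert j V \<longrightarrow> w' i = u' i) \<and> (\<forall>f\<in>F. sgn (f w) = sgn (f w'))))"
    unfolding sign_determines_def by blast
  then show ?case using G by blast
qed

section \<open>Polynomials of bounded degree in each variable\<close>

text \<open>The degree is bounded in each of the first \<open>n\<close> variables separately. The
  recursion singles out the last one, as the induction that counts sign vectors requires.\<close>

primrec bpoly :: "nat \<Rightarrow> nat \<Rightarrow> ((nat \<Rightarrow> real) \<Rightarrow> real) set" where
  "bpoly 0 D = {f. \<exists>c. f = (\<lambda>_. c)}"
| "bpoly (Suc n) D = {f. \<exists>c. (\<forall>k. c k \<in> bpoly n D) \<and> f = (\<lambda>v. \<Sum>k\<le>D. c k v * v n ^ k)}"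

lemma bpoly_SucI: "(\<And>k. c k \<in> bpoly n D) \<Longrightarrow> (\<lambda>v. \<Sum>k\<le>D. c k v * v n ^ k) \<in> bpoly (Suc n) D"
  by auto

lemma bpoly_const: "(\<lambda>_. a) \<in> bpoly n D"
proof (induction n)
  case (Suc n)
  have z: "(\<lambda>_. 0) \<in> bpoly n D"
    by (induction n) (auto intro!: exI[of _ "\<lambda>_ _. 0"])
  have "a = (\<Sum>k\<le>D. (if k = 0 then a else 0) * v n ^ k)" for v :: "nat \<Rightarrow> real"
    by (subst sum.remove[of _ 0]) auto
  then have eq: "(\<lambda>_. a) = (\<lambda>v::nat \<Rightarrow> real. \<Sum>k\<le>D. (\<lambda>k _. if k = 0 then a else 0) k v * v n ^ k)" by auto
  show ?case by (subst eq, rule bpoly_SucI) (use Suc z in auto)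
qed auto

lemma bpoly_local: "f \<in> bpoly n D \<Longrightarrow> (\<And>i. i < n \<Longrightarrow> v i = v' i) \<Longrightarrow> f v = f v'"
proof (induction n arbitrary: f)
  case (Suc n)
  then obtain c where c: "\<forall>k. c k \<in> bpoly n D" "f = (\<lambda>v. \<Sum>k\<le>D. c k v * v n ^ k)" by auto
  have "c k v = c k v'" for k by (rule Suc.IH) (use c Suc.prems in auto)
  then show ?case using c Suc.prems(2)[of n] by simp
qed auto

lemma bpoly_mono: "D \<le> D' \<Longrightarrow> bpoly n D \<subseteq> bpoly n D'"
proof (induction n)
  case (Suc n)
  show ?case
  proof
    fix f assume "f \<in> bpoly (Suc n) D"
    then obtain c where c: "\<forall>k. c k \<in> bpoly n D" "f = (\<lambda>v. \<Sum>k\<le>D. c k v * v n ^ k)" by auto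
    define c' where "c' = (\<lambda>k. if k \<le> D then c k else (\<lambda>_. 0))"
    have "\<forall>k. c' k \<in> bpoly n D'" using c Suc by (auto simp: c'_def bpoly_const)
    moreover have "f v = (\<Sum>k\<le>D'. c' k v * v n ^ k)" for v
      unfolding c(2) using Suc.prems by (intro sum.mono_neutral_cong_left) (auto simp: c'_def)
    then have "f = (\<lambda>v. \<Sum>k\<le>D'. c' k v * v n ^ k)" by auto
    ultimately show "f \<in> bpoly (Suc n) D'" by auto
  qed
qed auto

lemma bpoly_add: "f \<in> bpoly n D \<Longrightarrow> g \<in> bpoly n D \<Longrightarrow> (\<lambda>v. f v + g v) \<in> bpoly n D"
proof (induction n arbitrary: f g)
  case (Suc n)
  obtain c where c: "\<forall>k. c k \<in> bpoly n D" "f = (\<lambda>v. \<Sum>k\<le>D. c k v * v n ^ k)" using Suc.prems by auto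
  obtain d where d: "\<forall>k. d k \<in> bpoly n D" "g = (\<lambda>v. \<Sum>k\<le>D. d k v * v n ^ k)" using Suc.prems by auto
  have "\<forall>k. (\<lambda>v. c k v + d k v) \<in> bpoly n D" using Suc.IH c d by auto
  moreover have "(\<lambda>v. f v + g v) = (\<lambda>v. \<Sum>k\<le>D. (\<lambda>k v. c k v + d k v) k v * v n ^ k)"
    by (auto simp: c d sum.distrib distrib_right)
  ultimately show ?case using bpoly_SucI[of "\<lambda>k v. c k v + d k v" n D] by simp
qed auto

lemma bpoly_sum: "(\<And>x. x \<in> A \<Longrightarrow> f x \<in> bpoly n D) \<Longrightarrow> (\<lambda>v. \<Sum>x\<in>A. f x v) \<in> bpoly n D"
  by (induction A rule: infinite_finite_induct) (auto intro: bpoly_const bpoly_add)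

lemma bpoly_mult: "f \<in> bpoly n D \<Longrightarrow> g \<in> bpoly n E \<Longrightarrow> (\<lambda>v. f v * g v) \<in> bpoly n (D + E)"
proof (induction n arbitrary: f g)
  case (Suc n)
  obtain c where c: "\<forall>k. c k \<in> bpoly n D" "f = (\<lambda>v. \<Sum>k\<le>D. c k v * v n ^ k)" using Suc.prems by auto
  obtain d where d: "\<forall>k. d k \<in> bpoly n E" "g = (\<lambda>v. \<Sum>k\<le>E. d k v * v n ^ k)" using Suc.prems by auto
  define e where "e = (\<lambda>m v. \<Sum>k\<in>{k. k \<le> D \<and> k \<le> m \<and> m - k \<le> E}. c k v * d (m - k) v)"
  have "\<forall>m. e m \<in> bpoly n (D + E)"
    unfolding e_def using Suc.IH c d by (auto intro!: bpoly_sum)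
  moreover have "f v * g v = (\<Sum>m\<le>D + E. e m v * v n ^ m)" for v
  proof -
    have "f v * g v = (\<Sum>(k, l)\<in>{..D} \<times> {..E}. c k v * d l v * v n ^ (k + l))"
      by (simp add: c d sum_product sum.cartesian_product power_add mult_ac)
    also have "\<dots> = (\<Sum>(m, k)\<in>(SIGMA m:{..D+E}. {k. k \<le> D \<and> k \<le> m \<and> m - k \<le> E}). c k v * d (m - k) v * v n ^ m)"
      by (rule sum.reindex_bij_witness[of _ "\<lambda>(m, k). (k, m - k)" "\<lambda>(k, l). (k + l, k)"]) auto
    also have "\<dots> = (\<Sum>m\<le>D + E. \<Sum>k\<in>{k. k \<le> D \<and> k \<le> m \<and> m - k \<le> E}. c k v * d (m - k) v * v n ^ m)"
      by (rule sum.Sigma[symmetric]) auto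
    finally show ?thesis by (simp add: e_def sum_distrib_right)
  qed
  then have "(\<lambda>v. f v * g v) = (\<lambda>v. \<Sum>m\<le>D + E. e m v * v n ^ m)" by auto
  ultimately show ?case unfolding bpoly.simps by blast
qed auto

lemma bpoly_var: "i < n \<Longrightarrow> (\<lambda>v. v i) \<in> bpoly n 1"
proof (induction n)
  case (Suc n)
  show ?case
  proof (cases "i = n")
    case True
    have eq: "(\<lambda>v::nat \<Rightarrow> real. v i) = (\<lambda>v. \<Sum>k\<le>1. (\<lambda>k _. if k = 1 then 1 else 0) k v * v n ^ k)"
      by (rule ext) (simp add: True)
    show ?thesis by (subst eq, rule bpoly_SucI) (auto simp: bpoly_const)
  next
    case False
    then have 1: "(\<lambda>v. v i) \<in> bpoly n 1" using Suc by simp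
    have eq: "(\<lambda>v::nat \<Rightarrow> real. v i) = (\<lambda>v. \<Sum>k\<le>1. (\<lambda>k v. if k = 0 then v i else 0) k v * v n ^ k)"
      by (rule ext) simp
    have "(\<lambda>v. if k = 0 then v i else 0) \<in> bpoly n 1" for k :: nat
      using 1 bpoly_const[of 0 n 1] by (cases "k = 0") auto
    then show ?thesis by (subst eq, intro bpoly_SucI)
  qed
qed auto

text \<open>The degree \<open>D'\<close> is fixed before the substitution \<open>c\<close> is
  chosen. This uniformity keeps the constants of the counting bounds independent of the point
  configuration.\<close>

lemma polyfun_compose_bpoly:
  assumes "g \<in> polyfun"
  shows "\<exists>D'. \<forall>c. (\<forall>i. c i \<in> bpoly n D) \<longrightarrow> (\<lambda>v. g (\<lambda>i. c i v)) \<in> bpoly n D'"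
  using assms
proof induction
  case (const c) then show ?case by (auto intro: bpoly_const)
next
  case (var i) then show ?case by auto
next
  case (add f g)
  then obtain D1 D2 where D: "\<forall>c. (\<forall>i. c i \<in> bpoly n D) \<longrightarrow> (\<lambda>v. f (\<lambda>i. c i v)) \<in> bpoly n D1"
    "\<forall>c. (\<forall>i. c i \<in> bpoly n D) \<longrightarrow> (\<lambda>v. g (\<lambda>i. c i v)) \<in> bpoly n D2" by blast
  then show ?case using bpoly_mono[of D1 "max D1 D2" n] bpoly_mono[of D2 "max D1 D2" n]
    by (intro exI[of _ "max D1 D2"]) (auto intro!: bpoly_add)
next
  case (mult f g)
  then obtain D1 D2 where D: "\<forall>c. (\<forall>i. c i \<in> bpoly n D) \<longrightarrow> (\<lambda>v. f (\<lambda>i. c i v)) \<in> bpoly n D1"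
    "\<forall>c. (\<forall>i. c i \<in> bpoly n D) \<longrightarrow> (\<lambda>v. g (\<lambda>i. c i v)) \<in> bpoly n D2" by blast
  then show ?case by (intro exI[of _ "D1 + D2"]) (auto intro!: bpoly_mult)
qed

section \<open>Counting sign vectors\<close>

lemma poly_poly_at: "poly (poly_at cs u) x = (\<Sum>k<length cs. (cs ! k) u * x ^ k)"
proof (induction cs)
  case (Cons c cs)
  have "poly (poly_at (c # cs) u) x = c u + x * poly (poly_at cs u) x" by (simp add: poly_at_def)
  also have "\<dots> = (\<Sum>k<length (c # cs). ((c # cs) ! k) u * x ^ k)"
    unfolding Cons.IH by (simp add: sum.lessThan_Suc_shift sum_distrib_left mult_ac del: sum.lessThan_Suc)
  finally show ?case .
qed simp

lemma poly_at_iterated_derivative: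
  assumes "function_algebra \<A>" "set cs \<subseteq> \<A>"
  shows "\<exists>ds. set ds \<subseteq> \<A> \<and> (\<forall>u. poly_at ds u = (pderiv ^^ k) (poly_at cs u))"
proof (induction k)
  case 0 then show ?case using assms by auto
next
  case (Suc k)
  then obtain ds where ds: "set ds \<subseteq> \<A>" "\<forall>u. poly_at ds u = (pderiv ^^ k) (poly_at cs u)" by blast
  show ?case
  proof (cases "length ds \<ge> 2")
    case True
    obtain es where "set es \<subseteq> \<A>" "\<And>u. poly_at es u = pderiv (poly_at ds u)"
      using poly_at_derivative[OF assms(1) ds(1) True] by metis
    then show ?thesis using ds by (intro exI[of _ es]) simp
  next
    case False
    then have "ds = [] \<or> (\<exists>d. ds = [d])" by (cases ds; cases "tl ds") auto
    then have "pderiv (poly_at ds u) = 0" for u by (auto simp: poly_at_def pderiv_pCons)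
    then show ?thesis using ds by (intro exI[of _ "[]"]) simp
  qed
qed

lemma card_range_le_if_determined:
  assumes "\<And>w w'. \<delta> w = \<delta> w' \<Longrightarrow> S w = S w'" "range \<delta> \<subseteq> B" "finite B"
  shows "finite (range S) \<and> card (range S) \<le> card B"
proof -
  have "range S \<subseteq> (\<lambda>d. S (SOME w. \<delta> w = d)) ` range \<delta>"
  proof
    fix y assume "y \<in> range S"
    then obtain w where w: "y = S w" by blast
    have "\<delta> (SOME w'. \<delta> w' = \<delta> w) = \<delta> w" by (rule someI) simp
    then have "S (SOME w'. \<delta> w' = \<delta> w) = S w" by (rule assms(1))
    then show "y \<in> (\<lambda>d. S (SOME w. \<delta> w = d)) ` range \<delta>" using w by (intro image_eqI[of _ _ "\<delta> w"]) auto
  qed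
  moreover have "finite (range \<delta>)" using assms finite_subset by blast
  ultimately have "finite (range S)" "card (range S) \<le> card (range \<delta>)"
    by (auto intro: finite_surj surj_card_le)
  then show ?thesis using card_mono[OF assms(3,2)] by simp
qed

definition sign_vectors :: "((nat \<Rightarrow> real) \<Rightarrow> real) set \<Rightarrow> (((nat \<Rightarrow> real) \<Rightarrow> real) \<Rightarrow> real) set" where
  "sign_vectors F = range (\<lambda>v. \<lambda>f\<in>F. sgn (f v))"

lemma finite_sign_vectors: "finite F \<Longrightarrow> finite (sign_vectors F)"
proof -
  assume "finite F"
  moreover have "sign_vectors F \<subseteq> PiE F (\<lambda>_. {-1, 0, 1})"
  proof -
    have "sgn x \<in> {-1, 0, 1}" for x :: real by (auto simp: sgn_if)
    then show ?thesis unfolding sign_vectors_def by (intro image_subsetI restrict_PiE_iff[THEN iffD2] ballI)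
  qed
  ultimately show ?thesis by (meson finite_PiE finite.intros finite_subset)
qed

lemma bpoly_common_degree:
  assumes "finite G" "G \<subseteq> polyfun"
  shows "\<exists>D'. \<forall>g\<in>G. \<forall>c. (\<forall>i. c i \<in> bpoly n D) \<longrightarrow> (\<lambda>v. g (\<lambda>i. c i v)) \<in> bpoly n D'"
  using assms
proof (induction G rule: finite_induct)
  case (insert g G)
  then obtain D1 D2 where D: "\<forall>g\<in>G. \<forall>c. (\<forall>i. c i \<in> bpoly n D) \<longrightarrow> (\<lambda>v. g (\<lambda>i. c i v)) \<in> bpoly n D1"
    "\<forall>c. (\<forall>i. c i \<in> bpoly n D) \<longrightarrow> (\<lambda>v. g (\<lambda>i. c i v)) \<in> bpoly n D2"
    using polyfun_compose_bpoly[of g n D] by auto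
  show ?case
    using D bpoly_mono[of D1 "max D1 D2" n] bpoly_mono[of D2 "max D1 D2" n]
    by (intro exI[of _ "max D1 D2"]) auto
qed simp

text \<open>A point \<open>(y, x)\<close> is located by the largest root \<open>\<rho> \<le> x\<close> of the family on the line over \<open>y\<close>;
  if \<open>\<rho>\<close> is a root of \<open>f\<^sub>a\<close>, it is identified by the signs of the derivatives of \<open>f\<^sub>a\<close> at \<open>\<rho>\<close> (Thom).\<close>

theorem card_sign_vectors_le:
  "\<exists>C. \<forall>F. finite F \<longrightarrow> F \<subseteq> bpoly n D \<longrightarrow> card (sign_vectors F) \<le> C * (card F + 1) ^ n"
proof (induction n arbitrary: D)
  case 0
  have "card (sign_vectors F) \<le> 1" if "F \<subseteq> bpoly 0 D" for F
  proof -
    have "(\<lambda>f\<in>F. sgn (f v)) = (\<lambda>f\<in>F. sgn (f (\<lambda>_. 0)))" for v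
      by (rule restrict_ext) (use that bpoly_local[of _ 0 D] in \<open>metis less_zeroE subsetD\<close>)
    then have "sign_vectors F \<subseteq> {\<lambda>f\<in>F. sgn (f (\<lambda>_. 0))}" unfolding sign_vectors_def by blast
    then show ?thesis by (metis card.empty card_insert_disjoint card_mono finite.intros empty_iff One_nat_def)
  qed
  then show ?case by (intro exI[of _ 1]) auto
next
  case (Suc n)
  \<comment> \<open>A generic pair of polynomials of degree at most \<open>D\<close>, whose
    coefficients are independent variables: \<open>La\<close> stands for the one with a marked root,
    \<open>Lb\<close> for the one whose sign is wanted. Eliminating once for this pair yields a
    \<open>G\<close> that does not depend on \<open>F\<close>.\<close>
  define La where "La = map (\<lambda>k (u::nat \<Rightarrow> real). u k) [0..<Suc D]"
  define Lb where "Lb = map (\<lambda>k (u::nat \<Rightarrow> real). u (Suc D + k)) [0..<Suc D]"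
  have La: "set La \<subseteq> polyfun" and Lb: "set Lb \<subseteq> polyfun"
    by (auto simp: La_def Lb_def intro: polyfun.var)
  have "\<forall>k. \<exists>ds. set ds \<subseteq> polyfun \<and> (\<forall>u. poly_at ds u = (pderiv ^^ k) (poly_at La u))"
    using poly_at_iterated_derivative[OF function_algebra_polyfun La] by blast
  from choice[OF this] obtain dA where dA': "\<forall>k. set (dA k) \<subseteq> polyfun \<and> (\<forall>u. poly_at (dA k) u = (pderiv ^^ k) (poly_at La u))"
    by (elim exE)
  have dA1: "set (dA k) \<subseteq> polyfun" and dA2: "poly_at (dA k) u = (pderiv ^^ k) (poly_at La u)" for k u
    using dA'[rule_format, of k] by auto
  define L where "L = Lb # map dA [0..<Suc D]"
  have "\<forall>cs\<in>set L. set cs \<subseteq> polyfun" using Lb dA1 by (auto simp: L_def)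
  from sign_isomorphism_elimination[OF function_algebra_polyfun this]
  obtain G where G: "finite G" "G \<subseteq> polyfun" and
    iso: "sign_determines G (\<lambda>u u'. \<exists>\<phi>. strict_mono \<phi> \<and> surj \<phi> \<and>
         (\<forall>c\<in>set L. \<forall>x. sgn (poly (poly_at c u) x) = sgn (poly (poly_at c u') (\<phi> x))))"
    unfolding sign_determines_def[symmetric] by (elim exE conjE)
  obtain D' where D': "\<And>g c. g \<in> G \<Longrightarrow> (\<forall>i. c i \<in> bpoly n D) \<Longrightarrow> (\<lambda>v. g (\<lambda>i. c i v)) \<in> bpoly n D'"
    using bpoly_common_degree[OF G] by blast
  obtain C where C: "\<And>F. finite F \<Longrightarrow> F \<subseteq> bpoly n D' \<Longrightarrow> card (sign_vectors F) \<le> C * (card F + 1) ^ n"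
    using Suc.IH by blast
  \<comment> \<open>The factors are the Thom sign vectors, the two values of \<open>fl\<close>, and
    the inductive bound for \<open>H a\<close>, a set of at most \<open>card G * card F\<close>
    polynomials.\<close>
  define C' where "C' = 3 ^ (Suc D) * 2 * (C * (card G + 1) ^ n)"
  have "card (sign_vectors F) \<le> C' * (card F + 1) ^ Suc n" if F: "finite F" "F \<subseteq> bpoly (Suc n) D" for F
  proof -
    have "\<forall>f\<in>F. \<exists>c. (\<forall>k. c k \<in> bpoly n D) \<and> f = (\<lambda>v. \<Sum>k\<le>D. c k v * v n ^ k)" using F by auto
    from bchoice[OF this] obtain c where c': "\<forall>f\<in>F. (\<forall>k. c f k \<in> bpoly n D) \<and> f = (\<lambda>v. \<Sum>k\<le>D. c f k v * v n ^ k)"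
      by (elim exE)
    have c1: "c f k \<in> bpoly n D" and c2: "f v = (\<Sum>k\<le>D. c f k v * v n ^ k)" if "f \<in> F" for f k v
      using c'[rule_format, OF that] by (blast, metis)
    define cc where "cc = (\<lambda>a k v. case a of None \<Rightarrow> (0::real) | Some f \<Rightarrow> c f k v)"
    \<comment> \<open>Coefficients of the pair formed by the polynomial named by \<open>a\<close>
      and by \<open>f\<close>, as functions of the first \<open>n\<close> coordinates;
      \<open>None\<close> names the zero polynomial.\<close>
    define e where "e = (\<lambda>a f k v. if k \<le> D then cc a k v else if k \<le> 2 * D + 1 then c f (k - Suc D) v else 0)"
    define Opt where "Opt = insert None (Some ` F)"
    have e_b: "e a f k \<in> bpoly n D" if aO: "a \<in> Opt" and fF: "f \<in> F" for a f k
    proof -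
      consider "k \<le> D" "a = None" | f0 where "k \<le> D" "a = Some f0" "f0 \<in> F" | "k > D" "k \<le> 2 * D + 1" | "k > D" "\<not> k \<le> 2 * D + 1"
        using aO fF by (cases a; cases "k \<le> D"; cases "k \<le> 2 * D + 1") (auto simp: Opt_def)
      then show ?thesis using c1 fF by cases (auto simp: e_def cc_def bpoly_const)
    qed
    define P where "P = (\<lambda>a v. poly_at La (\<lambda>k. e a undefined k v))"
    have Pa: "poly_at La (\<lambda>k. e a f k v) = P a v" for a f v
      unfolding P_def La_def poly_at_def by (rule arg_cong[of _ _ Poly]) (auto simp: e_def)
    have Pb: "poly_at Lb (\<lambda>k. e a f k v) = P (Some f) v" for a f v
      unfolding P_def La_def Lb_def poly_at_def by (rule arg_cong[of _ _ Poly]) (auto simp: e_def cc_def)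
    have fP: "f w = poly (P (Some f) w) (w n)" if "f \<in> F" for f w
    proof -
      have "poly (P (Some f) w) (w n) = (\<Sum>k<Suc D. c f k w * w n ^ k)"
        unfolding P_def poly_poly_at by (rule sum.cong) (auto simp: La_def e_def cc_def simp del: upt_Suc)
      then show ?thesis using c2[OF that] by (simp add: lessThan_Suc_atMost)
    qed
    define H where "H = (\<lambda>a. (\<lambda>(g, f) v. g (\<lambda>k. e a f k v)) ` (G \<times> F))"
    have H: "finite (H a)" "H a \<subseteq> bpoly n D'" "card (H a) \<le> card G * card F" if "a \<in> Opt" for a
    proof -
      show "finite (H a)" using G F by (simp add: H_def)
      show "H a \<subseteq> bpoly n D'" using D' e_b[OF that] by (auto simp: H_def)
      show "card (H a) \<le> card G * card F" unfolding H_def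
        using card_image_le[of "G \<times> F"] G F by (simp add: card_cartesian_product)
    qed
    define pat where "pat = (\<lambda>a v. \<lambda>h\<in>H a. sgn (h v))"
    define Data where "Data = (SIGMA a:Opt. (PiE {..D} (\<lambda>_. {-1, 0, 1::real})) \<times> (UNIV :: bool set) \<times> sign_vectors (H a))"
    \<comment> \<open>\<open>\<tau>\<close> is the Thom code of the marked root \<rho>,
      \<open>fl\<close> records whether the point sits on that root, and \<pi> collects the signs of
      \<open>H a\<close>, which see the first \<open>n\<close> coordinates alone. With
      \<open>None\<close> there is no root at or below \<open>w n\<close>, and \<open>\<tau>\<close>
      and \<open>fl\<close> are dummies.\<close>
    define cond where "cond = (\<lambda>w (a, \<tau>, fl, \<pi>). \<pi> = pat a w \<and> (case a of
        None \<Rightarrow> (\<forall>f\<in>F. \<forall>t\<le>w n. P (Some f) w \<noteq> 0 \<longrightarrow> poly (P (Some f) w) t \<noteq> 0)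
      | Some f0 \<Rightarrow> (\<exists>\<rho>\<le>w n. P a w \<noteq> 0 \<and> poly (P a w) \<rho> = 0 \<and>
           (\<forall>k\<le>D. \<tau> k = sgn (poly ((pderiv ^^ k) (P a w)) \<rho>)) \<and> fl = (\<rho> = w n) \<and>
           (\<forall>f\<in>F. \<forall>t. \<rho> < t \<longrightarrow> t \<le> w n \<longrightarrow> P (Some f) w \<noteq> 0 \<longrightarrow> poly (P (Some f) w) t \<noteq> 0))))"
    have sgn3: "sgn x \<in> {-1, 0, 1::real}" for x :: real by (auto simp: sgn_if)
    have ex: "\<exists>d\<in>Data. cond w d" for w
    proof (cases "\<forall>f\<in>F. \<forall>t\<le>w n. P (Some f) w \<noteq> 0 \<longrightarrow> poly (P (Some f) w) t \<noteq> 0")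
      case True
      have "(None, (\<lambda>k\<in>{..D}. 0), True, pat None w) \<in> Data"
        by (auto simp: Data_def Opt_def sign_vectors_def pat_def)
      moreover have "cond w (None, (\<lambda>k\<in>{..D}. 0), True, pat None w)" using True by (simp add: cond_def)
      ultimately show ?thesis by blast
    next
      case False
      define R where "R = {t. t \<le> w n \<and> (\<exists>f\<in>F. P (Some f) w \<noteq> 0 \<and> poly (P (Some f) w) t = 0)}"
      have "R \<noteq> {}" using False by (auto simp: R_def)
      moreover have "finite R"
      proof (rule finite_subset)
        show "R \<subseteq> (\<Union>f\<in>{f\<in>F. P (Some f) w \<noteq> 0}. {t. poly (P (Some f) w) t = 0})" by (auto simp: R_def)
        show "finite (\<Union>f\<in>{f\<in>F. P (Some f) w \<noteq> 0}. {t. poly (P (Some f) w) t = 0})"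
          using F(1) by (auto intro: poly_roots_finite)
      qed
      ultimately have R: "Max R \<in> R" "\<And>t. t \<in> R \<Longrightarrow> t \<le> Max R" by auto
      then obtain f0 where f0: "f0 \<in> F" "P (Some f0) w \<noteq> 0" "poly (P (Some f0) w) (Max R) = 0" "Max R \<le> w n"
        by (auto simp: R_def)
      define \<tau> where "\<tau> = (\<lambda>k\<in>{..D}. sgn (poly ((pderiv ^^ k) (P (Some f0) w)) (Max R)))"
      have nr: "\<forall>f\<in>F. \<forall>t. Max R < t \<longrightarrow> t \<le> w n \<longrightarrow> P (Some f) w \<noteq> 0 \<longrightarrow> poly (P (Some f) w) t \<noteq> 0"
        using R(2) unfolding R_def by force
      have "(Some f0, \<tau>, (Max R = w n), pat (Some f0) w) \<in> Data"
        using f0 sgn3 by (auto simp: Data_def Opt_def sign_vectors_def pat_def \<tau>_def)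
      moreover have "cond w (Some f0, \<tau>, (Max R = w n), pat (Some f0) w)"
        using f0 nr unfolding cond_def by (auto simp: \<tau>_def intro!: exI[of _ "Max R"])
      ultimately show ?thesis by blast
    qed
    \<comment> \<open>Equal signs of \<open>H a\<close> give a sign isomorphism \<phi> between the
      lines over \<open>w\<close> and \<open>w'\<close>, and Thom's lemma makes it send \<rho> to
      \<open>\<rho>'\<close>. As \<open>f\<close> has no root between a marked root and the
      corresponding point, it has none between \<open>\<phi> (w n)\<close> and \<open>w' n\<close>
      either.\<close>
    have det: "sgn (f w) = sgn (f w')" if d: "d \<in> Data" and cw: "cond w d" and cw': "cond w' d" and fF: "f \<in> F" for w w' d f
    proof -
      obtain a \<tau> fl \<pi> where d_eq: "d = (a, \<tau>, fl, \<pi>)" by (cases d) auto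
      have aO: "a \<in> Opt" using d d_eq by (simp add: Data_def)
      have peq: "pat a w = pat a w'" using cw cw' d_eq by (simp add: cond_def)
      have "\<forall>g\<in>G. sgn (g (\<lambda>k. e a f k w)) = sgn (g (\<lambda>k. e a f k w'))"
      proof
        fix g assume "g \<in> G"
        then have "(\<lambda>v. g (\<lambda>k. e a f k v)) \<in> H a" using fF unfolding H_def by force
        then show "sgn (g (\<lambda>k. e a f k w)) = sgn (g (\<lambda>k. e a f k w'))"
          using fun_cong[OF peq, of "\<lambda>v. g (\<lambda>k. e a f k v)"] by (simp add: pat_def)
      qed
      then obtain \<phi> where \<phi>: "strict_mono \<phi>" "surj \<phi>" and
        \<phi>L: "\<forall>cs\<in>set L. \<forall>x. sgn (poly (poly_at cs (\<lambda>k. e a f k w)) x) = sgn (poly (poly_at cs (\<lambda>k. e a f k w')) (\<phi> x))"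
        using iso unfolding sign_determines_def by blast
      have "Lb \<in> set L" by (simp add: L_def)
      then have \<phi>f: "sgn (poly (P (Some f) w) x) = sgn (poly (P (Some f) w') (\<phi> x))" for x
        using \<phi>L Pb by metis
      have \<phi>a: "sgn (poly ((pderiv ^^ k) (P a w)) x) = sgn (poly ((pderiv ^^ k) (P a w')) (\<phi> x))" if "k \<le> D" for x k
      proof -
        have "dA k \<in> set L" using that by (auto simp: L_def simp del: upt_Suc)
        then show ?thesis using \<phi>L by (metis Pa dA2)
      qed
      have zero: "P (Some f) w = 0 \<longleftrightarrow> P (Some f) w' = 0"
      proof -
        have "P (Some f) w = 0 \<longleftrightarrow> (\<forall>x. sgn (poly (P (Some f) w) x) = 0)" by (simp add: sgn_zero_iff poly_all_0_iff_0)
        also have "\<dots> \<longleftrightarrow> (\<forall>x. sgn (poly (P (Some f) w') x) = 0)" using \<phi>f \<phi>(2) by (metis surjD)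
        also have "\<dots> \<longleftrightarrow> P (Some f) w' = 0" by (simp add: sgn_zero_iff poly_all_0_iff_0)
        finally show ?thesis .
      qed
      have lt: "\<phi> x < \<phi> y \<longleftrightarrow> x < y" for x y using \<phi>(1) by (rule strict_mono_less)
      show ?thesis
      proof (cases "P (Some f) w = 0")
        case True
        then show ?thesis using zero fP[OF fF] by simp
      next
        case nz: False
        then have nz': "P (Some f) w' \<noteq> 0" using zero by simp
        have "sgn (poly (P (Some f) w') (\<phi> (w n))) = sgn (poly (P (Some f) w') (w' n))"
        proof (cases a)
          case None
          have 1: "poly (P (Some f) w) t \<noteq> 0" if "t \<le> w n" for t
            using cw d_eq None fF nz that by (auto simp: cond_def)
          have 2: "poly (P (Some f) w') t \<noteq> 0" if "t \<le> w' n" for t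
            using cw' d_eq None fF nz' that by (auto simp: cond_def)
          show ?thesis
          proof (rule sgn_poly_eq_if_no_root)
            fix z assume z: "min (\<phi> (w n)) (w' n) \<le> z" "z \<le> max (\<phi> (w n)) (w' n)"
            obtain t where t: "z = \<phi> t" using \<phi>(2) by (metis surjD)
            have "z \<le> w' n \<or> t \<le> w n" using z t lt[of "w n" t] by (auto simp: max_def split: if_splits)
            then show "poly (P (Some f) w') z \<noteq> 0" using 1[of t] 2[of z] \<phi>f[of t] t by (metis sgn_zero_iff)
          qed
        next
          case (Some f0)
          obtain \<rho> where \<rho>: "\<rho> \<le> w n" "P a w \<noteq> 0" "poly (P a w) \<rho> = 0"
            "\<And>k. k \<le> D \<Longrightarrow> \<tau> k = sgn (poly ((pderiv ^^ k) (P a w)) \<rho>)" "fl = (\<rho> = w n)"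
            "\<And>t. \<rho> < t \<Longrightarrow> t \<le> w n \<Longrightarrow> poly (P (Some f) w) t \<noteq> 0"
            using cw d_eq Some fF nz by (auto simp: cond_def)
          obtain \<rho>' where \<rho>': "\<rho>' \<le> w' n" "P a w' \<noteq> 0" "poly (P a w') \<rho>' = 0"
            "\<And>k. k \<le> D \<Longrightarrow> \<tau> k = sgn (poly ((pderiv ^^ k) (P a w')) \<rho>')" "fl = (\<rho>' = w' n)"
            "\<And>t. \<rho>' < t \<Longrightarrow> t \<le> w' n \<Longrightarrow> poly (P (Some f) w') t \<noteq> 0"
            using cw' d_eq Some fF nz' by (auto simp: cond_def)
          have degP: "degree (P a v) \<le> D" for v
            by (rule degree_le) (auto simp: P_def coeff_poly_at La_def)
          have hi: "(pderiv ^^ k) (P a v) = 0" if "k > D" for k v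
          proof -
            have dj: "degree ((pderiv ^^ j) (P a v)) \<le> D - j" for j
              by (induction j) (use degP[of v] in \<open>auto simp: degree_pderiv\<close>)
            have "degree ((pderiv ^^ D) (P a v)) = 0" using dj[of D] by simp
            then have "(pderiv ^^ Suc D) (P a v) = 0" by (simp add: pderiv_eq_0_iff)
            moreover define j where "j = k - Suc D"
            then have j: "k = j + Suc D" using that by simp
            moreover have "(pderiv ^^ j) (0 :: real poly) = 0" by (induction j) auto
            ultimately show ?thesis unfolding j funpow_add comp_def by simp
          qed
          have "\<phi> \<rho> = \<rho>'"
          proof (rule thom_root_unique[OF \<rho>'(2) _ \<rho>'(3)])
            show "poly (P a w') (\<phi> \<rho>) = 0" using \<phi>a[of 0 \<rho>] \<rho>(3) by (simp add: sgn_zero_iff)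
            show "sgn (poly ((pderiv ^^ k) (P a w')) (\<phi> \<rho>)) = sgn (poly ((pderiv ^^ k) (P a w')) \<rho>')" for k
              using \<phi>a[of k \<rho>] \<rho>(4)[of k] \<rho>'(4)[of k] hi[of k] by (cases "k \<le> D") auto
          qed
          show ?thesis
          proof (cases "\<rho> = w n")
            case True then show ?thesis using \<open>\<phi> \<rho> = \<rho>'\<close> \<rho>(5) \<rho>'(5) by simp
          next
            case False
            then have l: "\<rho> < w n" "\<rho>' < w' n" using \<rho>(1,5) \<rho>'(1,5) by auto
            show ?thesis
            proof (rule sgn_poly_eq_if_no_root)
              fix z assume z: "min (\<phi> (w n)) (w' n) \<le> z" "z \<le> max (\<phi> (w n)) (w' n)"
              obtain t where t: "z = \<phi> t" using \<phi>(2) by (metis surjD)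
              have "\<rho>' < z" using z l lt[of \<rho> "w n"] \<open>\<phi> \<rho> = \<rho>'\<close> by (auto simp: min_def split: if_splits)
              then have "\<rho> < t" using t \<open>\<phi> \<rho> = \<rho>'\<close> lt by blast
              have "z \<le> w' n \<or> t \<le> w n" using z t lt[of "w n" t] by (auto simp: max_def split: if_splits)
              then show "poly (P (Some f) w') z \<noteq> 0"
                using \<rho>(6)[OF \<open>\<rho> < t\<close>] \<rho>'(6)[OF \<open>\<rho>' < z\<close>] \<phi>f[of t] t by (metis sgn_zero_iff)
            qed
          qed
        qed
        then show ?thesis using \<phi>f[of "w n"] fP[OF fF] by simp
      qed
    qed
    have finData: "finite Data" unfolding Data_def
      using F H by (auto simp: Opt_def intro!: finite_SigmaI finite_PiE finite_sign_vectors)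
    have "\<forall>w. \<exists>d. d \<in> Data \<and> cond w d" using ex by blast
    from choice[OF this] obtain \<delta> where \<delta>: "\<And>w. \<delta> w \<in> Data \<and> cond w (\<delta> w)" by blast
    have "finite (sign_vectors F) \<and> card (sign_vectors F) \<le> card Data"
      unfolding sign_vectors_def
    proof (rule card_range_le_if_determined[where \<delta>=\<delta>])
      show "(\<lambda>f\<in>F. sgn (f w)) = (\<lambda>f\<in>F. sgn (f w'))" if "\<delta> w = \<delta> w'" for w w'
        by (rule restrict_ext) (use det[of "\<delta> w" w w'] \<delta> that in metis)
    qed (use \<delta> finData in auto)
    then have "card (sign_vectors F) \<le> card Data" by simp
    also have "card Data = (\<Sum>a\<in>Opt. 3 ^ Suc D * (2 * card (sign_vectors (H a))))"
    proof -
      have c3: "card {-1, 0, 1::real} = 3" by simp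
      have fO: "finite Opt" using F by (simp add: Opt_def)
      have fin: "\<forall>a\<in>Opt. finite ((PiE {..D} (\<lambda>_. {-1, 0, 1::real})) \<times> (UNIV :: bool set) \<times> sign_vectors (H a))"
        using H by (intro ballI finite_cartesian_product finite_PiE finite_sign_vectors) auto
      show ?thesis unfolding Data_def card_SigmaI[OF fO fin]
      proof (rule sum.cong)
        fix a assume "a \<in> Opt"
        have "card (PiE {..D} (\<lambda>_. {-1, 0, 1::real})) = 3 ^ Suc D" by (simp only: card_PiE finite_atMost c3 prod_constant card_atMost)
        then show "card ((PiE {..D} (\<lambda>_. {-1, 0, 1::real})) \<times> (UNIV :: bool set) \<times> sign_vectors (H a)) = 3 ^ Suc D * (2 * card (sign_vectors (H a)))"
          by (simp only: card_cartesian_product card_UNIV_bool)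
      qed simp
    qed
    also have "\<dots> \<le> (\<Sum>a\<in>Opt. C' * (card F + 1) ^ n)"
    proof (rule sum_mono)
      fix a assume a: "a \<in> Opt"
      have "card (sign_vectors (H a)) \<le> C * (card (H a) + 1) ^ n" using C H[OF a] by blast
      also have "\<dots> \<le> C * ((card G + 1) * (card F + 1)) ^ n"
        using H(3)[OF a] by (intro mult_left_mono power_mono) auto
      also have "\<dots> = C * (card G + 1) ^ n * (card F + 1) ^ n"
        by (simp only: power_mult_distrib mult.assoc)
      finally have "card (sign_vectors (H a)) \<le> C * (card G + 1) ^ n * (card F + 1) ^ n" .
      then have "3 ^ Suc D * (2 * card (sign_vectors (H a))) \<le> 3 ^ Suc D * (2 * (C * (card G + 1) ^ n * (card F + 1) ^ n))"
        by (intro mult_left_mono) auto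
      then show "3 ^ Suc D * (2 * card (sign_vectors (H a))) \<le> C' * (card F + 1) ^ n"
        by (simp add: C'_def mult_ac)
    qed
    also have "\<dots> = C' * (card F + 1) ^ Suc n"
      using F by (simp add: Opt_def card_image mult_ac)
    finally show ?thesis .
  qed
  then show ?case by blast
qed

section \<open>Sign patterns of intersecting hulls\<close>

text \<open>Coefficients are attached to indices instead of points, so coinciding points do no harm
  and the number of coefficient variables is fixed.\<close>

lemma convex_hull_image_sum:
  fixes f :: "'i \<Rightarrow> 'a::euclidean_space"
  assumes "finite P"
  shows "x \<in> convex hull (f ` P) \<longleftrightarrow> (\<exists>c. (\<forall>k\<in>P. c k \<ge> 0) \<and> sum c P = 1 \<and> (\<Sum>k\<in>P. c k *\<^sub>R f k) = x)"
proof -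
  have eq: "f ` P = (\<Union>k\<in>P. {f k})" by blast
  have "\<forall>k\<in>P. convex {f k} \<and> {f k} \<noteq> {}" by simp
  from convex_hull_finite_union[OF assms this] have
    "convex hull (f ` P) = {\<Sum>k\<in>P. c k *\<^sub>R s k |c s. (\<forall>k\<in>P. 0 \<le> c k) \<and> sum c P = 1 \<and> (\<forall>k\<in>P. s k \<in> {f k})}"
    unfolding eq .
  moreover have "(\<Sum>k\<in>P. c k *\<^sub>R s k) = (\<Sum>k\<in>P. c k *\<^sub>R f k)" if "\<forall>k\<in>P. s k \<in> {f k}" for c :: "'i \<Rightarrow> real" and s
    using that by (intro sum.cong) auto
  ultimately show ?thesis
    by (auto intro!: exI[of _ f])
qed

text \<open>The negation of the tightness equation for simplices given by vertex lists, so that it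
  becomes a condition on coordinates.\<close>

definition hulls_meet :: "nat set \<Rightarrow> (nat \<Rightarrow> nat \<Rightarrow> 'a::euclidean_space) \<Rightarrow> bool" where
  "hulls_meet I w \<longleftrightarrow> (\<Inter>i\<in>I. convex hull (\<Union>j\<in>I - {i}. w j ` {..DIM('a)})) \<noteq> {}"

text \<open>The \<open>Inr\<close> indices are spare variables, zero here: they will carry the
  barycentric coefficients of a common point and are quantified away.\<close>

definition coords :: "(nat \<Rightarrow> nat \<Rightarrow> 'a::euclidean_space) \<Rightarrow> (nat \<times> nat \<times> 'a) + (nat \<times> nat \<times> nat) \<Rightarrow> real" where
  "coords w x = (case x of Inl (k, a, b) \<Rightarrow> if a \<le> DIM('a) \<and> b \<in> Basis then w k a \<bullet> b else 0 | Inr _ \<Rightarrow> 0)"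

text \<open>A common point amounts to one convex combination for each \<open>i\<close>, all with the
  same value. Nonnegativity, total weight one and equality are sign conditions on polynomials in
  vertices and coefficients; eliminating the coefficients leaves a condition on the
  vertices.\<close>

lemma hulls_meet_sign_determined:
  assumes I: "finite I" "I \<noteq> {}"
  shows "\<exists>G. finite G \<and> G \<subseteq> polyfun \<and> (\<forall>w w' :: nat \<Rightarrow> nat \<Rightarrow> 'a::euclidean_space.
    (\<forall>g\<in>G. sgn (g (coords w)) = sgn (g (coords w'))) \<longrightarrow> hulls_meet I w \<longrightarrow> hulls_meet I w')"
proof -
  define P where "P = (\<lambda>i. (I - {i}) \<times> {..DIM('a)})"
  have fP: "finite (P i)" for i using I by (simp add: P_def)
  have Pd: "snd k \<le> DIM('a)" if "k \<in> P i" for k i using that by (auto simp: P_def)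
  define V :: "((nat \<times> nat \<times> 'a) + (nat \<times> nat \<times> nat)) set" where "V = Inr ` (SIGMA i:I. P i)"
  have fV: "finite V" unfolding V_def using I fP by auto
  define f1 :: "nat \<times> nat \<times> nat \<Rightarrow> ((nat \<times> nat \<times> 'a) + (nat \<times> nat \<times> nat) \<Rightarrow> real) \<Rightarrow> real" where "f1 = (\<lambda>t u. u (Inr t))"
  define f2 :: "nat \<Rightarrow> ((nat \<times> nat \<times> 'a) + (nat \<times> nat \<times> nat) \<Rightarrow> real) \<Rightarrow> real" where "f2 = (\<lambda>i u. (\<Sum>x\<in>P i. u (Inr (i, x))) - 1)"
  define z :: "nat \<Rightarrow> 'a \<Rightarrow> ((nat \<times> nat \<times> 'a) + (nat \<times> nat \<times> nat) \<Rightarrow> real) \<Rightarrow> real"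
    where "z = (\<lambda>i b u. \<Sum>x\<in>P i. u (Inr (i, x)) * u (Inl (fst x, snd x, b)))"
  \<comment> \<open>Comparing the combinations with each other avoids further variables for the
    common point.\<close>
  define f3 where "f3 = (\<lambda>(i, i', b) u. z i b u - z i' b u)"
  define F where "F = f1 ` (SIGMA i:I. P i) \<union> f2 ` I \<union> f3 ` (I \<times> I \<times> Basis)"
  define ok where "ok = (\<lambda>u. (\<forall>t\<in>(SIGMA i:I. P i). 0 \<le> f1 t u) \<and> (\<forall>i\<in>I. f2 i u = 0) \<and> (\<forall>t\<in>I \<times> I \<times> Basis. f3 t u = 0))"
  have fF: "finite F" unfolding F_def using I fP by auto
  have z_poly: "z i b \<in> polyfun" for i b
    unfolding z_def by (intro polyfun_sum polyfun.mult polyfun.var)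
  have F_poly: "F \<subseteq> polyfun"
    unfolding F_def f1_def f2_def f3_def
    by (auto intro!: polyfun.var polyfun_diff polyfun_sum polyfun.const z_poly)
  have ok_sgn: "ok u'" if "\<forall>f\<in>F. sgn (f u) = sgn (f u')" "ok u" for u u'
    unfolding ok_def
  proof (intro conjI ballI)
    fix t assume t: "t \<in> (SIGMA i:I. P i)"
    then have "sgn (f1 t u) = sgn (f1 t u')" "0 \<le> f1 t u" using that unfolding F_def ok_def by blast+
    then show "0 \<le> f1 t u'" by (simp add: sgn_if split: if_splits)
  next
    fix i assume "i \<in> I"
    then have "sgn (f2 i u) = sgn (f2 i u')" "f2 i u = 0" using that unfolding F_def ok_def by blast+
    then show "f2 i u' = 0" by (metis sgn_0_0)
  next
    fix t assume "t \<in> I \<times> I \<times> (Basis :: 'a set)"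
    then have "sgn (f3 t u) = sgn (f3 t u')" "f3 t u = 0" using that unfolding F_def ok_def by blast+
    then show "f3 t u' = 0" by (metis sgn_0_0)
  qed
  have hull: "convex hull (\<Union>j\<in>I - {i}. w j ` {..DIM('a)}) = convex hull ((\<lambda>x. w (fst x) (snd x)) ` P i)" for i and w :: "nat \<Rightarrow> nat \<Rightarrow> 'a"
  proof (rule arg_cong[where f = "\<lambda>S. convex hull S"], intro set_eqI iffI)
    fix y assume "y \<in> (\<Union>j\<in>I - {i}. w j ` {..DIM('a)})"
    then obtain j a where "j \<in> I - {i}" "a \<le> DIM('a)" "y = w j a" by auto
    then show "y \<in> (\<lambda>x. w (fst x) (snd x)) ` P i" unfolding P_def by (intro image_eqI[of _ _ "(j, a)"]) auto
  next
    fix y assume "y \<in> (\<lambda>x. w (fst x) (snd x)) ` P i"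
    then obtain k where k: "k \<in> P i" "y = w (fst k) (snd k)" by blast
    then have "fst k \<in> I - {i}" "snd k \<in> {..DIM('a)}" unfolding P_def mem_Times_iff by blast+
    then show "y \<in> (\<Union>j\<in>I - {i}. w j ` {..DIM('a)})" unfolding k(2) by blast
  qed
  have meet_ok: "hulls_meet I w \<longleftrightarrow> (\<exists>u. (\<forall>x. x \<notin> V \<longrightarrow> u x = coords w x) \<and> ok u)" for w :: "nat \<Rightarrow> nat \<Rightarrow> 'a"
  proof
    assume "hulls_meet I w"
    then obtain x where x: "\<And>i. i \<in> I \<Longrightarrow> x \<in> convex hull ((\<lambda>x. w (fst x) (snd x)) ` P i)" unfolding hulls_meet_def hull by blast
    have "\<forall>i\<in>I. \<exists>c. (\<forall>k\<in>P i. c k \<ge> 0) \<and> sum c (P i) = 1 \<and> (\<Sum>k\<in>P i. c k *\<^sub>R w (fst k) (snd k)) = x"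
      by (intro ballI convex_hull_image_sum[OF fP, THEN iffD1] x)
    from bchoice[OF this] obtain c where c: "\<And>i. i \<in> I \<Longrightarrow> (\<forall>k\<in>P i. c i k \<ge> 0) \<and> sum (c i) (P i) = 1 \<and> (\<Sum>k\<in>P i. c i k *\<^sub>R w (fst k) (snd k)) = x"
      by blast
    define u where "u = (\<lambda>y. case y of Inl _ \<Rightarrow> coords w y | Inr (i, k) \<Rightarrow> if i \<in> I \<and> k \<in> P i then c i k else 0)"
    have u1: "u (Inr (i, k)) = c i k" if "i \<in> I" "k \<in> P i" for i k using that by (simp add: u_def)
    have u2: "u (Inl (k, a, b)) = w k a \<bullet> b" if "a \<le> DIM('a)" "b \<in> Basis" for k a b using that by (simp add: u_def coords_def)
    have u3: "u y = coords w y" if "y \<notin> V" for y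
    proof (cases y)
      case (Inl l) then show ?thesis by (simp add: u_def)
    next
      case (Inr t)
      obtain i k where t: "t = (i, k)" by (cases t)
      then have "\<not> (i \<in> I \<and> k \<in> P i)" using that Inr by (auto simp: V_def)
      then show ?thesis using Inr t by (auto simp: u_def coords_def)
    qed
    have zx: "z i b u = x \<bullet> b" if i: "i \<in> I" and b: "b \<in> Basis" for i b
    proof -
      have "x \<bullet> b = (\<Sum>k\<in>P i. c i k *\<^sub>R w (fst k) (snd k)) \<bullet> b" using c[OF i] by simp
      also have "\<dots> = (\<Sum>k\<in>P i. c i k * (w (fst k) (snd k) \<bullet> b))" by (simp add: inner_sum_left)
      also have "\<dots> = z i b u" unfolding z_def by (intro sum.cong refl) (simp add: u1[OF i] u2 Pd[of _ i] b)
      finally show ?thesis by simp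
    qed
    have "sum (c i) (P i) = (\<Sum>k\<in>P i. u (Inr (i, k)))" if "i \<in> I" for i by (intro sum.cong refl) (simp add: u1[OF that])
    then have "ok u" unfolding ok_def f1_def f2_def f3_def using c zx u1 by auto
    then show "\<exists>u. (\<forall>x. x \<notin> V \<longrightarrow> u x = coords w x) \<and> ok u" using u3 by blast
  next
    assume "\<exists>u. (\<forall>x. x \<notin> V \<longrightarrow> u x = coords w x) \<and> ok u"
    then obtain u where u: "\<And>x. x \<notin> V \<Longrightarrow> u x = coords w x" and ok: "ok u" by blast
    have u2: "u (Inl (k, a, b)) = w k a \<bullet> b" if "a \<le> DIM('a)" "b \<in> Basis" for k a b
      using u[of "Inl (k, a, b)"] that by (auto simp: V_def coords_def)
    define y where "y = (\<lambda>i. \<Sum>k\<in>P i. u (Inr (i, k)) *\<^sub>R w (fst k) (snd k))"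
    have yz: "y i \<bullet> b = z i b u" if "b \<in> Basis" for i b
      unfolding y_def z_def inner_sum_left inner_scaleR_left by (intro sum.cong refl) (simp add: u2 Pd[of _ i] that)
    obtain i0 where i0: "i0 \<in> I" using I by blast
    have "y i0 \<in> convex hull ((\<lambda>x. w (fst x) (snd x)) ` P i)" if i: "i \<in> I" for i
    proof -
      have "y i0 = y i"
      proof (rule euclidean_eqI)
        fix b :: 'a assume b: "b \<in> Basis"
        then have "f3 (i0, i, b) u = 0" using ok i i0 unfolding ok_def by blast
        then show "y i0 \<bullet> b = y i \<bullet> b" unfolding yz[OF b] f3_def by simp
      qed
      moreover have "f2 i u = 0" using ok i unfolding ok_def by blast
      moreover have "0 \<le> u (Inr (i, k))" if "k \<in> P i" for k
        using ok i that unfolding ok_def f1_def by blast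
      ultimately show ?thesis
        unfolding convex_hull_image_sum[OF fP]
        by (intro exI[of _ "\<lambda>k. u (Inr (i, k))"]) (simp add: f2_def y_def)
    qed
    then show "hulls_meet I w" unfolding hulls_meet_def hull by blast
  qed
  obtain G where G: "finite G" "G \<subseteq> polyfun" and det: "sign_determines G (\<lambda>u u'. \<forall>w. (\<forall>i. i \<notin> V \<longrightarrow> w i = u i) \<longrightarrow>
      (\<exists>w'. (\<forall>i. i \<notin> V \<longrightarrow> w' i = u' i) \<and> (\<forall>f\<in>F. sgn (f w) = sgn (f w'))))"
    using polyfun_eliminate[OF fV fF F_poly] by (elim exE conjE)
  have "hulls_meet I w'" if sg: "\<forall>g\<in>G. sgn (g (coords w)) = sgn (g (coords w'))" and m: "hulls_meet I w" for w w' :: "nat \<Rightarrow> nat \<Rightarrow> 'a"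
  proof -
    obtain u where u: "\<forall>x. x \<notin> V \<longrightarrow> u x = coords w x" and ok: "ok u" using m unfolding meet_ok by blast
    have "\<forall>y. (\<forall>i. i \<notin> V \<longrightarrow> y i = coords w i) \<longrightarrow>
      (\<exists>w''. (\<forall>i. i \<notin> V \<longrightarrow> w'' i = coords w' i) \<and> (\<forall>f\<in>F. sgn (f y) = sgn (f w'')))"
      using det[unfolded sign_determines_def, THEN spec, THEN spec, THEN mp, OF sg] .
    note this[THEN spec, THEN mp, OF u]
    then obtain u' where u': "\<forall>i. i \<notin> V \<longrightarrow> u' i = coords w' i" "\<forall>f\<in>F. sgn (f u) = sgn (f u')" by (elim exE conjE)
    show ?thesis unfolding meet_ok using ok_sgn[OF u'(2) ok] u'(1) by (intro exI[of _ u'] conjI)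
  qed
  then show ?thesis using G by blast
qed

lemma card_image_factor:
  assumes "finite B" "\<And>x. x \<in> A \<Longrightarrow> h x \<in> B" "\<And>x y. x \<in> A \<Longrightarrow> y \<in> A \<Longrightarrow> h x = h y \<Longrightarrow> f x = f y"
  shows "card (f ` A) \<le> card B"
proof -
  have "card (f ` A) \<le> card (h ` A)"
  proof (rule surj_card_le)
    show "finite (h ` A)" using assms(1,2) by (meson finite_subset image_subsetI)
    show "f ` A \<subseteq> (\<lambda>b. f (SOME x. x \<in> A \<and> h x = b)) ` (h ` A)"
    proof
      fix y assume "y \<in> f ` A"
      then obtain x where x: "x \<in> A" "y = f x" by blast
      then have "(SOME x'. x' \<in> A \<and> h x' = h x) \<in> A \<and> h (SOME x'. x' \<in> A \<and> h x' = h x) = h x" by (rule_tac someI[of _ x]) simp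
      then have "f (SOME x'. x' \<in> A \<and> h x' = h x) = f x" using assms(3) x by blast
      then show "y \<in> (\<lambda>b. f (SOME x. x \<in> A \<and> h x = b)) ` (h ` A)" using x by (intro image_eqI[of _ _ "h x"]) auto
    qed
  qed
  also have "\<dots> \<le> card B" using assms by (intro card_mono) auto
  finally show ?thesis .
qed

text \<open>The moving simplex has d + 1 vertices with d coordinates each, whence the exponent. The
  other simplices enter as constants, so each test contributes boundedly many polynomials of bounded
  degree in these variables, and their sign vector determines the pattern.\<close>

theorem hulls_meet_patterns:
  assumes I: "finite I" "I \<noteq> {}"
  shows "\<exists>C>0. \<forall>j s. \<forall>\<xi> :: nat \<Rightarrow> nat \<Rightarrow> nat \<Rightarrow> 'a::euclidean_space.
    card (range (\<lambda>w. {m. m < s \<and> hulls_meet I ((\<xi> m)(j := w))})) \<le> C * (s + 1) ^ (DIM('a) * (DIM('a) + 1))"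
proof -
  let ?d = "DIM('a)" and ?n = "DIM('a) * (DIM('a) + 1)"
  obtain G where G: "finite G" "G \<subseteq> polyfun" and det: "\<And>w w' :: nat \<Rightarrow> nat \<Rightarrow> 'a.
    (\<forall>g\<in>G. sgn (g (coords w)) = sgn (g (coords w'))) \<Longrightarrow> hulls_meet I w \<Longrightarrow> hulls_meet I w'"
    using hulls_meet_sign_determined[OF I] by blast
  obtain D where D: "\<And>g c. g \<in> G \<Longrightarrow> (\<forall>i. c i \<in> bpoly ?n 1) \<Longrightarrow> (\<lambda>v. g (\<lambda>i. c i v)) \<in> bpoly ?n D"
    using bpoly_common_degree[OF G, of ?n 1] by blast
  obtain C where C: "\<And>F. finite F \<Longrightarrow> F \<subseteq> bpoly ?n D \<Longrightarrow> card (sign_vectors F) \<le> C * (card F + 1) ^ ?n"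
    using card_sign_vectors_le[of ?n D] by blast
  obtain e where e: "bij_betw e (Basis :: 'a set) {..<?d}"
    using ex_bij_betw_finite_nat[OF finite_Basis] lessThan_atLeast0 by metis
  have e_lt: "e b < ?d" if "b \<in> Basis" for b using bij_betwE[OF e] that by auto
  have patterns: "card (range (\<lambda>w. {m. m < s \<and> hulls_meet I ((\<xi> m)(j := w))})) \<le> (C + 1) * (card G + 1) ^ ?n * (s + 1) ^ ?n"
    for j s and \<xi> :: "nat \<Rightarrow> nat \<Rightarrow> nat \<Rightarrow> 'a"
  proof -
    \<comment> \<open>Coordinate \<open>b\<close> of vertex \<open>a\<close> of the moving simplex
      becomes the variable with number \<open>a * d + e b\<close>; all other coordinates stay
      constants.\<close>
    define c :: "nat \<Rightarrow> (nat \<times> nat \<times> 'a) + (nat \<times> nat \<times> nat) \<Rightarrow> (nat \<Rightarrow> real) \<Rightarrow> real"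
      where "c = (\<lambda>m x v. case x of Inl (k, a, b) \<Rightarrow>
        if k = j then if a \<le> ?d \<and> b \<in> Basis then v (a * ?d + e b) else 0 else coords (\<xi> m) x | Inr _ \<Rightarrow> 0)"
    have c_poly: "c m x \<in> bpoly ?n 1" for m x
    proof (cases "\<exists>a b. x = Inl (j, a, b) \<and> a \<le> ?d \<and> b \<in> Basis")
      case True
      then obtain a b where x: "x = Inl (j, a, b)" "a \<le> ?d" "b \<in> Basis" by blast
      have "a * ?d + e b < a * ?d + ?d" using e_lt x by simp
      also have "\<dots> = (a + 1) * ?d" by simp
      also have "\<dots> \<le> (?d + 1) * ?d" using x by (intro mult_right_mono) auto
      finally have "a * ?d + e b < ?n" by (simp add: mult.commute)
      then have "(\<lambda>v. v (a * ?d + e b)) \<in> bpoly ?n 1" by (rule bpoly_var)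
      moreover have "c m x = (\<lambda>v. v (a * ?d + e b))" using x by (simp add: c_def)
      ultimately show ?thesis by simp
    next
      case False
      then have "c m x v = c m x (\<lambda>_. 0)" for v by (auto simp: c_def split: sum.splits)
      then have "c m x = (\<lambda>_. c m x (\<lambda>_. 0))" by blast
      then show ?thesis using bpoly_const by metis
    qed
    define F where "F = (\<lambda>(g, m). \<lambda>v. g (\<lambda>x. c m x v)) ` (G \<times> {..<s})"
    have F: "finite F" "F \<subseteq> bpoly ?n D" unfolding F_def using G D c_poly by auto
    have cF: "card F \<le> card G * s" unfolding F_def using card_image_le[of "G \<times> {..<s}"] G by (simp add: card_cartesian_product)
    define val where "val = (\<lambda>(w :: nat \<Rightarrow> 'a) i. w (i div ?d) \<bullet> inv_into Basis e (i mod ?d))"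
    have val: "val w (a * ?d + e b) = w a \<bullet> b" if "b \<in> Basis" for w a b
      using that e_lt[OF that] bij_betw_inv_into_left[OF e that] by (simp add: val_def)
    have c_val: "(\<lambda>x. c m x (val w)) = coords ((\<xi> m)(j := w))" for m w
    proof
      fix x show "c m x (val w) = coords ((\<xi> m)(j := w)) x"
        by (auto simp: c_def coords_def val split: sum.splits)
    qed
    have "card (range (\<lambda>w. {m. m < s \<and> hulls_meet I ((\<xi> m)(j := w))})) \<le> card (sign_vectors F)"
    proof (rule card_image_factor[where h = "\<lambda>w. \<lambda>f\<in>F. sgn (f (val w))"])
      show "finite (sign_vectors F)" by (rule finite_sign_vectors[OF F(1)])
      show "(\<lambda>f\<in>F. sgn (f (val w))) \<in> sign_vectors F" for w unfolding sign_vectors_def by blast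
      fix w w' assume eq: "(\<lambda>f\<in>F. sgn (f (val w))) = (\<lambda>f\<in>F. sgn (f (val w')))"
      have "sgn (g (coords ((\<xi> m)(j := w)))) = sgn (g (coords ((\<xi> m)(j := w'))))" if g: "g \<in> G" and m: "m < s" for g m
      proof -
        let ?f = "\<lambda>v. g (\<lambda>x. c m x v)"
        have "?f \<in> F" unfolding F_def using g m by (intro image_eqI[of _ _ "(g, m)"]) auto
        then have "sgn (?f (val w)) = sgn (?f (val w'))" using fun_cong[OF eq, of ?f] by simp
        then show ?thesis unfolding c_val .
      qed
      then have "hulls_meet I ((\<xi> m)(j := w)) \<longleftrightarrow> hulls_meet I ((\<xi> m)(j := w'))" if "m < s" for m
        using det that by metis
      then show "{m. m < s \<and> hulls_meet I ((\<xi> m)(j := w))} = {m. m < s \<and> hulls_meet I ((\<xi> m)(j := w'))}" by blast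
    qed
    also have "\<dots> \<le> C * (card F + 1) ^ ?n" by (rule C[OF F])
    also have "\<dots> \<le> (C + 1) * ((card G + 1) * (s + 1)) ^ ?n"
    proof (intro mult_mono power_mono)
      have "card G * s + 1 \<le> (card G + 1) * (s + 1)" by simp
      then show "card F + 1 \<le> (card G + 1) * (s + 1)" using cF by linarith
    qed auto
    finally show ?thesis by (simp only: power_mult_distrib mult.assoc)
  qed
  have "(C + 1) * (card G + 1) ^ ?n > 0" by simp
  then show ?thesis using patterns by blast
qed

section \<open>Cochains on coloured simplices\<close>

lemma bit_add_self: "(x::bit) + x = 0"
  by (cases x) auto

lemma bit_eq_iff_add: "(x::bit) = y \<longleftrightarrow> x + y = 0"
  by (cases x; cases y) auto

text \<open>Cochains mod 2 on the join of the discrete colour classes: a face is a colour set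
  \<open>J\<close> with a choice of vertices, read off from \<open>f\<close> on \<open>J\<close>;
  \<open>local_cochain\<close> expresses that nothing else matters. Degrees are counted by
  \<open>card J\<close>, and the empty face belongs to the complex.\<close>

definition coboundary :: "(nat set \<Rightarrow> (nat \<Rightarrow> 'v) \<Rightarrow> bit) \<Rightarrow> nat set \<Rightarrow> (nat \<Rightarrow> 'v) \<Rightarrow> bit" where
  "coboundary g J f = (\<Sum>j\<in>J. g (J - {j}) f)"

definition local_cochain :: "(nat set \<Rightarrow> (nat \<Rightarrow> 'v) \<Rightarrow> bit) \<Rightarrow> bool" where
  "local_cochain g \<longleftrightarrow> (\<forall>J f f'. (\<forall>j\<in>J. f j = f' j) \<longrightarrow> g J f = g J f')"

text \<open>Normalising by the number of faces over \<open>J\<close> frees the cofilling constant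
  from the class sizes.\<close>

definition weight :: "(nat \<Rightarrow> 'v set) \<Rightarrow> (nat set \<Rightarrow> (nat \<Rightarrow> 'v) \<Rightarrow> bit) \<Rightarrow> nat set \<Rightarrow> real" where
  "weight A g J = real (card {f \<in> PiE J A. g J f \<noteq> 0}) / real (\<Prod>j\<in>J. card (A j))"

definition total_weight :: "(nat \<Rightarrow> 'v set) \<Rightarrow> nat set \<Rightarrow> (nat set \<Rightarrow> (nat \<Rightarrow> 'v) \<Rightarrow> bit) \<Rightarrow> nat \<Rightarrow> real" where
  "total_weight A I g m = (\<Sum>J | J \<subseteq> I \<and> card J = m. weight A g J)"

text \<open>Restriction to the faces through the vertex \<open>a\<close> of colour \<open>i\<close>,
  regarded as a cochain on the link of \<open>a\<close>.\<close>

definition slice :: "nat \<Rightarrow> 'v \<Rightarrow> (nat set \<Rightarrow> (nat \<Rightarrow> 'v) \<Rightarrow> bit) \<Rightarrow> nat set \<Rightarrow> (nat \<Rightarrow> 'v) \<Rightarrow> bit" where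
  "slice i a g J f = g (insert i J) (f(i := a))"

lemma local_cochainD: "local_cochain g \<Longrightarrow> (\<And>j. j \<in> J \<Longrightarrow> f j = f' j) \<Longrightarrow> g J f = g J f'"
  by (auto simp: local_cochain_def)

lemma local_cochain_slice: "local_cochain g \<Longrightarrow> local_cochain (slice i a g)"
  unfolding local_cochain_def slice_def by (auto simp: fun_upd_def)

lemma weight_nonneg: "weight A g J \<ge> 0"
  by (simp add: weight_def prod_nonneg)

lemma total_weight_nonneg: "total_weight A I g m \<ge> 0"
  by (simp add: total_weight_def sum_nonneg weight_nonneg)

lemma weight_cong: "(\<And>f. f \<in> PiE J A \<Longrightarrow> g J f = g' J f) \<Longrightarrow> weight A g J = weight A g' J"
  unfolding weight_def by (metis (mono_tags, lifting) Collect_cong)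

lemma weight_add:
  assumes "finite J" "\<And>j. j \<in> J \<Longrightarrow> finite (A j)"
  shows "weight A (\<lambda>J f. g J f + g' J f) J \<le> weight A g J + weight A g' J"
proof -
  have "finite (PiE J A)" using assms by (simp add: finite_PiE)
  then have "card {f \<in> PiE J A. g J f + g' J f \<noteq> 0} \<le> card ({f \<in> PiE J A. g J f \<noteq> 0} \<union> {f \<in> PiE J A. g' J f \<noteq> 0})"
    by (intro card_mono) auto
  also have "\<dots> \<le> card {f \<in> PiE J A. g J f \<noteq> 0} + card {f \<in> PiE J A. g' J f \<noteq> 0}" by (rule card_Un_le)
  finally have "real (card {f \<in> PiE J A. g J f + g' J f \<noteq> 0}) \<le> real (card {f \<in> PiE J A. g J f \<noteq> 0}) + real (card {f \<in> PiE J A. g' J f \<noteq> 0})"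
    by linarith
  then show ?thesis unfolding weight_def add_divide_distrib[symmetric] by (rule divide_right_mono) (simp add: prod_nonneg)
qed

lemma total_weight_add:
  assumes "finite I" "\<And>j. j \<in> I \<Longrightarrow> finite (A j)"
  shows "total_weight A I (\<lambda>J f. g J f + g' J f) m \<le> total_weight A I g m + total_weight A I g' m"
  unfolding total_weight_def sum.distrib[symmetric]
  by (intro sum_mono weight_add) (use assms finite_subset in auto)

lemma weight_insert:
  assumes "finite J" "i \<notin> J" "finite (A i)" "\<And>j. j \<in> J \<Longrightarrow> finite (A j)"
  shows "weight A g (insert i J) = (\<Sum>a\<in>A i. weight A (slice i a g) J) / card (A i)"
proof -
  let ?h = "\<lambda>(a, f). f(i := a)"
  let ?S = "SIGMA a:A i. {f \<in> PiE J A. slice i a g J f \<noteq> 0}"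
  have fP: "finite (PiE J A)" using assms by (simp add: finite_PiE)
  have "{f \<in> PiE (insert i J) A. g (insert i J) f \<noteq> 0} = ?h ` ?S"
    unfolding PiE_insert_eq by (auto simp: slice_def image_iff)
  moreover have "inj_on ?h ?S"
    by (rule inj_on_subset[OF inj_combinator[OF assms(2), of A]]) auto
  ultimately have "card {f \<in> PiE (insert i J) A. g (insert i J) f \<noteq> 0} = card ?S"
    by (simp add: card_image del: bit_not_zero_iff)
  also have "\<dots> = (\<Sum>a\<in>A i. card {f \<in> PiE J A. slice i a g J f \<noteq> 0})"
    by (rule card_SigmaI) (use fP assms in auto)
  finally show ?thesis unfolding weight_def using assms
    by (simp add: sum_divide_distrib mult.commute del: bit_not_zero_iff)
qed

lemma subsets_insert:
  assumes "finite I" "i \<notin> I" "m \<ge> 1"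
  shows "{J. J \<subseteq> insert i I \<and> card J = m} = {J. J \<subseteq> I \<and> card J = m} \<union> insert i ` {J. J \<subseteq> I \<and> card J = m - 1}"
    (is "?L = ?A \<union> ?B")
proof (intro set_eqI iffI)
  fix J assume J: "J \<in> ?L"
  then have fJ: "finite J" using assms finite_subset by auto
  show "J \<in> ?A \<union> ?B"
  proof (cases "i \<in> J")
    case True
    then have "J = insert i (J - {i})" "J - {i} \<subseteq> I" "card (J - {i}) = m - 1" using J fJ by auto
    then show ?thesis by blast
  next
    case False then show ?thesis using J by blast
  qed
next
  fix J assume "J \<in> ?A \<union> ?B"
  then show "J \<in> ?L"
  proof
    assume "J \<in> ?B"
    then obtain K where K: "J = insert i K" "K \<subseteq> I" "card K = m - 1" by blast
    then have "finite K" "i \<notin> K" using assms finite_subset by auto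
    then show ?thesis using K assms(3) by auto
  qed auto
qed

lemma total_weight_insert:
  assumes "finite I" "i \<notin> I" "m \<ge> 1" "\<And>j. j \<in> insert i I \<Longrightarrow> finite (A j)"
  shows "total_weight A (insert i I) g m =
    total_weight A I g m + (\<Sum>a\<in>A i. total_weight A I (slice i a g) (m - 1)) / card (A i)"
proof -
  have "total_weight A (insert i I) g m = (\<Sum>J\<in>{J. J \<subseteq> I \<and> card J = m} \<union> insert i ` {J. J \<subseteq> I \<and> card J = m - 1}. weight A g J)"
    unfolding total_weight_def subsets_insert[OF assms(1-3)] ..
  also have "\<dots> = total_weight A I g m + (\<Sum>J\<in>insert i ` {J. J \<subseteq> I \<and> card J = m - 1}. weight A g J)"
    unfolding total_weight_def using assms by (intro sum.union_disjoint) auto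
  also have "(\<Sum>J\<in>insert i ` {J. J \<subseteq> I \<and> card J = m - 1}. weight A g J) = (\<Sum>J | J \<subseteq> I \<and> card J = m - 1. weight A g (insert i J))"
  proof (rule sum.reindex_cong[of "insert i"])
    show "inj_on (insert i) {J. J \<subseteq> I \<and> card J = m - 1}"
      using assms(2) by (auto simp: inj_on_def insert_ident)
  qed auto
  also have "\<dots> = (\<Sum>J | J \<subseteq> I \<and> card J = m - 1. (\<Sum>a\<in>A i. weight A (slice i a g) J) / card (A i))"
    by (intro sum.cong refl weight_insert) (use assms finite_subset in auto)
  also have "\<dots> = (\<Sum>a\<in>A i. total_weight A I (slice i a g) (m - 1)) / card (A i)"
    unfolding total_weight_def sum_divide_distrib[symmetric] by (subst sum.swap) simp
  finally show ?thesis .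
qed

lemma exists_le_average:
  fixes f :: "'b \<Rightarrow> real"
  assumes "finite S" "S \<noteq> {}"
  shows "\<exists>a\<in>S. f a \<le> sum f S / card S"
proof (rule ccontr)
  assume "\<not> ?thesis"
  then have "(\<Sum>a\<in>S. sum f S / card S) < sum f S" using assms by (intro sum_strict_mono) auto
  then show False using assms by simp
qed

text \<open>Small cofillings in the join of the discrete sets \<open>A i\<close>. Coning from a well-chosen point \<open>a\<close> of
  one colour class removes \<open>g\<close> on the faces avoiding that colour; what remains lives on the links.\<close>

lemma cofilling:
  assumes "finite I"
  shows "(\<And>i. i \<in> I \<Longrightarrow> finite (A i) \<and> A i \<noteq> {}) \<Longrightarrow> local_cochain g \<Longrightarrow> m \<ge> 1 \<Longrightarrow>
    (m < card I \<and> (\<forall>J f. J \<subseteq> I \<longrightarrow> card J = Suc m \<longrightarrow> (\<forall>j\<in>J. f j \<in> A j) \<longrightarrow> coboundary g J f = 0)) \<or>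
    (m = card I \<and> (\<exists>\<alpha>. local_cochain \<alpha> \<and> (\<forall>f. (\<forall>j\<in>I. f j \<in> A j) \<longrightarrow> g I f = coboundary \<alpha> I f))) \<Longrightarrow>
    \<exists>e. local_cochain e \<and> (\<forall>J f. J \<subseteq> I \<longrightarrow> card J = m \<longrightarrow> (\<forall>j\<in>J. f j \<in> A j) \<longrightarrow> g J f = coboundary e J f) \<and>
      total_weight A I e (m - 1) \<le> 3 ^ card I * total_weight A I g m"
  using assms
proof (induction I arbitrary: g m rule: finite_induct)
  case empty then show ?case by auto
next
  case (insert i I)
  note A = insert.prems(1) and lg = insert.prems(2) and m1 = insert.prems(3)
  have fA: "\<And>j. j \<in> insert i I \<Longrightarrow> finite (A j)" using A by blast
  let ?T = "total_weight A (insert i I) g m"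
  \<comment> \<open>A cone point at most as heavy as the average: the weights of the links over
    colour \<open>i\<close> average to no more than \<open>?T\<close>.\<close>
  obtain a where a: "a \<in> A i" "total_weight A I (slice i a g) (m - 1) \<le>
      (\<Sum>a\<in>A i. total_weight A I (slice i a g) (m - 1)) / card (A i)"
    using exists_le_average[of "A i" "\<lambda>a. total_weight A I (slice i a g) (m - 1)"] A by auto
  have Teq: "?T = total_weight A I g m + (\<Sum>a\<in>A i. total_weight A I (slice i a g) (m - 1)) / card (A i)"
    by (rule total_weight_insert) (use insert.hyps m1 fA in auto)
  have avg: "(\<Sum>a\<in>A i. total_weight A I (slice i a g) (m - 1)) / card (A i) \<le> ?T"
    using Teq total_weight_nonneg[of A I g m] by simp
  have aT: "total_weight A I (slice i a g) (m - 1) \<le> ?T" using a avg by simp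
  have gupd: "g J (f(i := v)) = g J f" if "i \<notin> J" for J f v
    by (rule local_cochainD[OF lg]) (use that in auto)
  have sub: "insert i J - {j} = insert i (J - {j})" if "i \<notin> J" "j \<in> J" for J j using that by auto
  have cob_ins: "coboundary h (insert i J) f = h J f + (\<Sum>j\<in>J. h (insert i (J - {j})) f)" if "i \<notin> J" "finite J" for h :: "nat set \<Rightarrow> (nat \<Rightarrow> 'a) \<Rightarrow> bit" and J f
    unfolding coboundary_def using that sub by (simp add: sum.insert)
  define closed where "closed \<longleftrightarrow> m < card (insert i I) \<and> (\<forall>J f. J \<subseteq> insert i I \<longrightarrow> card J = Suc m \<longrightarrow> (\<forall>j\<in>J. f j \<in> A j) \<longrightarrow> coboundary g J f = 0)"
  have cl: "g J (f(i := v)) + (\<Sum>j\<in>J. slice i v g (J - {j}) f) = 0"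
    if "closed" "J \<subseteq> I" "card J = m" "\<forall>j\<in>J. f j \<in> A j" "v \<in> A i" for J f v
  proof -
    have fJ: "finite J" "i \<notin> J" using that insert.hyps finite_subset by auto
    have "coboundary g (insert i J) (f(i := v)) = 0"
    proof -
      have "insert i J \<subseteq> insert i I" "card (insert i J) = Suc m" "\<forall>j\<in>insert i J. (f(i := v)) j \<in> A j"
        using that fJ by auto
      then show ?thesis using that(1) unfolding closed_def by blast
    qed
    then show ?thesis unfolding cob_ins[OF fJ(2,1)] slice_def .
  qed
  define ex where "ex \<longleftrightarrow> m = card (insert i I) \<and> (\<exists>\<alpha>. local_cochain \<alpha> \<and> (\<forall>f. (\<forall>j\<in>insert i I. f j \<in> A j) \<longrightarrow> g (insert i I) f = coboundary \<alpha> (insert i I) f))"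
  have alt: "closed \<or> ex" using insert.prems(4) unfolding closed_def ex_def .
  \<comment> \<open>Over faces avoiding \<open>i\<close> the coboundary of either slice equals
    \<open>g\<close>, so the sum of the two slices is closed on \<open>I\<close>; in top degree it
    is exact for the same reason. Induction fills it.\<close>
  define g' where "g' = (\<lambda>v J f. slice i v g J f + slice i a g J f)"
  have E: "\<exists>E. local_cochain E \<and> (\<forall>J f. J \<subseteq> I \<longrightarrow> card J = m - 1 \<longrightarrow> (\<forall>j\<in>J. f j \<in> A j) \<longrightarrow> g' v J f = coboundary E J f) \<and>
      (m \<ge> 2 \<longrightarrow> total_weight A I E (m - 2) \<le> 3 ^ card I * total_weight A I (g' v) (m - 1))" if v: "v \<in> A i" for v
  proof (cases "m = 1")
    \<comment> \<open>In the lowest degree both slices live on the empty face and have to agree.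
      Closedness gives this through a vertex \<open>y\<close> of a further colour, exactness through
      the value of \<alpha> on the empty face.\<close>
    case True
    have "g' v J f = 0" if J: "J \<subseteq> I" "card J = m - 1" for J f
    proof -
      have Je: "J = {}" using J True insert.hyps finite_subset by fastforce
      from alt have "g {i} (f(i := v)) = g {i} (f(i := a))"
      proof
        assume c: closed
        then obtain k where k: "k \<in> I" using True insert.hyps unfolding closed_def
          by (metis card.empty card_insert_disjoint all_not_in_conv less_irrefl One_nat_def)
        obtain y where y: "y \<in> A k" using A k by blast
        have ki: "k \<noteq> i" using k insert.hyps by blast
        have 1: "g {k} ((f(k := y))(i := w)) + slice i w g {} (f(k := y)) = 0" if "w \<in> A i" for w
          using cl[OF c, of "{k}" "f(k := y)" w] True k y that by (simp add: insert_absorb)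
        have 2: "slice i w g {} (f(k := y)) = g {i} (f(i := w))" for w
          unfolding slice_def by (rule local_cochainD[OF lg]) auto
        have 3: "g {k} ((f(k := y))(i := w)) = g {k} (f(k := y))" for w by (rule gupd) (use ki in auto)
        show ?thesis using 1[OF v] 1[OF a(1)] unfolding 2 3 by (metis add_left_cancel)
      next
        assume e: ex
        then have "I = {}" using True insert.hyps unfolding ex_def by auto
        then obtain \<alpha> where \<alpha>: "local_cochain \<alpha>" "\<And>f. f i \<in> A i \<Longrightarrow> g {i} f = \<alpha> {} f"
          using e unfolding ex_def by (auto simp: coboundary_def)
        have "\<alpha> {} (f(i := v)) = \<alpha> {} (f(i := a))" by (rule local_cochainD[OF \<alpha>(1)]) auto
        then show ?thesis using \<alpha>(2) v a(1) by simp
      qed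
      then show ?thesis by (simp add: g'_def slice_def Je bit_add_self)
    qed
    moreover have "local_cochain (\<lambda>_ _. 0)" by (simp add: local_cochain_def)
    ultimately show ?thesis using True by (intro exI[of _ "\<lambda>_ _. 0"]) (auto simp: coboundary_def)
  next
    case False
    then have m2: "m - 1 \<ge> 1" using m1 by simp
    have lg': "local_cochain (g' v)"
      using local_cochain_slice[OF lg, of i v] local_cochain_slice[OF lg, of i a]
      unfolding local_cochain_def g'_def by metis
    have hyp: "(m - 1 < card I \<and> (\<forall>J f. J \<subseteq> I \<longrightarrow> card J = Suc (m - 1) \<longrightarrow> (\<forall>j\<in>J. f j \<in> A j) \<longrightarrow> coboundary (g' v) J f = 0)) \<or>
       (m - 1 = card I \<and> (\<exists>\<alpha>. local_cochain \<alpha> \<and> (\<forall>f. (\<forall>j\<in>I. f j \<in> A j) \<longrightarrow> g' v I f = coboundary \<alpha> I f)))"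
      using alt
    proof
      assume c: closed
      have "coboundary (g' v) J f = 0" if J: "J \<subseteq> I" "card J = m" "\<forall>j\<in>J. f j \<in> A j" for J f
      proof -
        have iJ: "i \<notin> J" using J insert.hyps by blast
        have "coboundary (g' v) J f = (\<Sum>j\<in>J. slice i v g (J - {j}) f) + (\<Sum>j\<in>J. slice i a g (J - {j}) f)"
          unfolding coboundary_def g'_def by (rule sum.distrib)
        moreover have "g J f + (\<Sum>j\<in>J. slice i v g (J - {j}) f) = 0" "g J f + (\<Sum>j\<in>J. slice i a g (J - {j}) f) = 0"
          using cl[OF c J v] cl[OF c J a(1)] gupd[OF iJ] by simp_all
        ultimately show ?thesis by (metis add_left_cancel bit_add_self)
      qed
      moreover have "m - 1 < card I"
      proof -
        have "m < Suc (card I)" using c insert.hyps by (simp add: closed_def)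
        then show ?thesis using m2 by linarith
      qed
      ultimately show ?thesis using m1 by simp
    next
      assume e: ex
      then obtain \<alpha> where \<alpha>: "local_cochain \<alpha>" "\<And>f. (\<forall>j\<in>insert i I. f j \<in> A j) \<Longrightarrow> g (insert i I) f = coboundary \<alpha> (insert i I) f"
        unfolding ex_def by blast
      have "g' v I f = coboundary (\<lambda>J f. slice i v \<alpha> J f + slice i a \<alpha> J f) I f" if f: "\<forall>j\<in>I. f j \<in> A j" for f
      proof -
        have s: "slice i w g I f = \<alpha> I f + (\<Sum>j\<in>I. slice i w \<alpha> (I - {j}) f)" if w: "w \<in> A i" for w
        proof -
          have "slice i w g I f = coboundary \<alpha> (insert i I) (f(i := w))"
            unfolding slice_def by (rule \<alpha>(2)) (use f w in auto)
          also have "\<dots> = \<alpha> I (f(i := w)) + (\<Sum>j\<in>I. slice i w \<alpha> (I - {j}) f)"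
            unfolding cob_ins[OF insert.hyps(2,1)] slice_def ..
          also have "\<alpha> I (f(i := w)) = \<alpha> I f" by (rule local_cochainD[OF \<alpha>(1)]) (use insert.hyps in auto)
          finally show ?thesis .
        qed
        have "g' v I f = (\<alpha> I f + \<alpha> I f) + ((\<Sum>j\<in>I. slice i v \<alpha> (I - {j}) f) + (\<Sum>j\<in>I. slice i a \<alpha> (I - {j}) f))"
          unfolding g'_def s[OF v] s[OF a(1)] by (simp only: ac_simps)
        then show ?thesis unfolding coboundary_def sum.distrib bit_add_self by (simp only: add_0)
      qed
      moreover have "local_cochain (\<lambda>J f. slice i v \<alpha> J f + slice i a \<alpha> J f)"
        using local_cochain_slice[OF \<alpha>(1), of i v] local_cochain_slice[OF \<alpha>(1), of i a]
        unfolding local_cochain_def by metis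
      moreover have "m - 1 = card I" using e insert.hyps by (simp add: ex_def)
      ultimately show ?thesis by blast
    qed
    have "\<exists>E. local_cochain E \<and> (\<forall>J f. J \<subseteq> I \<longrightarrow> card J = m - 1 \<longrightarrow> (\<forall>j\<in>J. f j \<in> A j) \<longrightarrow> g' v J f = coboundary E J f) \<and>
      total_weight A I E (m - 1 - 1) \<le> 3 ^ card I * total_weight A I (g' v) (m - 1)"
      by (rule insert.IH[OF _ lg' m2 hyp]) (use A in blast)
    moreover have "m - 1 - 1 = m - 2" by simp
    ultimately show ?thesis by metis
  qed
  then have "\<forall>v\<in>A i. \<exists>E. local_cochain E \<and> (\<forall>J f. J \<subseteq> I \<longrightarrow> card J = m - 1 \<longrightarrow> (\<forall>j\<in>J. f j \<in> A j) \<longrightarrow> g' v J f = coboundary E J f) \<and>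
      (m \<ge> 2 \<longrightarrow> total_weight A I E (m - 2) \<le> 3 ^ card I * total_weight A I (g' v) (m - 1))" by blast
  from bchoice[OF this] obtain E where E': "\<forall>v\<in>A i. local_cochain (E v) \<and> (\<forall>J f. J \<subseteq> I \<longrightarrow> card J = m - 1 \<longrightarrow> (\<forall>j\<in>J. f j \<in> A j) \<longrightarrow> g' v J f = coboundary (E v) J f) \<and>
      (m \<ge> 2 \<longrightarrow> total_weight A I (E v) (m - 2) \<le> 3 ^ card I * total_weight A I (g' v) (m - 1))" by (elim exE)
  define E2 where "E2 = (\<lambda>v. if v \<in> A i then E v else (\<lambda>_ _. 0))"
  have E2l: "local_cochain (E2 v)" for v using E' by (auto simp: E2_def local_cochain_def)
  have E2c: "g' v J f = coboundary (E2 v) J f" if "v \<in> A i" "J \<subseteq> I" "card J = m - 1" "\<forall>j\<in>J. f j \<in> A j" for v J f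
    using E' that by (simp add: E2_def)
  have E2w: "total_weight A I (E2 v) (m - 2) \<le> 3 ^ card I * total_weight A I (g' v) (m - 1)" if "v \<in> A i" "m \<ge> 2" for v
    using E' that by (simp add: E2_def)
  \<comment> \<open>Faces through a vertex \<open>v\<close> of colour \<open>i\<close> receive the
    filling of \<open>g' v\<close>, the others the cone from \<open>a\<close>. In a coboundary over
    \<open>insert i K\<close> the cone contributes the slice at \<open>a\<close>, which turns
    \<open>g' v\<close> back into the slice at \<open>v\<close>.\<close>
  define e where "e = (\<lambda>J f. if i \<in> J then E2 (f i) (J - {i}) f else slice i a g J f)"
  have le: "local_cochain e"
    unfolding local_cochain_def
  proof (intro allI impI)
    fix J and f f' :: "nat \<Rightarrow> 'a" assume ff: "\<forall>j\<in>J. f j = f' j"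
    show "e J f = e J f'"
    proof (cases "i \<in> J")
      case True
      then have "f i = f' i" using ff by blast
      moreover have "E2 v (J - {i}) f = E2 v (J - {i}) f'" for v by (rule local_cochainD[OF E2l]) (use ff in auto)
      ultimately show ?thesis using True by (simp add: e_def)
    next
      case False
      then show ?thesis using local_cochainD[OF local_cochain_slice[OF lg], of J f f'] ff by (simp add: e_def)
    qed
  qed
  have eq: "g J f = coboundary e J f" if J: "J \<subseteq> insert i I" "card J = m" "\<forall>j\<in>J. f j \<in> A j" for J f
  proof (cases "i \<in> J")
    case False
    then have JI: "J \<subseteq> I" using J by blast
    have "closed" using alt JI J insert.hyps card_mono[OF insert.hyps(1) JI] by (auto simp: ex_def)
    have "g J f + (\<Sum>j\<in>J. slice i a g (J - {j}) f) = 0"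
      using cl[OF \<open>closed\<close> JI J(2,3) a(1)] gupd[OF False] by simp
    moreover have "coboundary e J f = (\<Sum>j\<in>J. slice i a g (J - {j}) f)"
      unfolding coboundary_def e_def using False by simp
    ultimately show ?thesis by (metis bit_eq_iff_add)
  next
    case True
    define K where "K = J - {i}"
    have K: "J = insert i K" "i \<notin> K" "K \<subseteq> I" "finite K" using True J insert.hyps finite_subset[of J "insert i I"] by (auto simp: K_def)
    have cK: "card K = m - 1" using K J(2) by simp
    have fi: "f i \<in> A i" using J True by blast
    have "coboundary e J f = e K f + (\<Sum>j\<in>K. e (insert i (K - {j})) f)" unfolding K(1) by (rule cob_ins) (use K in auto)
    also have "e K f = slice i a g K f" using K by (simp add: e_def)
    also have "(\<Sum>j\<in>K. e (insert i (K - {j})) f) = coboundary (E2 (f i)) K f"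
      unfolding coboundary_def using K(2) by (intro sum.cong refl) (auto simp: e_def)
    also have "\<dots> = g' (f i) K f" using E2c[OF fi K(3) cK] J(3) K(1) by auto
    also have "slice i a g K f + g' (f i) K f = slice i (f i) g K f"
      by (cases "slice i (f i) g K f"; cases "slice i a g K f") (auto simp: g'_def)
    also have "\<dots> = g J f" by (simp add: slice_def K(1))
    finally show ?thesis by simp
  qed
  have wI: "total_weight A I e (m - 1) = total_weight A I (slice i a g) (m - 1)"
    unfolding total_weight_def using insert.hyps by (intro sum.cong refl weight_cong) (auto simp: e_def)
  \<comment> \<open>The cone costs at most \<open>?T\<close> and the links at most
    \<open>3 ^ card I\<close> times \<open>2 * ?T\<close>; together this is within
    \<open>3 ^ (card I + 1)\<close> times \<open>?T\<close>, so the constant reproduces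
    itself.\<close>
  have "total_weight A (insert i I) e (m - 1) \<le> 3 ^ card (insert i I) * ?T"
  proof (cases "m = 1")
    case True
    have Z: "{J. J \<subseteq> S \<and> card J = 0} = {{}}" if "finite S" for S :: "nat set" using that finite_subset by fastforce
    have "total_weight A (insert i I) e (m - 1) = total_weight A I e (m - 1)"
      unfolding total_weight_def using True Z[of I] Z[of "insert i I"] insert.hyps by simp
    also have "\<dots> \<le> 1 * ?T" using wI aT by simp
    also have "\<dots> \<le> 3 ^ card (insert i I) * ?T" by (rule mult_right_mono) (auto simp: total_weight_nonneg)
    finally show ?thesis .
  next
    case False
    then have m2: "m \<ge> 2" "m - 1 \<ge> 1" "m - 1 - 1 = m - 2" using m1 by auto
    have sl: "total_weight A I (slice i v e) (m - 2) = total_weight A I (E2 v) (m - 2)" for v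
      unfolding total_weight_def
    proof (intro sum.cong refl weight_cong)
      fix J f assume "J \<in> {J. J \<subseteq> I \<and> card J = m - 2}" "f \<in> PiE J A"
      then have iJ: "i \<notin> J" using insert.hyps by auto
      have "E2 v J (f(i := v)) = E2 v J f" by (rule local_cochainD[OF E2l]) (use iJ in auto)
      then show "slice i v e J f = E2 v J f" using iJ by (simp add: slice_def e_def)
    qed
    have Ew: "total_weight A I (E2 v) (m - 2) \<le> 3 ^ card I * (total_weight A I (slice i v g) (m - 1) + ?T)" if "v \<in> A i" for v
    proof -
      have "total_weight A I (g' v) (m - 1) \<le> total_weight A I (slice i v g) (m - 1) + total_weight A I (slice i a g) (m - 1)"
        unfolding g'_def by (rule total_weight_add) (use insert.hyps fA in auto)
      also have "\<dots> \<le> total_weight A I (slice i v g) (m - 1) + ?T" using aT by simp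
      finally have "3 ^ card I * total_weight A I (g' v) (m - 1) \<le> 3 ^ card I * (total_weight A I (slice i v g) (m - 1) + ?T)"
        by (rule mult_left_mono) simp
      then show ?thesis using E2w[OF that m2(1)] by linarith
    qed
    have cA: "card (A i) > 0" using A by (simp add: card_gt_0_iff)
    have "total_weight A (insert i I) e (m - 1) = total_weight A I e (m - 1) + (\<Sum>v\<in>A i. total_weight A I (E2 v) (m - 2)) / card (A i)"
      using total_weight_insert[of I i "m - 1" A e] insert.hyps m2 fA sl by simp
    also have "\<dots> \<le> ?T + (\<Sum>v\<in>A i. 3 ^ card I * (total_weight A I (slice i v g) (m - 1) + ?T)) / card (A i)"
      using wI aT Ew by (intro add_mono divide_right_mono sum_mono) auto
    also have "(\<Sum>v\<in>A i. 3 ^ card I * (total_weight A I (slice i v g) (m - 1) + ?T)) / card (A i) =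
        3 ^ card I * ((\<Sum>v\<in>A i. total_weight A I (slice i v g) (m - 1)) / card (A i) + ?T)"
      using cA by (simp add: sum_distrib_left[symmetric] sum.distrib field_simps)
    also have "?T + \<dots> \<le> ?T + 3 ^ card I * (?T + ?T)" using avg by (intro add_left_mono mult_left_mono add_right_mono) auto
    also have "\<dots> \<le> 3 ^ card (insert i I) * ?T"
    proof -
      have "1 * ?T \<le> 3 ^ card I * ?T" by (rule mult_right_mono) (auto simp: total_weight_nonneg)
      then show ?thesis using insert.hyps by (simp add: algebra_simps)
    qed
    finally show ?thesis .
  qed
  then show ?case using le eq by blast
qed

section \<open>Grids in general position\<close>

text \<open>The feasible parameters form the interval from the largest lower bound to the smallest
  upper bound. As the roots are distinct, each end belongs to exactly one constraint and the two
  ends differ, so two roots are feasible, or none if the interval is empty.\<close>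

lemma even_feasible_roots:
  fixes \<alpha> \<beta> :: "'m \<Rightarrow> real"
  assumes M: "finite M" "\<And>m. m \<in> M \<Longrightarrow> \<beta> m \<noteq> 0"
    and inj: "inj_on (\<lambda>m. - \<alpha> m / \<beta> m) M"
    and pos: "\<exists>m\<in>M. \<beta> m > 0" and neg: "\<exists>m\<in>M. \<beta> m < 0"
  shows "even (card {m \<in> M. \<forall>m'\<in>M. \<alpha> m' + (- \<alpha> m / \<beta> m) * \<beta> m' \<ge> 0})"
proof -
  define r where "r = (\<lambda>m. - \<alpha> m / \<beta> m)"
  define Lo where "Lo = {m \<in> M. \<beta> m > 0}"
  define Up where "Up = {m \<in> M. \<beta> m < 0}"
  have fin: "finite (r ` Lo)" "finite (r ` Up)" "r ` Lo \<noteq> {}" "r ` Up \<noteq> {}" using M pos neg by (auto simp: Lo_def Up_def)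
  obtain l where l: "l \<in> Lo" "r l = Max (r ` Lo)" using Max_in[OF fin(1,3)] by force
  obtain u where u: "u \<in> Up" "r u = Min (r ` Up)" using Min_in[OF fin(2,4)] by force
  have g: "\<alpha> m + t * \<beta> m \<ge> 0 \<longleftrightarrow> (if \<beta> m > 0 then r m \<le> t else t \<le> r m)" if "m \<in> M" for m t
    using M(2)[OF that] by (auto simp: r_def field_simps)
  have feas: "(\<forall>m'\<in>M. \<alpha> m' + t * \<beta> m' \<ge> 0) \<longleftrightarrow> r l \<le> t \<and> t \<le> r u" for t
  proof
    assume "\<forall>m'\<in>M. \<alpha> m' + t * \<beta> m' \<ge> 0"
    then show "r l \<le> t \<and> t \<le> r u" using l(1) u(1) g[of l t] g[of u t] by (auto simp: Lo_def Up_def)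
  next
    assume a: "r l \<le> t \<and> t \<le> r u"
    show "\<forall>m'\<in>M. \<alpha> m' + t * \<beta> m' \<ge> 0"
    proof
      fix m assume m: "m \<in> M"
      show "\<alpha> m + t * \<beta> m \<ge> 0"
      proof (cases "\<beta> m > 0")
        case True
        then have "r m \<le> r l" using m l fin by (auto simp: Lo_def)
        then show ?thesis using g[OF m] True a by auto
      next
        case False
        then have "m \<in> Up" using m M(2)[OF m] by (auto simp: Up_def)
        then have "r u \<le> r m" using u fin by auto
        then show ?thesis using g[OF m] False a by auto
      qed
    qed
  qed
  have inj': "r m = r m' \<longleftrightarrow> m = m'" if "m \<in> M" "m' \<in> M" for m m'
    using inj that unfolding r_def inj_on_def by blast
  have lu: "l \<in> M" "u \<in> M" "l \<noteq> u" using l u by (auto simp: Lo_def Up_def)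
  have set: "{m \<in> M. \<forall>m'\<in>M. \<alpha> m' + (- \<alpha> m / \<beta> m) * \<beta> m' \<ge> 0} = {m \<in> M. r l \<le> r m \<and> r m \<le> r u}"
    using feas[of "r _"] unfolding r_def by blast
  show ?thesis
  proof (cases "r l < r u")
    case True
    have "{m \<in> M. r l \<le> r m \<and> r m \<le> r u} = {l, u}"
    proof (intro set_eqI iffI)
      fix m assume m: "m \<in> {m \<in> M. r l \<le> r m \<and> r m \<le> r u}"
      then have mM: "m \<in> M" by simp
      have "r m \<le> r l \<or> r m \<ge> r u"
      proof (cases "\<beta> m > 0")
        case True then show ?thesis using mM l fin by (auto simp: Lo_def)
      next
        case False
        then have "m \<in> Up" using mM M(2)[OF mM] by (auto simp: Up_def)
        then show ?thesis using u fin by auto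
      qed
      then have "r m = r l \<or> r m = r u" using m by auto
      then show "m \<in> {l, u}" using inj' mM lu by auto
    qed (use True lu in auto)
    then show ?thesis using set lu by simp
  next
    case False
    have "r l \<noteq> r u" using inj' lu by blast
    then have e: "{m \<in> M. r l \<le> r m \<and> r m \<le> r u} = {}" using False by auto
    show ?thesis unfolding set e by simp
  qed
qed

section \<open>Genericity under coordinate projections, and grid cells\<close>

definition proj :: "'a::euclidean_space set \<Rightarrow> 'a \<Rightarrow> 'a" where
  "proj S x = (\<Sum>b\<in>S. (x \<bullet> b) *\<^sub>R b)"

text \<open>A cell fixes the coordinates outside \<open>F\<close>, so meeting it is a linear system
  in those coordinates. Points are therefore asked to stay affinely independent in every coordinate
  subspace that has room for them.\<close>

definition generic :: "'a::euclidean_space set \<Rightarrow> bool" where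
  "generic X \<longleftrightarrow> finite X \<and> (\<forall>S \<sigma>. S \<subseteq> Basis \<longrightarrow> \<sigma> \<subseteq> X \<longrightarrow> card \<sigma> \<le> card S + 1 \<longrightarrow>
     inj_on (proj S) \<sigma> \<and> \<not> affine_dependent (proj S ` \<sigma>))"

text \<open>In the coordinates \<open>S\<close>, \<open>card S\<close> points span less than the
  full dimension, so a grid point in their hull would be a coincidence. Excluding it keeps two
  constraints from becoming tight simultaneously.\<close>

definition grid_generic :: "'a::euclidean_space set \<Rightarrow> ('a \<Rightarrow> real set) \<Rightarrow> bool" where
  "grid_generic X V \<longleftrightarrow> (\<forall>S \<sigma> y. S \<subseteq> Basis \<longrightarrow> \<sigma> \<subseteq> X \<longrightarrow> card \<sigma> = card S \<longrightarrow> (\<forall>b\<in>S. y \<bullet> b \<in> V b) \<longrightarrow>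
     proj S y \<notin> affine hull (proj S ` \<sigma>))"

text \<open>\<open>F\<close> is the set of directions of the cell; in the remaining directions \<open>r\<close> is ignored.\<close>

definition cell :: "'a::euclidean_space set \<Rightarrow> ('a \<Rightarrow> real) \<Rightarrow> ('a \<Rightarrow> real) \<Rightarrow> 'a set" where
  "cell F q r = {y. (\<forall>b\<in>Basis - F. y \<bullet> b = q b) \<and> (\<forall>b\<in>F. q b \<le> y \<bullet> b \<and> y \<bullet> b \<le> r b)}"

definition hit :: "'a::euclidean_space set \<Rightarrow> 'a set \<Rightarrow> ('a \<Rightarrow> real) \<Rightarrow> ('a \<Rightarrow> real) \<Rightarrow> bit" where
  "hit \<sigma> F q r = of_bool (convex hull \<sigma> \<inter> cell F q r \<noteq> {})"

lemma proj_lin: "linear (proj S)"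
  by (rule linearI) (simp_all add: proj_def inner_left_distrib scaleR_add_left sum.distrib scaleR_sum_right)

lemma proj_sum: "proj S (\<Sum>v\<in>A. c v *\<^sub>R v) = (\<Sum>v\<in>A. c v *\<^sub>R proj S v)"
  by (simp add: linear_sum[OF proj_lin] linear_scale[OF proj_lin])

lemma proj_inner: "S \<subseteq> Basis \<Longrightarrow> b \<in> Basis \<Longrightarrow> proj S x \<bullet> b = (if b \<in> S then x \<bullet> b else 0)"
proof -
  assume S: "S \<subseteq> Basis" "b \<in> Basis"
  then have fS: "finite S" using finite_subset finite_Basis by blast
  have "proj S x \<bullet> b = (\<Sum>c\<in>S. if c = b then x \<bullet> c else 0)"
    unfolding proj_def inner_sum_left using S by (intro sum.cong) (auto simp: inner_Basis)
  then show ?thesis using fS by simp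
qed

lemma proj_in_span: "proj S x \<in> span S"
  unfolding proj_def by (intro span_sum span_scale span_base)

lemma proj_eq_iff: "S \<subseteq> Basis \<Longrightarrow> proj S x = proj S y \<longleftrightarrow> (\<forall>b\<in>S. x \<bullet> b = y \<bullet> b)"
  by (subst euclidean_eq_iff) (auto simp: proj_inner)

lemma generic_independent:
  assumes "generic X" "S \<subseteq> Basis" "\<sigma> \<subseteq> X" "card \<sigma> \<le> card S + 1"
    and "sum w \<sigma> = 0" "(\<Sum>v\<in>\<sigma>. w v *\<^sub>R proj S v) = 0" "v \<in> \<sigma>"
  shows "w v = (0::real)"
proof (rule ccontr)
  assume nz: "w v \<noteq> 0"
  have fin: "finite \<sigma>" using assms(1,3) finite_subset by (auto simp: generic_def)
  have inj: "inj_on (proj S) \<sigma>" and nd: "\<not> affine_dependent (proj S ` \<sigma>)"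
    using assms(1-4) by (auto simp: generic_def)
  define u where "u = (\<lambda>p. w (the_inv_into \<sigma> (proj S) p))"
  have u: "u (proj S v) = w v" if "v \<in> \<sigma>" for v
    using the_inv_into_f_f[OF inj that] by (simp add: u_def)
  have "affine_dependent (proj S ` \<sigma>)"
  proof (subst affine_dependent_explicit_finite)
    show "finite (proj S ` \<sigma>)" using fin by simp
    have "sum u (proj S ` \<sigma>) = 0" using assms(5) by (simp add: sum.reindex[OF inj] u)
    moreover have "(\<Sum>p\<in>proj S ` \<sigma>. u p *\<^sub>R p) = 0"
      using assms(6) by (simp add: sum.reindex[OF inj] u)
    moreover have "\<exists>p\<in>proj S ` \<sigma>. u p \<noteq> 0" using nz u assms(7) by auto
    ultimately show "\<exists>U. sum U (proj S ` \<sigma>) = 0 \<and> (\<exists>v\<in>proj S ` \<sigma>. U v \<noteq> 0) \<and> (\<Sum>v\<in>proj S ` \<sigma>. U v *\<^sub>R v) = 0" by blast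
  qed
  then show False using nd by blast
qed

lemma generic_spanning:
  assumes "generic X" "S \<subseteq> Basis" "\<sigma> \<subseteq> X" "card \<sigma> = card S + 1"
  shows "\<exists>u. sum u \<sigma> = 1 \<and> (\<Sum>v\<in>\<sigma>. u v *\<^sub>R proj S v) = proj S y"
proof -
  have fin: "finite \<sigma>" using assms(1,3) finite_subset by (auto simp: generic_def)
  have inj: "inj_on (proj S) \<sigma>" and nd: "\<not> affine_dependent (proj S ` \<sigma>)"
    using assms by (auto simp: generic_def)
  have cP: "card (proj S ` \<sigma>) = card S + 1" using assms(4) inj by (simp add: card_image)
  have sub: "affine hull (proj S ` \<sigma>) \<subseteq> span S"
  proof (rule hull_minimal)
    show "proj S ` \<sigma> \<subseteq> span S" using proj_in_span by blast
  qed (simp add: subspace_imp_affine)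
  have "independent S" using independent_Basis independent_mono assms(2) by blast
  then have "aff_dim (span S) = card S" by (simp add: aff_dim_subspace dim_eq_card_independent)
  moreover have "aff_dim (affine hull (proj S ` \<sigma>)) = card S"
    using aff_dim_affine_independent[OF nd] cP by simp
  ultimately have "affine hull (proj S ` \<sigma>) = span S"
    using sub cP by (intro affine_dim_equal) (auto simp: subspace_imp_affine)
  moreover have "proj S y \<in> span S" by (rule proj_in_span)
  ultimately have "proj S y \<in> affine hull (proj S ` \<sigma>)" by simp
  then obtain u where u: "sum u (proj S ` \<sigma>) = 1" "(\<Sum>p\<in>proj S ` \<sigma>. u p *\<^sub>R p) = proj S y"
    using affine_hull_finite[of "proj S ` \<sigma>"] fin by auto
  then show ?thesis by (intro exI[of _ "u \<circ> proj S"]) (simp add: sum.reindex[OF inj])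
qed

lemma proj_affine_combination_in_hull:
  assumes "finite \<sigma>" "sum u \<sigma> = 1"
  shows "proj S (\<Sum>v\<in>\<sigma>. u v *\<^sub>R v) \<in> affine hull (proj S ` \<sigma>)"
proof -
  have "(\<Sum>v\<in>\<sigma>. u v *\<^sub>R v) \<in> affine hull \<sigma>" using affine_hull_finite[OF assms(1)] assms(2) by auto
  then show ?thesis using affine_hull_linear_image[of "proj S" \<sigma>] proj_lin by (auto simp: linear_conv_bounded_linear)
qed

lemma sum_UNIV_bool: "(\<Sum>h\<in>(UNIV :: bool set). f h) = (f False + f True :: 'b::comm_monoid_add)"
  by (simp add: UNIV_bool)

lemma bit_sum_of_bool: "finite M \<Longrightarrow> even (card {m \<in> M. P m}) \<Longrightarrow> (\<Sum>m\<in>M. of_bool (P m)) = (0::bit)"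
proof -
  assume M: "finite M" and ev: "even (card {m \<in> M. P m})"
  have "(\<Sum>m\<in>M. of_bool (P m)) = (of_nat (card {m \<in> M. P m}) :: bit)"
    using M by (simp add: of_bool_def sum.If_cases Int_def)
  also have "\<dots> = 0" using ev by (auto elim!: evenE)
  finally show ?thesis .
qed

text \<open>The solutions of the equations defining the directions fixed by the cell form a line; along it the
  simplex and the cell cut out a segment, both endpoints of which are counted.\<close>

lemma hit_parity:
  fixes X :: "'a::euclidean_space set"
  assumes X: "generic X" and V: "grid_generic X V"
    and F: "F \<subseteq> Basis" and qr: "\<And>b. b \<in> Basis \<Longrightarrow> q b \<in> V b" "\<And>b. b \<in> F \<Longrightarrow> r b \<in> V b \<and> q b < r b"
    and \<tau>: "\<tau> \<subseteq> X" "card \<tau> = card (Basis - F) + 2"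
  shows "(\<Sum>v\<in>\<tau>. hit (\<tau> - {v}) F q r) + (\<Sum>b\<in>F. hit \<tau> (F - {b}) q r + hit \<tau> (F - {b}) (q(b := r b)) r) = 0"
proof -
  define S where "S = Basis - F"
  have SB: "S \<subseteq> Basis" by (auto simp: S_def)
  have fB: "finite F" "finite S" using F finite_Basis finite_subset S_def by blast+
  have f\<tau>: "finite \<tau>" using X \<tau>(1) finite_subset by (auto simp: generic_def)
  have c\<tau>: "card \<tau> = card S + 2" using \<tau> S_def by simp
  then have "\<tau> \<noteq> {}" by auto
  then obtain v0 where v0: "v0 \<in> \<tau>" by blast
  have cm: "card (\<tau> - {v}) = card S + 1" "\<tau> - {v} \<subseteq> X" if "v \<in> \<tau>" for v using that c\<tau> f\<tau> \<tau> by auto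
  define Q where "Q = (\<Sum>b\<in>Basis. q b *\<^sub>R b)"
  have Qb: "Q \<bullet> b = q b" if "b \<in> Basis" for b
    using that by (simp add: Q_def inner_sum_left inner_Basis if_distrib cong: if_cong)
  obtain u1 where u1: "sum u1 (\<tau> - {v0}) = 1" "(\<Sum>v\<in>\<tau> - {v0}. u1 v *\<^sub>R proj S v) = proj S v0"
    using generic_spanning[OF X SB cm(2,1)[OF v0]] by blast
  obtain u2 where u2: "sum u2 (\<tau> - {v0}) = 1" "(\<Sum>v\<in>\<tau> - {v0}. u2 v *\<^sub>R proj S v) = proj S Q"
    using generic_spanning[OF X SB cm(2,1)[OF v0]] by blast
  \<comment> \<open>\<open>lz\<close> is one affine combination with the prescribed coordinates in
    \<open>S\<close>, and \<mu> is an affine dependence of the projected points, normalised at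
    \<open>v0\<close>; the solutions are \<open>lz + t * \<mu>\<close>.\<close>
  define \<mu> where "\<mu> = u1(v0 := - 1)"
  define lz where "lz = u2(v0 := 0)"
  have spl: "sum f \<tau> = f v0 + sum f (\<tau> - {v0})" for f :: "'a \<Rightarrow> 'b::comm_monoid_add" by (rule sum.remove[OF f\<tau> v0])
  have \<mu>1: "sum \<mu> \<tau> = 0" 
  proof -
    have "sum \<mu> (\<tau> - {v0}) = sum u1 (\<tau> - {v0})" by (rule sum.cong) (auto simp: \<mu>_def)
    moreover have "sum \<mu> \<tau> = \<mu> v0 + sum \<mu> (\<tau> - {v0})" by (rule spl)
    moreover have "\<mu> v0 = - 1" by (simp add: \<mu>_def)
    ultimately show ?thesis using u1(1) by simp
  qed
  have \<mu>2: "(\<Sum>v\<in>\<tau>. \<mu> v *\<^sub>R proj S v) = 0"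
  proof -
    have "(\<Sum>v\<in>\<tau> - {v0}. \<mu> v *\<^sub>R proj S v) = (\<Sum>v\<in>\<tau> - {v0}. u1 v *\<^sub>R proj S v)" by (rule sum.cong) (auto simp: \<mu>_def)
    moreover have "(\<Sum>v\<in>\<tau>. \<mu> v *\<^sub>R proj S v) = \<mu> v0 *\<^sub>R proj S v0 + (\<Sum>v\<in>\<tau> - {v0}. \<mu> v *\<^sub>R proj S v)" by (rule spl)
    moreover have "\<mu> v0 = - 1" by (simp add: \<mu>_def)
    ultimately show ?thesis using u1(2) by simp
  qed
  have lz1: "sum lz \<tau> = 1" 
  proof -
    have "sum lz (\<tau> - {v0}) = sum u2 (\<tau> - {v0})" by (rule sum.cong) (auto simp: lz_def)
    moreover have "sum lz \<tau> = lz v0 + sum lz (\<tau> - {v0})" by (rule spl)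
    moreover have "lz v0 = 0" by (simp add: lz_def)
    ultimately show ?thesis using u2(1) by simp
  qed
  have lz2: "(\<Sum>v\<in>\<tau>. lz v *\<^sub>R proj S v) = proj S Q"
  proof -
    have "(\<Sum>v\<in>\<tau> - {v0}. lz v *\<^sub>R proj S v) = (\<Sum>v\<in>\<tau> - {v0}. u2 v *\<^sub>R proj S v)" by (rule sum.cong) (auto simp: lz_def)
    moreover have "(\<Sum>v\<in>\<tau>. lz v *\<^sub>R proj S v) = lz v0 *\<^sub>R proj S v0 + (\<Sum>v\<in>\<tau> - {v0}. lz v *\<^sub>R proj S v)" by (rule spl)
    moreover have "lz v0 = 0" by (simp add: lz_def)
    ultimately show ?thesis using u2(2) by simp
  qed
  \<comment> \<open>A zero coefficient would leave an affine dependence among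
    \<open>card S + 1\<close> projected points.\<close>
  have \<mu>nz: "\<mu> v \<noteq> 0" if v: "v \<in> \<tau>" for v
  proof
    assume z: "\<mu> v = 0"
    then have "v \<noteq> v0" by (auto simp: \<mu>_def)
    then have "\<mu> v0 = 0"
      using generic_independent[OF X SB cm(2)[OF v], of \<mu> v0] cm(1)[OF v] v0 \<mu>1 \<mu>2 z f\<tau> v
      by (simp add: sum_diff1)
    then show False by (simp add: \<mu>_def)
  qed
  define Y0 where "Y0 = (\<Sum>v\<in>\<tau>. lz v *\<^sub>R v)"
  define N where "N = (\<Sum>v\<in>\<tau>. \<mu> v *\<^sub>R v)"
  define lam where "lam = (\<lambda>t v. lz v + t * \<mu> v)"
  define Y where "Y = (\<lambda>t. Y0 + t *\<^sub>R N)"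
  have Yeq: "Y t = (\<Sum>v\<in>\<tau>. lam t v *\<^sub>R v)" for t
    by (simp add: Y_def Y0_def N_def lam_def scaleR_add_left sum.distrib scaleR_sum_right)
  have lam1: "sum (lam t) \<tau> = 1" for t
    using lz1 \<mu>1 by (simp add: lam_def sum.distrib sum_distrib_left[symmetric])
  have YS: "Y t \<bullet> b = q b" if "b \<in> S" for t b
  proof -
    have "proj S (Y t) = (\<Sum>v\<in>\<tau>. lz v *\<^sub>R proj S v) + t *\<^sub>R (\<Sum>v\<in>\<tau>. \<mu> v *\<^sub>R proj S v)"
      unfolding Yeq proj_sum by (simp add: lam_def scaleR_add_left sum.distrib scaleR_sum_right)
    then have "proj S (Y t) = proj S Q" using \<mu>2 lz2 by simp
    then show ?thesis using proj_eq_iff[OF SB] Qb that SB by auto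
  qed
  have Nb: "N \<bullet> b \<noteq> 0" if b: "b \<in> F" for b
  proof
    assume z: "N \<bullet> b = 0"
    have SB': "insert b S \<subseteq> Basis" using b F SB by auto
    have bS: "b \<notin> S" using b by (simp add: S_def)
    have "proj (insert b S) N = (N \<bullet> b) *\<^sub>R b + proj S N" using fB bS by (simp add: proj_def)
    also have "proj S N = 0" using \<mu>2 by (simp add: N_def proj_sum)
    finally have "(\<Sum>v\<in>\<tau>. \<mu> v *\<^sub>R proj (insert b S) v) = 0" using z by (simp add: N_def proj_sum)
    then have "\<mu> v0 = 0"
      using generic_independent[OF X SB' \<tau>(1) _ \<mu>1 _ v0] c\<tau> bS fB by simp
    then show False by (simp add: \<mu>_def)
  qed
  have sol: "\<exists>t. (\<forall>v\<in>\<tau>. u v = lam t v) \<and> (\<Sum>v\<in>\<tau>. u v *\<^sub>R v) = Y t"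
    if u: "sum u \<tau> = 1" "\<And>b. b \<in> S \<Longrightarrow> (\<Sum>v\<in>\<tau>. u v *\<^sub>R v) \<bullet> b = q b" for u
  proof -
    define t where "t = - u v0"
    have pS: "(\<Sum>v\<in>\<tau>. u v *\<^sub>R proj S v) = proj S Q"
      using u(2) Qb SB proj_eq_iff[OF SB, of "\<Sum>v\<in>\<tau>. u v *\<^sub>R v" Q] by (auto simp: proj_sum)
    have w0: "u v0 - lam t v0 = 0" by (simp add: lam_def t_def \<mu>_def lz_def)
    have s1: "(\<Sum>v\<in>\<tau>. u v - lam t v) = 0" using u(1) lam1 by (simp add: sum_subtractf)
    have "(\<Sum>v\<in>\<tau>. lam t v *\<^sub>R proj S v) = proj S Q"
      using lz2 \<mu>2 by (simp add: lam_def scaleR_add_left sum.distrib scaleR_sum_right[symmetric] flip: scaleR_scaleR)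
    then have s2: "(\<Sum>v\<in>\<tau>. (u v - lam t v) *\<^sub>R proj S v) = 0" using pS by (simp add: scaleR_diff_left sum_subtractf)
    have "u v - lam t v = 0" if "v \<in> \<tau>" for v
    proof (cases "v = v0")
      case False
      then show ?thesis
        using generic_independent[OF X SB cm(2)[OF v0], of "\<lambda>v. u v - lam t v" v] cm(1)[OF v0] s1 s2 w0 that
        by (simp add: spl)
    qed (use w0 in simp)
    then have "\<forall>v\<in>\<tau>. u v = lam t v" by auto
    then show ?thesis using Yeq by (intro exI[of _ t]) auto
  qed
  \<comment> \<open>\<open>Inl v\<close> is the constraint that the coefficient of \<open>v\<close>
    is nonnegative; \<open>Inr (b, False)\<close> and \<open>Inr (b, True)\<close> are the lower and
    the upper wall of the cell in direction \<open>b\<close>.\<close>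
  define M where "M = Inl ` \<tau> \<union> Inr ` (F \<times> (UNIV :: bool set))"
  define \<alpha> where "\<alpha> = case_sum lz (\<lambda>(b, h). if h then r b - Y0 \<bullet> b else Y0 \<bullet> b - q b)"
  define \<beta> where "\<beta> = case_sum \<mu> (\<lambda>(b, h). if h then - (N \<bullet> b) else N \<bullet> b)"
  define root where "root = (\<lambda>m. - \<alpha> m / \<beta> m)"
  have \<beta>nz: "\<beta> m \<noteq> 0" if "m \<in> M" for m
    using that \<mu>nz Nb by (auto simp: M_def \<beta>_def split: if_splits)
  have root_iff: "t = root m \<longleftrightarrow> \<alpha> m + t * \<beta> m = 0" if "m \<in> M" for m t
    using \<beta>nz[OF that] by (auto simp: root_def field_simps)
  have aI: "\<alpha> (Inl v) + t * \<beta> (Inl v) = lam t v" for v t by (simp add: \<alpha>_def \<beta>_def lam_def)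
  have aF: "\<alpha> (Inr (b, False)) + t * \<beta> (Inr (b, False)) = Y t \<bullet> b - q b" for b t
    by (simp add: \<alpha>_def \<beta>_def Y_def inner_add_left)
  have aT: "\<alpha> (Inr (b, True)) + t * \<beta> (Inr (b, True)) = r b - Y t \<bullet> b" for b t
    by (simp add: \<alpha>_def \<beta>_def Y_def inner_add_left)
  have feas: "(\<forall>m\<in>M. \<alpha> m + t * \<beta> m \<ge> 0) \<longleftrightarrow> (\<forall>v\<in>\<tau>. lam t v \<ge> 0) \<and> (\<forall>b\<in>F. q b \<le> Y t \<bullet> b \<and> Y t \<bullet> b \<le> r b)" for t
    unfolding M_def by (auto simp: aI aF aT ball_Un) (metis aF aT UNIV_bool UNIV_I diff_ge_0_iff_ge)+
  have ghull: False
    if "S' \<subseteq> Basis" "\<sigma> \<subseteq> \<tau>" "card \<sigma> = card S'" "\<And>b. b \<in> S' \<Longrightarrow> Y t \<bullet> b \<in> V b" "\<And>v. v \<in> \<tau> - \<sigma> \<Longrightarrow> lam t v = 0" for S' \<sigma> t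
  proof -
    have f\<sigma>: "finite \<sigma>" using that f\<tau> finite_subset by blast
    have "sum (lam t) \<sigma> = 1" using lam1[of t] sum.mono_neutral_right[OF f\<tau> that(2), of "lam t"] that(5) by auto
    moreover have "Y t = (\<Sum>v\<in>\<sigma>. lam t v *\<^sub>R v)" unfolding Yeq
      by (rule sum.mono_neutral_right[OF f\<tau> that(2)]) (use that(5) in auto)
    ultimately have "proj S' (Y t) \<in> affine hull (proj S' ` \<sigma>)" using proj_affine_combination_in_hull[OF f\<sigma>] by simp
    then show False using V that \<tau>(1) unfolding grid_generic_def by blast
  qed
  have SV: "Y t \<bullet> b \<in> V b" if "b \<in> S" for t b using YS[OF that] qr(1) SB that by auto
  have Yroot: "Y t \<bullet> b \<in> V b" if "Inr (b, h) \<in> M" "\<alpha> (Inr (b, h)) + t * \<beta> (Inr (b, h)) = 0" for b h t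
  proof -
    have b: "b \<in> F" using that by (auto simp: M_def)
    have "Y t \<bullet> b = (if h then r b else q b)" using that(2) aF aT by (cases h) auto
    then show ?thesis using qr b F by auto
  qed
  \<comment> \<open>Two constraints tight at the same \<open>t\<close> would put a point with grid
    coordinates into the hull of too few vertices: a vanishing coefficient removes a vertex, a tight
    wall adds a direction to \<open>S\<close>. Opposite walls are kept apart by
    \<open>q b < r b\<close>.\<close>
  have inj: "inj_on root M"
  proof (rule inj_onI, rule ccontr)
    fix m m' assume m: "m \<in> M" "m' \<in> M" "root m = root m'" and ne: "m \<noteq> m'"
    define t where "t = root m"
    have r1: "\<alpha> m + t * \<beta> m = 0" "\<alpha> m' + t * \<beta> m' = 0" using m(3) root_iff[OF m(1)] root_iff[OF m(2)] t_def by metis+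
    have case_LL: False if "v \<in> \<tau>" "v' \<in> \<tau>" "v \<noteq> v'" "lam t v = 0" "lam t v' = 0" for v v'
      by (rule ghull[of S "\<tau> - {v, v'}" t]) (use that SB SV c\<tau> f\<tau> in \<open>auto simp: card_Diff_subset\<close>)
    have case_LR: False if "v \<in> \<tau>" "lam t v = 0" "b \<in> F" "Y t \<bullet> b \<in> V b" for v b
      by (rule ghull[of "insert b S" "\<tau> - {v}" t]) (use that SB SV F c\<tau> f\<tau> fB in \<open>auto simp: S_def\<close>)
    show False
    proof (cases m; cases m')
      fix v v' assume "m = Inl v" "m' = Inl v'"
      then show False using case_LL[of v v'] r1 m ne aI by (auto simp: M_def)
    next
      fix v bh assume "m = Inl v" "m' = Inr bh"
      then show False using case_LR[of v "fst bh"] r1 m aI Yroot[of "fst bh" "snd bh" t] by (auto simp: M_def)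
    next
      fix v bh assume "m = Inr bh" "m' = Inl v"
      then show False using case_LR[of v "fst bh"] r1 m aI Yroot[of "fst bh" "snd bh" t] by (auto simp: M_def)
    next
      fix bh bh' assume e: "m = Inr bh" "m' = Inr bh'"
      obtain b h where bh: "bh = (b, h)" by (cases bh)
      obtain b' h' where bh': "bh' = (b', h')" by (cases bh')
      have bF: "b \<in> F" "b' \<in> F" using m e bh bh' by (auto simp: M_def)
      show False
      proof (cases "b = b'")
        case True
        then have "h \<noteq> h'" using ne e bh bh' by auto
        then have "Y t \<bullet> b = r b" "Y t \<bullet> b = q b" using r1 e bh bh' True aF aT by (cases h; cases h'; auto)+
        then show False using qr(2)[OF bF(1)] by simp
      next
        case False
        have "Y t \<bullet> b \<in> V b" "Y t \<bullet> b' \<in> V b'" using Yroot[of b h t] Yroot[of b' h' t] m r1 e bh bh' by auto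
        moreover have "card (insert b (insert b' S)) = card S + 2" using False bF fB by (simp add: S_def)
        ultimately show False using ghull[of "insert b (insert b' S)" \<tau> t] bF F SB SV c\<tau> by auto
      qed
    qed
  qed
  have ps: "\<exists>m\<in>M. \<beta> m > 0" "\<exists>m\<in>M. \<beta> m < 0"
  proof -
    have "\<exists>v\<in>\<tau>. \<mu> v > 0"
    proof (rule ccontr)
      assume "\<not> ?thesis"
      then have "sum \<mu> \<tau> < sum (\<lambda>_. 0) \<tau>" using f\<tau> v0 \<mu>nz by (intro sum_strict_mono) (auto simp: not_less order_less_le)
      then show False using \<mu>1 by simp
    qed
    then obtain v where "v \<in> \<tau>" "\<mu> v > 0" by blast
    then show "\<exists>m\<in>M. \<beta> m > 0" by (intro bexI[of _ "Inl v"]) (auto simp: M_def \<beta>_def)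
    have "\<mu> v0 < 0" by (simp add: \<mu>_def)
    then show "\<exists>m\<in>M. \<beta> m < 0" using v0 by (auto simp: M_def \<beta>_def intro!: bexI[of _ "Inl v0"])
  qed
  define feasible where "feasible = (\<lambda>m. \<forall>m'\<in>M. \<alpha> m' + root m * \<beta> m' \<ge> 0)"
  have fM: "finite M" using f\<tau> fB by (simp add: M_def)
  have ev: "even (card {m \<in> M. feasible m})"
    unfolding feasible_def root_def by (rule even_feasible_roots[OF fM \<beta>nz _ ps]) (use inj root_def in auto)
  have cl: "y \<in> convex hull \<sigma> \<longleftrightarrow> (\<exists>u. (\<forall>v\<in>\<tau>. 0 \<le> u v) \<and> (\<forall>v\<in>\<tau> - \<sigma>. u v = 0) \<and> sum u \<tau> = 1 \<and> (\<Sum>v\<in>\<tau>. u v *\<^sub>R v) = y)"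
    if "\<sigma> \<subseteq> \<tau>" for \<sigma> y
  proof -
    have f\<sigma>: "finite \<sigma>" using that f\<tau> finite_subset by blast
    show ?thesis
    proof
      assume "y \<in> convex hull \<sigma>"
      then obtain u where u: "\<forall>v\<in>\<sigma>. 0 \<le> u v" "sum u \<sigma> = 1" "(\<Sum>v\<in>\<sigma>. u v *\<^sub>R v) = y"
        using convex_hull_finite[OF f\<sigma>] by auto
      define w where "w = (\<lambda>v. if v \<in> \<sigma> then u v else 0)"
      have "sum w \<tau> = 1" using u(2) sum.mono_neutral_right[OF f\<tau> that, of w] by (auto simp: w_def cong: sum.cong)
      moreover have "(\<Sum>v\<in>\<tau>. w v *\<^sub>R v) = y"
        using u(3) sum.mono_neutral_right[OF f\<tau> that, of "\<lambda>v. w v *\<^sub>R v"] by (auto simp: w_def cong: sum.cong)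
      ultimately show "\<exists>u. (\<forall>v\<in>\<tau>. 0 \<le> u v) \<and> (\<forall>v\<in>\<tau> - \<sigma>. u v = 0) \<and> sum u \<tau> = 1 \<and> (\<Sum>v\<in>\<tau>. u v *\<^sub>R v) = y"
        using u(1) by (intro exI[of _ w]) (auto simp: w_def)
    next
      assume "\<exists>u. (\<forall>v\<in>\<tau>. 0 \<le> u v) \<and> (\<forall>v\<in>\<tau> - \<sigma>. u v = 0) \<and> sum u \<tau> = 1 \<and> (\<Sum>v\<in>\<tau>. u v *\<^sub>R v) = y"
      then obtain u where u: "\<forall>v\<in>\<tau>. 0 \<le> u v" "\<forall>v\<in>\<tau> - \<sigma>. u v = 0" "sum u \<tau> = 1" "(\<Sum>v\<in>\<tau>. u v *\<^sub>R v) = y" by blast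
      have "sum u \<sigma> = 1" using u(3) sum.mono_neutral_right[OF f\<tau> that, of u] u(2) by auto
      moreover have "(\<Sum>v\<in>\<sigma>. u v *\<^sub>R v) = y"
        using u(4) sum.mono_neutral_right[OF f\<tau> that, of "\<lambda>v. u v *\<^sub>R v"] u(2) by auto
      ultimately show "y \<in> convex hull \<sigma>"
        unfolding convex_hull_finite[OF f\<sigma>] mem_Collect_eq by (intro exI[of _ u]) (use u(1) that in auto)
    qed
  qed
  have hitiff: "convex hull \<sigma> \<inter> {y. (\<forall>b\<in>S. y \<bullet> b = q b) \<and> R y} \<noteq> {} \<longleftrightarrow> (\<exists>t. (\<forall>v\<in>\<tau>. lam t v \<ge> 0) \<and> (\<forall>v\<in>\<tau> - \<sigma>. lam t v = 0) \<and> R (Y t))"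
    if \<sigma>: "\<sigma> \<subseteq> \<tau>" for \<sigma> R
  proof
    assume "convex hull \<sigma> \<inter> {y. (\<forall>b\<in>S. y \<bullet> b = q b) \<and> R y} \<noteq> {}"
    then obtain y where y: "y \<in> convex hull \<sigma>" "\<forall>b\<in>S. y \<bullet> b = q b" "R y" by blast
    then obtain u where u: "\<forall>v\<in>\<tau>. 0 \<le> u v" "\<forall>v\<in>\<tau> - \<sigma>. u v = 0" "sum u \<tau> = 1" "(\<Sum>v\<in>\<tau>. u v *\<^sub>R v) = y" unfolding cl[OF \<sigma>] by (elim exE conjE)
    then obtain t where "\<forall>v\<in>\<tau>. u v = lam t v" "y = Y t" using sol[of u] y by auto
    then show "\<exists>t. (\<forall>v\<in>\<tau>. lam t v \<ge> 0) \<and> (\<forall>v\<in>\<tau> - \<sigma>. lam t v = 0) \<and> R (Y t)" using u y by (intro exI[of _ t]) auto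
  next
    assume "\<exists>t. (\<forall>v\<in>\<tau>. lam t v \<ge> 0) \<and> (\<forall>v\<in>\<tau> - \<sigma>. lam t v = 0) \<and> R (Y t)"
    then obtain t where t: "\<forall>v\<in>\<tau>. lam t v \<ge> 0" "\<forall>v\<in>\<tau> - \<sigma>. lam t v = 0" "R (Y t)" by blast
    have "Y t \<in> convex hull \<sigma>" unfolding cl[OF \<sigma>] by (intro exI[of _ "lam t"]) (use t lam1 Yeq in auto)
    then show "convex hull \<sigma> \<inter> {y. (\<forall>b\<in>S. y \<bullet> b = q b) \<and> R y} \<noteq> {}" using YS t(3) by blast
  qed
  \<comment> \<open>A facet of the simplex or of the cell is met exactly when the root of its
    constraint is feasible, so the sum in question counts feasible roots mod 2.\<close>
  have h1: "hit (\<tau> - {v}) F q r = of_bool (feasible (Inl v))" if v: "v \<in> \<tau>" for v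
  proof -
    have c: "cell F q r = {y. (\<forall>b\<in>S. y \<bullet> b = q b) \<and> (\<forall>b\<in>F. q b \<le> y \<bullet> b \<and> y \<bullet> b \<le> r b)}" by (simp add: cell_def S_def)
    have vM: "Inl v \<in> M" using v by (simp add: M_def)
    have "\<tau> - (\<tau> - {v}) = {v}" using v by blast
    then have "convex hull (\<tau> - {v}) \<inter> cell F q r \<noteq> {} \<longleftrightarrow> (\<exists>t. (\<forall>m\<in>M. \<alpha> m + t * \<beta> m \<ge> 0) \<and> lam t v = 0)"
      unfolding c feas by (subst hitiff) auto
    also have "\<dots> \<longleftrightarrow> feasible (Inl v)" unfolding feasible_def using root_iff[OF vM] aI[of v] by metis
    finally show ?thesis by (simp add: hit_def)
  qed
  have h2: "hit \<tau> (F - {b}) q r = of_bool (feasible (Inr (b, False)))" if b: "b \<in> F" for b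
  proof -
    have "Basis - (F - {b}) = insert b S" using b F by (auto simp: S_def)
    then have c: "cell (F - {b}) q r = {y. (\<forall>b\<in>S. y \<bullet> b = q b) \<and> (y \<bullet> b = q b \<and> (\<forall>b\<in>F. q b \<le> y \<bullet> b \<and> y \<bullet> b \<le> r b))}"
      unfolding cell_def using qr(2)[OF b] by force
    have bM: "Inr (b, False) \<in> M" using b by (simp add: M_def)
    have "convex hull \<tau> \<inter> cell (F - {b}) q r \<noteq> {} \<longleftrightarrow> (\<exists>t. (\<forall>m\<in>M. \<alpha> m + t * \<beta> m \<ge> 0) \<and> Y t \<bullet> b - q b = 0)"
      unfolding c feas by (subst hitiff) auto
    also have "\<dots> \<longleftrightarrow> feasible (Inr (b, False))" unfolding feasible_def using root_iff[OF bM] aF[of b] by metis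
    finally show ?thesis by (simp add: hit_def)
  qed
  have h3: "hit \<tau> (F - {b}) (q(b := r b)) r = of_bool (feasible (Inr (b, True)))" if b: "b \<in> F" for b
  proof -
    have "Basis - (F - {b}) = insert b S" "b \<notin> S" using b F by (auto simp: S_def)
    then have c: "cell (F - {b}) (q(b := r b)) r = {y. (\<forall>b\<in>S. y \<bullet> b = q b) \<and> (y \<bullet> b = r b \<and> (\<forall>b\<in>F. q b \<le> y \<bullet> b \<and> y \<bullet> b \<le> r b))}"
      unfolding cell_def using qr(2)[OF b] by (auto split: if_splits)
    have bM: "Inr (b, True) \<in> M" using b by (simp add: M_def)
    have "convex hull \<tau> \<inter> cell (F - {b}) (q(b := r b)) r \<noteq> {} \<longleftrightarrow> (\<exists>t. (\<forall>m\<in>M. \<alpha> m + t * \<beta> m \<ge> 0) \<and> r b - Y t \<bullet> b = 0)"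
      unfolding c feas by (subst hitiff) auto
    also have "\<dots> \<longleftrightarrow> feasible (Inr (b, True))" unfolding feasible_def using root_iff[OF bM] aT[of b] by metis
    finally show ?thesis by (simp add: hit_def)
  qed
  have "(\<Sum>m\<in>M. of_bool (feasible m)) = (\<Sum>v\<in>\<tau>. of_bool (feasible (Inl v))) + (\<Sum>b\<in>F. of_bool (feasible (Inr (b, False))) + (of_bool (feasible (Inr (b, True))) :: bit))"
  proof -
    have "(\<Sum>m\<in>M. of_bool (feasible m) :: bit) = (\<Sum>m\<in>Inl ` \<tau>. of_bool (feasible m)) + (\<Sum>m\<in>Inr ` (F \<times> UNIV). of_bool (feasible m))"
      unfolding M_def by (rule sum.union_disjoint) (use f\<tau> fB in auto)
    also have "(\<Sum>m\<in>Inl ` \<tau>. of_bool (feasible m) :: bit) = (\<Sum>v\<in>\<tau>. of_bool (feasible (Inl v)))"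
      by (subst sum.reindex) auto
    also have "(\<Sum>m\<in>Inr ` (F \<times> UNIV). of_bool (feasible m) :: bit) = (\<Sum>bh\<in>F \<times> UNIV. of_bool (feasible (Inr bh)))"
      by (subst sum.reindex) auto
    also have "\<dots> = (\<Sum>b\<in>F. \<Sum>h\<in>UNIV. of_bool (feasible (Inr (b, h))))"
      unfolding sum.cartesian_product by (intro sum.cong refl) (simp split: prod.split)
    also have "\<dots> = (\<Sum>b\<in>F. of_bool (feasible (Inr (b, False))) + of_bool (feasible (Inr (b, True))))"
      by (simp only: sum_UNIV_bool)
    finally show ?thesis .
  qed
  moreover have "(\<Sum>m\<in>M. of_bool (feasible m)) = (0::bit)" by (rule bit_sum_of_bool[OF fM ev])
  ultimately show ?thesis using h1 h2 h3 by (simp only: cong: sum.cong)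
qed

lemma total_weight_sum:
  assumes "finite I" "\<And>j. j \<in> I \<Longrightarrow> finite (A j)" "finite F"
  shows "total_weight A I (\<lambda>J f. \<Sum>b\<in>F. h b J f) m \<le> (\<Sum>b\<in>F. total_weight A I (h b) m)"
  using assms(3)
proof (induction F rule: finite_induct)
  case empty then show ?case by (simp add: total_weight_def weight_def)
next
  case (insert b F)
  have "total_weight A I (\<lambda>J f. \<Sum>b\<in>insert b F. h b J f) m = total_weight A I (\<lambda>J f. h b J f + (\<Sum>b\<in>F. h b J f)) m"
    using insert.hyps by simp
  also have "\<dots> \<le> total_weight A I (h b) m + total_weight A I (\<lambda>J f. \<Sum>b\<in>F. h b J f) m"
    by (rule total_weight_add) (use assms in auto)
  finally show ?case using insert by simp
qed

text \<open>The reason why the boundary of a cell boundary vanishes: every pair of directions is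
  counted twice.\<close>

lemma bit_sum_symmetric_pairs:
  assumes "finite F" "\<And>b b'. b \<in> F \<Longrightarrow> b' \<in> F \<Longrightarrow> s b b' = (s b' b :: bit)"
  shows "(\<Sum>b\<in>F. \<Sum>b'\<in>F - {b}. s b b') = 0"
  using assms
proof (induction F rule: finite_induct)
  case empty then show ?case by (simp only: sum.empty)
next
  case (insert x F)
  have 1: "(\<Sum>b'\<in>insert x F - {b}. s b b') = s b x + (\<Sum>b'\<in>F - {b}. s b b')" if "b \<in> F" for b
  proof -
    have "insert x F - {b} = insert x (F - {b})" using that insert.hyps by auto
    then show ?thesis using insert.hyps by (simp only: sum.insert finite_Diff Diff_iff simp_thms)
  qed
  have "insert x F - {x} = F" using insert.hyps by auto
  then have "(\<Sum>b\<in>insert x F. \<Sum>b'\<in>insert x F - {b}. s b b') = (\<Sum>b'\<in>F. s x b') + (\<Sum>b\<in>F. \<Sum>b'\<in>insert x F - {b}. s b b')"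
    using insert.hyps by (simp only: sum.insert simp_thms)
  also have "(\<Sum>b\<in>F. \<Sum>b'\<in>insert x F - {b}. s b b') = (\<Sum>b\<in>F. s b x) + (\<Sum>b\<in>F. \<Sum>b'\<in>F - {b}. s b b')"
    unfolding sum.distrib[symmetric] by (intro sum.cong refl 1)
  also have "(\<Sum>b\<in>F. \<Sum>b'\<in>F - {b}. s b b') = 0" by (rule insert.IH) (use insert.prems in auto)
  also have "(\<Sum>b\<in>F. s b x) = (\<Sum>b'\<in>F. s x b')" by (rule sum.cong) (use insert.prems in auto)
  finally show ?case by (simp only: add_0_right bit_add_self)
qed

lemma bit_telescope: "l \<le> N \<Longrightarrow> (\<Sum>k=l..<N. \<phi> k + \<phi> (Suc k)) = (\<phi> l + \<phi> N :: bit)"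
proof (induction N rule: nat_induct_at_least[of l])
  case base then show ?case by (simp only: bit_add_self atLeastLessThan_empty sum.empty order_refl)
next
  case (Suc n)
  have "(\<Sum>k=l..<Suc n. \<phi> k + \<phi> (Suc k)) = (\<phi> l + \<phi> n) + (\<phi> n + \<phi> (Suc n))"
    using Suc by (simp only: sum.atLeastLessThan_Suc)
  also have "\<dots> = \<phi> l + (\<phi> n + \<phi> n) + \<phi> (Suc n)" by (simp only: ac_simps)
  finally show ?case by (simp only: bit_add_self add_0_right)
qed

section \<open>Gromov's induction over the cells of a grid\<close>

text \<open>In units of \<open>selection_const\<close>, a bound for the weight of a filling over a
  \<open>k\<close>-dimensional cell: the cofilling factor \<open>3 ^ (d + 1)\<close> times the
  weight of \<open>cc\<close>, at most one unit for each colour set, plus that of the fillings on at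
  most \<open>2 * d\<close> facets. At a grid vertex a single colour set occurs.\<close>

primrec growth :: "nat \<Rightarrow> nat \<Rightarrow> real" where
  "growth d 0 = 3 ^ (d + 1)"
| "growth d (Suc k) = 3 ^ (d + 1) * (2 ^ (d + 1) + 2 * real d * growth d k)"

lemma growth_nonneg: "growth d k \<ge> 0"
  by (induction k) auto

text \<open>Chosen so that the right-hand side over a full-dimensional cell has total weight at most
  1/2, whereas a cochain equal to one on all vertices of a colour has weight one there.\<close>

definition selection_const :: "nat \<Rightarrow> real" where
  "selection_const d = 1 / (2 * (2 ^ (d + 1) + 2 * real d * growth d (d - 1)))"

lemma selection_const_pos: "selection_const d > 0"
  unfolding selection_const_def by (intro divide_pos_pos mult_pos_pos add_pos_nonneg mult_nonneg_nonneg growth_nonneg) auto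

text \<open>Assuming that each cell of a fine grid is hit by few faces, small cochains \<open>e F z\<close> with coboundary
  \<open>cc F z + bd e F z\<close> are chosen by induction on the dimension of the cell. For full-dimensional cells the
  right-hand side is a cocycle in degree zero that is too small to be nonzero; but its values at a single
  vertex add up, over all cells, to the number of cells containing that vertex, which is one.\<close>

locale coloured_grid =
  fixes I :: "nat set" and A :: "nat \<Rightarrow> 'a::euclidean_space set" and g :: "'a \<Rightarrow> nat \<Rightarrow> real" and N :: nat
  assumes I: "finite I" "card I = DIM('a) + 1"
    and A: "\<And>i. i \<in> I \<Longrightarrow> finite (A i) \<and> A i \<noteq> {}" "disjoint_family_on A I"
    and X: "generic (\<Union>i\<in>I. A i)"
    and g_mono: "\<And>b k. b \<in> Basis \<Longrightarrow> g b k < g b (Suc k)"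
    and V: "grid_generic (\<Union>i\<in>I. A i) (\<lambda>b. range (g b))"
    and inside: "\<And>i x b. i \<in> I \<Longrightarrow> x \<in> A i \<Longrightarrow> b \<in> Basis \<Longrightarrow> g b 0 < x \<bullet> b \<and> x \<bullet> b < g b N"
    and small: "\<And>F z J. F \<subseteq> Basis \<Longrightarrow> F \<noteq> {} \<Longrightarrow> J \<subseteq> I \<Longrightarrow> card J = card (Basis - F) + 1 \<Longrightarrow>
      weight A (\<lambda>J f. hit (f ` J) F (\<lambda>b. g b (z b)) (\<lambda>b. g b (Suc (z b)))) J \<le> selection_const DIM('a)"
    and few: "\<And>z. weight A (\<lambda>J f. hit (f ` J) {} (\<lambda>b. g b (z b)) (\<lambda>b. g b (Suc (z b)))) I \<le> selection_const DIM('a)"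
begin

definition cc :: "'a set \<Rightarrow> ('a \<Rightarrow> nat) \<Rightarrow> nat set \<Rightarrow> (nat \<Rightarrow> 'a) \<Rightarrow> bit" where
  "cc F z J f = hit (f ` J) F (\<lambda>b. g b (z b)) (\<lambda>b. g b (Suc (z b)))"

definition bd :: "('a set \<Rightarrow> ('a \<Rightarrow> nat) \<Rightarrow> nat set \<Rightarrow> (nat \<Rightarrow> 'a) \<Rightarrow> bit) \<Rightarrow> 'a set \<Rightarrow> ('a \<Rightarrow> nat) \<Rightarrow> nat set \<Rightarrow> (nat \<Rightarrow> 'a) \<Rightarrow> bit" where
  "bd e F z J f = (\<Sum>b\<in>F. e (F - {b}) z J f + e (F - {b}) (z(b := Suc (z b))) J f)"

text \<open>Cells in the boundary of the grid box. All points lie strictly inside, so these cells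
  are not hit; keeping their fillings zero makes the final sum over the box telescope to
  nothing.\<close>

definition outer :: "'a set \<Rightarrow> ('a \<Rightarrow> nat) \<Rightarrow> bool" where
  "outer F z \<longleftrightarrow> (\<exists>b\<in>Basis - F. z b = 0 \<or> z b = N)"

lemma fA: "i \<in> I \<Longrightarrow> finite (A i)" using A by blast

lemma cc_local: "local_cochain (cc F z)"
  unfolding local_cochain_def cc_def by (metis image_cong)

lemma inj_face: "J \<subseteq> I \<Longrightarrow> (\<And>j. j \<in> J \<Longrightarrow> f j \<in> A j) \<Longrightarrow> inj_on f J"
proof (rule inj_onI)
  fix x y assume J: "J \<subseteq> I" and f: "\<And>j. j \<in> J \<Longrightarrow> f j \<in> A j" and xy: "x \<in> J" "y \<in> J" "f x = f y"
  have "f x \<in> A x \<inter> A y" using f[OF xy(1)] f[OF xy(2)] xy(3) by simp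
  then show "x = y" using A(2) J xy unfolding disjoint_family_on_def by (metis empty_iff subsetD)
qed

lemma face_sub: "J \<subseteq> I \<Longrightarrow> (\<And>j. j \<in> J \<Longrightarrow> f j \<in> A j) \<Longrightarrow> f ` J \<subseteq> (\<Union>i\<in>I. A i)"
  by blast

text \<open>The parity lemma read as a chain map: \<open>cc\<close> takes cell boundaries to
  coboundaries. Disjointness of the classes makes a face have as many vertices as colours.\<close>

lemma cc_parity:
  assumes F: "F \<subseteq> Basis" and J: "J \<subseteq> I" "card J = card (Basis - F) + 2" and f: "\<And>j. j \<in> J \<Longrightarrow> f j \<in> A j"
  shows "coboundary (cc F z) J f = bd cc F z J f"
proof -
  let ?q = "\<lambda>b. g b (z b)" and ?r = "\<lambda>b. g b (Suc (z b))"
  have inj: "inj_on f J" by (rule inj_face) (use J f in auto)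
  have "(\<Sum>v\<in>f ` J. hit (f ` J - {v}) F ?q ?r) + (\<Sum>b\<in>F. hit (f ` J) (F - {b}) ?q ?r + hit (f ` J) (F - {b}) (?q(b := ?r b)) ?r) = 0"
  proof (rule hit_parity[OF X V F])
    show "f ` J \<subseteq> (\<Union>i\<in>I. A i)" by (rule face_sub) (use J f in auto)
    show "card (f ` J) = card (Basis - F) + 2" using J inj by (simp add: card_image)
  qed (use g_mono F in auto)
  moreover have "(\<Sum>v\<in>f ` J. hit (f ` J - {v}) F ?q ?r) = coboundary (cc F z) J f"
    unfolding coboundary_def sum.reindex[OF inj] comp_def cc_def
  proof (rule sum.cong)
    fix j assume "j \<in> J"
    then have "f ` (J - {j}) = f ` J - {f j}" using inj by (auto simp: inj_on_def)
    then show "hit (f ` J - {f j}) F ?q ?r = hit (f ` (J - {j})) F ?q ?r" by simp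
  qed simp
  moreover have "hit (f ` J) (F - {b}) (?q(b := ?r b)) ?r = cc (F - {b}) (z(b := Suc (z b))) J f" for b
  proof -
    have "cell (F - {b}) (?q(b := ?r b)) ?r = cell (F - {b}) (\<lambda>c. g c ((z(b := Suc (z b))) c)) (\<lambda>c. g c (Suc ((z(b := Suc (z b))) c)))"
      unfolding cell_def by auto
    then show ?thesis unfolding cc_def hit_def by simp
  qed
  ultimately have "coboundary (cc F z) J f + bd cc F z J f = 0" unfolding bd_def cc_def[of "F - _" z] by (simp only:)
  then show ?thesis by (metis bit_eq_iff_add)
qed

lemma cc_outer: "outer F z \<Longrightarrow> J \<subseteq> I \<Longrightarrow> (\<And>j. j \<in> J \<Longrightarrow> f j \<in> A j) \<Longrightarrow> cc F z J f = 0"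
proof -
  assume o: "outer F z" and J: "J \<subseteq> I" and f: "\<And>j. j \<in> J \<Longrightarrow> f j \<in> A j"
  obtain b where b: "b \<in> Basis" "b \<notin> F" "z b = 0 \<or> z b = N" using o by (auto simp: outer_def)
  have "f ` J \<subseteq> {y. g b 0 < b \<bullet> y} \<inter> {y. b \<bullet> y < g b N}"
  proof
    fix y assume "y \<in> f ` J"
    then obtain j where "j \<in> I" "f j \<in> A j" "y = f j" using J f by blast
    then show "y \<in> {y. g b 0 < b \<bullet> y} \<inter> {y. b \<bullet> y < g b N}" using inside[OF _ _ b(1), of j y] by (simp add: inner_commute)
  qed
  then have "convex hull (f ` J) \<subseteq> {y. g b 0 < b \<bullet> y} \<inter> {y. b \<bullet> y < g b N}"
    by (rule hull_minimal) (intro convex_Int convex_halfspace_gt convex_halfspace_lt)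
  then have "convex hull (f ` J) \<inter> cell F (\<lambda>b. g b (z b)) (\<lambda>b. g b (Suc (z b))) = {}"
    using b by (auto simp: cell_def inner_commute subset_iff)
  then show ?thesis by (simp add: cc_def hit_def)
qed

lemma outer_sub: "outer F z \<Longrightarrow> b \<in> F \<Longrightarrow> outer (F - {b}) z \<and> outer (F - {b}) (z(b := k))"
  by (auto simp: outer_def)

lemma total_cc:
  assumes "F \<subseteq> Basis" "F \<noteq> {}"
  shows "total_weight A I (cc F z) (card (Basis - F) + 1) \<le> 2 ^ (DIM('a) + 1) * selection_const DIM('a)"
proof -
  have "total_weight A I (cc F z) (card (Basis - F) + 1) \<le> (\<Sum>J | J \<subseteq> I \<and> card J = card (Basis - F) + 1. selection_const DIM('a))"
    unfolding total_weight_def cc_def by (intro sum_mono small[OF assms]) auto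
  also have "\<dots> = card {J. J \<subseteq> I \<and> card J = card (Basis - F) + 1} * selection_const DIM('a)" by simp
  also have "\<dots> \<le> card (Pow I) * selection_const DIM('a)"
    using I selection_const_pos[of "DIM('a)"] by (intro mult_right_mono) (auto intro!: card_mono)
  finally show ?thesis using I by (simp add: card_Pow)
qed

text \<open>The third clause is the equation of a chain homotopy from \<open>cc\<close> to zero,
  built over the skeleta of the grid; vanishing on outer cells keeps it relative to the boundary of
  the box.\<close>

definition good :: "('a set \<Rightarrow> ('a \<Rightarrow> nat) \<Rightarrow> nat set \<Rightarrow> (nat \<Rightarrow> 'a) \<Rightarrow> bit) \<Rightarrow> 'a set \<Rightarrow> ('a \<Rightarrow> nat) \<Rightarrow> bool" where
  "good e F z \<longleftrightarrow> local_cochain (e F z) \<and> (outer F z \<longrightarrow> (\<forall>J f. e F z J f = 0)) \<and>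
     (\<forall>J f. J \<subseteq> I \<longrightarrow> card J = card (Basis - F) + 1 \<longrightarrow> (\<forall>j\<in>J. f j \<in> A j) \<longrightarrow>
        coboundary (e F z) J f = cc F z J f + bd e F z J f) \<and>
     total_weight A I (e F z) (card (Basis - F)) \<le> selection_const DIM('a) * growth DIM('a) (card F)"

lemma good_local: "good e F z \<Longrightarrow> local_cochain (e F z)"
  and good_weight: "good e F z \<Longrightarrow> total_weight A I (e F z) (card (Basis - F)) \<le> selection_const DIM('a) * growth DIM('a) (card F)"
  unfolding good_def by simp_all

lemma bd_bd:
  assumes "finite F"
  shows "(\<Sum>b\<in>F. bd e (F - {b}) z J f + bd e (F - {b}) (z(b := Suc (z b))) J f) = 0"
proof -
  define s where "s = (\<lambda>b b'. (e (F - {b} - {b'}) z J f + e (F - {b} - {b'}) (z(b' := Suc (z b'))) J f) +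
      (e (F - {b} - {b'}) (z(b := Suc (z b))) J f + e (F - {b} - {b'}) (z(b := Suc (z b), b' := Suc (z b'))) J f))"
  have "bd e (F - {b}) z J f + bd e (F - {b}) (z(b := Suc (z b))) J f = (\<Sum>b'\<in>F - {b}. s b b')" for b
    unfolding bd_def sum.distrib[symmetric] s_def by (intro sum.cong refl) auto
  moreover have "(\<Sum>b\<in>F. \<Sum>b'\<in>F - {b}. s b b') = 0"
  proof (rule bit_sum_symmetric_pairs[OF assms])
    fix b b'
    have "F - {b} - {b'} = F - {b'} - {b}" by auto
    moreover have "z(b := Suc (z b), b' := Suc (z b')) = z(b' := Suc (z b'), b := Suc (z b))"
      by (cases "b = b'") (auto simp: fun_upd_twist)
    ultimately show "s b b' = s b' b" unfolding s_def by (simp only: ac_simps)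
  qed
  ultimately show ?thesis by (simp only:)
qed

text \<open>The coboundary of \<open>cc\<close> is \<open>bd cc\<close>, and that of
  \<open>bd e\<close> is \<open>bd cc + bd (bd e)\<close> by the equations for the facets. The last
  term vanishes, the others cancel mod 2.\<close>

lemma closed_h:
  assumes F: "F \<subseteq> Basis" and IH: "\<And>b. b \<in> F \<Longrightarrow> good e (F - {b}) z \<and> good e (F - {b}) (z(b := Suc (z b)))"
    and J: "J \<subseteq> I" "card J = card (Basis - F) + 2" and f: "\<forall>j\<in>J. f j \<in> A j"
  shows "coboundary (\<lambda>J f. cc F z J f + bd e F z J f) J f = 0"
proof -
  have fF: "finite F" using F finite_Basis finite_subset by blast
  have cb: "card (Basis - (F - {b})) = card (Basis - F) + 1" if "b \<in> F" for b
  proof -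
    have "Basis - (F - {b}) = insert b (Basis - F)" using that F by auto
    then show ?thesis using that by simp
  qed
  have "coboundary (\<lambda>J f. cc F z J f + bd e F z J f) J f = coboundary (cc F z) J f +
      (\<Sum>b\<in>F. coboundary (e (F - {b}) z) J f + coboundary (e (F - {b}) (z(b := Suc (z b)))) J f)"
    unfolding coboundary_def bd_def sum.distrib by (subst (3 4) sum.swap) simp
  also have "coboundary (cc F z) J f = bd cc F z J f" by (rule cc_parity[OF F J]) (use f in blast)
  also have "(\<Sum>b\<in>F. coboundary (e (F - {b}) z) J f + coboundary (e (F - {b}) (z(b := Suc (z b)))) J f) =
      (\<Sum>b\<in>F. (cc (F - {b}) z J f + bd e (F - {b}) z J f) + (cc (F - {b}) (z(b := Suc (z b))) J f + bd e (F - {b}) (z(b := Suc (z b))) J f))"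
  proof (rule sum.cong)
    fix b assume b: "b \<in> F"
    have "card J = card (Basis - (F - {b})) + 1" using J(2) cb[OF b] by simp
    then show "coboundary (e (F - {b}) z) J f + coboundary (e (F - {b}) (z(b := Suc (z b)))) J f =
       (cc (F - {b}) z J f + bd e (F - {b}) z J f) + (cc (F - {b}) (z(b := Suc (z b))) J f + bd e (F - {b}) (z(b := Suc (z b))) J f)"
      using IH[OF b] J(1) f unfolding good_def by metis
  qed simp
  also have "\<dots> = bd cc F z J f + (\<Sum>b\<in>F. bd e (F - {b}) z J f + bd e (F - {b}) (z(b := Suc (z b))) J f)"
    unfolding bd_def[of cc] sum.distrib by (simp only: ac_simps)
  also have "\<dots> = bd cc F z J f" unfolding bd_bd[OF fF] by (simp only: add_0_right)
  finally show ?thesis by (simp only: bit_add_self)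
qed

lemma total_h:
  assumes F: "F \<subseteq> Basis" "F \<noteq> {}" and IH: "\<And>b. b \<in> F \<Longrightarrow> good e (F - {b}) z \<and> good e (F - {b}) (z(b := Suc (z b)))"
  shows "total_weight A I (\<lambda>J f. cc F z J f + bd e F z J f) (card (Basis - F) + 1) \<le>
    selection_const DIM('a) * (2 ^ (DIM('a) + 1) + 2 * real DIM('a) * growth DIM('a) (card F - 1))"
proof -
  let ?m = "card (Basis - F) + 1"
  have fF: "finite F" using F finite_Basis finite_subset by blast
  have cF: "card F \<le> DIM('a)" using F by (simp add: card_mono)
  have cb: "card (Basis - (F - {b})) = ?m" if "b \<in> F" for b
  proof -
    have "Basis - (F - {b}) = insert b (Basis - F)" using that F by auto
    then show ?thesis using that by simp
  qed
  have "total_weight A I (\<lambda>J f. bd e F z J f) ?m \<le> (\<Sum>b\<in>F. total_weight A I (\<lambda>J f. e (F - {b}) z J f + e (F - {b}) (z(b := Suc (z b))) J f) ?m)"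
    unfolding bd_def by (rule total_weight_sum) (use I fA fF in auto)
  also have "\<dots> \<le> (\<Sum>b\<in>F. selection_const DIM('a) * growth DIM('a) (card F - 1) + selection_const DIM('a) * growth DIM('a) (card F - 1))"
  proof (rule sum_mono)
    fix b assume b: "b \<in> F"
    have "total_weight A I (\<lambda>J f. e (F - {b}) z J f + e (F - {b}) (z(b := Suc (z b))) J f) ?m \<le>
       total_weight A I (e (F - {b}) z) ?m + total_weight A I (e (F - {b}) (z(b := Suc (z b)))) ?m"
      by (rule total_weight_add) (use I fA in auto)
    moreover have "card (F - {b}) = card F - 1" using b fF by simp
    ultimately show "total_weight A I (\<lambda>J f. e (F - {b}) z J f + e (F - {b}) (z(b := Suc (z b))) J f) ?m \<le>
       selection_const DIM('a) * growth DIM('a) (card F - 1) + selection_const DIM('a) * growth DIM('a) (card F - 1)"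
      using IH[OF b, THEN conjunct1, THEN good_weight] IH[OF b, THEN conjunct2, THEN good_weight] unfolding cb[OF b]
      by (simp only:)
  qed
  also have "\<dots> = card F * (2 * (selection_const DIM('a) * growth DIM('a) (card F - 1)))" by simp
  also have "\<dots> \<le> DIM('a) * (2 * (selection_const DIM('a) * growth DIM('a) (card F - 1)))"
    using cF selection_const_pos[of "DIM('a)"] growth_nonneg[of "DIM('a)" "card F - 1"] by (intro mult_right_mono) auto
  finally have b: "total_weight A I (bd e F z) ?m \<le> DIM('a) * (2 * (selection_const DIM('a) * growth DIM('a) (card F - 1)))" .
  have "total_weight A I (\<lambda>J f. cc F z J f + bd e F z J f) ?m \<le> total_weight A I (cc F z) ?m + total_weight A I (bd e F z) ?m"
    by (rule total_weight_add) (use I fA in auto)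
  also have "\<dots> \<le> 2 ^ (DIM('a) + 1) * selection_const DIM('a) + DIM('a) * (2 * (selection_const DIM('a) * growth DIM('a) (card F - 1)))"
    using b total_cc[OF F, of z] by linarith
  finally show ?thesis by (simp add: algebra_simps)
qed

lemma local_h: "(\<And>b. b \<in> F \<Longrightarrow> good e (F - {b}) z \<and> good e (F - {b}) (z(b := Suc (z b)))) \<Longrightarrow>
  local_cochain (\<lambda>J f. cc F z J f + bd e F z J f)"
  unfolding local_cochain_def
proof (intro allI impI)
  fix J and f f' :: "nat \<Rightarrow> 'a"
  assume IH: "\<And>b. b \<in> F \<Longrightarrow> good e (F - {b}) z \<and> good e (F - {b}) (z(b := Suc (z b)))" and ff: "\<forall>j\<in>J. f j = f' j"
  have "bd e F z J f = bd e F z J f'"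
    unfolding bd_def
  proof (rule sum.cong[OF refl])
    fix b assume b: "b \<in> F"
    have "e (F - {b}) z J f = e (F - {b}) z J f'" "e (F - {b}) (z(b := Suc (z b))) J f = e (F - {b}) (z(b := Suc (z b))) J f'"
      by (rule local_cochainD[OF good_local[OF IH[OF b, THEN conjunct1]]], use ff in blast)
         (rule local_cochainD[OF good_local[OF IH[OF b, THEN conjunct2]]], use ff in blast)
    then show "e (F - {b}) z J f + e (F - {b}) (z(b := Suc (z b))) J f = e (F - {b}) z J f' + e (F - {b}) (z(b := Suc (z b))) J f'" by simp
  qed
  moreover have "cc F z J f = cc F z J f'" by (rule local_cochainD[OF cc_local]) (use ff in auto)
  ultimately show "cc F z J f + bd e F z J f = cc F z J f' + bd e F z J f'" by simp
qed

text \<open>In top degree closedness says nothing, so exactness is shown directly: the cochains of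
  the edges on a grid line from \<open>z\<close> to the wall have coboundaries that telescope to
  \<open>cc {} z\<close>, the end of the line being outer.\<close>

lemma vertex_filling:
  assumes "\<forall>b\<in>Basis. z b \<le> N"
  shows "\<exists>E. local_cochain E \<and> (outer {} z \<longrightarrow> (\<forall>J f. E J f = 0)) \<and>
     (\<forall>J f. J \<subseteq> I \<longrightarrow> card J = DIM('a) + 1 \<longrightarrow> (\<forall>j\<in>J. f j \<in> A j) \<longrightarrow> coboundary E J f = cc {} z J f) \<and>
     total_weight A I E DIM('a) \<le> selection_const DIM('a) * growth DIM('a) 0"
proof (cases "outer {} z")
  case True
  have "total_weight A I (\<lambda>_ _. 0) DIM('a) = 0" by (simp add: total_weight_def weight_def)
  then show ?thesis using True cc_outer[OF True] selection_const_pos[of "DIM('a)"]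
    by (intro exI[of _ "\<lambda>_ _. 0"]) (auto simp: local_cochain_def coboundary_def)
next
  case False
  obtain b1 where b1: "b1 \<in> (Basis :: 'a set)" using nonempty_Basis by blast
  define \<alpha> where "\<alpha> = (\<lambda>J f. \<Sum>l=z b1..<N. cc {b1} (z(b1 := l)) J f)"
  have l\<alpha>: "local_cochain \<alpha>"
    unfolding local_cochain_def \<alpha>_def using cc_local[unfolded local_cochain_def] by (metis (no_types, lifting) sum.cong)
  have ex: "cc {} z I f = coboundary \<alpha> I f" if f: "\<forall>j\<in>I. f j \<in> A j" for f
  proof -
    have cI: "card I = card (Basis - {b1}) + 2" using I b1 DIM_positive[where 'a='a] by simp
    have "coboundary \<alpha> I f = (\<Sum>l=z b1..<N. coboundary (cc {b1} (z(b1 := l))) I f)"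
      unfolding coboundary_def \<alpha>_def by (rule sum.swap)
    also have "\<dots> = (\<Sum>l=z b1..<N. cc {} (z(b1 := l)) I f + cc {} (z(b1 := Suc l)) I f)"
    proof (rule sum.cong)
      fix l
      have "coboundary (cc {b1} (z(b1 := l))) I f = bd cc {b1} (z(b1 := l)) I f"
        by (rule cc_parity) (use b1 cI f in auto)
      then show "coboundary (cc {b1} (z(b1 := l))) I f = cc {} (z(b1 := l)) I f + cc {} (z(b1 := Suc l)) I f"
        unfolding bd_def by (simp only: sum.insert finite.emptyI sum.empty empty_iff simp_thms fun_upd_same fun_upd_upd Diff_cancel add_0_right)
    qed simp
    also have "\<dots> = cc {} (z(b1 := z b1)) I f + cc {} (z(b1 := N)) I f"
      by (rule bit_telescope) (use assms b1 in auto)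
    also have "cc {} (z(b1 := N)) I f = 0"
      by (rule cc_outer) (use b1 f in \<open>auto simp: outer_def\<close>)
    finally show ?thesis by (simp only: fun_upd_triv add_0_right)
  qed
  have "\<exists>e. local_cochain e \<and> (\<forall>J f. J \<subseteq> I \<longrightarrow> card J = card I \<longrightarrow> (\<forall>j\<in>J. f j \<in> A j) \<longrightarrow> cc {} z J f = coboundary e J f) \<and>
      total_weight A I e (card I - 1) \<le> 3 ^ card I * total_weight A I (cc {} z) (card I)"
  proof (rule cofilling[OF I(1) A(1) cc_local])
    show "card I \<ge> 1" using I by simp
    show "(card I < card I \<and> (\<forall>J f. J \<subseteq> I \<longrightarrow> card J = Suc (card I) \<longrightarrow> (\<forall>j\<in>J. f j \<in> A j) \<longrightarrow> coboundary (cc {} z) J f = 0)) \<or>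
      (card I = card I \<and> (\<exists>\<alpha>. local_cochain \<alpha> \<and> (\<forall>f. (\<forall>j\<in>I. f j \<in> A j) \<longrightarrow> cc {} z I f = coboundary \<alpha> I f)))"
      using l\<alpha> ex by blast
  qed
  then obtain E where E: "local_cochain E" "\<forall>J f. J \<subseteq> I \<longrightarrow> card J = card I \<longrightarrow> (\<forall>j\<in>J. f j \<in> A j) \<longrightarrow> cc {} z J f = coboundary E J f"
      "total_weight A I E (card I - 1) \<le> 3 ^ card I * total_weight A I (cc {} z) (card I)" by (elim exE conjE)
  have "{J. J \<subseteq> I \<and> card J = card I} = {I}" using card_subset_eq[OF I(1)] by blast
  then have "total_weight A I (cc {} z) (card I) \<le> selection_const DIM('a)" using few[of z] by (simp add: total_weight_def cc_def[abs_def])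
  then have "3 ^ card I * total_weight A I (cc {} z) (card I) \<le> 3 ^ card I * selection_const DIM('a)" by (intro mult_left_mono) auto
  then have "total_weight A I E DIM('a) \<le> 3 ^ card I * selection_const DIM('a)" using E(3) I(2) by (simp only: diff_Suc_1 Suc_eq_plus1[symmetric])
  then have "total_weight A I E DIM('a) \<le> selection_const DIM('a) * growth DIM('a) 0" using I(2) by (simp add: mult.commute)
  then show ?thesis using E False I by (intro exI[of _ E]) auto
qed

definition valid :: "'a set \<Rightarrow> ('a \<Rightarrow> nat) \<Rightarrow> bool" where
  "valid F z \<longleftrightarrow> (\<forall>b\<in>Basis. if b \<in> F then z b < N else z b \<le> N)"

lemma valid_sub: "valid F z \<Longrightarrow> b \<in> F \<Longrightarrow> valid (F - {b}) z \<and> valid (F - {b}) (z(b := Suc (z b)))"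
  by (force simp: valid_def)

lemma good_cong:
  assumes "e F z = e' F z" "\<And>b. b \<in> F \<Longrightarrow> e (F - {b}) = e' (F - {b})"
  shows "good e F z = good e' F z"
proof -
  have "bd e F z = bd e' F z" unfolding bd_def by (intro ext sum.cong refl) (simp add: assms(2))
  then show ?thesis unfolding good_def assms(1) by simp
qed

text \<open>The filling depends on the cell alone, so neighbouring cells use the same one on a
  common facet; the cancellation over the whole grid rests on this. Full-dimensional cells are left
  out, since they supply the contradiction.\<close>

lemma fillings_exist:
  "k < DIM('a) \<Longrightarrow> \<exists>e. \<forall>F z. F \<subseteq> Basis \<longrightarrow> card F \<le> k \<longrightarrow> valid F z \<longrightarrow> good e F z"
proof (induction k)
  case 0
  have "\<forall>z. \<exists>E. valid {} z \<longrightarrow> local_cochain E \<and> (outer {} z \<longrightarrow> (\<forall>J f. E J f = 0)) \<and>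
     (\<forall>J f. J \<subseteq> I \<longrightarrow> card J = DIM('a) + 1 \<longrightarrow> (\<forall>j\<in>J. f j \<in> A j) \<longrightarrow> coboundary E J f = cc {} z J f) \<and>
     total_weight A I E DIM('a) \<le> selection_const DIM('a) * growth DIM('a) 0"
    using vertex_filling by (simp add: valid_def)
  from choice[OF this] obtain E where E: "\<forall>z. valid {} z \<longrightarrow> local_cochain (E z) \<and> (outer {} z \<longrightarrow> (\<forall>J f. E z J f = 0)) \<and>
     (\<forall>J f. J \<subseteq> I \<longrightarrow> card J = DIM('a) + 1 \<longrightarrow> (\<forall>j\<in>J. f j \<in> A j) \<longrightarrow> coboundary (E z) J f = cc {} z J f) \<and>
     total_weight A I (E z) DIM('a) \<le> selection_const DIM('a) * growth DIM('a) 0" by (elim exE)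
  have "good (\<lambda>F. E) {} z" if "valid {} z" for z
    using E[rule_format, OF that] unfolding good_def bd_def by simp
  moreover have "F = {}" if "F \<subseteq> Basis" "card F \<le> 0" for F :: "'a set"
    using that finite_subset[OF that(1)] by auto
  ultimately show ?case by (intro exI[of _ "\<lambda>F. E"]) blast
next
  case (Suc k)
  then obtain e where e: "\<And>F z. F \<subseteq> Basis \<Longrightarrow> card F \<le> k \<Longrightarrow> valid F z \<Longrightarrow> good e F z" by auto
  define R where "R = (\<lambda>F z E. local_cochain E \<and> (outer F z \<longrightarrow> (\<forall>J f. E J f = 0)) \<and>
     (\<forall>J f. J \<subseteq> I \<longrightarrow> card J = card (Basis - F) + 1 \<longrightarrow> (\<forall>j\<in>J. f j \<in> A j) \<longrightarrow> coboundary E J f = cc F z J f + bd e F z J f) \<and>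
     total_weight A I E (card (Basis - F)) \<le> selection_const DIM('a) * growth DIM('a) (Suc k))"
  have "\<exists>E. local_cochain E \<and> (outer F z \<longrightarrow> (\<forall>J f. E J f = 0)) \<and>
     (\<forall>J f. J \<subseteq> I \<longrightarrow> card J = card (Basis - F) + 1 \<longrightarrow> (\<forall>j\<in>J. f j \<in> A j) \<longrightarrow> coboundary E J f = cc F z J f + bd e F z J f) \<and>
     total_weight A I E (card (Basis - F)) \<le> selection_const DIM('a) * growth DIM('a) (Suc k)"
    if F: "F \<subseteq> Basis" "card F = Suc k" "valid F z" for F z
  proof -
    have fF: "finite F" "F \<noteq> {}" using F finite_subset[OF F(1)] by auto
    have IH: "good e (F - {b}) z \<and> good e (F - {b}) (z(b := Suc (z b)))" if "b \<in> F" for b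
    proof -
      have "card (F - {b}) \<le> k" using that F fF by simp
      then show ?thesis using e[of "F - {b}"] F(1) valid_sub[OF F(3) that] by blast
    qed
    show ?thesis
    proof (cases "outer F z")
      case True
      have "bd e F z J f = 0" for J f
        unfolding bd_def
      proof (rule sum.neutral, intro ballI)
        fix b assume b: "b \<in> F"
        have "e (F - {b}) z J f = 0" "e (F - {b}) (z(b := Suc (z b))) J f = 0"
          using IH[OF b] outer_sub[OF True b] unfolding good_def by blast+
        then show "e (F - {b}) z J f + e (F - {b}) (z(b := Suc (z b))) J f = 0" by simp
      qed
      moreover have "total_weight A I (\<lambda>_ _. 0) (card (Basis - F)) = 0" by (simp add: total_weight_def weight_def)
      ultimately show ?thesis using True cc_outer[OF True] selection_const_pos[of "DIM('a)"] growth_nonneg[of "DIM('a)" "Suc k"]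
        by (intro exI[of _ "\<lambda>_ _. 0"]) (auto simp: local_cochain_def coboundary_def simp del: growth.simps)
    next
      case False
      let ?h = "\<lambda>J f. cc F z J f + bd e F z J f"
      let ?m = "card (Basis - F) + 1"
      have cBF: "card (Basis - F) = DIM('a) - Suc k" using F fF by (simp add: card_Diff_subset)
      have "\<exists>E. local_cochain E \<and> (\<forall>J f. J \<subseteq> I \<longrightarrow> card J = ?m \<longrightarrow> (\<forall>j\<in>J. f j \<in> A j) \<longrightarrow> ?h J f = coboundary E J f) \<and>
        total_weight A I E (?m - 1) \<le> 3 ^ card I * total_weight A I ?h ?m"
      proof (rule cofilling[OF I(1) A(1) local_h[OF IH]])
        show "(?m < card I \<and> (\<forall>J f. J \<subseteq> I \<longrightarrow> card J = Suc ?m \<longrightarrow> (\<forall>j\<in>J. f j \<in> A j) \<longrightarrow> coboundary ?h J f = 0)) \<or>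
          (?m = card I \<and> (\<exists>\<alpha>. local_cochain \<alpha> \<and> (\<forall>f. (\<forall>j\<in>I. f j \<in> A j) \<longrightarrow> ?h I f = coboundary \<alpha> I f)))"
          using closed_h[OF F(1) IH] cBF I Suc.prems by (intro disjI1) auto
      qed auto
      then obtain E where E: "local_cochain E" "\<forall>J f. J \<subseteq> I \<longrightarrow> card J = ?m \<longrightarrow> (\<forall>j\<in>J. f j \<in> A j) \<longrightarrow> ?h J f = coboundary E J f"
        "total_weight A I E (?m - 1) \<le> 3 ^ card I * total_weight A I ?h ?m" by (elim exE conjE)
      have "total_weight A I ?h ?m \<le> selection_const DIM('a) * (2 ^ (DIM('a) + 1) + 2 * real DIM('a) * growth DIM('a) k)"
        using total_h[OF F(1) fF(2) IH] F(2) by simp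
      then have "3 ^ card I * total_weight A I ?h ?m \<le> 3 ^ card I * (selection_const DIM('a) * (2 ^ (DIM('a) + 1) + 2 * real DIM('a) * growth DIM('a) k))"
        by (rule mult_left_mono) simp
      also have "\<dots> = selection_const DIM('a) * growth DIM('a) (Suc k)" using I by simp
      finally show ?thesis using E False by (intro exI[of _ E]) auto
    qed
  qed
  then have "\<forall>Fz. \<exists>E. fst Fz \<subseteq> Basis \<longrightarrow> card (fst Fz) = Suc k \<longrightarrow> valid (fst Fz) (snd Fz) \<longrightarrow> R (fst Fz) (snd Fz) E"
    unfolding R_def by (intro allI) (metis (mono_tags, lifting))
  from choice[OF this] obtain E' where "\<forall>Fz. fst Fz \<subseteq> Basis \<longrightarrow> card (fst Fz) = Suc k \<longrightarrow> valid (fst Fz) (snd Fz) \<longrightarrow> R (fst Fz) (snd Fz) (E' Fz)"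
    by (elim exE)
  then have E': "R F z (E' (F, z))" if "F \<subseteq> Basis" "card F = Suc k" "valid F z" for F z
    using that by (metis fst_conv snd_conv)
  define e' where "e' = (\<lambda>F z. if card F \<le> k then e F z else E' (F, z))"
  have "good e' F z" if F: "F \<subseteq> Basis" "card F \<le> Suc k" "valid F z" for F z
  proof -
    have fF: "finite F" by (rule finite_subset[OF F(1) finite_Basis])
    have sub: "e (F - {b}) = e' (F - {b})" if "b \<in> F" for b
    proof -
      have "card (F - {b}) \<le> k" using that F fF by simp
      then show ?thesis by (auto simp: e'_def)
    qed
    show ?thesis
    proof (cases "card F \<le> k")
      case True
      then have "good e F z = good e' F z" by (intro good_cong sub) (simp add: e'_def)
      then show ?thesis using e[OF F(1) True F(3)] by simp
    next
      case False
      then have c: "card F = Suc k" using F by simp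
      have "bd e F z = bd e' F z" unfolding bd_def by (intro ext sum.cong refl) (simp add: sub)
      have e'F: "e' F z = E' (F, z)" using False by (simp add: e'_def)
      show ?thesis using E'[OF F(1) c F(3)] unfolding good_def R_def e'F \<open>bd e F z = bd e' F z\<close> c .
    qed
  qed
  then show ?case by blast
qed

lemma contradiction: False
proof -
  have d1: "DIM('a) - 1 < DIM('a)" using DIM_positive[where 'a='a] by simp
  obtain e where e: "\<And>F z. F \<subseteq> Basis \<Longrightarrow> card F \<le> DIM('a) - 1 \<Longrightarrow> valid F z \<Longrightarrow> good e F z"
    using fillings_exist[OF d1] by blast
  define Z where "Z = PiE (Basis :: 'a set) (\<lambda>_. {..<N})"
  have fZ: "finite Z" by (simp add: Z_def finite_PiE)
  have IH: "good e (Basis - {b}) z \<and> good e (Basis - {b}) (z(b := Suc (z b)))" if "b \<in> Basis" "z \<in> Z" for b z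
  proof -
    have "valid Basis z" using that(2) by (auto simp: Z_def valid_def)
    then show ?thesis using e[of "Basis - {b}"] valid_sub[of Basis z b] that(1) by (simp add: card_Diff_subset)
  qed
  obtain i i' where i: "i \<in> I" "i' \<in> I" "i \<noteq> i'"
    using I DIM_positive[where 'a='a] by (metis One_nat_def Suc_eq_plus1 Suc_lessI card_1_singleton_iff card_eq_0_iff is_singletonI' is_singleton_altdef zero_less_Suc nat.simps(3) Suc_inject less_irrefl)
  obtain f where f: "\<forall>j\<in>I. f j \<in> A j" using bchoice[of I "\<lambda>i x. x \<in> A i"] A(1) by blast
  let ?h = "\<lambda>z J f. cc Basis z J f + bd e Basis z J f"
  \<comment> \<open>Over a full-dimensional cell the cochain lives on single vertices and is closed.
    If it were one at a vertex of colour \<open>i\<close>, edges to colour \<open>i'\<close> would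
    make it one on that whole class: weight one, against the bound 1/2.\<close>
  have h0: "?h z {i} f = 0" if z: "z \<in> Z" for z
  proof (rule ccontr)
    assume "?h z {i} f \<noteq> 0"
    then have h1: "?h z {i} f = 1" by simp
    have IHz: "\<And>b. b \<in> Basis \<Longrightarrow> good e (Basis - {b}) z \<and> good e (Basis - {b}) (z(b := Suc (z b)))" using IH z by blast
    have loc: "local_cochain (?h z)" by (rule local_h) (rule IHz)
    have one: "?h z {i'} f' = 1" if f': "f' i' \<in> A i'" for f'
    proof -
      let ?f = "f(i' := f' i')"
      have c0: "coboundary (?h z) {i, i'} ?f = 0"
        by (rule closed_h) (use i f f' IHz in auto)
      have "coboundary (?h z) {i, i'} ?f = ?h z ({i, i'} - {i}) ?f + ?h z ({i, i'} - {i'}) ?f"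
        unfolding coboundary_def using i(3) by (simp only: sum.insert finite.intros empty_iff insert_iff simp_thms sum.empty add_0_right)
      moreover have "{i, i'} - {i} = {i'}" "{i, i'} - {i'} = {i}" using i(3) by auto
      ultimately have "?h z {i'} ?f + ?h z {i} ?f = 0" using c0 by (simp only:)
      then have "?h z {i'} ?f = ?h z {i} ?f" by (rule iffD2[OF bit_eq_iff_add])
      moreover have "?h z {i'} ?f = ?h z {i'} f'" by (rule local_cochainD[OF loc]) simp
      moreover have "?h z {i} ?f = ?h z {i} f" by (rule local_cochainD[OF loc]) (use i in simp)
      ultimately show ?thesis using h1 by metis
    qed
    have "?h z {i'} F \<noteq> 0" if "F \<in> PiE {i'} A" for F
    proof -
      have "?h z {i'} F = 1" by (rule one) (rule PiE_mem[OF that], simp)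
      then show ?thesis by (metis zero_neq_one)
    qed
    then have "{F \<in> PiE {i'} A. ?h z {i'} F \<noteq> 0} = PiE {i'} A" by blast
    then have "weight A (?h z) {i'} = 1"
      using A(1)[OF i(2)] unfolding weight_def by (simp add: card_PiE card_gt_0_iff)
    then have "1 = weight A (?h z) {i'}" by (rule sym)
    also have "weight A (?h z) {i'} \<le> total_weight A I (?h z) 1"
      unfolding total_weight_def using I i by (intro member_le_sum) (auto simp: weight_nonneg)
    also have "\<dots> \<le> selection_const DIM('a) * (2 ^ (DIM('a) + 1) + 2 * real DIM('a) * growth DIM('a) (DIM('a) - 1))"
      using total_h[of Basis e z] IHz nonempty_Basis by simp
    also have "\<dots> = 1 / 2"
    proof -
      have "2 ^ (DIM('a) + 1) + 2 * real DIM('a) * growth DIM('a) (DIM('a) - 1) > 0"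
        by (intro add_pos_nonneg mult_nonneg_nonneg growth_nonneg) auto
      then show ?thesis by (simp add: selection_const_def field_simps)
    qed
    finally show False by simp
  qed
  have eq: "cc Basis z {i} f = bd e Basis z {i} f" if "z \<in> Z" for z using h0[OF that] by (metis bit_eq_iff_add)
  have fi: "f i \<in> A i" using f i by blast
  \<comment> \<open>Genericity of the grid keeps \<open>f i\<close> off the walls, so exactly one
    cell contains it.\<close>
  have "\<exists>!k. k < N \<and> g b k \<le> f i \<bullet> b \<and> f i \<bullet> b \<le> g b (Suc k)" if b: "b \<in> Basis" for b
  proof -
    have sm: "strict_mono (g b)" using g_mono[OF b] by (simp add: strict_mono_Suc_iff)
    have notV: "f i \<bullet> b \<noteq> g b k" for k
    proof
      assume "f i \<bullet> b = g b k"
      then have "proj {b} (f i) \<notin> affine hull (proj {b} ` {f i})"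
        using V fi i b unfolding grid_generic_def by (elim allE[of _ "{b}"] allE[of _ "{f i}"] allE[of _ "f i"]) auto
      then show False by simp
    qed
    have ins: "g b 0 < f i \<bullet> b" "f i \<bullet> b < g b N" using inside[OF i(1) fi b] by auto
    define k where "k = (LEAST k. f i \<bullet> b < g b (Suc k))"
    have "N > 0" using ins by (cases N) auto
    then have "f i \<bullet> b < g b (Suc (N - 1))" using ins by simp
    then have k1: "f i \<bullet> b < g b (Suc k)" "k \<le> N - 1" unfolding k_def by (rule LeastI, intro Least_le)
    have k2: "g b k \<le> f i \<bullet> b"
    proof (cases k)
      case 0 then show ?thesis using ins by simp
    next
      case (Suc k')
      then have "\<not> f i \<bullet> b < g b (Suc k')" using not_less_Least[of k' "\<lambda>k. f i \<bullet> b < g b (Suc k)"] k_def by auto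
      then show ?thesis using Suc by simp
    qed
    show ?thesis
    proof (rule ex1I[of _ k])
      show "k < N \<and> g b k \<le> f i \<bullet> b \<and> f i \<bullet> b \<le> g b (Suc k)" using k1 k2 \<open>N > 0\<close> by auto
      fix l assume l: "l < N \<and> g b l \<le> f i \<bullet> b \<and> f i \<bullet> b \<le> g b (Suc l)"
      have "g b l < g b (Suc k)" "g b k < g b (Suc l)" using l k1 k2 notV[of "Suc l"] by auto
      then show "l = k" using strict_mono_less[OF sm] by (metis less_Suc_eq_le order_antisym)
    qed
  qed
  then have "\<forall>b\<in>Basis. \<exists>k. k < N \<and> g b k \<le> f i \<bullet> b \<and> f i \<bullet> b \<le> g b (Suc k) \<and> (\<forall>l. l < N \<and> g b l \<le> f i \<bullet> b \<and> f i \<bullet> b \<le> g b (Suc l) \<longrightarrow> l = k)"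
    unfolding Ex1_def by blast
  from bchoice[OF this] obtain k where k: "\<forall>b\<in>Basis. k b < N \<and> g b (k b) \<le> f i \<bullet> b \<and> f i \<bullet> b \<le> g b (Suc (k b)) \<and> (\<forall>l. l < N \<and> g b l \<le> f i \<bullet> b \<and> f i \<bullet> b \<le> g b (Suc l) \<longrightarrow> l = k b)"
    by (elim exE)
  define z0 where "z0 = (\<lambda>b\<in>Basis. k b)"
  have z0: "z0 \<in> Z" using k by (auto simp: z0_def Z_def)
  have "cc Basis z {i} f = of_bool (z = z0)" if z: "z \<in> Z" for z
  proof -
    have zb: "z b < N" if "b \<in> Basis" for b using z that by (auto simp: Z_def)
    have "f i \<in> cell Basis (\<lambda>b. g b (z b)) (\<lambda>b. g b (Suc (z b))) \<longleftrightarrow> (\<forall>b\<in>Basis. z b = k b)"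
      unfolding cell_def using k zb by (auto dest: bspec)
    also have "\<dots> \<longleftrightarrow> z = z0"
      using z z0 unfolding Z_def by (auto simp: z0_def intro!: PiE_ext[of z Basis "\<lambda>_. {..<N}"])
    finally show ?thesis by (simp add: cc_def hit_def)
  qed
  then have "(\<Sum>z\<in>Z. cc Basis z {i} f) = (\<Sum>z\<in>Z. of_bool (z = z0))" by (rule sum.cong[OF refl])
  also have "\<dots> = (\<Sum>z\<in>Z. if z = z0 then 1 else 0)" by (rule sum.cong) auto
  also have "\<dots> = (1::bit)" using z0 fZ by (simp only: sum.delta if_True)
  finally have L: "(\<Sum>z\<in>Z. cc Basis z {i} f) = 1" .
  \<comment> \<open>In a row of cells each inner wall is counted from both sides, and the two end
    walls are outer, where fillings vanish. So the same sum is both 1 and 0.\<close>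
  have tel: "(\<Sum>z\<in>Z. e (Basis - {b}) z {i} f + e (Basis - {b}) (z(b := Suc (z b))) {i} f) = 0" if b: "b \<in> Basis" for b
  proof -
    define \<phi> where "\<phi> = (\<lambda>z. e (Basis - {b}) z {i} f)"
    define P where "P = PiE (Basis - {b}) (\<lambda>_. {..<N})"
    have fP: "finite P" by (simp add: P_def finite_PiE)
    have ins: "insert b (Basis - {b}) = Basis" using b by blast
    have Zeq: "Z = (\<lambda>(y, w). w(b := y)) ` ({..<N} \<times> P)"
      unfolding Z_def P_def using PiE_insert_eq[of b "Basis - {b}" "\<lambda>_. {..<N}"] ins by simp
    have inj: "inj_on (\<lambda>(y, w). w(b := y)) ({..<N} \<times> P)"
      unfolding P_def using inj_combinator[of b "Basis - {b}" "\<lambda>_. {..<N}"] by simp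
    have "(\<Sum>z\<in>Z. \<phi> z + \<phi> (z(b := Suc (z b)))) = (\<Sum>(y, w)\<in>{..<N} \<times> P. \<phi> (w(b := y)) + \<phi> (w(b := Suc y)))"
      unfolding Zeq by (subst sum.reindex[OF inj]) (simp only: comp_def case_prod_beta' fun_upd_same fun_upd_upd)
    also have "\<dots> = (\<Sum>y<N. \<Sum>w\<in>P. \<phi> (w(b := y)) + \<phi> (w(b := Suc y)))"
      by (rule sum.cartesian_product[symmetric])
    also have "\<dots> = (\<Sum>w\<in>P. \<Sum>y<N. \<phi> (w(b := y)) + \<phi> (w(b := Suc y)))" by (rule sum.swap)
    also have "\<dots> = (\<Sum>w\<in>P. \<phi> (w(b := 0)) + \<phi> (w(b := N)))"
      unfolding lessThan_atLeast0 by (intro sum.cong refl bit_telescope) simp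
    also have "\<dots> = 0"
    proof (rule sum.neutral, intro ballI)
      fix w assume w: "w \<in> P"
      have wb: "w c < N" if "c \<in> Basis" "c \<noteq> b" for c using w that by (auto simp: P_def)
      have z: "\<phi> (w(b := n)) = 0" if n: "n = 0 \<or> n = N" for n
      proof -
        have "valid (Basis - {b}) (w(b := n))" using wb n by (auto simp: valid_def)
        moreover have "card (Basis - {b}) \<le> DIM('a) - 1" using b by (simp add: card_Diff_subset)
        ultimately have "good e (Basis - {b}) (w(b := n))" using e by blast
        moreover have "outer (Basis - {b}) (w(b := n))" using b n by (auto simp: outer_def)
        ultimately show ?thesis unfolding good_def \<phi>_def by blast
      qed
      show "\<phi> (w(b := 0)) + \<phi> (w(b := N)) = 0" using z[of 0] z[of N] by simp
    qed
    finally show ?thesis unfolding \<phi>_def .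
  qed
  have "(\<Sum>z\<in>Z. bd e Basis z {i} f) = (\<Sum>b\<in>Basis. \<Sum>z\<in>Z. e (Basis - {b}) z {i} f + e (Basis - {b}) (z(b := Suc (z b))) {i} f)"
    unfolding bd_def by (rule sum.swap)
  also have "\<dots> = 0" by (rule sum.neutral, rule ballI, rule tel)
  finally have "(\<Sum>z\<in>Z. bd e Basis z {i} f) = 0" .
  then show False using L eq by (simp cong: sum.cong)
qed

end

section \<open>Coloured selection\<close>

lemma card_PiE_fibre:
  assumes J: "finite J" "l \<in> J" and A: "\<And>j. j \<in> J \<Longrightarrow> finite (A j)" and S: "S \<subseteq> PiE J A"
    and fibre: "\<And>w. w \<in> PiE (J - {l}) A \<Longrightarrow> card {a \<in> A l. w(l := a) \<in> S} \<le> m"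
  shows "card S \<le> m * (\<Prod>j\<in>J - {l}. card (A j))"
proof -
  have ins: "insert l (J - {l}) = J" using J by blast
  have fP: "finite (PiE (J - {l}) A)" using J A by (intro finite_PiE) auto
  have "S \<subseteq> (\<Union>w\<in>PiE (J - {l}) A. (\<lambda>a. w(l := a)) ` {a \<in> A l. w(l := a) \<in> S})"
  proof
    fix f assume f: "f \<in> S"
    then have fP: "f \<in> PiE (insert l (J - {l})) A" using S ins by auto
    then obtain y w where "y \<in> A l" "w \<in> PiE (J - {l}) A" "f = w(l := y)" unfolding PiE_insert_eq by auto
    then show "f \<in> (\<Union>w\<in>PiE (J - {l}) A. (\<lambda>a. w(l := a)) ` {a \<in> A l. w(l := a) \<in> S})" using f by blast
  qed
  moreover have "finite (\<Union>w\<in>PiE (J - {l}) A. (\<lambda>a. w(l := a)) ` {a \<in> A l. w(l := a) \<in> S})"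
    using fP A[OF J(2)] by auto
  ultimately have "card S \<le> card (\<Union>w\<in>PiE (J - {l}) A. (\<lambda>a. w(l := a)) ` {a \<in> A l. w(l := a) \<in> S})" by (simp add: card_mono)
  also have "\<dots> \<le> (\<Sum>w\<in>PiE (J - {l}) A. card ((\<lambda>a. w(l := a)) ` {a \<in> A l. w(l := a) \<in> S}))" by (rule card_UN_le[OF fP])
  also have "\<dots> \<le> (\<Sum>w\<in>PiE (J - {l}) A. m)"
    using A[OF J(2)] fibre by (intro sum_mono order_trans[OF card_image_le fibre]) auto
  also have "\<dots> = m * (\<Prod>j\<in>J - {l}. card (A j))" using J by (simp add: card_PiE)
  finally show ?thesis .
qed

section \<open>Generic positions by avoiding null sets\<close>

lemma affine_negligible:
  fixes B :: "'a::euclidean_space set"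
  assumes "affine B" "B \<noteq> UNIV"
  shows "negligible B"
proof -
  have "aff_dim B < DIM('a)" using assms by (simp add: aff_dim_lt_full affine_hull_eq[THEN iffD2])
  then obtain a b where "a \<noteq> 0" "B \<subseteq> {x. a \<bullet> x = b}" by (rule aff_lowdim_subset_hyperplane)
  then show ?thesis using negligible_hyperplane negligible_subset by blast
qed

text \<open>The condition is affine in \<open>x\<close>. If it held for all \<open>x\<close>, the
  hull would contain 0 and the vectors of \<open>S\<close> and thus have dimension
  \<open>card S\<close>, more than \<open>card S\<close> points can span.\<close>

lemma proj_hull_negligible:
  fixes w :: "'a::euclidean_space"
  assumes S: "S \<subseteq> Basis" and \<sigma>: "finite \<sigma>" "card \<sigma> \<le> card S"
  shows "negligible {x. proj S (x + w) \<in> affine hull (proj S ` \<sigma>)}"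
proof (rule affine_negligible)
  show "affine {x. proj S (x + w) \<in> affine hull (proj S ` \<sigma>)}"
    unfolding affine_def[of "{x. proj S (x + w) \<in> affine hull (proj S ` \<sigma>)}"]
  proof (intro ballI allI impI)
    fix x y and u v :: real
    assume xy: "x \<in> {x. proj S (x + w) \<in> affine hull (proj S ` \<sigma>)}" "y \<in> {x. proj S (x + w) \<in> affine hull (proj S ` \<sigma>)}" and uv: "u + v = 1"
    have "u *\<^sub>R x + v *\<^sub>R y + w = u *\<^sub>R (x + w) + v *\<^sub>R (y + w)"
      using uv by (simp add: algebra_simps flip: scaleR_add_left)
    then have "proj S (u *\<^sub>R x + v *\<^sub>R y + w) = u *\<^sub>R proj S (x + w) + v *\<^sub>R proj S (y + w)"
      by (simp only: linear_add[OF proj_lin] linear_scale[OF proj_lin])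
    also have "\<dots> \<in> affine hull (proj S ` \<sigma>)"
      using xy uv by (intro mem_affine[OF affine_affine_hull]) auto
    finally show "u *\<^sub>R x + v *\<^sub>R y \<in> {x. proj S (x + w) \<in> affine hull (proj S ` \<sigma>)}" by simp
  qed
  show "{x. proj S (x + w) \<in> affine hull (proj S ` \<sigma>)} \<noteq> UNIV"
  proof
    assume all: "{x. proj S (x + w) \<in> affine hull (proj S ` \<sigma>)} = UNIV"
    have fS: "finite S" using S finite_Basis finite_subset by blast
    have "S \<subseteq> affine hull (proj S ` \<sigma>)" if "0 \<in> affine hull (proj S ` \<sigma>)"
    proof
      fix b assume b: "b \<in> S"
      have "proj S b = b" using S b by (subst euclidean_eq_iff) (auto simp: proj_inner inner_Basis)
      moreover have "b - w \<in> {x. proj S (x + w) \<in> affine hull (proj S ` \<sigma>)}" unfolding all by simp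
      ultimately show "b \<in> affine hull (proj S ` \<sigma>)" by simp
    qed
    moreover have zero: "0 \<in> affine hull (proj S ` \<sigma>)"
    proof -
      have "- w \<in> {x. proj S (x + w) \<in> affine hull (proj S ` \<sigma>)}" unfolding all by simp
      then show ?thesis by (simp add: linear_0[OF proj_lin])
    qed
    ultimately have "insert 0 S \<subseteq> affine hull (proj S ` \<sigma>)" by blast
    then have "aff_dim (insert 0 S) \<le> aff_dim (proj S ` \<sigma>)" using aff_dim_subset aff_dim_affine_hull by metis
    also have "aff_dim (proj S ` \<sigma>) \<le> int (card (proj S ` \<sigma>)) - 1" using \<sigma> by (intro aff_dim_le_card) auto
    also have "\<dots> \<le> int (card S) - 1" using \<sigma> card_image_le[of \<sigma> "proj S"] by simp
    also have "aff_dim (insert 0 S) = card S"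
    proof -
      have "independent S" using independent_Basis independent_mono S by blast
      then have "dim (insert 0 S) = card S" by (metis dim_eq_card_independent dim_span span_insert_0)
      then show ?thesis by (simp add: aff_dim_zero hull_inc)
    qed
    finally show False by simp
  qed
qed

lemma genericD:
  "generic X \<Longrightarrow> S \<subseteq> Basis \<Longrightarrow> \<sigma> \<subseteq> X \<Longrightarrow> card \<sigma> \<le> card S + 1 \<Longrightarrow> inj_on (proj S) \<sigma> \<and> \<not> affine_dependent (proj S ` \<sigma>)"
  by (simp add: generic_def)

text \<open>A bad new point lies in one of finitely many null sets, one for each \<open>S\<close>
  and each choice of at most \<open>card S\<close> old points, or coincides with an old point; these
  cannot cover an open set.\<close>

lemma generic_insert:
  fixes X :: "'a::euclidean_space set"
  assumes X: "generic X" and U: "open U" "U \<noteq> {}"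
  shows "\<exists>x\<in>U. x \<notin> X \<and> generic (insert x X)"
proof -
  have fX: "finite X" using X by (simp add: generic_def)
  define P where "P = {(S, \<sigma>). S \<subseteq> (Basis :: 'a set) \<and> \<sigma> \<subseteq> X \<and> card \<sigma> \<le> card S}"
  define B where "B = X \<union> (\<Union>(S, \<sigma>)\<in>P. {x. proj S (x + 0) \<in> affine hull (proj S ` \<sigma>)})"
  have "P \<subseteq> Pow Basis \<times> Pow X" by (auto simp: P_def)
  then have "finite P" using fX finite_subset by (metis finite_Basis finite_Pow_iff finite_SigmaI)
  have "negligible (\<Union>(S, \<sigma>)\<in>P. {x. proj S (x + 0) \<in> affine hull (proj S ` \<sigma>)})"
  proof (rule negligible_Union)
    fix T assume "T \<in> (\<lambda>(S, \<sigma>). {x. proj S (x + 0) \<in> affine hull (proj S ` \<sigma>)}) ` P"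
    then obtain S \<sigma> where T: "S \<subseteq> (Basis :: 'a set)" "\<sigma> \<subseteq> X" "card \<sigma> \<le> card S" "T = {x. proj S (x + 0) \<in> affine hull (proj S ` \<sigma>)}"
      by (auto simp: P_def)
    show "negligible T" unfolding T(4) by (rule proj_hull_negligible[OF T(1) finite_subset[OF T(2) fX] T(3)])
  qed (use \<open>finite P\<close> in simp)
  then have "negligible B" unfolding B_def by (rule negligible_Un[OF negligible_finite[OF fX]])
  then have "\<not> U \<subseteq> B" using U open_not_negligible negligible_subset by blast
  then obtain x where x: "x \<in> U" "x \<notin> B" by blast
  have "generic (insert x X)"
    unfolding generic_def
  proof (intro conjI allI impI)
    fix S \<sigma> assume S: "S \<subseteq> (Basis :: 'a set)" and \<sigma>: "\<sigma> \<subseteq> insert x X" "card \<sigma> \<le> card S + 1"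
    have "inj_on (proj S) \<sigma> \<and> \<not> affine_dependent (proj S ` \<sigma>)"
    proof (cases "x \<in> \<sigma>")
      case False
      then show ?thesis using X S \<sigma> unfolding generic_def by blast
    next
      case True
      then obtain \<tau> where \<tau>: "\<sigma> = insert x \<tau>" "x \<notin> \<tau>" by (metis mk_disjoint_insert)
      have s: "\<tau> \<subseteq> X" "finite \<tau>" using \<sigma> \<tau> fX finite_subset[of \<tau> X] by auto
      then have c: "card \<tau> \<le> card S" using \<sigma>(2) \<tau> by simp
      then have i: "inj_on (proj S) \<tau>" "\<not> affine_dependent (proj S ` \<tau>)" using X S s(1) unfolding generic_def by auto
      have nx: "proj S x \<notin> affine hull (proj S ` \<tau>)" using x(2) S s(1) c by (auto simp: B_def P_def)
      then have "proj S x \<notin> proj S ` \<tau>" using hull_inc by metis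
      then show ?thesis using i nx \<tau> by (auto simp: affine_independent_insert)
    qed
    then show "inj_on (proj S) \<sigma>" "\<not> affine_dependent (proj S ` \<sigma>)" by auto
  qed (use fX in auto)
  then show ?thesis using x by (auto simp: B_def)
qed

lemma generic_affine_hull_card:
  fixes X :: "'a::euclidean_space set"
  assumes X: "generic X" and T: "finite T" "card T \<le> DIM('a)"
  shows "card (X \<inter> affine hull T) \<le> DIM('a)"
proof (rule ccontr)
  assume "\<not> ?thesis"
  then have "DIM('a) + 1 \<le> card (X \<inter> affine hull T)" by simp
  then obtain \<sigma> where \<sigma>: "\<sigma> \<subseteq> X \<inter> affine hull T" "card \<sigma> = DIM('a) + 1" by (rule obtain_subset_with_card_n)
  have pB: "proj Basis = (id :: 'a \<Rightarrow> 'a)" by (auto simp: proj_def euclidean_representation)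
  have "\<not> affine_dependent (proj Basis ` \<sigma>)" using genericD[OF X, of Basis \<sigma>] \<sigma> by auto
  then have "aff_dim \<sigma> = DIM('a)" using aff_dim_affine_independent[of \<sigma>] \<sigma>(2) unfolding pB by simp
  moreover have "aff_dim \<sigma> \<le> aff_dim T" using \<sigma>(1) aff_dim_subset[of \<sigma> "affine hull T"] by simp
  moreover have "aff_dim T \<le> int (card T) - 1" using T by (intro aff_dim_le_card)
  ultimately show False using T by simp
qed

text \<open>A Lebesgue number argument: if a subfamily has empty intersection, the complements cover
  its compact union, so a small enough set misses a member. With the least such number over all
  subfamilies, the sets met by \<open>Y\<close> have a common point, possibly outside
  \<open>Y\<close>.\<close>

lemma mesh:
  fixes \<C> :: "'a::euclidean_space set set"
  assumes fin: "finite \<C>" and cpt: "\<And>C. C \<in> \<C> \<Longrightarrow> compact C"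
  shows "\<exists>\<eta>>0. \<forall>Y. bounded Y \<longrightarrow> diameter Y < \<eta> \<longrightarrow> (\<exists>z. \<forall>C\<in>\<C>. C \<inter> Y \<noteq> {} \<longrightarrow> z \<in> C)"
proof -
  have "\<exists>\<eta>>0. \<Inter>\<D> = {} \<longrightarrow> (\<forall>Y. bounded Y \<longrightarrow> diameter Y < \<eta> \<longrightarrow> (\<exists>C\<in>\<D>. C \<inter> Y = {}))" if D: "\<D> \<subseteq> \<C>" for \<D>
  proof (cases "\<Inter>\<D> = {}")
    case True
    have fD: "finite \<D>" using D fin finite_subset by blast
    have c: "compact (\<Union>\<D>)" using D fD cpt by (intro compact_Union) auto
    have "\<D> \<noteq> {}" using True by auto
    then have "uminus ` \<D> \<noteq> {}" "\<Union>\<D> \<subseteq> \<Union>(uminus ` \<D>)" using True by auto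
    moreover have "open B" if "B \<in> uminus ` \<D>" for B using that D cpt by (auto intro!: compact_imp_closed)
    ultimately obtain e where e: "0 < e" "\<And>T. T \<subseteq> \<Union>\<D> \<Longrightarrow> diameter T < e \<Longrightarrow> \<exists>B\<in>uminus ` \<D>. T \<subseteq> B"
      using Lebesgue_number_lemma[OF c] by metis
    have "\<exists>C\<in>\<D>. C \<inter> Y = {}" if Y: "bounded Y" "diameter Y < e" for Y
    proof -
      have "diameter (Y \<inter> \<Union>\<D>) \<le> diameter Y" using Y by (intro diameter_subset) auto
      then obtain C where "C \<in> \<D>" "Y \<inter> \<Union>\<D> \<subseteq> - C" using e(2)[of "Y \<inter> \<Union>\<D>"] Y by auto
      then show ?thesis by (intro bexI[of _ C]) auto
    qed
    then show ?thesis using e(1) by blast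
  qed (auto intro: exI[of _ 1])
  then obtain \<eta> where \<eta>: "\<And>\<D>. \<D> \<subseteq> \<C> \<Longrightarrow> \<eta> \<D> > (0::real)"
      "\<And>\<D> Y. \<D> \<subseteq> \<C> \<Longrightarrow> \<Inter>\<D> = {} \<Longrightarrow> bounded Y \<Longrightarrow> diameter Y < \<eta> \<D> \<Longrightarrow> \<exists>C\<in>\<D>. C \<inter> Y = {}"
    by metis
  let ?e = "Min (\<eta> ` Pow \<C>)"
  have "?e > 0" using fin \<eta>(1) by (subst Min_gr_iff) auto
  moreover have "\<exists>z. \<forall>C\<in>\<C>. C \<inter> Y \<noteq> {} \<longrightarrow> z \<in> C" if Y: "bounded Y" "diameter Y < ?e" for Y
  proof (rule ccontr)
    assume n: "\<not> ?thesis"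
    let ?D = "{C \<in> \<C>. C \<inter> Y \<noteq> {}}"
    have "\<Inter>?D = {}" using n by blast
    moreover have "?e \<le> \<eta> ?D" using fin by (intro Min_le) auto
    ultimately have "\<exists>C\<in>?D. C \<inter> Y = {}" using Y by (intro \<eta>(2)) auto
    then show False by blast
  qed
  ultimately show ?thesis by blast
qed

text \<open>A vertex with nonzero coefficient lies in the affine hull of \<open>z\<close> and the at
  most d - 1 other vertices, which contains at most d points of \<open>X\<close>. Given the other
  vertices, at most d of the at least \<open>t\<close> choices for that colour remain; summing over
  the colours gives the second factor d.\<close>

lemma point_in_hulls_card:
  fixes A :: "nat \<Rightarrow> 'a::euclidean_space set"
  assumes X: "generic X" and J: "finite J" "card J \<le> DIM('a)" "J \<noteq> {}"
    and A: "\<And>j. j \<in> J \<Longrightarrow> A j \<subseteq> X \<and> t \<le> card (A j)" and t: "t > 0"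
  shows "real (card {f \<in> PiE J A. z \<in> convex hull (f ` J)}) \<le> real DIM('a) ^ 2 / t * real (\<Prod>j\<in>J. card (A j))"
proof -
  have fA: "finite (A j)" if "j \<in> J" for j using A[OF that] X finite_subset by (auto simp: generic_def)
  have fP: "finite (PiE J A)" using J fA by (intro finite_PiE) auto
  define S where "S = (\<lambda>l. {f \<in> PiE J A. f l \<in> affine hull (insert z (f ` (J - {l})))})"
  have sub: "{f \<in> PiE J A. z \<in> convex hull (f ` J)} \<subseteq> (\<Union>l\<in>J. S l)"
  proof
    fix f assume f: "f \<in> {f \<in> PiE J A. z \<in> convex hull (f ` J)}"
    then obtain u where u: "\<forall>x\<in>f ` J. 0 \<le> u x" "sum u (f ` J) = 1" "(\<Sum>x\<in>f ` J. u x *\<^sub>R x) = z"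
      using convex_hull_finite[of "f ` J"] J by auto
    obtain y where y: "y \<in> f ` J" "u y \<noteq> 0" using u(2) by (metis sum.neutral zero_neq_one)
    then obtain l where l: "l \<in> J" "y = f l" by auto
    let ?Y = "f ` J - {y}"
    have fY: "finite ?Y" using J by auto
    have c: "u y + sum u ?Y = 1" "u y *\<^sub>R y + (\<Sum>x\<in>?Y. u x *\<^sub>R x) = z"
      using u(2,3) sum.remove[OF _ y(1), of u] sum.remove[OF _ y(1), of "\<lambda>x. u x *\<^sub>R x"] J by simp_all
    have "y = (1 / u y) *\<^sub>R z - (1 / u y) *\<^sub>R (\<Sum>x\<in>?Y. u x *\<^sub>R x)"
    proof -
      have "(1 / u y) *\<^sub>R z = (1 / u y) *\<^sub>R (u y *\<^sub>R y) + (1 / u y) *\<^sub>R (\<Sum>x\<in>?Y. u x *\<^sub>R x)" using c(2) by (metis scaleR_add_right)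
      then show ?thesis using y by simp
    qed
    also have "\<dots> \<in> affine hull (insert z ?Y)"
    proof (cases "z \<in> ?Y")
      case True
      define w where "w = (\<lambda>x. (if x = z then 1 / u y else 0) - u x / u y)"
      have "sum w ?Y = 1"
      proof -
        have "sum w ?Y = 1 / u y - sum u ?Y / u y" using True fY by (simp add: w_def sum_subtractf sum_divide_distrib sum.delta)
        also have "\<dots> = (1 - sum u ?Y) / u y" by (simp add: diff_divide_distrib)
        also have "\<dots> = 1" using c(1) y(2) by (simp add: field_simps)
        finally show ?thesis .
      qed
      moreover have "(\<Sum>x\<in>?Y. w x *\<^sub>R x) = (1 / u y) *\<^sub>R z - (1 / u y) *\<^sub>R (\<Sum>x\<in>?Y. u x *\<^sub>R x)"
      proof -
        have "(\<Sum>x\<in>?Y. w x *\<^sub>R x) = (\<Sum>x\<in>?Y. (if x = z then (1 / u y) *\<^sub>R z else 0)) - (\<Sum>x\<in>?Y. (u x / u y) *\<^sub>R x)"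
          unfolding sum_subtractf[symmetric] by (rule sum.cong) (auto simp: w_def scaleR_left_diff_distrib)
        then show ?thesis using True fY by (simp add: sum.delta scaleR_sum_right)
      qed
      ultimately show ?thesis using affine_hull_finite[of "insert z ?Y"] fY True by (auto simp: insert_absorb)
    next
      case False
      define w where "w = (\<lambda>x. if x = z then 1 / u y else - u x / u y)"
      have 1: "sum w ?Y = sum (\<lambda>x. - u x / u y) ?Y" using False by (intro sum.cong) (auto simp: w_def)
      have 2: "(\<Sum>x\<in>?Y. w x *\<^sub>R x) = (\<Sum>x\<in>?Y. (- u x / u y) *\<^sub>R x)" using False by (intro sum.cong) (auto simp: w_def)
      have "sum w (insert z ?Y) = 1 / u y - sum u ?Y / u y" using False fY 1 by (simp add: w_def sum_divide_distrib sum_negf)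
      also have "\<dots> = (1 - sum u ?Y) / u y" by (simp add: diff_divide_distrib)
      also have "\<dots> = 1" using c(1) y(2) by (simp add: field_simps)
      finally have "sum w (insert z ?Y) = 1" .
      moreover have "(\<Sum>x\<in>insert z ?Y. w x *\<^sub>R x) = (1 / u y) *\<^sub>R z - (1 / u y) *\<^sub>R (\<Sum>x\<in>?Y. u x *\<^sub>R x)"
        using False fY 2 by (simp add: w_def scaleR_sum_right sum_negf)
      ultimately show ?thesis using affine_hull_finite[of "insert z ?Y"] fY by auto
    qed
    also have "\<dots> \<subseteq> affine hull (insert z (f ` (J - {l})))" by (rule hull_mono) (use l in auto)
    finally show "f \<in> (\<Union>l\<in>J. S l)" using f l by (auto simp: S_def)
  qed
  have Sl: "real (card (S l)) \<le> real DIM('a) / t * real (\<Prod>j\<in>J. card (A j))" if l: "l \<in> J" for l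
  proof -
    have "card (S l) \<le> DIM('a) * (\<Prod>j\<in>J - {l}. card (A j))"
    proof (rule card_PiE_fibre[OF J(1) l fA])
      fix w assume w: "w \<in> PiE (J - {l}) A"
      have "{a \<in> A l. w(l := a) \<in> S l} \<subseteq> X \<inter> affine hull (insert z (w ` (J - {l})))"
        using A[OF l] by (auto simp: S_def)
      moreover have "card (insert z (w ` (J - {l}))) \<le> DIM('a)"
      proof -
        have "card (insert z (w ` (J - {l}))) \<le> card (w ` (J - {l})) + 1" using J by (simp add: card_insert_if)
        also have "card (w ` (J - {l})) \<le> card (J - {l})" using J by (intro card_image_le) auto
        also have "card (J - {l}) + 1 = card J" using J l by (metis Suc_eq_plus1 card_Suc_Diff1)
        finally show ?thesis using J by simp
      qed
      ultimately show "card {a \<in> A l. w(l := a) \<in> S l} \<le> DIM('a)"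
        using generic_affine_hull_card[OF X, of "insert z (w ` (J - {l}))"] J X
        by (meson card_mono finite_Int finite_Diff finite_imageI finite_insert generic_def order_trans)
    qed (auto simp: S_def)
    then have "real (card (S l)) \<le> real (DIM('a) * (\<Prod>j\<in>J - {l}. card (A j)))" by (rule of_nat_mono)
    also have "\<dots> \<le> real (DIM('a) * (\<Prod>j\<in>J - {l}. card (A j))) * (real (card (A l)) / t)"
    proof -
      have "1 \<le> real (card (A l)) / t" using A[OF l] t by simp
      then have "real (DIM('a) * (\<Prod>j\<in>J - {l}. card (A j))) * 1 \<le> real (DIM('a) * (\<Prod>j\<in>J - {l}. card (A j))) * (real (card (A l)) / t)"
        by (rule mult_left_mono) (rule of_nat_0_le_iff)
      then show ?thesis by (simp only: mult_1_right)
    qed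
    also have "\<dots> = real DIM('a) / t * real (\<Prod>j\<in>J. card (A j))"
      using l J by (simp add: prod.remove[of J l])
    finally show ?thesis .
  qed
  have "real (card {f \<in> PiE J A. z \<in> convex hull (f ` J)}) \<le> real (card (\<Union>l\<in>J. S l))"
    using sub fP J by (intro of_nat_mono card_mono) (auto simp: S_def)
  also have "\<dots> \<le> (\<Sum>l\<in>J. real (card (S l)))"
    using card_UN_le[OF J(1), of S] by (metis of_nat_mono of_nat_sum)
  also have "\<dots> \<le> (\<Sum>l\<in>J. real DIM('a) / t * real (\<Prod>j\<in>J. card (A j)))" by (intro sum_mono Sl)
  also have "\<dots> = card J * (real DIM('a) / t * real (\<Prod>j\<in>J. card (A j)))" by simp
  also have "\<dots> \<le> DIM('a) * (real DIM('a) / t * real (\<Prod>j\<in>J. card (A j)))"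
    using J by (intro mult_right_mono mult_nonneg_nonneg) (auto simp: prod_nonneg)
  finally show ?thesis by (simp add: power2_eq_square)
qed

lemma diameter_cell:
  fixes q :: "'a::euclidean_space \<Rightarrow> real"
  assumes "\<And>b. b \<in> Basis \<Longrightarrow> r b \<le> q b + h" "h \<ge> 0"
  shows "bounded (cell F q r)" "diameter (cell F q r) \<le> real DIM('a) * h"
proof -
  have d: "dist x y \<le> real DIM('a) * h" if "x \<in> cell F q r" "y \<in> cell F q r" for x y
  proof -
    have "dist x y \<le> (\<Sum>b\<in>Basis. \<bar>(x - y) \<bullet> b\<bar>)" unfolding dist_norm by (rule norm_le_l1)
    also have "\<dots> \<le> (\<Sum>b\<in>(Basis::'a set). h)"
    proof (rule sum_mono)
      fix b :: 'a assume b: "b \<in> Basis"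
      then show "\<bar>(x - y) \<bullet> b\<bar> \<le> h"
        using that assms(1)[OF b] assms(2) unfolding cell_def inner_diff_left by (cases "b \<in> F") force+
    qed
    finally show ?thesis by simp
  qed
  show "bounded (cell F q r)" unfolding bounded_two_points using d by blast
  show "diameter (cell F q r) \<le> real DIM('a) * h"
    using d assms by (intro diameter_le) (auto simp: dist_norm)
qed

text \<open>Otherwise the claim fails at every vertex of a fine generic grid. For cells of positive
  dimension, fineness makes the faces that meet a cell share a point, and faces with at most d
  vertices through one point are few once the classes are large. Then all assumptions of
  \<open>coloured_grid\<close> hold, which is impossible.\<close>

theorem coloured_selection:
  fixes A :: "nat \<Rightarrow> 'a::euclidean_space set"
  assumes I: "finite I" "card I = DIM('a) + 1"
    and A: "disjoint_family_on A I" and X: "generic (\<Union>i\<in>I. A i)"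
    and big: "\<And>i. i \<in> I \<Longrightarrow> real DIM('a) ^ 2 / selection_const DIM('a) \<le> real (card (A i))"
  shows "\<exists>p. (\<forall>\<sigma>\<subseteq>(\<Union>i\<in>I. A i). card \<sigma> = DIM('a) \<longrightarrow> p \<notin> affine hull \<sigma>) \<and>
     real (card {f \<in> PiE I A. p \<in> convex hull (f ` I)}) > selection_const DIM('a) * real (\<Prod>i\<in>I. card (A i))"
proof (rule ccontr)
  assume neg: "\<not> ?thesis"
  let ?X = "\<Union>i\<in>I. A i"
  have fX: "finite ?X" using X by (simp add: generic_def)
  then have fA: "finite (A i)" if "i \<in> I" for i using that finite_subset[of "A i" ?X] by blast
  have cA: "card (A i) > 0" if "i \<in> I" for i
  proof -
    have "0 < real DIM('a) ^ 2 / selection_const DIM('a)" using selection_const_pos DIM_positive[where 'a='a] by (intro divide_pos_pos) auto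
    then show ?thesis using big[OF that] by simp
  qed
  obtain \<eta> where \<eta>: "\<eta> > 0" "\<And>Y. bounded Y \<Longrightarrow> diameter Y < \<eta> \<Longrightarrow> \<exists>z. \<forall>C\<in>(\<lambda>\<sigma>. convex hull \<sigma>) ` Pow ?X. C \<inter> Y \<noteq> {} \<longrightarrow> z \<in> C"
  proof -
    have "\<exists>\<eta>>0. \<forall>Y. bounded Y \<longrightarrow> diameter Y < \<eta> \<longrightarrow> (\<exists>z. \<forall>C\<in>(\<lambda>\<sigma>. convex hull \<sigma>) ` Pow ?X. C \<inter> Y \<noteq> {} \<longrightarrow> z \<in> C)"
    proof (rule mesh)
      fix C assume "C \<in> (\<lambda>\<sigma>. convex hull \<sigma>) ` Pow ?X"
      then obtain \<sigma> where "\<sigma> \<subseteq> ?X" "C = convex hull \<sigma>" by blast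
      then show "compact C" using fX finite_subset finite_imp_compact_convex_hull by metis
    qed (use fX in simp)
    then show ?thesis using that by (elim exE conjE) blast
  qed
  \<comment> \<open>Cells of side \<open>h\<close> have diameter at most d h, half of the mesh bound
    \<eta>.\<close>
  define h where "h = \<eta> / (2 * real DIM('a))"
  have h: "h > 0" "real DIM('a) * h < \<eta>" using \<eta>(1) DIM_positive[where 'a='a] by (auto simp: h_def)
  \<comment> \<open>The offset \<open>o'\<close> has to be generic for all grid vertices at once;
    over the integer lattice this excludes countably many null sets.\<close>
  define W where "W = (\<lambda>k. \<Sum>b\<in>Basis. (h * real_of_int (k b)) *\<^sub>R b) ` PiE (Basis :: 'a set) (\<lambda>_. UNIV)"
  have cW: "countable W" unfolding W_def by (intro countable_image countable_PiE) auto
  define P where "P = {(S, \<sigma>). S \<subseteq> (Basis :: 'a set) \<and> \<sigma> \<subseteq> ?X \<and> card \<sigma> = card S}"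
  have "P \<subseteq> Pow Basis \<times> Pow ?X" by (auto simp: P_def)
  then have fP: "finite P" using fX finite_subset by (metis finite_Basis finite_Pow_iff finite_SigmaI)
  define B where "B = (\<Union>((S, \<sigma>), w)\<in>P \<times> W. {x. proj S (x + w) \<in> affine hull (proj S ` \<sigma>)})"
  have "negligible B"
    unfolding B_def
  proof (rule negligible_countable_Union)
    show "countable ((\<lambda>((S, \<sigma>), w). {x. proj S (x + w) \<in> affine hull (proj S ` \<sigma>)}) ` (P \<times> W))"
      using fP cW by (intro countable_image countable_SIGMA) (auto intro: countable_finite)
    fix T assume "T \<in> (\<lambda>((S, \<sigma>), w). {x. proj S (x + w) \<in> affine hull (proj S ` \<sigma>)}) ` (P \<times> W)"
    then obtain S \<sigma> w where T: "S \<subseteq> (Basis :: 'a set)" "\<sigma> \<subseteq> ?X" "card \<sigma> = card S" "T = {x. proj S (x + w) \<in> affine hull (proj S ` \<sigma>)}"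
    proof -
      from \<open>T \<in> _\<close> obtain Q where Q: "Q \<in> P \<times> W" "T = (\<lambda>((S, \<sigma>), w). {x. proj S (x + w) \<in> affine hull (proj S ` \<sigma>)}) Q" by (rule imageE)
      obtain S \<sigma> w where "Q = ((S, \<sigma>), w)" by (metis surj_pair)
      then show ?thesis using Q that[of S \<sigma> w] unfolding P_def by simp
    qed
    show "negligible T" unfolding T(4) by (rule proj_hull_negligible[OF T(1) finite_subset[OF T(2) fX]]) (simp add: T(3))
  qed
  then have "B \<noteq> UNIV" using open_not_negligible[of UNIV] by auto
  then obtain o' where o': "o' \<notin> B" by blast
  have o'_bad: "proj S (o' + w) \<notin> affine hull (proj S ` \<sigma>)" if "S \<subseteq> Basis" "\<sigma> \<subseteq> ?X" "card \<sigma> = card S" "w \<in> W" for S \<sigma> w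
  proof
    assume "proj S (o' + w) \<in> affine hull (proj S ` \<sigma>)"
    moreover have "((S, \<sigma>), w) \<in> P \<times> W" using that by (simp add: P_def)
    ultimately have "o' \<in> B" unfolding B_def by (intro UN_I[of "((S, \<sigma>), w)"]) simp_all
    then show False using o' by contradiction
  qed
  obtain L where L: "\<And>x. x \<in> ?X \<Longrightarrow> norm x \<le> L" using finite_imp_bounded[OF fX] unfolding bounded_iff by blast
  \<comment> \<open>\<open>M\<close> steps from \<open>o'\<close> in each coordinate direction lead
    beyond all points; the shift by \<open>M\<close> in \<open>g\<close> lets the indices start at
    0.\<close>
  define M where "M = nat \<lceil>(L + norm o') / h\<rceil> + 1"
  have M: "h * real M > L + norm o'"
  proof -
    have "(L + norm o') / h < real M" unfolding M_def by linarith
    then show ?thesis using h by (simp add: field_simps)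
  qed
  define g where "g = (\<lambda>b k. o' \<bullet> b + h * real_of_int (int k - int M))"
  define N where "N = 2 * M"
  have cg: "coloured_grid I A g N"
  proof
    show "finite I" "card I = DIM('a) + 1" "disjoint_family_on A I" "generic ?X" by fact+
    show "finite (A i) \<and> A i \<noteq> {}" if "i \<in> I" for i using fA[OF that] cA[OF that] by auto
    show "g b k < g b (Suc k)" for b k using h by (simp add: g_def algebra_simps)
    show gg: "grid_generic ?X (\<lambda>b. range (g b))"
      unfolding grid_generic_def
    proof (intro allI impI)
      fix S \<sigma> and y :: 'a
      assume S: "S \<subseteq> Basis" "\<sigma> \<subseteq> ?X" "card \<sigma> = card S" and y: "\<forall>b\<in>S. y \<bullet> b \<in> range (g b)"
      have "\<forall>b\<in>S. \<exists>k. y \<bullet> b = g b k" using y by auto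
      then obtain k where k: "\<forall>b\<in>S. y \<bullet> b = g b (k b)" by (metis bchoice)
      define k' where "k' = (\<lambda>b\<in>Basis. int (k b) - int M)"
      define w where "w = (\<Sum>b\<in>Basis. (h * real_of_int (k' b)) *\<^sub>R (b::'a))"
      have "w \<in> W" unfolding w_def W_def k'_def by (intro imageI) auto
      then have "proj S (o' + w) \<notin> affine hull (proj S ` \<sigma>)" by (rule o'_bad[OF S])
      moreover have "proj S y = proj S (o' + w)"
        unfolding proj_eq_iff[OF S(1)]
      proof
        fix b assume b: "b \<in> S"
        then have bB: "b \<in> Basis" using S by blast
        have "w \<bullet> b = h * real_of_int (k' b)" unfolding w_def using bB by simp
        then show "y \<bullet> b = (o' + w) \<bullet> b" using k b bB by (simp add: g_def k'_def inner_add_left)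
      qed
      ultimately show "proj S y \<notin> affine hull (proj S ` \<sigma>)" by simp
    qed
    show "g b 0 < x \<bullet> b \<and> x \<bullet> b < g b N" if "i \<in> I" "x \<in> A i" "b \<in> Basis" for i x b
    proof -
      have "\<bar>x \<bullet> b\<bar> \<le> L" "\<bar>o' \<bullet> b\<bar> \<le> norm o'" using L[of x] that Basis_le_norm order_trans by blast+
      then show ?thesis using M unfolding g_def N_def by (simp add: algebra_simps) linarith
    qed
    show "weight A (\<lambda>J f. hit (f ` J) F (\<lambda>b. g b (z b)) (\<lambda>b. g b (Suc (z b)))) J \<le> selection_const DIM('a)"
      if F: "F \<subseteq> Basis" "F \<noteq> {}" and J: "J \<subseteq> I" "card J = card (Basis - F) + 1" for F z J
    proof -
      let ?Y = "cell F (\<lambda>b. g b (z b)) (\<lambda>b. g b (Suc (z b)))"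
      have "bounded ?Y" "diameter ?Y \<le> real DIM('a) * h"
        by (rule diameter_cell[where h = h]; use h in \<open>simp add: g_def algebra_simps\<close>)+
      then obtain w where w: "\<forall>C\<in>(\<lambda>\<sigma>. convex hull \<sigma>) ` Pow ?X. C \<inter> ?Y \<noteq> {} \<longrightarrow> w \<in> C" using \<eta>(2)[of ?Y] h by auto
      have sub: "{f \<in> PiE J A. hit (f ` J) F (\<lambda>b. g b (z b)) (\<lambda>b. g b (Suc (z b))) \<noteq> 0} \<subseteq> {f \<in> PiE J A. w \<in> convex hull (f ` J)}"
      proof (rule Collect_mono, rule impI, elim conjE, rule conjI)
        fix f assume f: "f \<in> PiE J A" "hit (f ` J) F (\<lambda>b. g b (z b)) (\<lambda>b. g b (Suc (z b))) \<noteq> 0"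
        show "f \<in> PiE J A" by (rule f)
        have "f j \<in> A j" if "j \<in> J" for j using PiE_mem[OF f(1) that] .
        then have "f ` J \<in> Pow ?X" using J(1) by blast
        moreover have "convex hull (f ` J) \<inter> ?Y \<noteq> {}" using f(2) unfolding hit_def by simp
        ultimately show "w \<in> convex hull (f ` J)" using w[THEN bspec, OF imageI, of "f ` J"] by blast
      qed
      have fJ: "finite J" using J I finite_subset by blast
      have cJ: "card J \<le> DIM('a)"
      proof -
        have "card (Basis - F) < card (Basis :: 'a set)" using F by (intro psubset_card_mono) auto
        then show ?thesis using J by simp
      qed
      have Jne: "J \<noteq> {}" using J by auto
      define t where "t = Min ((\<lambda>j. card (A j)) ` J)"
      have tin: "t \<in> (\<lambda>j. card (A j)) ` J" unfolding t_def using fJ Jne by (intro Min_in) auto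
      have tle: "t \<le> card (A j)" if "j \<in> J" for j unfolding t_def using fJ that by (intro Min_le) auto
      have tpos: "t > 0" using tin cA J by auto
      have "real DIM('a) ^ 2 / selection_const DIM('a) \<le> t" using tin big J by auto
      then have td: "real DIM('a) ^ 2 / t \<le> selection_const DIM('a)"
        using tpos selection_const_pos[of "DIM('a)"] by (simp add: field_simps)
      have "real (card {f \<in> PiE J A. hit (f ` J) F (\<lambda>b. g b (z b)) (\<lambda>b. g b (Suc (z b))) \<noteq> 0}) \<le> real (card {f \<in> PiE J A. w \<in> convex hull (f ` J)})"
      proof (intro of_nat_mono card_mono[OF _ sub])
        have "finite (PiE J A)" using fJ fA J by (intro finite_PiE) auto
        then show "finite {f \<in> PiE J A. w \<in> convex hull (f ` J)}" by simp
      qed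
      also have "\<dots> \<le> real DIM('a) ^ 2 / t * real (\<Prod>j\<in>J. card (A j))"
        by (rule point_in_hulls_card[OF X fJ cJ Jne]) (use J tle tpos in auto)
      also have "\<dots> \<le> selection_const DIM('a) * real (\<Prod>j\<in>J. card (A j))"
        using td by (intro mult_right_mono) (auto simp: prod_nonneg)
      finally show ?thesis
      proof -
        assume le: "real (card {f \<in> PiE J A. hit (f ` J) F (\<lambda>b. g b (z b)) (\<lambda>b. g b (Suc (z b))) \<noteq> 0}) \<le> selection_const DIM('a) * real (\<Prod>j\<in>J. card (A j))"
        have "(\<Prod>j\<in>J. card (A j)) > 0" using cA J by (intro prod_pos) auto
        then show ?thesis using le unfolding weight_def by (subst pos_divide_le_eq) (simp_all only: of_nat_0_less_iff)
      qed
    qed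
    show "weight A (\<lambda>J f. hit (f ` J) {} (\<lambda>b. g b (z b)) (\<lambda>b. g b (Suc (z b)))) I \<le> selection_const DIM('a)" for z
    proof -
      define p where "p = (\<Sum>b\<in>Basis. g b (z b) *\<^sub>R (b::'a))"
      have pb: "p \<bullet> b = g b (z b)" if "b \<in> Basis" for b unfolding p_def using that by simp
      have "cell {} (\<lambda>b. g b (z b)) (\<lambda>b. g b (Suc (z b))) = {p}"
      proof -
        have "(\<forall>b\<in>Basis. y \<bullet> b = g b (z b)) \<longleftrightarrow> y = p" for y using pb euclidean_eq_iff[of y p] by metis
        then show ?thesis unfolding cell_def by simp
      qed
      then have eq: "{f \<in> PiE I A. hit (f ` I) {} (\<lambda>b. g b (z b)) (\<lambda>b. g b (Suc (z b))) \<noteq> 0} = {f \<in> PiE I A. p \<in> convex hull (f ` I)}"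
        by (simp add: hit_def)
      have pB: "proj Basis = (id :: 'a \<Rightarrow> 'a)" by (auto simp: proj_def euclidean_representation)
      have np: "p \<notin> affine hull \<sigma>" if "\<sigma> \<subseteq> ?X" "card \<sigma> = DIM('a)" for \<sigma>
      proof -
        have "proj Basis p \<notin> affine hull (proj Basis ` \<sigma>)" 
          by (rule gg[unfolded grid_generic_def, THEN spec, THEN spec, THEN spec, THEN mp, THEN mp, THEN mp, THEN mp]) (use that pb in simp_all)
        then show ?thesis unfolding pB by simp
      qed
      have le: "real (card {f \<in> PiE I A. p \<in> convex hull (f ` I)}) \<le> selection_const DIM('a) * real (\<Prod>i\<in>I. card (A i))"
      proof (rule ccontr)
        assume "\<not> ?thesis"
        then have "real (card {f \<in> PiE I A. p \<in> convex hull (f ` I)}) > selection_const DIM('a) * real (\<Prod>i\<in>I. card (A i))"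
          by (rule not_le_imp_less)
        then have "\<exists>p. (\<forall>\<sigma>\<subseteq>?X. card \<sigma> = DIM('a) \<longrightarrow> p \<notin> affine hull \<sigma>) \<and>
           real (card {f \<in> PiE I A. p \<in> convex hull (f ` I)}) > selection_const DIM('a) * real (\<Prod>i\<in>I. card (A i))"
          by (intro exI[of _ p]) (simp add: np)
        then show False by (rule notE[OF neg])
      qed
      have "(\<Prod>j\<in>I. card (A j)) > 0" using cA by (intro prod_pos) auto
      then have "0 < real (\<Prod>j\<in>I. card (A j))" by (rule of_nat_0_less_iff[THEN iffD2])
      from pos_divide_le_eq[OF this] show ?thesis using le unfolding weight_def eq by (simp only:)
    qed
  qed
  show False by (rule coloured_grid.contradiction[OF cg])
qed

section \<open>Hyperplanes through a point\<close>

lemma normal_to_few: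
  fixes W :: "'a::euclidean_space set"
  assumes "finite W" "card W < DIM('a)"
  shows "\<exists>n. n \<noteq> 0 \<and> (\<forall>x\<in>W. n \<bullet> (x - p) = 0)"
proof -
  have "dim ((\<lambda>x. x - p) ` W) \<le> card ((\<lambda>x. x - p) ` W)" using assms by (intro dim_le_card') auto
  also have "\<dots> \<le> card W" by (rule card_image_le[OF assms(1)])
  finally have "dim ((\<lambda>x. x - p) ` W) < DIM('a)" using assms by simp
  from lowdim_subset_hyperplane[OF this] obtain a where a: "a \<noteq> 0" "span ((\<lambda>x. x - p) ` W) \<subseteq> {x. a \<bullet> x = 0}" by metis
  have "a \<bullet> (x - p) = 0" if "x \<in> W" for x
  proof -
    have "x - p \<in> span ((\<lambda>x. x - p) ` W)" by (rule span_base) (rule imageI[OF that])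
    then show ?thesis using a(2) by blast
  qed
  then show ?thesis using a(1) by blast
qed

lemma dim_normals:
  fixes W :: "'a::euclidean_space set"
  shows "dim {y. \<forall>x\<in>W. y \<bullet> x = 0} + dim W = DIM('a)"
proof -
  have "dim {y \<in> UNIV. \<forall>x\<in>span W. orthogonal x y} + dim (span W) = dim (UNIV :: 'a set)"
    by (rule dim_subspace_orthogonal_to_vectors) auto
  moreover have "{y \<in> UNIV. \<forall>x\<in>span W. orthogonal x y} = {y. \<forall>x\<in>W. y \<bullet> x = 0}"
  proof (intro set_eqI iffI)
    fix y assume "y \<in> {y. \<forall>x\<in>W. y \<bullet> x = 0}"
    then have "orthogonal y x" if "x \<in> span W" for x
      by (intro orthogonal_to_span[OF that]) (auto simp: orthogonal_def)
    then show "y \<in> {y \<in> UNIV. \<forall>x\<in>span W. orthogonal x y}" by (simp add: orthogonal_commute)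
  qed (auto simp: orthogonal_def inner_commute span_base)
  ultimately show ?thesis by simp
qed

lemma second_normal:
  fixes W :: "'a::euclidean_space set"
  assumes W: "finite W" "card W + 2 \<le> DIM('a)"
  shows "\<exists>m. m \<notin> span {n} \<and> (\<forall>x\<in>W. m \<bullet> x = 0)"
proof (rule ccontr)
  assume "\<not> ?thesis"
  then have "{y. \<forall>x\<in>W. y \<bullet> x = 0} \<subseteq> span {n}" by blast
  then have "dim {y. \<forall>x\<in>W. y \<bullet> x = 0} \<le> card {n}" using dim_le_card[of _ "{n}"] by blast
  moreover have "dim W \<le> card W" using W by (intro dim_le_card') auto
  ultimately show False using dim_normals[of W] W by simp
qed

text \<open>Vectors orthogonal to two independent normals lie in a space of dimension d - 2, too
  small for d - 1 independent ones.\<close>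

lemma two_normals_dependent:
  fixes w :: "'i \<Rightarrow> 'a::euclidean_space"
  assumes L: "finite L" "card L + 1 = DIM('a)" and n: "n \<noteq> 0" "m \<notin> span {n}"
    and orth: "\<And>j. j \<in> L \<Longrightarrow> n \<bullet> w j = 0 \<and> m \<bullet> w j = 0"
  shows "\<exists>k\<in>L. w k \<in> span (w ` (L - {k}))"
proof (rule ccontr)
  assume neg: "\<not> ?thesis"
  have inj: "inj_on w L"
  proof (rule inj_onI, rule ccontr)
    fix x y assume xy: "x \<in> L" "y \<in> L" "w x = w y" "x \<noteq> y"
    then have "w x \<in> span (w ` (L - {x}))" by (intro span_base) auto
    then show False using neg xy by blast
  qed
  have "independent (w ` L)"
    unfolding dependent_def
  proof (intro notI, elim bexE)
    fix a assume a: "a \<in> w ` L" "a \<in> span (w ` L - {a})"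
    then obtain k where k: "k \<in> L" "a = w k" by blast
    then have "w ` L - {a} \<subseteq> w ` (L - {k})" by auto
    then have "w k \<in> span (w ` (L - {k}))" using a(2) k(2) span_mono subsetD by metis
    then show False using neg k(1) by blast
  qed
  then have 1: "dim (w ` L) = card L" using inj by (simp add: dim_eq_card_independent card_image)
  have "independent {m, n}" using n by (simp add: independent_insert)
  moreover have "{m, n} \<subseteq> {y. \<forall>x\<in>w ` L. y \<bullet> x = 0}" using orth by auto
  ultimately have "card {m, n} \<le> dim {y. \<forall>x\<in>w ` L. y \<bullet> x = 0}" by (intro independent_card_le_dim)
  moreover have "m \<noteq> n" by (rule notI) (use n(2) in \<open>simp add: span_base\<close>)
  ultimately show False using dim_normals[of "w ` L"] 1 L by simp
qed

lemma hull_meets_zero: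
  fixes V :: "'a::euclidean_space set"
  assumes "finite V"
  shows "(\<exists>x\<in>convex hull V. n \<bullet> x = c) \<longleftrightarrow> (\<exists>v\<in>V. n \<bullet> v \<le> c) \<and> (\<exists>v\<in>V. n \<bullet> v \<ge> c)"
proof
  assume "\<exists>x\<in>convex hull V. n \<bullet> x = c"
  then obtain x where x: "x \<in> convex hull V" "n \<bullet> x = c" by blast
  have "\<exists>v\<in>V. n \<bullet> v \<le> c"
  proof (rule ccontr)
    assume "\<not> ?thesis"
    then have "convex hull V \<subseteq> {y. n \<bullet> y > c}" by (intro hull_minimal convex_halfspace_gt) auto
    then show False using x by auto
  qed
  moreover have "\<exists>v\<in>V. n \<bullet> v \<ge> c"
  proof (rule ccontr)
    assume "\<not> ?thesis"
    then have "convex hull V \<subseteq> {y. n \<bullet> y < c}" by (intro hull_minimal convex_halfspace_lt) auto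
    then show False using x by auto
  qed
  ultimately show "(\<exists>v\<in>V. n \<bullet> v \<le> c) \<and> (\<exists>v\<in>V. n \<bullet> v \<ge> c)" by blast
next
  assume "(\<exists>v\<in>V. n \<bullet> v \<le> c) \<and> (\<exists>v\<in>V. n \<bullet> v \<ge> c)"
  then obtain v v' where v: "v \<in> V" "n \<bullet> v \<le> c" "v' \<in> V" "n \<bullet> v' \<ge> c" by blast
  then show "\<exists>x\<in>convex hull V. n \<bullet> x = c"
    using connected_ivt_hyperplane[of "convex hull V" v v' n c] hull_inc[of _ V] convex_connected[OF convex_convex_hull] by blast
qed

text \<open>A hyperplane through the origin meeting all the polytopes is rotated until it
  passes through a vertex of all but one of them.\<close>

lemma rotate_hyperplane:
  fixes V :: "'i \<Rightarrow> 'a::euclidean_space set"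
  assumes J: "finite J" "card J = DIM('a)" and V: "\<And>j. j \<in> J \<Longrightarrow> finite (V j)"
    and n: "n \<noteq> 0" "\<And>j. j \<in> J \<Longrightarrow> \<exists>x\<in>convex hull V j. n \<bullet> x = 0"
  shows "\<exists>n' m w. n' \<noteq> 0 \<and> m \<in> J \<and> (\<forall>j\<in>J - {m}. w j \<in> V j \<and> n' \<bullet> w j = 0) \<and> (\<exists>x\<in>convex hull V m. n' \<bullet> x = 0)"
proof -
  define ok where "ok = (\<lambda>n. n \<noteq> 0 \<and> (\<forall>j\<in>J. (\<exists>v\<in>V j. n \<bullet> v \<le> 0) \<and> (\<exists>v\<in>V j. n \<bullet> v \<ge> 0)))"
  define Z where "Z = (\<lambda>n. {j \<in> J. \<exists>v\<in>V j. n \<bullet> v = 0})"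
  have ZJ: "card (Z n) \<le> DIM('a)" for n unfolding Z_def using J by (metis (no_types, lifting) card_mono mem_Collect_eq subsetI)
  have ok_n: "ok n" unfolding ok_def using n hull_meets_zero[OF V] by blast
  \<comment> \<open>An extremal choice: among the hyperplanes meeting all polytopes, one that passes
    through a vertex of as many of them as possible.\<close>
  obtain n' where n': "ok n'" "\<And>y. ok y \<Longrightarrow> card (Z y) \<le> card (Z n')"
  proof -
    have "\<forall>y. ok y \<longrightarrow> card (Z y) < Suc DIM('a)" using ZJ by (simp add: less_Suc_eq_le)
    from ex_has_greatest_nat[of ok n "\<lambda>n. card (Z n)", OF ok_n this] show ?thesis using that by blast
  qed
  have fZ: "finite (Z n')" using J by (simp add: Z_def)
  have "card (Z n') + 1 \<ge> DIM('a)"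
  proof (rule ccontr)
    assume "\<not> ?thesis"
    then have small: "card (Z n') + 2 \<le> DIM('a)" by simp
    have "\<forall>j\<in>Z n'. \<exists>v. v \<in> V j \<and> n' \<bullet> v = 0" by (auto simp: Z_def)
    from bchoice[OF this] obtain w where w: "\<And>j. j \<in> Z n' \<Longrightarrow> w j \<in> V j \<and> n' \<bullet> w j = 0" by blast
    have "card (w ` Z n') + 2 \<le> DIM('a)" using small card_image_le[OF fZ, of w] by linarith
    then obtain m where m: "m \<notin> span {n'}" "\<And>j. j \<in> Z n' \<Longrightarrow> m \<bullet> w j = 0"
      using second_normal[of "w ` Z n'" n'] fZ by auto
    have m0: "m \<noteq> 0" using m(1) span_0 by auto
    have ZnJ: "Z n' \<noteq> J" using small J by auto
    define U where "U = (\<Union>j\<in>J - Z n'. V j)"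
    have fU: "finite U" unfolding U_def using J V by auto
    have nz: "n' \<bullet> v \<noteq> 0" if "v \<in> U" for v using that by (auto simp: U_def Z_def)
    have Vne: "V j \<noteq> {}" if "j \<in> J" for j using n'(1) that by (auto simp: ok_def)
    show False
    proof (cases "\<exists>v\<in>U. m \<bullet> v \<noteq> 0")
      \<comment> \<open>Here \<open>m\<close> vanishes on all remaining vertices, so it is itself an
        admissible normal, and its hyperplane has a vertex of every polytope.\<close>
      case False
      have Zm: "j \<in> Z m" if j: "j \<in> J" for j
      proof (cases "j \<in> Z n'")
        case True
        then show ?thesis using w m(2) j by (auto simp: Z_def)
      next
        case nZ: False
        obtain v where "v \<in> V j" using Vne[OF j] by blast
        then show ?thesis using False nZ j by (auto simp: Z_def U_def)
      qed
      have "ok m"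
        unfolding ok_def
      proof (intro conjI m0 ballI)
        fix j assume "j \<in> J"
        then obtain v where "v \<in> V j" "m \<bullet> v = 0" using Zm[of j] by (auto simp: Z_def)
        then show "\<exists>v\<in>V j. m \<bullet> v \<le> 0" "\<exists>v\<in>V j. m \<bullet> v \<ge> 0" by (auto intro: bexI[of _ v])
      qed
      moreover have "Z m = J" using Zm by (auto simp: Z_def)
      moreover have "card (Z n') < card J" using small J by simp
      ultimately show False using n'(2)[of m] by simp
    next
      case True
      \<comment> \<open>The parameters at which the hyperplane of \<open>n' + t m\<close> reaches a
        vertex in \<open>U\<close>. At the one of least modulus no vertex in \<open>U\<close> has
        crossed over yet, so all polytopes are still met, and one more of them in a vertex.\<close>
      define R where "R = (\<lambda>v. - (n' \<bullet> v) / (m \<bullet> v)) ` {v \<in> U. m \<bullet> v \<noteq> 0}"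
      have "finite R" "R \<noteq> {}" unfolding R_def using fU True by auto
      then obtain t where t: "t \<in> R" "\<And>s. s \<in> R \<Longrightarrow> \<bar>t\<bar> \<le> \<bar>s\<bar>"
        using ex_min_if_finite[of "abs ` R"] by (metis (no_types, lifting) arg_min_if_finite(1) arg_min_least)
      obtain v0 where v0: "v0 \<in> U" "m \<bullet> v0 \<noteq> 0" "t = - (n' \<bullet> v0) / (m \<bullet> v0)" using t(1) by (auto simp: R_def)
      let ?n = "n' + t *\<^sub>R m"
      have inner: "?n \<bullet> v = n' \<bullet> v + t * (m \<bullet> v)" for v by (simp add: inner_add_left)
      have tnz: "t \<noteq> 0" using v0 nz by auto
      have n0: "?n \<noteq> 0"
      proof
        assume "?n = 0"
        then have "n' = (- t) *\<^sub>R m" by (simp add: eq_neg_iff_add_eq_0)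
        then have "m = (- 1 / t) *\<^sub>R n'" using tnz by simp
        then show False using m(1) by (metis span_base span_scale singletonI)
      qed
      have bd: "\<bar>t * (m \<bullet> v)\<bar> \<le> \<bar>n' \<bullet> v\<bar>" if v: "v \<in> U" for v
      proof (cases "m \<bullet> v = 0")
        case False
        then have "- (n' \<bullet> v) / (m \<bullet> v) \<in> R" using v by (auto simp: R_def)
        then have "\<bar>t\<bar> \<le> \<bar>n' \<bullet> v\<bar> / \<bar>m \<bullet> v\<bar>" using t(2) by fastforce
        then show ?thesis using False by (simp add: abs_mult field_simps)
      qed simp
      have okn: "ok ?n"
        unfolding ok_def
      proof (intro conjI n0 ballI)
        fix j assume j: "j \<in> J"
        have "(\<exists>v\<in>V j. ?n \<bullet> v \<le> 0) \<and> (\<exists>v\<in>V j. ?n \<bullet> v \<ge> 0)"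
        proof (cases "j \<in> Z n'")
          case True
          then have "?n \<bullet> w j = 0" "w j \<in> V j" using w m(2) by (simp_all add: inner)
          then show ?thesis by (intro conjI bexI[of _ "w j"]) simp_all
        next
          case nZ: False
          obtain v v' where v: "v \<in> V j" "n' \<bullet> v \<le> 0" "v' \<in> V j" "n' \<bullet> v' \<ge> 0" using n'(1) j unfolding ok_def by blast
          have "v \<in> U" "v' \<in> U" using v j nZ by (auto simp: U_def)
          then have "?n \<bullet> v \<le> 0" "?n \<bullet> v' \<ge> 0" using bd[of v] bd[of v'] v unfolding inner by linarith+
          then show ?thesis using v by blast
        qed
        then show "\<exists>v\<in>V j. ?n \<bullet> v \<le> 0" "\<exists>v\<in>V j. ?n \<bullet> v \<ge> 0" by auto
      qed
      obtain j0 where j0: "j0 \<in> J" "j0 \<notin> Z n'" "v0 \<in> V j0" using v0 by (auto simp: U_def)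
      have "?n \<bullet> v0 = 0" unfolding inner using v0 by simp
      then have "j0 \<in> Z ?n" using j0 by (auto simp: Z_def simp del: inner_add_left)
      moreover have "Z n' \<subseteq> Z ?n"
      proof
        fix j assume j: "j \<in> Z n'"
        then have "?n \<bullet> w j = 0" "w j \<in> V j" "j \<in> J" using w m(2) by (simp_all add: inner, simp add: Z_def)
        then show "j \<in> Z ?n" unfolding Z_def by blast
      qed
      ultimately have "Z n' \<subset> Z ?n" using j0 by blast
      moreover have "finite (Z ?n)" using J by (simp add: Z_def)
      ultimately have "card (Z n') < card (Z ?n)" by (simp add: psubset_card_mono)
      then show False using n'(2)[OF okn] by simp
    qed
  qed
  then have "card (J - Z n') \<le> 1" using J fZ by (subst card_Diff_subset) (auto simp: Z_def)
  moreover have "J \<noteq> {}" using J DIM_positive[where 'a='a] by auto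
  ultimately obtain m where m: "m \<in> J" "J - {m} \<subseteq> Z n'"
  proof (cases "J - Z n' = {}")
    case False
    then obtain m where "m \<in> J - Z n'" by blast
    moreover have "card (J - Z n') = 1" using \<open>card (J - Z n') \<le> 1\<close> False J by (simp add: card_gt_0_iff le_antisym Suc_leI)
    ultimately have "J - Z n' = {m}" by (metis card_1_singletonE singletonD)
    then show ?thesis using that[of m] by blast
  qed (use that in blast)
  have "\<forall>j\<in>J - {m}. \<exists>v. v \<in> V j \<and> n' \<bullet> v = 0" using m by (auto simp: Z_def)
  from bchoice[OF this] obtain w where w: "\<forall>j\<in>J - {m}. w j \<in> V j \<and> n' \<bullet> w j = 0" by blast
  moreover have "\<exists>x\<in>convex hull V m. n' \<bullet> x = 0" using n'(1) m V hull_meets_zero unfolding ok_def by blast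
  moreover have "n' \<noteq> 0" using n'(1) by (simp add: ok_def)
  ultimately show ?thesis using m by blast
qed

text \<open>One fixed normal for each vertex set: the counting assigns a single hyperplane to every
  choice of vertices and applies the crossing bound to it.\<close>

definition normal_at :: "'a::euclidean_space \<Rightarrow> 'a set \<Rightarrow> 'a" where
  "normal_at p W = (SOME n. n \<noteq> 0 \<and> (\<forall>x\<in>W. n \<bullet> (x - p) = 0))"

lemma normal_at:
  fixes W :: "'a::euclidean_space set"
  assumes "finite W" "card W < DIM('a)"
  shows "normal_at p W \<noteq> 0" "x \<in> W \<Longrightarrow> normal_at p W \<bullet> (x - p) = 0"
  using someI_ex[OF normal_to_few[OF assms, of p]] unfolding normal_at_def by blast+

text \<open>The rotated hyperplane need not be the one fixed by \<open>normal_at\<close>. If the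
  normals are not proportional, the vectors from \<open>p\<close> to the chosen vertices are
  dependent, so some \<open>w k\<close> lies in every hyperplane through \<open>p\<close> and the
  other vertices; exchanging \<open>w k\<close> for a vertex of the polytope left out gives the
  claim with \<open>k\<close>.\<close>

lemma common_hyperplane_vertices:
  fixes V :: "'i \<Rightarrow> 'a::euclidean_space set"
  assumes J: "finite J" "card J = DIM('a)" and V: "\<And>j. j \<in> J \<Longrightarrow> finite (V j)"
    and n: "n \<noteq> 0" "\<And>j. j \<in> J \<Longrightarrow> \<exists>x\<in>convex hull V j. n \<bullet> x = n \<bullet> p"
  shows "\<exists>k\<in>J. \<exists>w. (\<forall>j\<in>J - {k}. w j \<in> V j) \<and> (\<exists>x\<in>convex hull V k. normal_at p (w ` (J - {k})) \<bullet> x = normal_at p (w ` (J - {k})) \<bullet> p)"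
proof -
  let ?V = "\<lambda>j. (\<lambda>x. x - p) ` V j"
  have hull: "convex hull ?V j = (\<lambda>x. x - p) ` (convex hull V j)" for j
    using convex_hull_translation[of "- p" "V j"] by simp
  have meet: "(\<exists>x\<in>convex hull ?V j. y \<bullet> x = 0) \<longleftrightarrow> (\<exists>x\<in>convex hull V j. y \<bullet> x = y \<bullet> p)" for y j
    unfolding hull by (simp add: inner_diff_right)
  obtain n' m w' where n': "n' \<noteq> 0" "m \<in> J" "\<forall>j\<in>J - {m}. w' j \<in> ?V j \<and> n' \<bullet> w' j = 0" "\<exists>x\<in>convex hull ?V m. n' \<bullet> x = 0"
  proof -
    have "\<exists>n' m w. n' \<noteq> 0 \<and> m \<in> J \<and> (\<forall>j\<in>J - {m}. w j \<in> ?V j \<and> n' \<bullet> w j = 0) \<and> (\<exists>x\<in>convex hull ?V m. n' \<bullet> x = 0)"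
      by (rule rotate_hyperplane[OF J _ n(1)]) (simp_all only: meet n(2) finite_imageI V)
    then show ?thesis using that by (elim exE conjE)
  qed
  define w where "w = (\<lambda>j. w' j + p)"
  have w: "w j \<in> V j" "n' \<bullet> (w j - p) = 0" if "j \<in> J - {m}" for j using n'(3)[rule_format, OF that] by (auto simp: w_def)
  have cJ: "card (u ` (J - {k})) < DIM('a)" if "k \<in> J" for k and u :: "'i \<Rightarrow> 'a"
  proof -
    have "card (u ` (J - {k})) \<le> card (J - {k})" using J by (intro card_image_le) auto
    also have "\<dots> < card J" using J(1) that by (rule card_Diff1_less)
    finally show ?thesis using J by simp
  qed
  let ?n = "normal_at p (w ` (J - {m}))"
  have nn: "?n \<noteq> 0" "\<And>j. j \<in> J - {m} \<Longrightarrow> ?n \<bullet> (w j - p) = 0"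
    using normal_at(1)[OF _ cJ[OF n'(2), of w], of p] normal_at(2)[OF _ cJ[OF n'(2), of w], of _ p] J by auto
  show ?thesis
  proof (cases "n' \<in> span {?n}")
    case True
    then obtain s where s: "n' = s *\<^sub>R ?n" unfolding span_singleton by blast
    then have "s \<noteq> 0" using n'(1) by auto
    then have "\<exists>x\<in>convex hull V m. ?n \<bullet> x = ?n \<bullet> p" using n'(4) unfolding meet s by simp
    then show ?thesis using n'(2) w by blast
  next
    case False
    have "card (J - {m}) + 1 = DIM('a)" using J n'(2) by (metis Suc_eq_plus1 card_Suc_Diff1)
    then obtain k where k: "k \<in> J - {m}" "w k - p \<in> span ((\<lambda>j. w j - p) ` (J - {m} - {k}))"
      using two_normals_dependent[of "J - {m}" ?n n' "\<lambda>j. w j - p"] J nn False w by blast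
    have "V m \<noteq> {}" using n'(4) by auto
    then obtain v where v: "v \<in> V m" by blast
    let ?w = "w(m := v)"
    let ?N = "normal_at p (?w ` (J - {k}))"
    have N: "?N \<bullet> (?w j - p) = 0" if "j \<in> J - {k}" for j
      using normal_at(2)[OF _ cJ[of k ?w], of "?w j" p] J k that by auto
    have "orthogonal ?N (w k - p)"
    proof (rule orthogonal_to_span[OF k(2)])
      fix x assume "x \<in> (\<lambda>j. w j - p) ` (J - {m} - {k})"
      then obtain j where "j \<in> J - {m} - {k}" "x = w j - p" by blast
      then show "orthogonal ?N x" using N[of j] by (auto simp: orthogonal_def)
    qed
    then have "?N \<bullet> w k = ?N \<bullet> p" by (simp add: orthogonal_def inner_diff_right)
    moreover have "w k \<in> convex hull V k" using w(1)[OF k(1)] by (rule hull_inc)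
    moreover have "\<forall>j\<in>J - {k}. ?w j \<in> V j" using w v by auto
    ultimately show ?thesis using k(1) by blast
  qed
qed

section \<open>Tuples without a hyperplane through the point that meets d of the sets\<close>

definition robust :: "nat set \<Rightarrow> 'a::euclidean_space \<Rightarrow> (nat \<Rightarrow> 'a set) \<Rightarrow> bool" where
  "robust I p T \<longleftrightarrow> (\<forall>i\<in>I. \<forall>n. n \<noteq> 0 \<longrightarrow> (\<exists>j\<in>I - {i}. \<forall>x\<in>T j. n \<bullet> x \<noteq> n \<bullet> p))"

text \<open>A nonzero coefficient would express one \<open>w k - p\<close> by the d - 1 others, and
  a normal to those defines a hyperplane through \<open>p\<close> meeting all sets except perhaps
  \<open>T i\<close>.\<close>

lemma robust_no_dependency:
  assumes rob: "robust I p T" and I: "finite I" "card I = DIM('a) + 1" "i \<in> I"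
    and w: "\<And>j. j \<in> I - {i} \<Longrightarrow> w j \<in> (T j :: 'a::euclidean_space set)"
    and dep: "(\<Sum>j\<in>I - {i}. c j *\<^sub>R (w j - p)) = 0" and k: "k \<in> I - {i}"
  shows "c k = 0"
proof (rule ccontr)
  assume ck: "c k \<noteq> 0"
  let ?L = "I - {i} - {k}"
  have "c k *\<^sub>R (w k - p) + (\<Sum>j\<in>?L. c j *\<^sub>R (w j - p)) = 0" using dep I k by (subst sum.remove[symmetric]) auto
  then have wk: "w k - p = (- 1 / c k) *\<^sub>R (\<Sum>j\<in>?L. c j *\<^sub>R (w j - p))"
  proof -
    have "(1 / c k) *\<^sub>R (c k *\<^sub>R (w k - p)) = (1 / c k) *\<^sub>R (- (\<Sum>j\<in>?L. c j *\<^sub>R (w j - p)))"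
      by (rule arg_cong[where f = "\<lambda>x. (1 / c k) *\<^sub>R x"]) (use \<open>c k *\<^sub>R (w k - p) + _ = 0\<close> in \<open>simp only: eq_neg_iff_add_eq_0\<close>)
    then show ?thesis using ck by simp
  qed
  have "card (I - {i}) = DIM('a)" using I by simp
  then have "card ?L = DIM('a) - 1" using k by simp
  then have "card (w ` ?L) < DIM('a)" using card_image_le[of ?L w] I DIM_positive[where 'a='a] finite_Diff[OF finite_Diff[OF I(1)]] by (metis diff_less le_less_trans zero_less_one)
  then obtain n where n: "n \<noteq> 0" "\<And>j. j \<in> ?L \<Longrightarrow> n \<bullet> (w j - p) = 0"
    using normal_to_few[of "w ` ?L" p] I by auto
  have "n \<bullet> (w k - p) = 0" unfolding wk by (simp add: inner_sum_right n(2))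
  then have "n \<bullet> w j = n \<bullet> p" if "j \<in> I - {i}" for j
    using n(2)[of j] that by (cases "j = k") (auto simp: inner_diff_right)
  then show False using rob n(1) I(3) w unfolding robust_def by blast
qed

text \<open>Both \<open>x - p\<close> and \<open>p - x\<close> would be in the cone over the \<open>T j - p\<close>, \<open>j \<noteq> i\<close>, for a suitable \<open>i\<close>.\<close>

lemma robust_hulls_disjoint:
  fixes T :: "nat \<Rightarrow> 'a::euclidean_space set"
  assumes rob: "robust I p T" and I: "finite I" "card I = DIM('a) + 1"
    and T: "\<And>i. i \<in> I \<Longrightarrow> convex (T i)" and v: "\<And>i. i \<in> I \<Longrightarrow> v i \<in> T i" and p: "p \<in> convex hull (v ` I)"
  shows "(\<Inter>i\<in>I. convex hull (\<Union>j\<in>I - {i}. T j)) = {}"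
proof (rule ccontr)
  assume "\<not> ?thesis"
  then obtain x where x: "\<And>i. i \<in> I \<Longrightarrow> x \<in> convex hull (\<Union>j\<in>I - {i}. T j)" by blast
  have "v ` I = (\<Union>i\<in>I. {v i})" by blast
  then have "p \<in> convex hull (\<Union>i\<in>I. {v i})" using p by simp
  then obtain lam where l: "\<forall>i\<in>I. lam i \<ge> 0" "sum lam I = 1" "(\<Sum>i\<in>I. lam i *\<^sub>R v i) = p"
    unfolding convex_hull_finite_union[OF I(1), of "\<lambda>i. {v i}", simplified] by auto
  have dep: "(\<Sum>i\<in>I. lam i *\<^sub>R (v i - p)) = 0"
    using l by (simp add: scaleR_diff_right sum_subtractf flip: scaleR_left.sum)
  have lpos: "lam i > 0" if i: "i \<in> I" for i
  proof (rule ccontr)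
    assume "\<not> lam i > 0"
    then have "lam i = 0" using l(1) i by force
    then have "(\<Sum>j\<in>I - {i}. lam j *\<^sub>R (v j - p)) = 0" using dep I i by (simp add: sum.remove)
    then have "lam k = 0" if "k \<in> I - {i}" for k
      using robust_no_dependency[OF rob I i _ _ that, of v lam] v by blast
    then have "sum lam I = 0" using \<open>lam i = 0\<close> by (intro sum.neutral) auto
    then show False using l(2) by simp
  qed
  obtain i0 where i0: "i0 \<in> I" using I by fastforce
  obtain \<mu> where mu: "x - p = (\<Sum>j\<in>I. \<mu> j *\<^sub>R (v j - p))"
  proof -
    let ?L = "I - {i0}" and ?u = "\<lambda>j. v j - p"
    have dep0: "c k = 0" if "(\<Sum>j\<in>?L. c j *\<^sub>R ?u j) = 0" "k \<in> ?L" for c k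
      using robust_no_dependency[OF rob I i0 _ that] v by blast
    have inj: "inj_on ?u ?L"
    proof (rule inj_onI, rule ccontr)
      fix a b assume ab: "a \<in> ?L" "b \<in> ?L" "?u a = ?u b" "a \<noteq> b"
      define c where "c = (\<lambda>j. if j = a then 1 else if j = b then - 1 else (0::real))"
      have "(\<Sum>j\<in>?L. c j *\<^sub>R ?u j) = (\<Sum>j\<in>{a, b}. c j *\<^sub>R ?u j)"
        using I ab by (intro sum.mono_neutral_right) (auto simp: c_def)
      also have "\<dots> = 0" using ab by (simp add: c_def)
      finally have "c a = 0" using dep0 ab by blast
      then show False by (simp add: c_def)
    qed
    have ind: "independent (?u ` ?L)"
    proof (rule independent_if_scalars_zero)
      fix f y assume "(\<Sum>y\<in>?u ` ?L. f y *\<^sub>R y) = 0" and y: "y \<in> ?u ` ?L"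
      then have "(\<Sum>j\<in>?L. f (?u j) *\<^sub>R ?u j) = 0" by (simp add: sum.reindex[OF inj])
      then show "f y = 0" using dep0[of "\<lambda>j. f (?u j)"] y by blast
    qed (use I in auto)
    have "card (?u ` ?L) = DIM('a)" using inj I i0 by (simp add: card_image)
    then have "span (?u ` ?L) = UNIV" using ind by (metis card_eq_dim dim_UNIV independent_imp_finite subset_UNIV top.extremum_uniqueI)
    then have "x - p \<in> span (?u ` ?L)" by simp
    then obtain f where f: "x - p = (\<Sum>y\<in>?u ` ?L. f y *\<^sub>R y)" using I span_finite[of "?u ` ?L"] by auto
    have "x - p = (\<Sum>j\<in>?L. f (?u j) *\<^sub>R ?u j)" using f by (simp add: sum.reindex[OF inj])
    also have "\<dots> = (\<Sum>j\<in>I. (if j = i0 then 0 else f (?u j)) *\<^sub>R ?u j)"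
      using I i0 by (subst sum.remove[of I i0]) (auto intro!: sum.cong)
    finally show ?thesis by (rule that)
  qed
  \<comment> \<open>Subtracting \<mu> from a suitable multiple of the positive dependence
    \<open>lam\<close> writes \<open>p - x\<close> with nonnegative coefficients; the maximal ratio
    makes the one at \<open>i\<close> zero.\<close>
  obtain i where i: "i \<in> I" "\<And>j. j \<in> I \<Longrightarrow> \<mu> j / lam j \<le> \<mu> i / lam i"
  proof -
    have "Max ((\<lambda>j. \<mu> j / lam j) ` I) \<in> (\<lambda>j. \<mu> j / lam j) ` I" using I i0 by (intro Max_in) auto
    then obtain i where i: "i \<in> I" "Max ((\<lambda>j. \<mu> j / lam j) ` I) = \<mu> i / lam i" by auto
    have "\<mu> j / lam j \<le> \<mu> i / lam i" if "j \<in> I" for j unfolding i(2)[symmetric] using I that by (intro Max_ge) auto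
    then show ?thesis using i(1) that by blast
  qed
  define a where "a = (\<lambda>j. (\<mu> i / lam i) * lam j - \<mu> j)"
  have a0: "a j \<ge> 0" if "j \<in> I" for j using i(2)[OF that] lpos[OF that] by (simp add: a_def pos_divide_le_eq)
  have "(\<Sum>j\<in>I. a j *\<^sub>R (v j - p)) = (\<mu> i / lam i) *\<^sub>R (\<Sum>j\<in>I. lam j *\<^sub>R (v j - p)) - (\<Sum>j\<in>I. \<mu> j *\<^sub>R (v j - p))"
    by (simp add: a_def scaleR_diff_left sum_subtractf scaleR_sum_right)
  then have asum: "(\<Sum>j\<in>I. a j *\<^sub>R (v j - p)) = p - x" unfolding dep mu[symmetric] by simp
  have "a i = 0" using lpos[OF i(1)] by (simp add: a_def)
  then have asum: "(\<Sum>j\<in>I - {i}. a j *\<^sub>R (v j - p)) = p - x" using asum I i(1) by (simp add: sum.remove)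
  have "x \<in> convex hull (\<Union>j\<in>I - {i}. T j)" by (rule x[OF i(1)])
  then obtain b q where b: "\<forall>j\<in>I - {i}. b j \<ge> 0" "sum b (I - {i}) = 1" "\<forall>j\<in>I - {i}. q j \<in> T j" "x = (\<Sum>j\<in>I - {i}. b j *\<^sub>R q j)"
  proof -
    have "\<forall>j\<in>I - {i}. convex (T j) \<and> T j \<noteq> {}" using T v by auto
    from convex_hull_finite_union[OF _ this] I x[OF i(1)] that show ?thesis by auto
  qed
  have bsum: "(\<Sum>j\<in>I - {i}. b j *\<^sub>R (q j - p)) = x - p"
    using b(2,4) by (simp add: scaleR_diff_right sum_subtractf flip: scaleR_left.sum)
  define c where "c = (\<lambda>j. a j + b j)"
  \<comment> \<open>Convexity merges \<open>v j\<close> and \<open>q j\<close> into one point of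
    \<open>T j\<close> with weight \<open>a j + b j\<close>. Adding the representations of
    \<open>p - x\<close> and \<open>x - p\<close> gives a vanishing combination, so all weights
    vanish, although those in \<open>b\<close> sum to one.\<close>
  define w where "w = (\<lambda>j. if c j = 0 then v j else (a j / c j) *\<^sub>R v j + (b j / c j) *\<^sub>R q j)"
  have wT: "w j \<in> T j" if j: "j \<in> I - {i}" for j
  proof (cases "c j = 0")
    case True then show ?thesis using v j by (simp add: w_def)
  next
    case False
    have "a j \<ge> 0" "b j \<ge> 0" using a0 b j by auto
    then have "(a j / c j) *\<^sub>R v j + (b j / c j) *\<^sub>R q j \<in> T j"
      using False T[of j] v[of j] b(3) j by (intro convexD) (auto simp: c_def add_divide_distrib[symmetric])
    then show ?thesis using False by (simp add: w_def)
  qed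
  have "c j *\<^sub>R (w j - p) = a j *\<^sub>R (v j - p) + b j *\<^sub>R (q j - p)" if j: "j \<in> I - {i}" for j
  proof (cases "c j = 0")
    case True
    then have "a j = 0" "b j = 0" using a0[of j] b(1) j by (auto simp: c_def add_nonneg_eq_0_iff)
    then show ?thesis using True by simp
  next
    case False
    then have "c j *\<^sub>R w j = a j *\<^sub>R v j + b j *\<^sub>R q j" by (simp add: w_def scaleR_add_right)
    then show ?thesis by (simp add: scaleR_diff_right c_def scaleR_add_left algebra_simps)
  qed
  then have "(\<Sum>j\<in>I - {i}. c j *\<^sub>R (w j - p)) = (\<Sum>j\<in>I - {i}. a j *\<^sub>R (v j - p)) + (\<Sum>j\<in>I - {i}. b j *\<^sub>R (q j - p))"
    by (simp add: sum.distrib)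
  then have "(\<Sum>j\<in>I - {i}. c j *\<^sub>R (w j - p)) = 0" unfolding asum bsum by simp
  then have c0: "c k = 0" if "k \<in> I - {i}" for k using robust_no_dependency[OF rob I i(1) wT _ that] by blast
  have "b k = 0" if "k \<in> I - {i}" for k
    using c0[OF that] a0[of k] b(1) that by (auto simp: c_def add_nonneg_eq_0_iff)
  then show False using b(2) by simp
qed

text \<open>With colours \<open>i\<close> and \<open>k\<close> chosen and the sets of all colours
  but \<open>k\<close> fixed, at most \<open>(d + 1) ^ (d - 1)\<close> choices of vertices in the
  colours other than \<open>i\<close> and \<open>k\<close> remain. Each determines one hyperplane
  through \<open>p\<close>, which crosses at most \<open>h\<close> candidates for colour
  \<open>k\<close>.\<close>

lemma nonrobust_card:
  fixes \<A> :: "nat \<Rightarrow> 'a::euclidean_space set set" and V :: "'a set \<Rightarrow> 'a set"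
  assumes I: "finite I" "card I = DIM('a) + 1" and fin: "\<And>i. i \<in> I \<Longrightarrow> finite (\<A> i)"
    and V: "\<And>i K. i \<in> I \<Longrightarrow> K \<in> \<A> i \<Longrightarrow> finite (V K) \<and> card (V K) \<le> DIM('a) + 1 \<and> K = convex hull (V K)"
    and meets: "\<And>i n b. i \<in> I \<Longrightarrow> n \<noteq> 0 \<Longrightarrow> card {K \<in> \<A> i. \<exists>x\<in>K. n \<bullet> x = b} \<le> h"
  shows "card {T \<in> PiE I \<A>. \<not> robust I p T} \<le>
    (\<Sum>i\<in>I. \<Sum>k\<in>I - {i}. (DIM('a) + 1) ^ (DIM('a) - 1) * h * (\<Prod>j\<in>I - {k}. card (\<A> j)))"
proof -
  define S where "S = (\<lambda>i k. {T \<in> PiE I \<A>. \<exists>w. (\<forall>j\<in>I - {i} - {k}. w j \<in> V (T j)) \<and>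
     (\<exists>x\<in>T k. normal_at p (w ` (I - {i} - {k})) \<bullet> x = normal_at p (w ` (I - {i} - {k})) \<bullet> p)})"
  have fP: "finite (PiE I \<A>)" using I fin by (intro finite_PiE) auto
  have cI: "card (I - {i}) = DIM('a)" if "i \<in> I" for i using I that by simp
  have "{T \<in> PiE I \<A>. \<not> robust I p T} \<subseteq> (\<Union>i\<in>I. \<Union>k\<in>I - {i}. S i k)"
  proof
    fix T assume "T \<in> {T \<in> PiE I \<A>. \<not> robust I p T}"
    then have T: "T \<in> PiE I \<A>" and "\<not> robust I p T" by auto
    then obtain i n where i: "i \<in> I" "n \<noteq> 0" "\<And>j. j \<in> I - {i} \<Longrightarrow> \<exists>x\<in>T j. n \<bullet> x = n \<bullet> p"
      unfolding robust_def by blast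
    have TV: "finite (V (T j))" "T j = convex hull V (T j)" if "j \<in> I" for j
      using V[OF that] PiE_mem[OF T that] by blast+
    have "\<exists>k\<in>I - {i}. \<exists>w. (\<forall>j\<in>I - {i} - {k}. w j \<in> V (T j)) \<and>
       (\<exists>x\<in>convex hull V (T k). normal_at p (w ` (I - {i} - {k})) \<bullet> x = normal_at p (w ` (I - {i} - {k})) \<bullet> p)"
    proof (rule common_hyperplane_vertices[OF _ cI[OF i(1)]])
      show "n \<noteq> 0" by (rule i)
      show "\<exists>x\<in>convex hull V (T j). n \<bullet> x = n \<bullet> p" if "j \<in> I - {i}" for j
        using i(3)[OF that] TV(2)[of j] that by simp
    qed (use I TV in auto)
    then obtain k w where k: "k \<in> I - {i}" and kw: "(\<forall>j\<in>I - {i} - {k}. w j \<in> V (T j)) \<and>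
       (\<exists>x\<in>convex hull V (T k). normal_at p (w ` (I - {i} - {k})) \<bullet> x = normal_at p (w ` (I - {i} - {k})) \<bullet> p)" by (elim bexE exE)
    have "T k = convex hull V (T k)" using TV(2) k by blast
    then have "T \<in> S i k" using T kw unfolding S_def by (intro CollectI conjI exI[of _ w]) simp_all
    then show "T \<in> (\<Union>i\<in>I. \<Union>k\<in>I - {i}. S i k)" using i(1) k by blast
  qed
  moreover have "finite (\<Union>i\<in>I. \<Union>k\<in>I - {i}. S i k)"
    using fP by (rule finite_subset[rotated]) (auto simp: S_def)
  ultimately have "card {T \<in> PiE I \<A>. \<not> robust I p T} \<le> card (\<Union>i\<in>I. \<Union>k\<in>I - {i}. S i k)" by (simp add: card_mono)
  also have "\<dots> \<le> (\<Sum>i\<in>I. card (\<Union>k\<in>I - {i}. S i k))" by (rule card_UN_le[OF I(1)])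
  also have "\<dots> \<le> (\<Sum>i\<in>I. \<Sum>k\<in>I - {i}. card (S i k))" using I by (intro sum_mono card_UN_le) auto
  also have "\<dots> \<le> (\<Sum>i\<in>I. \<Sum>k\<in>I - {i}. (DIM('a) + 1) ^ (DIM('a) - 1) * h * (\<Prod>j\<in>I - {k}. card (\<A> j)))"
  proof (intro sum_mono)
    fix i k assume i: "i \<in> I" and k: "k \<in> I - {i}"
    let ?L = "I - {i} - {k}"
    have cL: "card ?L = DIM('a) - 1" using cI[OF i] k by simp
    show "card (S i k) \<le> (DIM('a) + 1) ^ (DIM('a) - 1) * h * (\<Prod>j\<in>I - {k}. card (\<A> j))"
    proof (rule card_PiE_fibre[OF I(1)])
      fix f assume f: "f \<in> PiE (I - {k}) \<A>"
      have fV: "finite (V (f j))" "card (V (f j)) \<le> DIM('a) + 1" if "j \<in> ?L" for j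
        using V[of j "f j"] PiE_mem[OF f, of j] that by auto
      have sub: "{K \<in> \<A> k. f(k := K) \<in> S i k} \<subseteq>
        (\<Union>w\<in>PiE ?L (\<lambda>j. V (f j)). {K \<in> \<A> k. \<exists>x\<in>K. normal_at p (w ` ?L) \<bullet> x = normal_at p (w ` ?L) \<bullet> p})"
      proof
        fix K assume "K \<in> {K \<in> \<A> k. f(k := K) \<in> S i k}"
        then have K: "K \<in> \<A> k" and "f(k := K) \<in> S i k" by auto
        then obtain w where w: "\<forall>j\<in>?L. w j \<in> V ((f(k := K)) j)" "\<exists>x\<in>K. normal_at p (w ` ?L) \<bullet> x = normal_at p (w ` ?L) \<bullet> p"
          unfolding S_def by auto
        let ?w = "restrict w ?L"
        have "?w \<in> PiE ?L (\<lambda>j. V (f j))" using w(1) by auto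
        moreover have "?w ` ?L = w ` ?L" by auto
        ultimately show "K \<in> (\<Union>w\<in>PiE ?L (\<lambda>j. V (f j)). {K \<in> \<A> k. \<exists>x\<in>K. normal_at p (w ` ?L) \<bullet> x = normal_at p (w ` ?L) \<bullet> p})"
          using K w(2) by (intro UN_I[of ?w]) simp_all
      qed
      have fin': "finite (PiE ?L (\<lambda>j. V (f j)))" using I fV by (intro finite_PiE) auto
      have "card {K \<in> \<A> k. f(k := K) \<in> S i k} \<le> card (\<Union>w\<in>PiE ?L (\<lambda>j. V (f j)). {K \<in> \<A> k. \<exists>x\<in>K. normal_at p (w ` ?L) \<bullet> x = normal_at p (w ` ?L) \<bullet> p})"
        using sub fin' fin k by (intro card_mono) auto
      also have "\<dots> \<le> (\<Sum>w\<in>PiE ?L (\<lambda>j. V (f j)). card {K \<in> \<A> k. \<exists>x\<in>K. normal_at p (w ` ?L) \<bullet> x = normal_at p (w ` ?L) \<bullet> p})"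
        by (rule card_UN_le[OF fin'])
      also have "\<dots> \<le> (\<Sum>w\<in>PiE ?L (\<lambda>j. V (f j)). h)"
      proof (rule sum_mono)
        fix w assume "w \<in> PiE ?L (\<lambda>j. V (f j))"
        have "card (w ` ?L) \<le> card ?L" using I by (intro card_image_le) auto
        then have "card (w ` ?L) < DIM('a)" using cL DIM_positive[where 'a='a] by linarith
        then show "card {K \<in> \<A> k. \<exists>x\<in>K. normal_at p (w ` ?L) \<bullet> x = normal_at p (w ` ?L) \<bullet> p} \<le> h"
          using I k by (intro meets normal_at) auto
      qed
      also have "\<dots> = (\<Prod>j\<in>?L. card (V (f j))) * h" using I by (simp add: card_PiE)
      also have "\<dots> \<le> (\<Prod>j\<in>?L. DIM('a) + 1) * h" using fV by (intro mult_right_mono prod_mono) auto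
      also have "\<dots> = (DIM('a) + 1) ^ (DIM('a) - 1) * h" using cL by simp
      finally show "card {K \<in> \<A> k. f(k := K) \<in> S i k} \<le> (DIM('a) + 1) ^ (DIM('a) - 1) * h" .
    qed (use k fin in \<open>auto simp: S_def\<close>)
  qed
  finally show ?thesis .
qed

section \<open>Dense boxes\<close>

lemma sum_PiE_insert:
  assumes "x \<notin> I"
  shows "(\<Sum>T\<in>PiE (insert x I) B. f T) = (\<Sum>a\<in>B x. \<Sum>w\<in>PiE I B. f (w(x := a)))"
proof -
  have "(\<Sum>T\<in>PiE (insert x I) B. f T) = (\<Sum>(a, w)\<in>B x \<times> PiE I B. f (w(x := a)))"
    unfolding PiE_insert_eq by (subst sum.reindex[OF inj_combinator[OF assms]]) (simp add: case_prod_beta')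
  then show ?thesis by (simp add: sum.cartesian_product)
qed

lemma card_eq_sum_of_bool: "finite A \<Longrightarrow> real (card {x \<in> A. P x}) = (\<Sum>x\<in>A. of_bool (P x))"
  by (induction A rule: finite_induct) (auto simp: Collect_conv_if card_insert_if intro!: arg_cong[where f = card] simp flip: card_insert_disjoint)

text \<open>An Efron--Stein inequality: walk from one point of the box to the other one coordinate at a time.\<close>

lemma box_variance:
  assumes "finite I" "\<And>i. i \<in> I \<Longrightarrow> finite (B i) \<and> B i \<noteq> {}"
  shows "(\<Sum>T\<in>PiE I B. \<Sum>T'\<in>PiE I B. of_bool (h T \<noteq> h T')) \<le>
    real (card (PiE I B)) * (\<Sum>T\<in>PiE I B. \<Sum>i\<in>I. (\<Sum>K\<in>B i. of_bool (h T \<noteq> h (T(i := K)))) / real (card (B i)))"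
  using assms
proof (induction I arbitrary: h rule: finite_induct)
  case empty then show ?case by simp
next
  case (insert x I)
  let ?P = "PiE I B"
  have fB: "finite (B i)" "card (B i) > 0" if "i \<in> insert x I" for i using insert.prems[OF that] by (auto simp: card_gt_0_iff)
  have cP: "card (PiE (insert x I) B) = card (B x) * card ?P" using insert.hyps by (simp add: card_PiE)
  have comm: "(w(x := a))(i := K) = (w(i := K))(x := a)" if "i \<in> I" for w i a K
    using that insert.hyps(2) by (intro fun_upd_twist) auto
  have "(\<Sum>T\<in>PiE (insert x I) B. \<Sum>T'\<in>PiE (insert x I) B. of_bool (h T \<noteq> h T')) =
      (\<Sum>a\<in>B x. \<Sum>w\<in>?P. \<Sum>a'\<in>B x. \<Sum>w'\<in>?P. of_bool (h (w(x := a)) \<noteq> h (w'(x := a'))) :: real)"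
    unfolding sum_PiE_insert[OF insert.hyps(2)] ..
  also have "\<dots> \<le> (\<Sum>a\<in>B x. \<Sum>w\<in>?P. \<Sum>a'\<in>B x. \<Sum>w'\<in>?P. of_bool (h (w(x := a)) \<noteq> h (w'(x := a))) + of_bool (h (w'(x := a)) \<noteq> h (w'(x := a'))))"
    by (intro sum_mono) auto
  also have "\<dots> = (\<Sum>a\<in>B x. \<Sum>w\<in>?P. \<Sum>a'\<in>B x. \<Sum>w'\<in>?P. of_bool (h (w(x := a)) \<noteq> h (w'(x := a)))) +
      (\<Sum>a\<in>B x. \<Sum>w\<in>?P. \<Sum>a'\<in>B x. \<Sum>w'\<in>?P. of_bool (h (w'(x := a)) \<noteq> h (w'(x := a'))))"
    by (simp only: sum.distrib)
  also have "(\<Sum>a\<in>B x. \<Sum>w\<in>?P. \<Sum>a'\<in>B x. \<Sum>w'\<in>?P. of_bool (h (w(x := a)) \<noteq> h (w'(x := a)))) =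
      real (card (B x)) * (\<Sum>a\<in>B x. \<Sum>w\<in>?P. \<Sum>w'\<in>?P. of_bool (h (w(x := a)) \<noteq> h (w'(x := a))))"
    by (simp add: sum_distrib_left)
  also have "\<dots> \<le> real (card (B x)) * (\<Sum>a\<in>B x. real (card ?P) * (\<Sum>w\<in>?P. \<Sum>i\<in>I. (\<Sum>K\<in>B i. of_bool (h (w(x := a)) \<noteq> h ((w(i := K))(x := a)))) / real (card (B i))))"
    by (intro mult_left_mono sum_mono insert.IH) (use insert.prems in auto)
  also have "\<dots> = real (card (PiE (insert x I) B)) * (\<Sum>T\<in>PiE (insert x I) B. \<Sum>i\<in>I. (\<Sum>K\<in>B i. of_bool (h T \<noteq> h (T(i := K)))) / real (card (B i)))"
  proof -
    have eq: "(\<Sum>i\<in>I. (\<Sum>K\<in>B i. of_bool (h (w(x := a)) \<noteq> h ((w(i := K))(x := a)))) / real (card (B i))) =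
      (\<Sum>i\<in>I. (\<Sum>K\<in>B i. of_bool (h (w(x := a)) \<noteq> h ((w(x := a))(i := K)))) / real (card (B i)))" for a w
      by (intro sum.cong refl) (simp only: comm)
    show ?thesis unfolding eq sum_PiE_insert[OF insert.hyps(2)] cP by (simp add: sum_distrib_left mult.assoc)
  qed
  also have "(\<Sum>a\<in>B x. \<Sum>w\<in>?P. \<Sum>a'\<in>B x. \<Sum>w'\<in>?P. of_bool (h (w'(x := a)) \<noteq> h (w'(x := a')))) =
      real (card ?P) * (\<Sum>a\<in>B x. \<Sum>w'\<in>?P. \<Sum>a'\<in>B x. of_bool (h (w'(x := a)) \<noteq> h (w'(x := a'))))"
  proof -
    have "(\<Sum>a'\<in>B x. \<Sum>w'\<in>?P. of_bool (h (w'(x := a)) \<noteq> h (w'(x := a')))) = (\<Sum>w'\<in>?P. \<Sum>a'\<in>B x. of_bool (h (w'(x := a)) \<noteq> h (w'(x := a'))) :: real)" for a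
      by (rule sum.swap)
    then show ?thesis by (simp add: sum_distrib_left)
  qed
  also have "\<dots> = real (card (PiE (insert x I) B)) * (\<Sum>T\<in>PiE (insert x I) B. (\<Sum>K\<in>B x. of_bool (h T \<noteq> h (T(x := K)))) / real (card (B x)))"
    unfolding sum_PiE_insert[OF insert.hyps(2)] cP using fB(2)[of x] by (simp add: sum_divide_distrib[symmetric])
  finally show ?case
    unfolding sum.insert[OF insert.hyps] sum.distrib distrib_left by (simp only: add.commute)
qed

section \<open>Packing bounds from pattern counts\<close>

text \<open>A union bound over random \<open>s\<close>-tuples: a given pair stays unseparated with
  probability at most \<open>(1 - \<delta>) ^ s\<close>, and there are at most
  \<open>card S ^ 2\<close> pairs.\<close>

lemma separating_tuple:
  assumes fin: "finite \<Omega>" "\<Omega> \<noteq> {}" "finite S"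
    and far: "\<And>K K'. K \<in> S \<Longrightarrow> K' \<in> S \<Longrightarrow> K \<noteq> K' \<Longrightarrow> real (card {w \<in> \<Omega>. \<phi> w K = \<phi> w K'}) \<le> (1 - \<delta>) * real (card \<Omega>)"
    and \<delta>: "\<delta> \<le> 1" and s: "real (card S) ^ 2 * (1 - \<delta>) ^ s < 1"
  shows "\<exists>x. (\<forall>m<s. x m \<in> \<Omega>) \<and> (\<forall>K\<in>S. \<forall>K'\<in>S. K \<noteq> K' \<longrightarrow> (\<exists>m<s. \<phi> (x m) K \<noteq> \<phi> (x m) K'))"
proof -
  let ?T = "PiE {..<s} (\<lambda>_. \<Omega>)"
  define bad where "bad = (\<lambda>(K, K'). PiE {..<s} (\<lambda>_. {w \<in> \<Omega>. \<phi> w K = \<phi> w K'}))"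
  let ?Q = "{(K, K'). K \<in> S \<and> K' \<in> S \<and> K \<noteq> K'}"
  have Q: "?Q \<subseteq> S \<times> S" by auto
  then have fQ: "finite ?Q" using fin finite_subset by blast
  have cQ: "card ?Q \<le> card S ^ 2" using card_mono[OF _ Q] fin by (simp add: card_cartesian_product power2_eq_square)
  have "real (card (\<Union>t\<in>?Q. bad t)) \<le> (\<Sum>t\<in>?Q. real (card (bad t)))"
    using of_nat_mono[OF card_UN_le[OF fQ, of bad], where 'a = real] by (simp only: of_nat_sum)
  also have "\<dots> \<le> (\<Sum>t\<in>?Q. ((1 - \<delta>) * real (card \<Omega>)) ^ s)"
  proof (rule sum_mono)
    fix t assume "t \<in> ?Q"
    then obtain K K' where t: "t = (K, K')" "K \<in> S" "K' \<in> S" "K \<noteq> K'" by auto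
    have "real (card (bad t)) = real (card {w \<in> \<Omega>. \<phi> w K = \<phi> w K'}) ^ s" by (simp add: bad_def t card_PiE)
    also have "\<dots> \<le> ((1 - \<delta>) * real (card \<Omega>)) ^ s" using far[OF t(2-4)] by (intro power_mono) auto
    finally show "real (card (bad t)) \<le> ((1 - \<delta>) * real (card \<Omega>)) ^ s" .
  qed
  also have "\<dots> = real (card ?Q) * ((1 - \<delta>) ^ s * real (card \<Omega>) ^ s)" by (simp add: power_mult_distrib)
  also have "\<dots> \<le> real (card S) ^ 2 * ((1 - \<delta>) ^ s * real (card \<Omega>) ^ s)"
    using cQ \<delta> by (intro mult_right_mono mult_nonneg_nonneg) (auto simp flip: of_nat_power)
  also have "\<dots> = (real (card S) ^ 2 * (1 - \<delta>) ^ s) * real (card \<Omega>) ^ s" by simp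
  also have "\<dots> < 1 * real (card \<Omega>) ^ s"
    using s fin by (intro mult_strict_right_mono zero_less_power) (auto simp: card_gt_0_iff)
  also have "\<dots> = real (card ?T)" by (simp add: card_PiE)
  finally have "card (\<Union>t\<in>?Q. bad t) < card ?T" by simp
  moreover have "finite ?T" using fin by (intro finite_PiE) auto
  moreover have "finite (\<Union>t\<in>?Q. bad t)" using fQ fin by (auto simp: bad_def intro!: finite_PiE)
  ultimately have "\<not> ?T \<subseteq> (\<Union>t\<in>?Q. bad t)" using card_mono[of "\<Union>t\<in>?Q. bad t" ?T] by linarith
  then obtain x where x: "x \<in> ?T" "x \<notin> (\<Union>t\<in>?Q. bad t)" by blast
  have "\<exists>m<s. \<phi> (x m) K \<noteq> \<phi> (x m) K'" if K: "K \<in> S" "K' \<in> S" "K \<noteq> K'" for K K'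
  proof (rule ccontr)
    assume "\<not> ?thesis"
    then have "x \<in> bad (K, K')" using x(1) by (auto simp: bad_def PiE_iff)
    then show False using x(2) K by blast
  qed
  then show ?thesis using x(1) by (intro exI[of _ x]) (auto simp: PiE_iff)
qed

text \<open>With \<open>s\<close> about \<open>2 ln m / \<delta>\<close>, the bound reads
  \<open>m\<close> at most a multiple of \<open>(ln m / \<delta>) ^ n\<close>. Since
  \<open>ln m\<close> is at most \<open>4 n y\<close> for \<open>y ^ (4 n) = m\<close>, the
  logarithm costs a quarter of the exponent of \<open>m\<close>; solving gives the power
  \<open>4 n / 3\<close> of \<open>1 / \<delta>\<close>, which \<open>4 n \<le> 3 q\<close> rounds
  up to \<open>q\<close>.\<close>

lemma packing_arithmetic:
  fixes \<delta> :: real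
  assumes n: "n \<ge> 1" "4 * n \<le> 3 * q" and C: "C \<ge> 1" and \<delta>: "0 < \<delta>" "\<delta> \<le> 1"
    and m: "m \<ge> 1" and bound: "\<And>s. real m ^ 2 * (1 - \<delta>) ^ s < 1 \<Longrightarrow> m \<le> C * (s + 1) ^ n"
  shows "real m \<le> (real C * (8 * real n + 3) ^ n) ^ 4 * (1 / \<delta>) ^ q"
proof -
  define y where "y = root (4 * n) (real m)"
  define X where "X = real C * (8 * real n + 3) ^ n"
  have y: "y ^ (4 * n) = real m" "y \<ge> 1" using n m by (auto simp: y_def)
  have X1: "X \<ge> 1"
  proof -
    have "1 * 1 \<le> real C * (8 * real n + 3) ^ n" using C by (intro mult_mono one_le_power) auto
    then show ?thesis by (simp add: X_def)
  qed
  have lnm: "ln (real m) \<le> 4 * real n * y"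
  proof -
    have "ln (real m) = real (4 * n) * ln y" using y by (simp flip: y(1) add: ln_realpow)
    also have "\<dots> \<le> real (4 * n) * y" using y ln_le_minus_one[of y] by (intro mult_left_mono) auto
    finally show ?thesis by simp
  qed
  define s where "s = nat \<lceil>2 * ln (real m) / \<delta>\<rceil> + 1"
  have q0: "2 * ln (real m) / \<delta> \<ge> 0" using m \<delta> by auto
  have s1: "2 * ln (real m) / \<delta> < real s" unfolding s_def by linarith
  have s2: "real s \<le> 2 * ln (real m) / \<delta> + 2" unfolding s_def using q0 by linarith
  have "(1 - \<delta>) ^ s \<le> exp (- \<delta>) ^ s" using \<delta> exp_ge_add_one_self[of "- \<delta>"] by (intro power_mono) auto
  also have "\<dots> = exp (- (real s * \<delta>))" by (simp flip: exp_of_nat_mult)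
  also have "\<dots> < exp (- (2 * ln (real m)))" using s1 \<delta> by (simp add: field_simps)
  also have "\<dots> = 1 / real m ^ 2"
  proof -
    have "exp (2 * ln (real m)) = real m ^ 2" using m exp_of_nat_mult[of 2 "ln (real m)"] by simp
    then show ?thesis by (simp add: exp_minus inverse_eq_divide)
  qed
  finally have "real m ^ 2 * (1 - \<delta>) ^ s < 1" using m by (simp add: field_simps)
  then have "m \<le> C * (s + 1) ^ n" by (rule bound)
  then have "real m \<le> real C * (real s + 1) ^ n" by (metis of_nat_1 of_nat_add of_nat_le_iff of_nat_mult of_nat_power)
  also have "\<dots> \<le> real C * ((8 * real n + 3) * (y / \<delta>)) ^ n"
  proof (intro mult_left_mono power_mono)
    have "1 \<le> y / \<delta>" using y \<delta> by simp
    moreover have "2 * ln (real m) / \<delta> \<le> 8 * real n * (y / \<delta>)" using lnm \<delta> by (simp add: field_simps)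
    ultimately have "real s + 1 \<le> 8 * real n * (y / \<delta>) + 3 * (y / \<delta>)" using s2 by linarith
    then show "real s + 1 \<le> (8 * real n + 3) * (y / \<delta>)" by (simp only: distrib_right)
  qed auto
  also have "\<dots> = X * (1 / \<delta>) ^ n * y ^ n" by (simp add: X_def power_mult_distrib power_divide)
  finally have "y ^ (3 * n) * y ^ n \<le> X * (1 / \<delta>) ^ n * y ^ n" using y(1) by (simp flip: power_add)
  then have "y ^ (3 * n) \<le> X * (1 / \<delta>) ^ n" using y(2) by (simp add: mult_le_cancel_right)
  then have "(y ^ (3 * n)) ^ 4 \<le> (X * (1 / \<delta>) ^ n) ^ 4" using y(2) by (intro power_mono) auto
  also have "\<dots> = X ^ 4 * (1 / \<delta>) ^ (4 * n)" by (simp add: power_mult_distrib mult.commute flip: power_mult)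
  also have "\<dots> \<le> (X ^ 4) ^ 3 * (1 / \<delta>) ^ (3 * q)"
  proof (rule mult_mono)
    have "X ^ 4 \<ge> 1" using X1 by (rule one_le_power)
    then show "X ^ 4 \<le> (X ^ 4) ^ 3" by (intro self_le_power) auto
    show "(1 / \<delta>) ^ (4 * n) \<le> (1 / \<delta>) ^ (3 * q)" using n(2) \<delta> by (intro power_increasing) auto
  qed (use X1 \<delta> in auto)
  also have "\<dots> = (X ^ 4 * (1 / \<delta>) ^ q) ^ 3" by (simp add: power_mult_distrib mult.commute flip: power_mult)
  also have "(y ^ (3 * n)) ^ 4 = real m ^ 3" by (simp add: mult.commute flip: power_mult y(1))
  finally have "real m \<le> X ^ 4 * (1 / \<delta>) ^ q"
    using X1 \<delta> by (subst (asm) power_mono_iff) auto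
  then show ?thesis by (simp add: X_def)
qed

text \<open>A pseudometric on the class of colour \<open>i\<close>, unnormalised; members at small
  distance are nearly interchangeable in \<open>E\<close>.\<close>

definition discrepancy :: "('i \<Rightarrow> 'k set) \<Rightarrow> 'i set \<Rightarrow> (('i \<Rightarrow> 'k) \<Rightarrow> bool) \<Rightarrow> 'i \<Rightarrow> 'k \<Rightarrow> 'k \<Rightarrow> real" where
  "discrepancy A I E i K K' = (\<Sum>w\<in>PiE (I - {i}) A. of_bool (E (w(i := K)) \<noteq> E (w(i := K'))))"

lemma discrepancy_self: "discrepancy A I E i K K = 0"
  by (simp add: discrepancy_def)

lemma discrepancy_sym: "discrepancy A I E i K K' = discrepancy A I E i K' K"
  unfolding discrepancy_def by (intro sum.cong) auto

lemma discrepancy_triangle: "discrepancy A I E i K K'' \<le> discrepancy A I E i K K' + discrepancy A I E i K' K''"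
  unfolding discrepancy_def sum.distrib[symmetric] by (intro sum_mono) auto

text \<open>Pairwise far members are told apart by a few random completions, on which they show
  different patterns; few patterns then mean few members. This is a packing bound in the manner of
  Haussler.\<close>

lemma separated_set_small:
  assumes I: "finite I" "i \<in> I" and A: "\<And>j. j \<in> I \<Longrightarrow> finite (A j) \<and> A j \<noteq> {}"
    and S: "S \<subseteq> A i" "S \<noteq> {}" and far: "\<And>K K'. K \<in> S \<Longrightarrow> K' \<in> S \<Longrightarrow> K \<noteq> K' \<Longrightarrow> discrepancy A I E i K K' > \<delta> * real (\<Prod>j\<in>I - {i}. card (A j))"
    and patterns: "\<And>s \<xi>. (\<And>m. m < s \<Longrightarrow> \<xi> m \<in> PiE (I - {i}) A) \<Longrightarrow> card ((\<lambda>K. {m. m < s \<and> E ((\<xi> m)(i := K))}) ` A i) \<le> C * (s + 1) ^ n"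
    and n: "n \<ge> 1" "4 * n \<le> 3 * q" and C: "C \<ge> 1" and \<delta>: "0 < \<delta>" "\<delta> \<le> 1"
  shows "real (card S) \<le> (real C * (8 * real n + 3) ^ n) ^ 4 * (1 / \<delta>) ^ q"
proof (rule packing_arithmetic[OF n C \<delta>])
  let ?W = "PiE (I - {i}) A"
  have fS: "finite S" using S A[OF I(2)] finite_subset by blast
  have fW: "finite ?W" "?W \<noteq> {}" using I A by (auto intro!: finite_PiE simp: PiE_eq_empty_iff)
  have cW: "card ?W = (\<Prod>j\<in>I - {i}. card (A j))" using I by (simp add: card_PiE)
  show "card S \<ge> 1" using fS S by (simp add: Suc_leI card_gt_0_iff)
  fix s assume s: "real (card S) ^ 2 * (1 - \<delta>) ^ s < 1"
  have near: "real (card {w \<in> ?W. E (w(i := K)) = E (w(i := K'))}) \<le> (1 - \<delta>) * real (card ?W)" if K: "K \<in> S" "K' \<in> S" "K \<noteq> K'" for K K'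
  proof -
    have "real (card {w \<in> ?W. E (w(i := K)) = E (w(i := K'))}) = (\<Sum>w\<in>?W. of_bool (E (w(i := K)) = E (w(i := K'))))"
      by (rule card_eq_sum_of_bool[OF fW(1)])
    also have "\<dots> = (\<Sum>w\<in>?W. 1 - of_bool (E (w(i := K)) \<noteq> E (w(i := K'))))" by (intro sum.cong) auto
    also have "\<dots> = real (card ?W) - discrepancy A I E i K K'" by (simp only: sum_subtractf discrepancy_def) simp
    also have "\<dots> \<le> (1 - \<delta>) * real (card ?W)" using far[OF K] unfolding cW by (simp add: left_diff_distrib)
    finally show ?thesis .
  qed
  have "\<exists>x. (\<forall>m<s. x m \<in> ?W) \<and> (\<forall>K\<in>S. \<forall>K'\<in>S. K \<noteq> K' \<longrightarrow> (\<exists>m<s. E ((x m)(i := K)) \<noteq> E ((x m)(i := K'))))"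
    by (rule separating_tuple[OF fW fS near \<delta>(2) s])
  then obtain x where x: "\<forall>m<s. x m \<in> ?W"
    "\<forall>K\<in>S. \<forall>K'\<in>S. K \<noteq> K' \<longrightarrow> (\<exists>m<s. E ((x m)(i := K)) \<noteq> E ((x m)(i := K')))" by (elim exE conjE)
  let ?f = "\<lambda>K. {m. m < s \<and> E ((x m)(i := K))}"
  have "inj_on ?f S"
  proof (rule inj_onI, rule ccontr)
    fix K K' assume K: "K \<in> S" "K' \<in> S" "?f K = ?f K'" "K \<noteq> K'"
    then obtain m where "m < s" "E ((x m)(i := K)) \<noteq> E ((x m)(i := K'))" using x(2) by blast
    then show False using K(3) by blast
  qed
  then have "card S = card (?f ` S)" by (simp add: card_image)
  also have "\<dots> \<le> card (?f ` A i)" using S A[OF I(2)] by (intro card_mono) auto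
  also have "\<dots> \<le> C * (s + 1) ^ n" using x(1) by (intro patterns) auto
  finally show "card S \<le> C * (s + 1) ^ n" .
qed

lemma maximal_separated:
  fixes dist :: "'k \<Rightarrow> 'k \<Rightarrow> real"
  assumes "finite A" "A \<noteq> {}" "\<And>K. dist K K = 0" "\<And>K K'. dist K K' = dist K' K" "c \<ge> 0"
  shows "\<exists>S\<subseteq>A. S \<noteq> {} \<and> (\<forall>K\<in>S. \<forall>K'\<in>S. K \<noteq> K' \<longrightarrow> dist K K' > c) \<and> (\<forall>K\<in>A. \<exists>K'\<in>S. dist K K' \<le> c)"
proof -
  define sep where "sep = (\<lambda>S. S \<subseteq> A \<and> (\<forall>K\<in>S. \<forall>K'\<in>S. K \<noteq> K' \<longrightarrow> dist K K' > c))"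
  obtain a where a: "a \<in> A" using assms(2) by blast
  have s0: "sep {a}" using a by (simp add: sep_def)
  have b: "\<forall>S. sep S \<longrightarrow> card S < Suc (card A)" unfolding sep_def using assms(1) by (auto simp: less_Suc_eq_le card_mono)
  obtain S where S: "sep S" "\<And>S'. sep S' \<Longrightarrow> card S' \<le> card S"
    using ex_has_greatest_nat[of sep "{a}" card, OF s0 b] by blast
  have fS: "finite S" using S(1) assms(1) finite_subset by (auto simp: sep_def)
  have "S \<noteq> {}" using S(2)[OF s0] by auto
  moreover have "\<exists>K'\<in>S. dist K K' \<le> c" if K: "K \<in> A" for K
  proof (rule ccontr)
    assume n: "\<not> ?thesis"
    then have far: "dist K K' > c" if "K' \<in> S" for K' using that by force
    have "K \<notin> S" using far[of K] assms(3,5) by force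
    moreover have "sep (insert K S)"
      unfolding sep_def
    proof (intro conjI ballI impI)
      show "insert K S \<subseteq> A" using S(1) K by (simp add: sep_def)
      fix a b assume "a \<in> insert K S" "b \<in> insert K S" "a \<noteq> b"
      then consider "a = K" "b \<in> S" | "a \<in> S" "b = K" | "a \<in> S" "b \<in> S" by blast
      then show "dist a b > c"
      proof cases
        case 1 then show ?thesis using far by simp
      next
        case 2 then show ?thesis using far[of a] assms(4)[of a K] by simp
      next
        case 3 then show ?thesis using S(1) \<open>a \<noteq> b\<close> unfolding sep_def by blast
      qed
    qed
    ultimately show False using S(2)[of "insert K S"] fS by simp
  qed
  ultimately show ?thesis using S(1) unfolding sep_def by (intro exI[of _ S]) simp
qed

text \<open>With \<open>a\<close> true and \<open>b\<close> false tuples there are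
  \<open>2 a b\<close> ordered pairs of different truth value. The variance bound makes this at most
  \<open>\<tau> a\<close> times the size of the box, and \<open>a\<close> cancels.\<close>

lemma box_density:
  assumes I: "finite I" and B: "\<And>i. i \<in> I \<Longrightarrow> finite (B i) \<and> B i \<noteq> {}"
    and small: "(\<Sum>T\<in>PiE I B. \<Sum>i\<in>I. (\<Sum>K\<in>B i. of_bool (E T \<noteq> E (T(i := K)))) / real (card (B i))) < \<tau> * real (card {T \<in> PiE I B. E T})"
  shows "real (card {T \<in> PiE I B. \<not> E T}) \<le> \<tau> * real (card (PiE I B))"
proof -
  let ?P = "PiE I B"
  let ?a = "real (card {T \<in> ?P. E T})" and ?b = "real (card {T \<in> ?P. \<not> E T})"
  have fP: "finite ?P" using I B by (intro finite_PiE) auto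
  have "(\<Sum>T'\<in>?P. of_bool (E T \<noteq> E T')) = (if E T then ?b else ?a)" for T
    using card_eq_sum_of_bool[OF fP, of "\<lambda>T'. E T \<noteq> E T'"] by auto
  then have "(\<Sum>T\<in>?P. \<Sum>T'\<in>?P. of_bool (E T \<noteq> E T')) = (\<Sum>T\<in>?P. if E T then ?b else ?a)" by simp
  also have "\<dots> = (\<Sum>T\<in>?P. of_bool (E T) * ?b + of_bool (\<not> E T) * ?a)" by (intro sum.cong) auto
  also have "\<dots> = ?a * ?b + ?b * ?a"
    by (simp only: sum.distrib sum_distrib_right[symmetric] card_eq_sum_of_bool[OF fP])
  finally have eq: "(\<Sum>T\<in>?P. \<Sum>T'\<in>?P. of_bool (E T \<noteq> E T')) = ?a * ?b + ?b * ?a" .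
  have "(\<Sum>T\<in>?P. \<Sum>T'\<in>?P. of_bool (E T \<noteq> E T')) \<le>
    real (card ?P) * (\<Sum>T\<in>?P. \<Sum>i\<in>I. (\<Sum>K\<in>B i. of_bool (E T \<noteq> E (T(i := K)))) / real (card (B i)))"
    by (rule box_variance[OF I B])
  then have "2 * (?a * ?b) \<le> real (card ?P) * (\<Sum>T\<in>?P. \<Sum>i\<in>I. (\<Sum>K\<in>B i. of_bool (E T \<noteq> E (T(i := K)))) / real (card (B i)))"
    unfolding eq by (simp only: mult.commute[of ?b] mult_2)
  also have "\<dots> \<le> real (card ?P) * (\<tau> * ?a)" using small by (intro mult_left_mono) auto
  finally have le: "?a * (2 * ?b) \<le> ?a * (\<tau> * real (card ?P))" by (simp add: mult_ac)
  have "?a > 0"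
  proof (rule ccontr)
    assume "\<not> ?a > 0"
    then have "?a = 0" by simp
    then have "(\<Sum>T\<in>?P. \<Sum>i\<in>I. (\<Sum>K\<in>B i. of_bool (E T \<noteq> E (T(i := K)))) / real (card (B i))) < 0" using small by simp
    moreover have "(\<Sum>T\<in>?P. \<Sum>i\<in>I. (\<Sum>K\<in>B i. of_bool (E T \<noteq> E (T(i := K)))) / real (card (B i))) \<ge> 0" by (intro sum_nonneg divide_nonneg_nonneg) auto
    ultimately show False by linarith
  qed
  then have "2 * ?b \<le> \<tau> * real (card ?P)" using le by (simp only: mult_le_cancel_left_pos)
  then show ?thesis by linarith
qed

text \<open>Maximal separated sets serve as centres, and attaching each element to a nearby centre
  forms the clusters. After tuples through small clusters are discarded, changing one coordinate
  within its cluster still rarely affects \<open>E\<close>; by averaging, some box of clusters has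
  little such variation compared with its number of true tuples.\<close>

theorem dense_box:
  fixes \<tau> :: real
  assumes I: "finite I" "I \<noteq> {}" and \<tau>: "0 < \<tau>" "\<tau> \<le> 1" and n: "n \<ge> 1" "4 * n \<le> 3 * q" and C: "C \<ge> 1"
  shows "\<exists>c>0. \<forall>(A :: 'i \<Rightarrow> 'k set) E R \<epsilon>. (\<forall>i\<in>I. finite (A i) \<and> real (card (A i)) \<le> R) \<longrightarrow> 0 < \<epsilon> \<longrightarrow> \<epsilon> \<le> 1 \<longrightarrow>
    (\<forall>i\<in>I. \<forall>s \<xi>. (\<forall>m<s. \<xi> m \<in> PiE (I - {i}) A) \<longrightarrow> card ((\<lambda>K. {m. m < s \<and> E ((\<xi> m)(i := K))}) ` A i) \<le> C * (s + 1) ^ n) \<longrightarrow>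
    real (card {T \<in> PiE I A. E T}) > \<epsilon> * R ^ card I \<longrightarrow>
    (\<exists>B. (\<forall>i\<in>I. B i \<subseteq> A i \<and> real (card (B i)) \<ge> c * \<epsilon> ^ (q + 1) * R) \<and>
       real (card {T \<in> PiE I B. \<not> E T}) \<le> \<tau> * real (card (PiE I B)))"
proof -
  define p where "p = real (card I)"
  have p: "p \<ge> 1" using I by (simp add: p_def Suc_leI card_gt_0_iff)
  define X where "X = (real C * (8 * real n + 3) ^ n) ^ 4"
  have X: "X > 0" using C by (simp add: X_def)
  \<comment> \<open>Set up for the identity \<open>p * (M * \<beta>) = \<epsilon> / 4\<close> below:
    discarding the clusters of relative size less than \<beta> costs at most a quarter of the
    assumed tuples.\<close>
  define c where "c = 1 / (4 * p * X) * (\<tau> / (8 * p)) ^ q"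
  have c: "c > 0" using p X \<tau> by (simp add: c_def)
  have main: "\<exists>B. (\<forall>i\<in>I. B i \<subseteq> A i \<and> real (card (B i)) \<ge> c * \<epsilon> ^ (q + 1) * R) \<and>
       real (card {T \<in> PiE I B. \<not> E T}) \<le> \<tau> * real (card (PiE I B))"
    if A: "\<forall>i\<in>I. finite (A i) \<and> real (card (A i)) \<le> R" and \<epsilon>: "0 < \<epsilon>" "\<epsilon> \<le> 1"
      and pat: "\<forall>i\<in>I. \<forall>s \<xi>. (\<forall>m<s. \<xi> m \<in> PiE (I - {i}) A) \<longrightarrow> card ((\<lambda>K. {m. m < s \<and> E ((\<xi> m)(i := K))}) ` A i) \<le> C * (s + 1) ^ n"
      and many: "real (card {T \<in> PiE I A. E T}) > \<epsilon> * R ^ card I"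
    for A :: "'i \<Rightarrow> 'k set" and E R \<epsilon>
  proof -
    \<comment> \<open>In units of \<open>R ^ card I\<close> the total variation is at most
      \<open>p * (2 * \<delta>) = \<tau> * \<epsilon> / 4\<close>, less than \<tau> times the
      \<open>3 / 4 * \<epsilon>\<close> of true tuples that survive.\<close>
    define \<delta> where "\<delta> = \<tau> * \<epsilon> / (8 * p)"
    have \<delta>: "0 < \<delta>" "\<delta> \<le> 1"
    proof -
      show "0 < \<delta>" using \<tau> \<epsilon> p by (simp add: \<delta>_def)
      have "\<tau> * \<epsilon> \<le> 1 * 1" using \<tau> \<epsilon> by (intro mult_mono) auto
      then show "\<delta> \<le> 1" using p by (simp add: \<delta>_def)
    qed
    define M where "M = X * (1 / \<delta>) ^ q"
    have M: "M > 0" using X \<delta> by (simp add: M_def)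
    define \<beta> where "\<beta> = c * \<epsilon> ^ (q + 1)"
    have \<beta>M: "p * (M * \<beta>) = \<epsilon> / 4"
    proof -
      have "\<beta> = \<epsilon> / (4 * p * X) * \<delta> ^ q" by (simp add: \<beta>_def c_def \<delta>_def power_mult_distrib power_divide)
      then show ?thesis using X p \<delta> by (simp add: M_def power_divide)
    qed
    have fA: "finite (A i)" if "i \<in> I" for i using A that by blast
    have fP: "finite (PiE I A)" using I fA by (intro finite_PiE) auto
    obtain i1 where i1: "i1 \<in> I" using I by blast
    then have R0: "R \<ge> 0" using A by (meson of_nat_0_le_iff order_trans)
    have "\<epsilon> * R ^ card I \<ge> 0" using \<epsilon> R0 by simp
    then have "{T \<in> PiE I A. E T} \<noteq> {}" using many by (metis card.empty not_le of_nat_0)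
    then have "PiE I A \<noteq> {}" by (metis (no_types, lifting) Collect_empty_eq ex_in_conv)
    then have Ane: "A i \<noteq> {}" if "i \<in> I" for i using that by (auto simp: PiE_eq_empty_iff)
    have Rpos: "R > 0"
    proof -
      have "card (A i1) > 0" using fA[OF i1] Ane[OF i1] by (simp add: card_gt_0_iff)
      then have "0 < real (card (A i1))" by simp
      also have "\<dots> \<le> R" using A i1 by blast
      finally show ?thesis .
    qed
    let ?Q = "\<lambda>i. real (\<Prod>j\<in>I - {i}. card (A j))"
    have QR: "?Q i \<le> R ^ (card I - 1)" if "i \<in> I" for i
    proof -
      have "?Q i = (\<Prod>j\<in>I - {i}. real (card (A j)))" by simp
      also have "\<dots> \<le> (\<Prod>j\<in>I - {i}. R)" using A by (intro prod_mono) auto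
      finally show ?thesis using that I by simp
    qed
    have RR: "R * R ^ (card I - 1) = R ^ card I" using I by (metis card_gt_0_iff power_minus_mult mult.commute)
    have "\<forall>i\<in>I. \<exists>S. S \<subseteq> A i \<and> S \<noteq> {} \<and> (\<forall>K\<in>S. \<forall>K'\<in>S. K \<noteq> K' \<longrightarrow> discrepancy A I E i K K' > \<delta> * ?Q i) \<and>
        (\<forall>K\<in>A i. \<exists>K'\<in>S. discrepancy A I E i K K' \<le> \<delta> * ?Q i)"
    proof
      fix i assume i: "i \<in> I"
      show "\<exists>S. S \<subseteq> A i \<and> S \<noteq> {} \<and> (\<forall>K\<in>S. \<forall>K'\<in>S. K \<noteq> K' \<longrightarrow> discrepancy A I E i K K' > \<delta> * ?Q i) \<and>
        (\<forall>K\<in>A i. \<exists>K'\<in>S. discrepancy A I E i K K' \<le> \<delta> * ?Q i)"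
        by (rule maximal_separated[OF fA[OF i] Ane[OF i] discrepancy_self discrepancy_sym]) (use \<delta> in \<open>simp add: prod_nonneg\<close>)
    qed
    from bchoice[OF this] obtain S where S: "\<forall>i\<in>I. S i \<subseteq> A i \<and> S i \<noteq> {} \<and> (\<forall>K\<in>S i. \<forall>K'\<in>S i. K \<noteq> K' \<longrightarrow> discrepancy A I E i K K' > \<delta> * ?Q i) \<and>
        (\<forall>K\<in>A i. \<exists>K'\<in>S i. discrepancy A I E i K K' \<le> \<delta> * ?Q i)" by (elim exE)
    have SA: "S i \<subseteq> A i" "S i \<noteq> {}" if "i \<in> I" for i using S that by blast+
    have cS: "real (card (S i)) \<le> M" if i: "i \<in> I" for i
      unfolding M_def X_def
    proof (rule separated_set_small[where I = I and i = i and A = A and E = E and \<delta> = \<delta>])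
      show "finite I" "i \<in> I" "S i \<subseteq> A i" "S i \<noteq> {}" "n \<ge> 1" "4 * n \<le> 3 * q" "C \<ge> 1" "0 < \<delta>" "\<delta> \<le> 1" by (fact | rule SA[OF i])+
      show "finite (A j) \<and> A j \<noteq> {}" if "j \<in> I" for j using fA Ane that by blast
      show "discrepancy A I E i K K' > \<delta> * ?Q i" if "K \<in> S i" "K' \<in> S i" "K \<noteq> K'" for K K'
        using S[THEN bspec, OF i] that by (elim conjE) blast
      show "card ((\<lambda>K. {m. m < s \<and> E ((\<xi> m)(i := K))}) ` A i) \<le> C * (s + 1) ^ n" if "\<And>m. m < s \<Longrightarrow> \<xi> m \<in> PiE (I - {i}) A" for s \<xi>
        using pat[THEN bspec, OF i, THEN spec, THEN spec, THEN mp] that by blast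
    qed
    define cen where "cen = (\<lambda>i K. SOME K'. K' \<in> S i \<and> discrepancy A I E i K K' \<le> \<delta> * ?Q i)"
    have cen: "cen i K \<in> S i \<and> discrepancy A I E i K (cen i K) \<le> \<delta> * ?Q i" if i: "i \<in> I" and K: "K \<in> A i" for i K
    proof -
      have "\<exists>K'. K' \<in> S i \<and> discrepancy A I E i K K' \<le> \<delta> * ?Q i" using S[THEN bspec, OF i, THEN conjunct2, THEN conjunct2, THEN conjunct2, THEN bspec, OF K] by (simp only: Bex_def)
      then show ?thesis unfolding cen_def by (rule someI_ex)
    qed
    define cl where "cl = (\<lambda>i K. {K' \<in> A i. cen i K' = cen i K})"
    have cl_near: "discrepancy A I E i K K' \<le> 2 * \<delta> * ?Q i" if i: "i \<in> I" "K \<in> A i" "K' \<in> cl i K" for i K K'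
    proof -
      have K': "K' \<in> A i" "cen i K' = cen i K" using i(3) by (auto simp: cl_def)
      have "discrepancy A I E i K K' \<le> discrepancy A I E i K (cen i K) + discrepancy A I E i (cen i K) K'" by (rule discrepancy_triangle)
      moreover have "discrepancy A I E i (cen i K) K' = discrepancy A I E i K' (cen i K')" using K' discrepancy_sym by metis
      ultimately show ?thesis using cen[OF i(1,2)] cen[OF i(1) K'(1)] by (simp only: mult_2 distrib_right) linarith
    qed
    have cl_self: "K \<in> cl i K" if "K \<in> A i" for i K using that by (simp add: cl_def)
    have fcl: "finite (cl i K)" if "i \<in> I" for i K using fA[OF that] by (simp add: cl_def)
    \<comment> \<open>Summed over the colours, the probability that resampling a coordinate within
      its cluster changes \<open>E\<close>. It is small on average because two members of a cluster
      are close to the same centre.\<close>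
    define G where "G = (\<lambda>T. \<Sum>i\<in>I. (\<Sum>K\<in>cl i (T i). of_bool (E T \<noteq> E (T(i := K)))) / real (card (cl i (T i))))"
    have G0: "G T \<ge> 0" for T unfolding G_def by (intro sum_nonneg divide_nonneg_nonneg) auto
    have sumG: "(\<Sum>T\<in>PiE I A. G T) \<le> p * (2 * \<delta> * R ^ card I)"
    proof -
      have "(\<Sum>T\<in>PiE I A. (\<Sum>K\<in>cl i (T i). of_bool (E T \<noteq> E (T(i := K)))) / real (card (cl i (T i)))) \<le> 2 * \<delta> * R ^ card I" if i: "i \<in> I" for i
      proof -
        have ins: "insert i (I - {i}) = I" using i by blast
        have "(\<Sum>T\<in>PiE I A. (\<Sum>K\<in>cl i (T i). of_bool (E T \<noteq> E (T(i := K)))) / real (card (cl i (T i)))) =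
          (\<Sum>K\<in>A i. \<Sum>w\<in>PiE (I - {i}) A. (\<Sum>K'\<in>cl i K. of_bool (E (w(i := K)) \<noteq> E (w(i := K')))) / real (card (cl i K)))"
          using sum_PiE_insert[of i "I - {i}" "\<lambda>T. (\<Sum>K\<in>cl i (T i). of_bool (E T \<noteq> E (T(i := K)))) / real (card (cl i (T i)))" A]
          unfolding ins by (simp only: fun_upd_same fun_upd_upd Diff_iff singletonI simp_thms)
        also have "\<dots> = (\<Sum>K\<in>A i. (\<Sum>K'\<in>cl i K. discrepancy A I E i K K') / real (card (cl i K)))"
          unfolding discrepancy_def sum_divide_distrib[symmetric] by (subst sum.swap) (rule refl)
        also have "\<dots> \<le> (\<Sum>K\<in>A i. 2 * \<delta> * ?Q i)"
        proof (rule sum_mono)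
          fix K assume K: "K \<in> A i"
          have "(\<Sum>K'\<in>cl i K. discrepancy A I E i K K') \<le> (\<Sum>K'\<in>cl i K. 2 * \<delta> * ?Q i)" by (intro sum_mono cl_near[OF i K])
          also have "\<dots> = real (card (cl i K)) * (2 * \<delta> * ?Q i)" by simp
          finally have le: "(\<Sum>K'\<in>cl i K. discrepancy A I E i K K') \<le> (2 * \<delta> * ?Q i) * real (card (cl i K))" by (simp only: mult.commute)
          have "real (card (cl i K)) > 0" using cl_self[OF K] fcl[OF i] by (auto simp: card_gt_0_iff)
          then show "(\<Sum>K'\<in>cl i K. discrepancy A I E i K K') / real (card (cl i K)) \<le> 2 * \<delta> * ?Q i"
            using le by (simp only: pos_divide_le_eq)
        qed
        also have "\<dots> = 2 * \<delta> * (real (card (A i)) * ?Q i)" by simp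
        also have "\<dots> \<le> 2 * \<delta> * (R * R ^ (card I - 1))"
          using A i QR[OF i] \<delta> R0 by (intro mult_left_mono mult_mono) (auto simp: prod_nonneg)
        finally show ?thesis unfolding RR .
      qed
      then have "(\<Sum>i\<in>I. \<Sum>T\<in>PiE I A. (\<Sum>K\<in>cl i (T i). of_bool (E T \<noteq> E (T(i := K)))) / real (card (cl i (T i)))) \<le> (\<Sum>i\<in>I. 2 * \<delta> * R ^ card I)"
        by (rule sum_mono)
      then show ?thesis unfolding G_def p_def by (subst sum.swap) simp
    qed
    define small where "small = (\<lambda>i. {K \<in> A i. real (card (cl i K)) < \<beta> * R})"
    have \<beta>R: "\<beta> * R \<ge> 0" using c \<epsilon> R0 by (simp add: \<beta>_def)
    have small_card: "real (card (small i)) \<le> M * (\<beta> * R)" if i: "i \<in> I" for i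
    proof -
      have fS: "finite (S i)" using SA[OF i] fA[OF i] finite_subset by blast
      define D where "D = (\<lambda>K0. {K \<in> small i. cen i K = K0})"
      have fD: "finite (D K0)" for K0 using fA[OF i] by (simp add: D_def small_def)
      have "small i \<subseteq> (\<Union>K0\<in>S i. D K0)" using cen[OF i] by (auto simp: D_def small_def)
      then have "card (small i) \<le> card (\<Union>K0\<in>S i. D K0)" using fS fD by (intro card_mono) auto
      also have "\<dots> \<le> (\<Sum>K0\<in>S i. card (D K0))" by (rule card_UN_le[OF fS])
      finally have "real (card (small i)) \<le> (\<Sum>K0\<in>S i. real (card (D K0)))" by (simp only: of_nat_sum[symmetric] of_nat_le_iff)
      also have "\<dots> \<le> (\<Sum>K0\<in>S i. \<beta> * R)"
      proof (rule sum_mono)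
        fix K0
        show "real (card (D K0)) \<le> \<beta> * R"
        proof (cases "D K0 = {}")
          case False
          then obtain K where K: "K \<in> D K0" by blast
          have "D K0 \<subseteq> cl i K" using K by (auto simp: D_def small_def cl_def)
          then have "card (D K0) \<le> card (cl i K)" by (rule card_mono[OF fcl[OF i]])
          moreover have "real (card (cl i K)) < \<beta> * R" using K by (simp add: D_def small_def)
          ultimately show ?thesis by linarith
        qed (use \<beta>R in simp)
      qed
      also have "\<dots> = real (card (S i)) * (\<beta> * R)" by simp
      also have "\<dots> \<le> M * (\<beta> * R)" using cS[OF i] \<beta>R by (rule mult_right_mono)
      finally show ?thesis .
    qed
    define N where "N = {T \<in> PiE I A. \<forall>i\<in>I. T i \<notin> small i}"
    have fN: "finite N" using fP by (simp add: N_def)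
    have "real (card (PiE I A - N)) \<le> \<epsilon> / 4 * R ^ card I"
    proof -
      have one: "real (card {T \<in> PiE I A. T i \<in> small i}) \<le> M * \<beta> * R ^ card I" if i: "i \<in> I" for i
      proof -
        have "card {T \<in> PiE I A. T i \<in> small i} \<le> card (small i) * (\<Prod>j\<in>I - {i}. card (A j))"
        proof (rule card_PiE_fibre[OF I(1) i fA])
          fix w show "card {a \<in> A i. w(i := a) \<in> {T \<in> PiE I A. T i \<in> small i}} \<le> card (small i)"
          proof (intro card_mono)
            show "finite (small i)" using fA[OF i] by (simp add: small_def)
            show "{a \<in> A i. w(i := a) \<in> {T \<in> PiE I A. T i \<in> small i}} \<subseteq> small i" by (intro subsetI) simp
          qed
        qed auto
        then have "real (card {T \<in> PiE I A. T i \<in> small i}) \<le> real (card (small i)) * ?Q i"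
          by (simp only: of_nat_mult[symmetric] of_nat_le_iff)
        also have "\<dots> \<le> (M * (\<beta> * R)) * R ^ (card I - 1)"
          using small_card[OF i] QR[OF i] M \<beta>R by (intro mult_mono) (auto simp: prod_nonneg)
        also have "\<dots> = M * \<beta> * R ^ card I" unfolding RR[symmetric] by simp
        finally show ?thesis .
      qed
      have "PiE I A - N \<subseteq> (\<Union>i\<in>I. {T \<in> PiE I A. T i \<in> small i})" by (auto simp: N_def)
      then have "card (PiE I A - N) \<le> card (\<Union>i\<in>I. {T \<in> PiE I A. T i \<in> small i})" using I fP by (intro card_mono) auto
      also have "\<dots> \<le> (\<Sum>i\<in>I. card {T \<in> PiE I A. T i \<in> small i})" by (rule card_UN_le[OF I(1)])
      finally have "real (card (PiE I A - N)) \<le> (\<Sum>i\<in>I. real (card {T \<in> PiE I A. T i \<in> small i}))" by (simp only: of_nat_sum[symmetric] of_nat_le_iff)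
      also have "\<dots> \<le> (\<Sum>i\<in>I. M * \<beta> * R ^ card I)" by (intro sum_mono one)
      also have "\<dots> = p * (M * \<beta>) * R ^ card I" by (simp add: p_def)
      finally show ?thesis unfolding \<beta>M .
    qed
    moreover have "real (card {T \<in> PiE I A. E T}) \<le> real (card {T \<in> N. E T}) + real (card (PiE I A - N))"
    proof -
      have "card {T \<in> PiE I A. E T} \<le> card ({T \<in> N. E T} \<union> (PiE I A - N))" using fP fN by (intro card_mono) auto
      also have "\<dots> \<le> card {T \<in> N. E T} + card (PiE I A - N)" by (rule card_Un_le)
      finally show ?thesis by linarith
    qed
    ultimately have eN: "real (card {T \<in> N. E T}) > 3 / 4 * (\<epsilon> * R ^ card I)" using many by simp
    have NG: "(\<Sum>T\<in>N. G T) < \<tau> * real (card {T \<in> N. E T})"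
    proof -
      have "(\<Sum>T\<in>N. G T) \<le> (\<Sum>T\<in>PiE I A. G T)" using fP G0 by (intro sum_mono2) (auto simp: N_def)
      also have "\<dots> \<le> \<tau> * (1 / 4 * (\<epsilon> * R ^ card I))" using sumG p by (simp add: \<delta>_def mult_ac)
      also have "\<dots> < \<tau> * (3 / 4 * (\<epsilon> * R ^ card I))" using \<tau> \<epsilon> Rpos by (intro mult_strict_left_mono) auto
      also have "\<dots> < \<tau> * real (card {T \<in> N. E T})" using eN \<tau> by (intro mult_strict_left_mono) auto
      finally show ?thesis .
    qed
    \<comment> \<open>The boxes of clusters partition \<open>N\<close>, so a positive sum of
      \<open>f\<close> over \<open>N\<close> forces a positive sum over one box, which is the
      hypothesis of \<open>box_density\<close>.\<close>
    define f where "f = (\<lambda>T. \<tau> * of_bool (E T) - G T)"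
    have sumf: "sum f Y = \<tau> * real (card {T \<in> Y. E T}) - (\<Sum>T\<in>Y. G T)" if "finite Y" for Y
      unfolding f_def sum_subtractf card_eq_sum_of_bool[OF that] sum_distrib_left ..
    \<comment> \<open>The tuple of centres names a box. Belonging to \<open>N\<close> depends on the
      clusters alone, so each fibre within \<open>N\<close> is a full product.\<close>
    define \<kappa> where "\<kappa> = (\<lambda>T. restrict (\<lambda>i. cen i (T i)) I)"
    have "0 < sum f N" using NG sumf[OF fN] by simp
    also have "\<dots> = (\<Sum>k\<in>\<kappa> ` N. sum f {T \<in> N. \<kappa> T = k})" by (rule sum.image_gen[OF fN])
    finally have pos': "0 < (\<Sum>k\<in>\<kappa> ` N. sum f {T \<in> N. \<kappa> T = k})" .
    obtain k where "k \<in> \<kappa> ` N" "0 < sum f {T \<in> N. \<kappa> T = k}"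
    proof (cases "\<exists>k\<in>\<kappa> ` N. 0 < sum f {T \<in> N. \<kappa> T = k}")
      case False
      then have "sum f {T \<in> N. \<kappa> T = k} \<le> 0" if "k \<in> \<kappa> ` N" for k using that not_less by blast
      then show ?thesis using pos' sum_nonpos[of "\<kappa> ` N" "\<lambda>k. sum f {T \<in> N. \<kappa> T = k}"] not_less by blast
    qed (use that in blast)
    then obtain T0 where T0: "T0 \<in> N" and pos: "0 < sum f {T \<in> N. \<kappa> T = \<kappa> T0}" by blast
    define B where "B = (\<lambda>i. cl i (T0 i))"
    have T0A: "T0 i \<in> A i" if "i \<in> I" for i using T0 that by (auto simp: N_def)
    have clB: "cl i (T i) = B i" if "i \<in> I" "T \<in> PiE I B" for T i
      using PiE_mem[OF that(2,1)] by (auto simp: B_def cl_def)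
    have box: "{T \<in> N. \<kappa> T = \<kappa> T0} = PiE I B"
    proof (intro set_eqI iffI)
      fix T assume T: "T \<in> {T \<in> N. \<kappa> T = \<kappa> T0}"
      then have "cen i (T i) = cen i (T0 i)" if "i \<in> I" for i
      proof -
        have "\<kappa> T i = \<kappa> T0 i" using T by simp
        then show ?thesis using that by (simp add: \<kappa>_def)
      qed
      then show "T \<in> PiE I B" using T by (auto simp: N_def B_def cl_def PiE_iff)
    next
      fix T assume T: "T \<in> PiE I B"
      then have TA: "T \<in> PiE I A" by (auto simp: B_def cl_def PiE_iff)
      have "T i \<notin> small i" if i: "i \<in> I" for i
        using clB[OF i T] T0 i T0A[OF i] by (auto simp: small_def B_def N_def)
      moreover have "\<kappa> T = \<kappa> T0" unfolding \<kappa>_def using PiE_mem[OF T] by (intro restrict_ext) (auto simp: B_def cl_def)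
      ultimately show "T \<in> {T \<in> N. \<kappa> T = \<kappa> T0}" using TA by (simp add: N_def)
    qed
    have fB: "finite (B i) \<and> B i \<noteq> {}" if "i \<in> I" for i using fcl[OF that] cl_self[OF T0A[OF that]] unfolding B_def by blast
    have fPB: "finite (PiE I B)" using I fB by (intro finite_PiE) auto
    have "(\<Sum>T\<in>PiE I B. G T) = (\<Sum>T\<in>PiE I B. \<Sum>i\<in>I. (\<Sum>K\<in>B i. of_bool (E T \<noteq> E (T(i := K)))) / real (card (B i)))"
      unfolding G_def by (intro sum.cong refl) (simp only: clB)
    then have small_sum: "(\<Sum>T\<in>PiE I B. \<Sum>i\<in>I. (\<Sum>K\<in>B i. of_bool (E T \<noteq> E (T(i := K)))) / real (card (B i))) < \<tau> * real (card {T \<in> PiE I B. E T})"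
      using pos sumf[OF fPB] unfolding box by simp
    have "real (card {T \<in> PiE I B. \<not> E T}) \<le> \<tau> * real (card (PiE I B))"
      by (rule box_density[where E = E, OF I(1) _ small_sum]) (rule fB)
    moreover have "B i \<subseteq> A i \<and> real (card (B i)) \<ge> c * \<epsilon> ^ (q + 1) * R" if i: "i \<in> I" for i
    proof -
      have "T0 i \<notin> small i" using T0 i by (simp add: N_def)
      then show ?thesis using T0A[OF i] unfolding small_def \<beta>_def B_def by (auto simp: cl_def)
    qed
    ultimately show ?thesis by blast
  qed
  show ?thesis using c main by (intro exI[of _ c] conjI allI impI)
qed

section \<open>Loose tuples\<close>

lemma generic_empty: "generic {}"
  by (simp add: generic_def)

lemma generic_representatives:
  fixes U :: "'q \<Rightarrow> 'a::euclidean_space set"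
  assumes "finite Q" "\<And>t. t \<in> Q \<Longrightarrow> open (U t) \<and> U t \<noteq> {}"
  shows "\<exists>v. inj_on v Q \<and> generic (v ` Q) \<and> (\<forall>t\<in>Q. v t \<in> U t)"
  using assms
proof (induction Q rule: finite_induct)
  case empty then show ?case by (simp add: generic_empty)
next
  case (insert t Q)
  then obtain v where v: "inj_on v Q" "generic (v ` Q)" "\<forall>t\<in>Q. v t \<in> U t" by auto
  obtain x where x: "x \<in> U t" "x \<notin> v ` Q" "generic (insert x (v ` Q))"
    using generic_insert[OF v(2), of "U t"] insert.prems by blast
  let ?v = "v(t := x)"
  have im: "?v ` Q = v ` Q" using insert.hyps(2) by auto
  have "inj_on ?v Q" using v(1) insert.hyps(2) by (auto simp: inj_on_def)
  then have "inj_on ?v (insert t Q)" using x(2) im insert.hyps(2) by simp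
  moreover have "generic (?v ` insert t Q)" unfolding image_insert im by (simp add: x(3))
  moreover have "\<forall>t'\<in>insert t Q. ?v t' \<in> U t'" using v(3) x(1) by auto
  ultimately show ?case by blast
qed

lemma convex_hull_UN_convex_hull: "convex hull (\<Union>j\<in>J. convex hull (V j)) = convex hull (\<Union>j\<in>J. V j)"
proof (rule antisym)
  have "convex hull (V j) \<subseteq> convex hull (\<Union>j\<in>J. V j)" if "j \<in> J" for j by (rule hull_mono) (use that in blast)
  then show "convex hull (\<Union>j\<in>J. convex hull (V j)) \<subseteq> convex hull (\<Union>j\<in>J. V j)" by (intro hull_minimal convex_convex_hull) blast
  show "convex hull (\<Union>j\<in>J. V j) \<subseteq> convex hull (\<Union>j\<in>J. convex hull (V j))"
    by (intro hull_mono UN_mono hull_subset subset_refl)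
qed

lemma simplex_enumeration:
  assumes "int DIM('a) simplex (K :: 'a::euclidean_space set)"
  shows "\<exists>w :: nat \<Rightarrow> 'a. K = convex hull (w ` {..DIM('a)})" "interior K \<noteq> {}"
proof -
  obtain C where C: "\<not> affine_dependent C" "int (card C) = int DIM('a) + 1" "K = convex hull C"
    using assms unfolding simplex_def by blast
  have fC: "finite C" by (rule aff_independent_finite[OF C(1)])
  have cC: "card C = Suc DIM('a)" using C(2) by simp
  obtain h where "bij_betw h {0..<card C} C" using ex_bij_betw_nat_finite[OF fC] by blast
  then have "h ` {..DIM('a)} = C" unfolding cC bij_betw_def by (simp add: atLeast0LessThan lessThan_Suc_atMost)
  then show "\<exists>w :: nat \<Rightarrow> 'a. K = convex hull (w ` {..DIM('a)})" using C(3) by blast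
  show "interior K \<noteq> {}" using interior_convex_hull_eq_empty[OF cC] C by simp
qed

section \<open>Selection against robustness in a dense box\<close>

text \<open>For more than a fraction \<open>selection_const\<close> of the tuples, the hull of the
  representatives contains \<open>p\<close>. Such a tuple is either not robust or has no common
  point of its hulls. Each kind makes up at most a quarter of that fraction, the former because the
  sides of the box are large compared with \<open>h\<close>, the latter by density.\<close>

lemma box_contradiction:
  fixes B :: "nat \<Rightarrow> 'a::euclidean_space set set"
  assumes I: "finite I" "card I = DIM('a) + 1" and fin: "\<And>i. i \<in> I \<Longrightarrow> finite (B i)"
    and splx: "\<And>i K. i \<in> I \<Longrightarrow> K \<in> B i \<Longrightarrow> int DIM('a) simplex K"
    and meets: "\<And>i n b. i \<in> I \<Longrightarrow> n \<noteq> 0 \<Longrightarrow> card {K \<in> B i. \<exists>x\<in>K. n \<bullet> x = b} \<le> h"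
    and big: "\<And>i. i \<in> I \<Longrightarrow> real DIM('a) ^ 2 / selection_const DIM('a) \<le> real (card (B i))"
      "\<And>i. i \<in> I \<Longrightarrow> 4 * real (DIM('a) + 1) ^ (DIM('a) + 1) / selection_const DIM('a) * h \<le> real (card (B i))"
    and dense: "real (card {T \<in> PiE I B. (\<Inter>i\<in>I. convex hull (\<Union>j\<in>I - {i}. T j)) = {}}) \<le> selection_const DIM('a) / 4 * real (card (PiE I B))"
  shows False
proof -
  let ?d = "DIM('a)" and ?s = "selection_const DIM('a)"
  have s: "?s > 0" by (rule selection_const_pos)
  have cB: "card (B i) > 0" if "i \<in> I" for i
  proof -
    have "0 < real ?d ^ 2 / ?s" using s DIM_positive[where 'a='a] by (intro divide_pos_pos) auto
    then show ?thesis using big(1)[OF that] by simp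
  qed
  have fP: "finite (PiE I B)" using I fin by (intro finite_PiE) auto
  have cP: "real (card (PiE I B)) = real (\<Prod>i\<in>I. card (B i))" using I by (simp add: card_PiE)
  have cPpos: "real (card (PiE I B)) > 0" unfolding cP using cB by (simp add: prod_pos)
  \<comment> \<open>Pairs, because the same simplex may occur in two colours and then needs two
    different representatives.\<close>
  define Q where "Q = (SIGMA i:I. B i)"
  have fQ: "finite Q" using I fin by (simp add: Q_def)
  have "\<exists>v. inj_on v Q \<and> generic (v ` Q) \<and> (\<forall>t\<in>Q. v t \<in> interior (snd t))"
  proof (rule generic_representatives[OF fQ])
    fix t assume "t \<in> Q"
    then have "int ?d simplex (snd t)" using splx by (auto simp: Q_def)
    then show "open (interior (snd t)) \<and> interior (snd t) \<noteq> {}" using simplex_enumeration(2) by blast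
  qed
  then obtain v where v: "inj_on v Q" "generic (v ` Q)" "\<forall>t\<in>Q. v t \<in> interior (snd t)" by (elim exE conjE)
  define A where "A = (\<lambda>i. (\<lambda>K. v (i, K)) ` B i)"
  have cA: "card (A i) = card (B i)" if "i \<in> I" for i
    unfolding A_def by (rule card_image, rule inj_onI) (use v(1) that in \<open>auto simp: inj_on_def Q_def\<close>)
  have UA: "(\<Union>i\<in>I. A i) = v ` Q" by (auto simp: A_def Q_def)
  have dA: "disjoint_family_on A I"
    unfolding disjoint_family_on_def
  proof (intro ballI impI, rule ccontr)
    fix i j assume ij: "i \<in> I" "j \<in> I" "i \<noteq> j" "A i \<inter> A j \<noteq> {}"
    then obtain K K' where "K \<in> B i" "K' \<in> B j" "v (i, K) = v (j, K')" by (auto simp: A_def)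
    then have "(i, K) = (j, K')" using ij by (intro inj_onD[OF v(1)]) (auto simp: Q_def)
    then show False using ij by simp
  qed
  have "\<exists>p. (\<forall>\<sigma>\<subseteq>(\<Union>i\<in>I. A i). card \<sigma> = ?d \<longrightarrow> p \<notin> affine hull \<sigma>) \<and>
     real (card {f \<in> PiE I A. p \<in> convex hull (f ` I)}) > ?s * real (\<Prod>i\<in>I. card (A i))"
    by (rule coloured_selection[OF I dA]) (use v(2) big(1) cA in \<open>simp_all add: UA\<close>)
  then obtain p where p: "real (card {f \<in> PiE I A. p \<in> convex hull (f ` I)}) > ?s * real (\<Prod>i\<in>I. card (A i))" by (elim exE conjE)
  define rep where "rep = (\<lambda>T. restrict (\<lambda>i. v (i, T i)) I)"
  define X1 where "X1 = {T \<in> PiE I B. p \<in> convex hull ((\<lambda>i. v (i, T i)) ` I)}"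
  have "{f \<in> PiE I A. p \<in> convex hull (f ` I)} \<subseteq> rep ` X1"
  proof
    fix f assume f: "f \<in> {f \<in> PiE I A. p \<in> convex hull (f ` I)}"
    then have "\<forall>i\<in>I. \<exists>K. K \<in> B i \<and> f i = v (i, K)" by (auto simp: A_def PiE_iff)
    from bchoice[OF this] obtain K where K: "\<forall>i\<in>I. K i \<in> B i \<and> f i = v (i, K i)" by (elim exE)
    let ?T = "restrict K I"
    have 1: "f = rep ?T"
    proof
      fix i show "f i = rep ?T i" using K f by (cases "i \<in> I") (auto simp: rep_def PiE_iff extensional_def)
    qed
    have "(\<lambda>i. v (i, ?T i)) ` I = f ` I" using K by (intro image_cong) auto
    then have "?T \<in> X1" using K f by (auto simp: X1_def)
    then show "f \<in> rep ` X1" using 1 by blast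
  qed
  moreover have fX1: "finite X1" using fP by (simp add: X1_def)
  ultimately have "card {f \<in> PiE I A. p \<in> convex hull (f ` I)} \<le> card X1" by (meson card_image_le card_mono finite_imageI le_trans)
  moreover have "real (\<Prod>i\<in>I. card (A i)) = real (card (PiE I B))" unfolding cP using cA by simp
  ultimately have many: "real (card X1) > ?s * real (card (PiE I B))" using p by simp
  define X2 where "X2 = {T \<in> PiE I B. \<not> robust I p T}"
  define X3 where "X3 = {T \<in> PiE I B. (\<Inter>i\<in>I. convex hull (\<Union>j\<in>I - {i}. T j)) = {}}"
  have X1_sub: "X1 \<subseteq> X2 \<union> X3"
  proof
    fix T assume T: "T \<in> X1"
    then have TB: "T i \<in> B i" if "i \<in> I" for i using that by (auto simp: X1_def)
    have "(\<Inter>i\<in>I. convex hull (\<Union>j\<in>I - {i}. T j)) = {}" if rob: "robust I p T"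
    proof (rule robust_hulls_disjoint[OF rob I])
      show "convex (T i)" if "i \<in> I" for i
        using simplex_enumeration(1)[OF splx[OF that TB[OF that]]] convex_convex_hull by metis
      show "v (i, T i) \<in> T i" if "i \<in> I" for i
        using v(3)[THEN bspec, of "(i, T i)"] interior_subset TB[OF that] that by (auto simp: Q_def)
      show "p \<in> convex hull ((\<lambda>i. v (i, T i)) ` I)" using T by (simp add: X1_def)
    qed
    then show "T \<in> X2 \<union> X3" using T by (auto simp: X1_def X2_def X3_def)
  qed
  have "\<forall>K. \<exists>w :: nat \<Rightarrow> 'a. int ?d simplex K \<longrightarrow> K = convex hull (w ` {..?d})" using simplex_enumeration(1) by blast
  from choice[OF this] obtain vert :: "'a set \<Rightarrow> nat \<Rightarrow> 'a" where vert: "\<And>K. int ?d simplex K \<Longrightarrow> K = convex hull (vert K ` {..?d})" by blast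
  have "card X2 \<le> (\<Sum>i\<in>I. \<Sum>k\<in>I - {i}. (?d + 1) ^ (?d - 1) * h * (\<Prod>j\<in>I - {k}. card (B j)))"
    unfolding X2_def
  proof (rule nonrobust_card[OF I fin, where V = "\<lambda>K. vert K ` {..?d}"])
    fix i K assume "i \<in> I" "K \<in> B i"
    then have "K = convex hull (vert K ` {..?d})" using splx vert by blast
    moreover have "card (vert K ` {..?d}) \<le> ?d + 1" using card_image_le[of "{..?d}" "vert K"] by simp
    ultimately show "finite (vert K ` {..?d}) \<and> card (vert K ` {..?d}) \<le> ?d + 1 \<and> K = convex hull (vert K ` {..?d})" by simp
  qed (use meets in auto)
  then have "real (card X2) \<le> real (\<Sum>i\<in>I. \<Sum>k\<in>I - {i}. (?d + 1) ^ (?d - 1) * h * (\<Prod>j\<in>I - {k}. card (B j)))" by (rule of_nat_mono)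
  also have "\<dots> = (\<Sum>i\<in>I. \<Sum>k\<in>I - {i}. real (?d + 1) ^ (?d - 1) * real h * real (\<Prod>j\<in>I - {k}. card (B j)))" by simp
  \<comment> \<open>There are at most \<open>(d + 1) ^ 2\<close> pairs \<open>(i, k)\<close>, so
    each may use that part of the allowed quarter; the second lower bound on the sides provides for
    this.\<close>
  also have "\<dots> \<le> (\<Sum>i\<in>I. \<Sum>k\<in>I - {i}. ?s / (4 * real (?d + 1) ^ 2) * real (card (PiE I B)))"
  proof (intro sum_mono)
    fix i k assume k: "k \<in> I - {i}"
    then have kI: "k \<in> I" by blast
    let ?D = "real (?d + 1)"
    have D: "?D > 0" by simp
    have pw: "?D ^ (?d + 1) = ?D ^ (?d - 1) * ?D ^ 2"
      using DIM_positive[where 'a='a] by (simp only: power_add[symmetric]) (rule arg_cong[where f = "\<lambda>n. ?D ^ n"], simp)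
    have "4 * ?D ^ (?d + 1) * real h \<le> ?s * real (card (B k))" using big(2)[OF kI] s by (simp add: field_simps)
    then have "?D ^ (?d - 1) * real h * (4 * ?D ^ 2) \<le> ?s * real (card (B k))" unfolding pw by (simp only: mult_ac)
    then have "?D ^ (?d - 1) * real h \<le> ?s * real (card (B k)) / (4 * ?D ^ 2)" using D by (simp only: pos_le_divide_eq zero_less_mult_iff zero_less_power zero_less_numeral simp_thms)
    then have "?D ^ (?d - 1) * real h * real (\<Prod>j\<in>I - {k}. card (B j)) \<le> ?s * real (card (B k)) / (4 * ?D ^ 2) * real (\<Prod>j\<in>I - {k}. card (B j))"
      by (rule mult_right_mono) (rule of_nat_0_le_iff)
    also have "\<dots> = ?s / (4 * ?D ^ 2) * (real (card (B k)) * real (\<Prod>j\<in>I - {k}. card (B j)))" by simp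
    also have "real (card (B k)) * real (\<Prod>j\<in>I - {k}. card (B j)) = real (card (PiE I B))"
      unfolding cP using I kI by (simp add: prod.remove[of I k])
    finally show "?D ^ (?d - 1) * real h * real (\<Prod>j\<in>I - {k}. card (B j)) \<le> ?s / (4 * ?D ^ 2) * real (card (PiE I B))" .
  qed
  also have "\<dots> \<le> ?s / 4 * real (card (PiE I B))"
  proof -
    let ?D = "real (?d + 1)"
    let ?z = "?s / (4 * ?D ^ 2) * real (card (PiE I B))"
    have z: "?z \<ge> 0" using s by simp
    have "(\<Sum>i\<in>I. \<Sum>k\<in>I - {i}. ?z) \<le> (\<Sum>i\<in>I. ?D * ?z)"
    proof (rule sum_mono)
      fix i
      have "(\<Sum>k\<in>I - {i}. ?z) = real (card (I - {i})) * ?z" by simp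
      also have "\<dots> \<le> ?D * ?z" using I card_mono[of I "I - {i}"] by (intro mult_right_mono z) auto
      finally show "(\<Sum>k\<in>I - {i}. ?z) \<le> ?D * ?z" .
    qed
    also have "\<dots> = ?D * (?D * ?z)" using I by simp
    also have "\<dots> = ?s / 4 * real (card (PiE I B))"
    proof -
      have "?D * (?D * (?s / (4 * ?D ^ 2) * y)) = ?s / 4 * y" for y
        using DIM_positive[where 'a='a] by (simp add: power2_eq_square divide_simps del: of_nat_add)
      then show ?thesis .
    qed
    finally show ?thesis .
  qed
  finally have b2: "real (card X2) \<le> ?s / 4 * real (card (PiE I B))" .
  have b3: "real (card X3) \<le> ?s / 4 * real (card (PiE I B))" using dense unfolding X3_def .
  have "card X1 \<le> card (X2 \<union> X3)" using X1_sub fP by (intro card_mono) (auto simp: X2_def X3_def)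
  also have "\<dots> \<le> card X2 + card X3" by (rule card_Un_le)
  finally have "real (card X1) \<le> real (card X2) + real (card X3)" by linarith
  also have "\<dots> \<le> ?s * real (card (PiE I B))" using b2 b3 s cPpos by (simp add: field_simps)
  finally show False using many by linarith
qed

section \<open>Balancing the sides of the box against the crossing number\<close>

theorem theorem5p3:
  fixes c :: real
  assumes "DIM('a::euclidean_space) \<ge> 2"
  shows "\<exists>(C::real) (r0::nat).
    \<forall>(P :: nat \<Rightarrow> 'a set) (Q :: nat \<Rightarrow> nat \<Rightarrow> 'a set) (\<Delta> :: nat \<Rightarrow> nat \<Rightarrow> 'a set) (r::nat).
      r > 0 \<longrightarrow> r \<ge> r0 \<longrightarrow>
      (\<forall>i\<in>{1..DIM('a) + 1}. finite (P i) \<and> general_position (P i) \<and> r \<le> card (P i) \<and>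
         matousek_partition c (P i) r (Q i) (\<Delta> i)) \<longrightarrow>
      real (card {T \<in> (\<Pi>\<^sub>E i\<in>{1..DIM('a) + 1}. \<Delta> i ` {1..r}). loose {1..DIM('a) + 1} T})
        \<le> C * real r powr (real DIM('a) + 1 - 1 / (real DIM('a) ^ 4 + real DIM('a)))"
proof -
  let ?d = "DIM('a)" and ?s = "selection_const DIM('a)"
  define I :: "nat set" where "I = {1..?d + 1}"
  have I: "finite I" "I \<noteq> {}" "card I = ?d + 1" by (auto simp: I_def)
  \<comment> \<open>\<open>q\<close> makes \<open>d (q + 1)\<close> equal to \<open>d^4 + d\<close>,
    and \<open>n\<close> counts the coordinates of a simplex. The inequality
    \<open>4 * n \<le> 3 * q\<close> amounts to \<open>4 (d + 1) \<le> 3 d^2\<close>, an equality at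
    d = 2.\<close>
  define q where "q = ?d ^ 3"
  define n where "n = ?d * (?d + 1)"
  have nq: "n \<ge> 1" "4 * n \<le> 3 * q"
  proof -
    show "n \<ge> 1" using DIM_positive[where 'a='a] by (simp add: n_def Suc_leI)
    have "2 * ?d \<le> ?d * ?d" using assms by (rule mult_right_mono) simp
    moreover have "4 * (x + 1) \<le> 3 * y" if "2 * x \<le> y" "2 \<le> x" for x y :: nat
    proof -
      have "3 * (2 * x) \<le> 3 * y" using that(1) by (rule mult_left_mono) simp
      moreover have "4 * (x + 1) \<le> 3 * (2 * x)" using that(2) by simp
      ultimately show ?thesis by (rule order_trans[rotated])
    qed
    ultimately have "4 * (?d + 1) \<le> 3 * (?d * ?d)" using assms by blast
    then have "?d * (4 * (?d + 1)) \<le> ?d * (3 * (?d * ?d))" by (rule mult_left_mono) simp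
    then show "4 * n \<le> 3 * q" by (simp only: n_def q_def power3_eq_cube mult_ac)
  qed
  have s: "?s > 0" by (rule selection_const_pos)
  \<comment> \<open>Exceptional tuples may use up a quarter of what selection guarantees; the
    minimum with 1 stays in the range of \<open>dense_box\<close>.\<close>
  define \<tau> where "\<tau> = min 1 (?s / 4)"
  have \<tau>: "0 < \<tau>" "\<tau> \<le> 1" "\<tau> \<le> ?s / 4" using s by (auto simp: \<tau>_def)
  obtain C0 where C0: "C0 > 0" and pat: "\<And>j s. \<And>\<xi> :: nat \<Rightarrow> nat \<Rightarrow> nat \<Rightarrow> 'a.
    card (range (\<lambda>w. {m. m < s \<and> hulls_meet I ((\<xi> m)(j := w))})) \<le> C0 * (s + 1) ^ n"
    using hulls_meet_patterns[OF I(1,2), where 'a='a] unfolding n_def by blast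
  obtain c0 where c0: "c0 > 0" and box: "\<And>(A :: nat \<Rightarrow> 'a set set) E R \<epsilon>. \<forall>i\<in>I. finite (A i) \<and> real (card (A i)) \<le> R \<Longrightarrow> 0 < \<epsilon> \<Longrightarrow> \<epsilon> \<le> 1 \<Longrightarrow>
    \<forall>i\<in>I. \<forall>s \<xi>. (\<forall>m<s. \<xi> m \<in> PiE (I - {i}) A) \<longrightarrow> card ((\<lambda>K. {m. m < s \<and> E ((\<xi> m)(i := K))}) ` A i) \<le> C0 * (s + 1) ^ n \<Longrightarrow>
    real (card {T \<in> PiE I A. E T}) > \<epsilon> * R ^ card I \<Longrightarrow>
    \<exists>B. (\<forall>i\<in>I. B i \<subseteq> A i \<and> real (card (B i)) \<ge> c0 * \<epsilon> ^ (q + 1) * R) \<and>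
       real (card {T \<in> PiE I B. \<not> E T}) \<le> \<tau> * real (card (PiE I B))"
    using dense_box[OF I(1,2) \<tau>(1,2) nq, of C0, where 'k = "'a set"] C0 by (auto simp: Suc_le_eq)
  define L where "L = 4 * real (?d + 1) ^ (?d + 1) / ?s"
  have L: "L > 0" using s by (simp add: L_def)
  \<comment> \<open>A positive majorant of the crossing constant.\<close>
  define c1 where "c1 = max c 1"
  \<comment> \<open>Sides of at least \<open>\<kappa> * r'\<close>, with \<open>r'\<close> equal to
    r^(1-1/d), satisfy both lower bounds of \<open>box_contradiction\<close>.\<close>
  define \<kappa> where "\<kappa> = max (L * c1) (real ?d ^ 2 / ?s)"
  \<comment> \<open>\<open>C \<ge> \<kappa> / c0\<close> turns the side bound of the box into
    \<open>\<kappa> * r'\<close>; \<open>C \<ge> 1\<close> allows passing from \<open>C\<close> to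
    its power \<open>C ^ (q + 1)\<close>.\<close>
  define C where "C = max 1 (\<kappa> / c0)"
  let ?e = "1 / (real ?d ^ 4 + real ?d)"
  have main: "real (card {T \<in> (\<Pi>\<^sub>E i\<in>I. \<Delta> i ` {1..r}). loose I T}) \<le> C * real r powr (real ?d + 1 - ?e)"
    if r: "r > 0" and part: "\<forall>i\<in>I. finite (P i) \<and> general_position (P i) \<and> r \<le> card (P i) \<and> matousek_partition c (P i) r (Q i) (\<Delta> i)"
    for P :: "nat \<Rightarrow> 'a set" and Q \<Delta> :: "nat \<Rightarrow> nat \<Rightarrow> 'a set" and r :: nat
  proof (rule ccontr)
    assume neg: "\<not> ?thesis"
    define A where "A = (\<lambda>i. \<Delta> i ` {1..r})"
    define E where "E = (\<lambda>T :: nat \<Rightarrow> 'a set. (\<Inter>i\<in>I. convex hull (\<Union>j\<in>I - {i}. T j)) \<noteq> {})"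
    \<comment> \<open>The bound to be proved, as a density among r^(d+1) tuples. If it is exceeded,
      then \<epsilon> is at most 1, since there are no more tuples than that.\<close>
    define \<epsilon> where "\<epsilon> = C * real r powr (- ?e)"
    have rr: "real r \<ge> 1" using r by simp
    have fA: "finite (A i)" for i by (simp add: A_def)
    have cA: "card (A i) \<le> r" for i unfolding A_def using card_image_le[of "{1..r}" "\<Delta> i"] by simp
    have fP: "finite (PiE I A)" using I fA by (intro finite_PiE) auto
    have C1: "C \<ge> 1" "C \<ge> \<kappa> / c0" by (auto simp: C_def)
    have rpow: "real r powr (real ?d + 1) = real r ^ card I"
      using r powr_realpow[of "real r" "card I"] by (simp only: I(3) of_nat_add of_nat_1 of_nat_0_less_iff)
    have "C * real r powr (real ?d + 1 - ?e) = \<epsilon> * real r ^ card I"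
      unfolding \<epsilon>_def rpow[symmetric] by (simp add: powr_add[symmetric] mult.assoc)
    moreover have "card {T \<in> PiE I A. loose I T} \<le> card {T \<in> PiE I A. E T}"
    proof (rule card_mono)
      show "{T \<in> PiE I A. loose I T} \<subseteq> {T \<in> PiE I A. E T}"
        unfolding loose_def tight_def E_def by (intro subsetI CollectI) simp
    qed (use fP in simp)
    ultimately have many: "real (card {T \<in> PiE I A. E T}) > \<epsilon> * real r ^ card I" using neg unfolding A_def by linarith
    have \<epsilon>0: "\<epsilon> > 0" using C1 r by (simp add: \<epsilon>_def)
    have \<epsilon>1: "\<epsilon> \<le> 1"
    proof (rule ccontr)
      assume "\<not> \<epsilon> \<le> 1"
      then have "1 * real r ^ card I \<le> \<epsilon> * real r ^ card I" by (intro mult_right_mono) auto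
      then have "real (r ^ card I) < real (card {T \<in> PiE I A. E T})" using many by (simp only: of_nat_power mult_1)
      also have "\<dots> \<le> real (card (PiE I A))" using fP by (intro of_nat_mono card_mono) auto
      also have "card (PiE I A) = (\<Prod>i\<in>I. card (A i))" using I by (simp add: card_PiE)
      also have "\<dots> \<le> (\<Prod>i\<in>I. r)" using cA by (intro prod_mono) auto
      finally show False by simp
    qed
    have splx: "int ?d simplex K" if "i \<in> I" "K \<in> A i" for i K
      using part that unfolding matousek_partition_def simplicial_partition_def A_def by blast
    \<comment> \<open>Vertices are listed once per simplex, so that \<open>E\<close> turns into
      \<open>hulls_meet\<close> of vertex lists and the pattern bound applies with one list
      varying.\<close>
    have "\<forall>K. \<exists>w :: nat \<Rightarrow> 'a. int ?d simplex K \<longrightarrow> K = convex hull (w ` {..?d})" using simplex_enumeration(1) by blast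
    from choice[OF this] obtain vert :: "'a set \<Rightarrow> nat \<Rightarrow> 'a" where vert: "\<And>K. int ?d simplex K \<Longrightarrow> K = convex hull (vert K ` {..?d})" by blast
    have E_vert: "E T \<longleftrightarrow> hulls_meet I w" if "\<And>j. j \<in> I \<Longrightarrow> T j = convex hull (w j ` {..?d})" for T w
    proof -
      have "convex hull (\<Union>j\<in>I - {i}. T j) = convex hull (\<Union>j\<in>I - {i}. w j ` {..?d})" for i
      proof -
        have "(\<Union>j\<in>I - {i}. T j) = (\<Union>j\<in>I - {i}. convex hull (w j ` {..?d}))" using that by (intro SUP_cong) auto
        then show ?thesis using convex_hull_UN_convex_hull[of "\<lambda>j. w j ` {..?d}" "I - {i}"] by simp
      qed
      then show ?thesis unfolding E_def hulls_meet_def by simp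
    qed
    have patterns: "card ((\<lambda>K. {m. m < s \<and> E ((\<xi> m)(i := K))}) ` A i) \<le> C0 * (s + 1) ^ n"
      if i: "i \<in> I" and xi: "\<forall>m<s. \<xi> m \<in> PiE (I - {i}) A" for i s \<xi>
    proof -
      let ?R = "range (\<lambda>w. {m. m < s \<and> hulls_meet I ((\<lambda>j. vert (\<xi> m j))(i := w))})"
      have "{m. m < s \<and> E ((\<xi> m)(i := K))} = {m. m < s \<and> hulls_meet I ((\<lambda>j. vert (\<xi> m j))(i := vert K))}" if K: "K \<in> A i" for K
      proof (intro Collect_cong conj_cong refl)
        fix m assume m: "m < s"
        show "E ((\<xi> m)(i := K)) \<longleftrightarrow> hulls_meet I ((\<lambda>j. vert (\<xi> m j))(i := vert K))"
        proof (rule E_vert)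
          fix j assume j: "j \<in> I"
          show "((\<xi> m)(i := K)) j = convex hull (((\<lambda>j. vert (\<xi> m j))(i := vert K)) j ` {..?d})"
          proof (cases "j = i")
            case True then show ?thesis using vert[OF splx[OF i K]] by simp
          next
            case False
            then have "\<xi> m j \<in> A j" using xi m j by (auto simp: PiE_iff)
            then show ?thesis using vert[OF splx[OF j]] False by simp
          qed
        qed
      qed
      then have "(\<lambda>K. {m. m < s \<and> E ((\<xi> m)(i := K))}) ` A i \<subseteq> ?R" by blast
      moreover have "?R \<subseteq> Pow {..<s}" by blast
      then have "finite ?R" by (rule finite_subset) simp
      ultimately have "card ((\<lambda>K. {m. m < s \<and> E ((\<xi> m)(i := K))}) ` A i) \<le> card ?R" by (intro card_mono)
      also have "\<dots> \<le> C0 * (s + 1) ^ n" by (rule pat)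
      finally show ?thesis .
    qed
    obtain B where B: "\<And>i. i \<in> I \<Longrightarrow> B i \<subseteq> A i" "\<And>i. i \<in> I \<Longrightarrow> real (card (B i)) \<ge> c0 * \<epsilon> ^ (q + 1) * real r"
      and dense: "real (card {T \<in> PiE I B. \<not> E T}) \<le> \<tau> * real (card (PiE I B))"
    proof -
      have "\<exists>B. (\<forall>i\<in>I. B i \<subseteq> A i \<and> real (card (B i)) \<ge> c0 * \<epsilon> ^ (q + 1) * real r) \<and>
        real (card {T \<in> PiE I B. \<not> E T}) \<le> \<tau> * real (card (PiE I B))"
        by (rule box) (use fA cA \<epsilon>0 \<epsilon>1 patterns many in auto)
      then show ?thesis using that by blast
    qed
    define r' where "r' = real r powr (1 - 1 / real ?d)"
    have r'1: "r' \<ge> 1" unfolding r'_def using rr assms by (intro ge_one_powr_ge_zero) auto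
    \<comment> \<open>As \<open>(q + 1) / (d^4 + d) = 1 / d\<close>, the power
      \<open>\<epsilon> ^ (q + 1)\<close> is \<open>C ^ (q + 1)\<close> times r^(-1/d). The
      guaranteed side thus has the same order \<open>r'\<close> as the crossing number, and the
      constants decide.\<close>
    have side: "real (card (B i)) \<ge> \<kappa> * r'" if i: "i \<in> I" for i
    proof -
      have de: "real ?d * (1 + real ?d ^ 3) = real ?d ^ 4 + real ?d" by (simp add: power4_eq_xxxx power3_eq_cube algebra_simps)
      have "1 + real ?d ^ 3 > 0" by (intro add_pos_nonneg) auto
      then have ex: "real (q + 1) * ?e = 1 / real ?d"
        unfolding de[symmetric] q_def by (simp add: add.commute divide_simps)
      have "(real r powr (- ?e)) ^ (q + 1) = real r powr (- ?e * real (q + 1))"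
        using rr powr_realpow[of "real r powr (- ?e)" "q + 1"] by (simp only: powr_powr[symmetric]) simp
      also have "- ?e * real (q + 1) = - (1 / real ?d)" using ex by (simp only: mult.commute mult_minus_left)
      finally have "\<epsilon> ^ (q + 1) * real r = C ^ (q + 1) * (real r powr (- (1 / real ?d)) * real r powr 1)"
        unfolding \<epsilon>_def power_mult_distrib using rr by simp
      also have "real r powr (- (1 / real ?d)) * real r powr 1 = r'" unfolding r'_def powr_add[symmetric] by (rule arg_cong[where f = "\<lambda>x. real r powr x"]) simp
      finally have e: "c0 * \<epsilon> ^ (q + 1) * real r = (c0 * C ^ (q + 1)) * r'" by (simp only: mult.assoc)
      have "\<kappa> \<le> c0 * C" using C1(2) c0 by (simp add: pos_divide_le_eq mult.commute)
      also have "\<dots> \<le> c0 * C ^ (q + 1)" using C1(1) c0 by (intro mult_left_mono self_le_power) auto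
      finally have "\<kappa> * r' \<le> (c0 * C ^ (q + 1)) * r'" using r'1 by (intro mult_right_mono) auto
      then show ?thesis using B(2)[OF i] e by linarith
    qed
    define h where "h = nat \<lfloor>c1 * r'\<rfloor>"
    have hr: "real h \<le> c1 * r'" unfolding h_def using r'1 by (intro of_nat_floor mult_nonneg_nonneg) (auto simp: c1_def)
    \<comment> \<open>Crossings are counted by index, and distinct members of \<open>B i\<close>
      come from distinct indices.\<close>
    have meets: "card {K \<in> B i. \<exists>x\<in>K. y \<bullet> x = b} \<le> h" if i: "i \<in> I" and y: "y \<noteq> 0" for i y b
    proof -
      let ?J = "{j \<in> {1..r}. {x. y \<bullet> x = b} \<inter> \<Delta> i j \<noteq> {}}"
      have "{K \<in> B i. \<exists>x\<in>K. y \<bullet> x = b} \<subseteq> \<Delta> i ` ?J" using B(1)[OF i] unfolding A_def by blast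
      then have "card {K \<in> B i. \<exists>x\<in>K. y \<bullet> x = b} \<le> card (\<Delta> i ` ?J)" by (intro card_mono) auto
      also have "\<dots> \<le> card ?J" by (intro card_image_le) auto
      finally have "real (card {K \<in> B i. \<exists>x\<in>K. y \<bullet> x = b}) \<le> real (card ?J)" by simp
      also have "\<dots> \<le> c * r'"
      proof -
        have "hyperplane {x. y \<bullet> x = b}" unfolding hyperplane_def using y by blast
        then show ?thesis using part[THEN bspec, OF i] unfolding matousek_partition_def r'_def by blast
      qed
      also have "\<dots> \<le> c1 * r'" using r'1 by (intro mult_right_mono) (auto simp: c1_def)
      finally show ?thesis unfolding h_def by (rule le_nat_floor)
    qed
    show False
    proof (rule box_contradiction[OF I(1,3), of B h])
      show "finite (B i)" if "i \<in> I" for i using B(1)[OF that] fA finite_subset by blast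
      show "int ?d simplex K" if "i \<in> I" "K \<in> B i" for i K using splx B(1) that by blast
      show "card {K \<in> B i. \<exists>x\<in>K. y \<bullet> x = b} \<le> h" if "i \<in> I" "y \<noteq> 0" for i y b by (rule meets[OF that])
      show "real ?d ^ 2 / ?s \<le> real (card (B i))" if i: "i \<in> I" for i
      proof -
        have "real ?d ^ 2 / ?s \<le> \<kappa> * 1" by (simp add: \<kappa>_def)
        also have "\<dots> \<le> \<kappa> * r'" using r'1 L by (intro mult_left_mono) (auto simp: \<kappa>_def c1_def le_max_iff_disj)
        finally show ?thesis using side[OF i] by linarith
      qed
      show "4 * real (?d + 1) ^ (?d + 1) / ?s * real h \<le> real (card (B i))" if i: "i \<in> I" for i
      proof -
        have "L * real h \<le> L * (c1 * r')" using hr L by (intro mult_left_mono) auto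
        also have "\<dots> \<le> \<kappa> * r'" unfolding mult.assoc[symmetric] using r'1 by (intro mult_right_mono) (auto simp: \<kappa>_def)
        finally show ?thesis using side[OF i] unfolding L_def by linarith
      qed
      have "real (card {T \<in> PiE I B. \<not> E T}) \<le> ?s / 4 * real (card (PiE I B))"
        using dense \<tau>(3) by (meson mult_right_mono of_nat_0_le_iff order_trans)
      then show "real (card {T \<in> PiE I B. (\<Inter>i\<in>I. convex hull (\<Union>j\<in>I - {i}. T j)) = {}}) \<le> ?s / 4 * real (card (PiE I B))"
        unfolding E_def by (simp only: not_not)
    qed
  qed
  show ?thesis
    using main unfolding I_def by (intro exI[of _ C] exI[of _ 0] allI impI)
qed

end
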